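(* Let $(X,d,\varphi)$ be an irreducible Smale space with periodic orbits $P,Q$ such that $P\cap Q=\varnothing$, and let $d'\in\mathrm{sM}_d(X,\varphi)$. The complex vector space of compactly supported Lipschitz functions $\mathrm{Lip}_c(G^s(Q),D_{s,d'})$ forms a dense $*$-subalgebra of $\mathcal S(Q)$. Moreover, it is $\alpha_s$-invariant, and therefore the algebraic crossed product $$\Lambda_{s,d'}(Q,\alpha_s)=\mathrm{Lip}_c(G^s(Q),D_{s,d'})\rtimes_{\alpha_s,\mathrm{alg}}\mathbb Z$$ is a well-defined dense $*$-subalgebra of $\mathcal R^s(Q)$. Similarly, in the unstable case, one obtains the dense $*$-subalgebra $$\Lambda_{u,d'}(P,\alpha_u)=\mathrm{Lip}_c(G^u(P),D_{u,d'})\rtimes_{\alpha_u,\mathrm{alg}}\mathbb Z$$ of the Ruelle algebra $\mathcal R^u(P)$.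
   Context: **Smale spaces.** All Smale spaces have infinite underlying space. A Smale space $(X,d,\varphi)$ is a compact metric space $(X,d)$ with a homeomorphism $\varphi:X\to X$, constants $\varepsilon_X>0$, $\lambda_X>1$ and a continuous map $[\cdot,\cdot]:\{(x,y)\in X\times X:d(x,y)\le\varepsilon_X\}\to X$ satisfying $[x,x]=x$, $[x,[y,z]]=[x,z]$, $[[x,y],z]=[x,z]$, $\varphi([x,y])=[\varphi(x),\varphi(y)]$ whenever both sides are defined, and such that, writing for $0<\varepsilon\le\varepsilon_X$ $$X^s(x,\varepsilon)=\{y:d(x,y)<\varepsilon,\ [x,y]=y\},\qquad X^u(x,\varepsilon)=\{y:d(x,y)<\varepsilon,\ [y,x]=y\},$$ one has $d(\varphi(y),\varphi(z))\le\lambda_X^{-1}d(y,z)$ for $y,z\in X^s(x,\varepsilon)$ and $d(\varphi^{-1}(y),\varphi^{-1}(z))\le\lambda_X^{-1}d(y,z)$ for $y,z\in X^u(x,\varepsilon)$. Fix $0<\varepsilon_X'\le\varepsilon_X/2$ such that $d(x,y)\le\varepsilon_X'$ implies $d(x,[x,y]),d(y,[x,y])<\varepsilon_X/2$. It is irreducible if for all non-empty open $U,V\subset X$ there is $n\in\mathbb N$ with $\varphi^n(U)\cap V\ne\varnothing$. It is self-similar if $\varphi,\varphi^{-1}$ are both $\lambda_X$-Lipschitz. $\mathrm{sM}_d(X,\varphi)$ is the (non-empty) set of metrics $d'$ inducing the same topology as $d$ for which $(X,d',\varphi)$ is a self-similar Smale space, with contraction constant $\lambda_{X,d'}>1$.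 **Groupoids.** $X^s(x)=\{y:\lim_{n\to+\infty}d(\varphi^n(x),\varphi^n(y))=0\}$, $X^u(x)=\{y:\lim_{n\to-\infty}d(\varphi^n(x),\varphi^n(y))=0\}$, $X^s(P)=\bigcup_{p\in P}X^s(p)$, $X^u(Q)=\bigcup_{q\in Q}X^u(q)$. Set $G^s(Q)=\{(v,w):v,w\in X^u(Q),\ w\in X^s(v)\}$, $G^u(P)=\{(v,w):v,w\in X^s(P),\ w\in X^u(v)\}$ with equivalence-relation groupoid structure. For $(v,w)\in G^s(Q)$, an integer $N\ge0$ with $\varphi^N(w)\in X^s(\varphi^N(v),\varepsilon_X'/2)$ and $\eta\in(0,\varepsilon_X/2]$ with $\varphi^N(X^u(w,\eta))\subset X^u(\varphi^N(w),\varepsilon_X'/2)$, let $h^s(z)=\varphi^{-N}[\varphi^N(z),\varphi^N(v)]$ and $V^s(v,w,h^s,\eta,N)=\{(h^s(z),z):z\in X^u(w,\eta)\}$. These sets form a base of a second countable, locally compact, Hausdorff étale topology on $G^s(Q)$ (independent of the choice of $d'\in\mathrm{sM}_d(X,\varphi)$ used in place of $d$). $G^u(P)$ is topologised likewise with $h^u(z)=\varphi^N[\varphi^{-N}(v),\varphi^{-N}(z)]$, $z\in X^s(w,\eta)$. **Groupoid metrics.** Let $d'\in\mathrm{sM}_d(X,\varphi)$; all local sets and constants ($\lambda=\lambda_{X,d'}$, $\varepsilon_X'$) refer to $d'$. For $a=(a_1,a_2)\in G^s(Q)$ let $N_a\ge0$ be least with $\varphi^{N_a}(a_2)\in X^s(\varphi^{N_a}(a_1),\varepsilon_X'/2)$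 and, for $n\ge1$, with $m=\max\{N_a,n\}$, let $V_n(a)=\{(\varphi^{-m}[\varphi^m(z),\varphi^m(a_1)],z):z\in X^u(a_2,\lambda^{-m}\varepsilon_X'/4)\}$. Put $k(a,1)=1$ and $k(a,n+1)=\max\{N_a,1\}+n\lceil\log_\lambda3\rceil$ for $n\ge1$, $\mathcal U_0=\{G^s(Q)\}$, $\mathcal U_n=\{V_{k(a,n)}(a):a\in G^s(Q)\}$ for $n\geq 1$, $\rho_{s,d'}(a,b)=\inf\{2^{-n}:\exists U\in\mathcal U_n,\ a,b\in U\}$ and $D_{s,d'}(a,b)=\inf\{\sum_{i=1}^{n-1}\rho_{s,d'}(c_i,c_{i+1}):c_1=a,\ c_n=b\}$, the infimum over finite chains in $G^s(Q)$. This is a metric generating the topology of $G^s(Q)$. $D_{u,d'}$ on $G^u(P)$ is defined in the same way after interchanging stable/unstable and $\varphi,\varphi^{-1}$: $N_a$ is least with $\varphi^{-N_a}(a_2)\in X^u(\varphi^{-N_a}(a_1),\varepsilon_X'/2)$ and $V_n(a)=\{(\varphi^m[\varphi^{-m}(a_1),\varphi^{-m}(z)],z):z\in X^s(a_2,\lambda^{-m}\varepsilon_X'/4)\}$. **Algebras.** Let $\mathscr H=\ell^2(X^s(P)\cap X^u(Q))$. $C_c(G^s(Q))$ is a $*$-algebra with $(f\cdot g)(v,w)=\sum_zf(v,z)g(z,w)$, $f^*(v,w)=\overline{f(w,v)}$, faithfully represented on $\mathscr H$ by $(\rho_s(f)\xi)(v)=\sum_{(v,z)\in G^s(Q)}f(v,z)\xi(z)$.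 $\mathcal S(Q)$ is the norm closure of its image, with $C_c(G^s(Q))$ regarded as a subalgebra; $\mathcal U(P)$ is defined in the same way from $G^u(P)$. $\alpha_s,\alpha_u$ are given by $f\mapsto f\circ(\varphi\times\varphi)^{-1}$. $\mathcal R^s(Q)=\mathcal S(Q)\rtimes_{\alpha_s}\mathbb Z$, $\mathcal R^u(P)=\mathcal U(P)\rtimes_{\alpha_u}\mathbb Z$. The algebraic crossed product consists of the finite sums $\sum_ja_ju^j$ with $a_j$ in the given invariant subalgebra and $u$ the canonical unitary. $\mathrm{Lip}_c(Z,D)$ denotes compactly supported complex-valued Lipschitz functions on a metric space $(Z,D)$. *)

theory Defs
  imports "HOL-Analysis.Analysis"
begin

section \<open>Smale spaces\<close>

text \<open>The component \<open>eps'\<close> is the auxiliary constant \<open>\<epsilon>'\<^sub>X\<close>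
  that is fixed together with a Smale space and used for the holonomy maps below.
  The bracket is a total function; it is only meaningful at points of \<open>pts\<close> at
  distance at most \<open>eps\<close>.\<close>

record 'a smale =
  pts :: "'a set"
  dst :: "'a \<Rightarrow> 'a \<Rightarrow> real"
  hom :: "'a \<Rightarrow> 'a"
  brk :: "'a \<Rightarrow> 'a \<Rightarrow> 'a"
  eps :: real
  lam :: real
  eps' :: real

definition hinv :: "'a smale \<Rightarrow> 'a \<Rightarrow> 'a" where
  "hinv S = inv_into (pts S) (hom S)"

definition top_of :: "'a smale \<Rightarrow> 'a topology" where
  "top_of S = Metric_space.mtopology (pts S) (dst S)"

definition local_stable :: "'a smale \<Rightarrow> 'a \<Rightarrow> real \<Rightarrow> 'a set" where
  "local_stable S x e = {y \<in> pts S. dst S x y < e \<and> brk S x y = y}"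

definition local_unstable :: "'a smale \<Rightarrow> 'a \<Rightarrow> real \<Rightarrow> 'a set" where
  "local_unstable S x e = {y \<in> pts S. dst S x y < e \<and> brk S y x = y}"

definition brk_def_at :: "'a smale \<Rightarrow> 'a \<Rightarrow> 'a \<Rightarrow> bool" where
  "brk_def_at S x y \<longleftrightarrow> x \<in> pts S \<and> y \<in> pts S \<and> dst S x y \<le> eps S"

definition smale_space :: "'a smale \<Rightarrow> bool" where
  "smale_space S \<longleftrightarrow>
     Metric_space (pts S) (dst S) \<and> compact_space (top_of S) \<and> infinite (pts S) \<and>
     homeomorphic_map (top_of S) (top_of S) (hom S) \<and>
     eps S > 0 \<and> lam S > 1 \<and>
     continuous_map
       (subtopology (prod_topology (top_of S) (top_of S)) {(x, y). brk_def_at S x y})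
       (top_of S) (\<lambda>(x, y). brk S x y) \<and>
     (\<forall>x\<in>pts S. brk S x x = x) \<and>
     (\<forall>x y z. brk_def_at S y z \<and> brk_def_at S x (brk S y z) \<and> brk_def_at S x z
        \<longrightarrow> brk S x (brk S y z) = brk S x z) \<and>
     (\<forall>x y z. brk_def_at S x y \<and> brk_def_at S (brk S x y) z \<and> brk_def_at S x z
        \<longrightarrow> brk S (brk S x y) z = brk S x z) \<and>
     (\<forall>x y. brk_def_at S x y \<and> brk_def_at S (hom S x) (hom S y)
        \<longrightarrow> hom S (brk S x y) = brk S (hom S x) (hom S y)) \<and>
     (\<forall>x\<in>pts S. \<forall>e. 0 < e \<and> e \<le> eps S \<longrightarrow>
        (\<forall>y\<in>local_stable S x e. \<forall>z\<in>local_stable S x e.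
           dst S (hom S y) (hom S z) \<le> inverse (lam S) * dst S y z) \<and>
        (\<forall>y\<in>local_unstable S x e. \<forall>z\<in>local_unstable S x e.
           dst S (hinv S y) (hinv S z) \<le> inverse (lam S) * dst S y z)) \<and>
     0 < eps' S \<and> eps' S \<le> eps S / 2 \<and>
     (\<forall>x\<in>pts S. \<forall>y\<in>pts S. dst S x y \<le> eps' S \<longrightarrow>
        dst S x (brk S x y) < eps S / 2 \<and> dst S y (brk S x y) < eps S / 2)"

definition irreducible_smale :: "'a smale \<Rightarrow> bool" where
  "irreducible_smale S \<longleftrightarrow>
     (\<forall>U V. openin (top_of S) U \<and> openin (top_of S) V \<and> U \<noteq> {} \<and> V \<noteq> {} \<longrightarrow>
        (\<exists>n::nat. (hom S ^^ n) ` U \<inter> V \<noteq> {}))"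

definition self_similar :: "'a smale \<Rightarrow> bool" where
  "self_similar S \<longleftrightarrow>
     (\<forall>x\<in>pts S. \<forall>y\<in>pts S. dst S (hom S x) (hom S y) \<le> lam S * dst S x y \<and>
        dst S (hinv S x) (hinv S y) \<le> lam S * dst S x y)"

text \<open>\<open>self_similar_form S S'\<close> says that the metric \<open>d' = dst S'\<close> belongs to
  \<open>sM\<^sub>d(X, \<phi>)\<close>, where \<open>(X, d, \<phi>)\<close> is \<open>S\<close>. The remaining components of \<open>S'\<close> are the
  bracket and the constants witnessing that \<open>(X, d', \<phi>)\<close> is a self-similar Smale
  space; they need not be those of \<open>S\<close>.\<close>

definition self_similar_form :: "'a smale \<Rightarrow> 'a smale \<Rightarrow> bool" where
  "self_similar_form S S' \<longleftrightarrow>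
     pts S' = pts S \<and> hom S' = hom S \<and> top_of S' = top_of S \<and>
     smale_space S' \<and> self_similar S'"

definition periodic_orbit :: "'a smale \<Rightarrow> 'a set \<Rightarrow> bool" where
  "periodic_orbit S P \<longleftrightarrow>
     (\<exists>p\<in>pts S. \<exists>k>0. (hom S ^^ k) p = p \<and> P = {(hom S ^^ i) p | i. i < k})"


section \<open>The stable and unstable groupoids\<close>

definition stable_set :: "'a smale \<Rightarrow> 'a \<Rightarrow> 'a set" where
  "stable_set S x = {y \<in> pts S. (\<lambda>n. dst S ((hom S ^^ n) x) ((hom S ^^ n) y)) \<longlonglongrightarrow> 0}"

definition unstable_set :: "'a smale \<Rightarrow> 'a \<Rightarrow> 'a set" where
  "unstable_set S x = {y \<in> pts S. (\<lambda>n. dst S ((hinv S ^^ n) x) ((hinv S ^^ n) y)) \<longlonglongrightarrow> 0}"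

definition stable_of :: "'a smale \<Rightarrow> 'a set \<Rightarrow> 'a set" where
  "stable_of S P = (\<Union>p\<in>P. stable_set S p)"

definition unstable_of :: "'a smale \<Rightarrow> 'a set \<Rightarrow> 'a set" where
  "unstable_of S Q = (\<Union>q\<in>Q. unstable_set S q)"

definition stable_groupoid :: "'a smale \<Rightarrow> 'a set \<Rightarrow> ('a \<times> 'a) set" where
  "stable_groupoid S Q =
     {(v, w). v \<in> unstable_of S Q \<and> w \<in> unstable_of S Q \<and> w \<in> stable_set S v}"

definition unstable_groupoid :: "'a smale \<Rightarrow> 'a set \<Rightarrow> ('a \<times> 'a) set" where
  "unstable_groupoid S P =
     {(v, w). v \<in> stable_of S P \<and> w \<in> stable_of S P \<and> w \<in> unstable_set S v}"

definition stable_holonomy :: "'a smale \<Rightarrow> nat \<Rightarrow> 'a \<Rightarrow> 'a \<Rightarrow> 'a" where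
  "stable_holonomy S N v z = (hinv S ^^ N) (brk S ((hom S ^^ N) z) ((hom S ^^ N) v))"

definition unstable_holonomy :: "'a smale \<Rightarrow> nat \<Rightarrow> 'a \<Rightarrow> 'a \<Rightarrow> 'a" where
  "unstable_holonomy S N v z = (hom S ^^ N) (brk S ((hinv S ^^ N) v) ((hinv S ^^ N) z))"

definition stable_topology :: "'a smale \<Rightarrow> 'a set \<Rightarrow> ('a \<times> 'a) topology" where
  "stable_topology S Q = topology_generated_by
     {{(stable_holonomy S N v z, z) | z. z \<in> local_unstable S w \<eta>} | v w N \<eta>.
        (v, w) \<in> stable_groupoid S Q \<and>
        (hom S ^^ N) w \<in> local_stable S ((hom S ^^ N) v) (eps' S / 2) \<and>
        0 < \<eta> \<and> \<eta> \<le> eps S / 2 \<and>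
        (hom S ^^ N) ` local_unstable S w \<eta> \<subseteq> local_unstable S ((hom S ^^ N) w) (eps' S / 2)}"

definition unstable_topology :: "'a smale \<Rightarrow> 'a set \<Rightarrow> ('a \<times> 'a) topology" where
  "unstable_topology S P = topology_generated_by
     {{(unstable_holonomy S N v z, z) | z. z \<in> local_stable S w \<eta>} | v w N \<eta>.
        (v, w) \<in> unstable_groupoid S P \<and>
        (hinv S ^^ N) w \<in> local_unstable S ((hinv S ^^ N) v) (eps' S / 2) \<and>
        0 < \<eta> \<and> \<eta> \<le> eps S / 2 \<and>
        (hinv S ^^ N) ` local_stable S w \<eta> \<subseteq> local_stable S ((hinv S ^^ N) w) (eps' S / 2)}"


section \<open>The groupoid metrics\<close>

text \<open>Common part of the two metrics: \<open>G\<close> is the groupoid, \<open>l\<close> the contraction constant,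
  \<open>N a\<close> the entry time of \<open>a\<close>, and \<open>V n a\<close> the basic neighbourhoods (\<open>n \<ge> 1\<close>).
  The value \<open>0\<close> off \<open>G\<close> is needed because \<open>Metric_space\<close> requires
  distances to be nonnegative on the whole type.\<close>

fun level :: "real \<Rightarrow> ('p \<Rightarrow> nat) \<Rightarrow> 'p \<Rightarrow> nat \<Rightarrow> nat" where
  "level l N a 0 = 0"
| "level l N a (Suc 0) = 1"
| "level l N a (Suc (Suc n)) = max (N a) 1 + Suc n * nat \<lceil>log l 3\<rceil>"

definition covers ::
  "'p set \<Rightarrow> real \<Rightarrow> ('p \<Rightarrow> nat) \<Rightarrow> (nat \<Rightarrow> 'p \<Rightarrow> 'p set) \<Rightarrow> nat \<Rightarrow> 'p set set" where
  "covers G l N V n = (if n = 0 then {G} else {V (level l N a n) a | a. a \<in> G})"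

definition pre_dist ::
  "'p set \<Rightarrow> real \<Rightarrow> ('p \<Rightarrow> nat) \<Rightarrow> (nat \<Rightarrow> 'p \<Rightarrow> 'p set) \<Rightarrow> 'p \<Rightarrow> 'p \<Rightarrow> real" where
  "pre_dist G l N V a b = Inf {(1 / 2) ^ n | n. \<exists>U\<in>covers G l N V n. a \<in> U \<and> b \<in> U}"

definition chain_dist ::
  "'p set \<Rightarrow> real \<Rightarrow> ('p \<Rightarrow> nat) \<Rightarrow> (nat \<Rightarrow> 'p \<Rightarrow> 'p set) \<Rightarrow> 'p \<Rightarrow> 'p \<Rightarrow> real" where
  "chain_dist G l N V a b = (if a \<in> G \<and> b \<in> G
     then Inf {(\<Sum>i=1..<n. pre_dist G l N V (c i) (c (Suc i))) | n c.
                 n \<ge> 1 \<and> c 1 = a \<and> c n = b \<and> (\<forall>i\<in>{1..n}. c i \<in> G)}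
     else 0)"

definition stable_time :: "'a smale \<Rightarrow> 'a \<times> 'a \<Rightarrow> nat" where
  "stable_time S a =
     (LEAST N. (hom S ^^ N) (snd a) \<in> local_stable S ((hom S ^^ N) (fst a)) (eps' S / 2))"

definition unstable_time :: "'a smale \<Rightarrow> 'a \<times> 'a \<Rightarrow> nat" where
  "unstable_time S a =
     (LEAST N. (hinv S ^^ N) (snd a) \<in> local_unstable S ((hinv S ^^ N) (fst a)) (eps' S / 2))"

definition stable_nbhd :: "'a smale \<Rightarrow> nat \<Rightarrow> 'a \<times> 'a \<Rightarrow> ('a \<times> 'a) set" where
  "stable_nbhd S n a = (let m = max (stable_time S a) n in
     {(stable_holonomy S m (fst a) z, z) | z.
        z \<in> local_unstable S (snd a) (inverse (lam S) ^ m * eps' S / 4)})"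

definition unstable_nbhd :: "'a smale \<Rightarrow> nat \<Rightarrow> 'a \<times> 'a \<Rightarrow> ('a \<times> 'a) set" where
  "unstable_nbhd S n a = (let m = max (unstable_time S a) n in
     {(unstable_holonomy S m (fst a) z, z) | z.
        z \<in> local_stable S (snd a) (inverse (lam S) ^ m * eps' S / 4)})"

definition stable_metric :: "'a smale \<Rightarrow> 'a set \<Rightarrow> 'a \<times> 'a \<Rightarrow> 'a \<times> 'a \<Rightarrow> real" where
  "stable_metric S Q =
     chain_dist (stable_groupoid S Q) (lam S) (stable_time S) (stable_nbhd S)"

definition unstable_metric :: "'a smale \<Rightarrow> 'a set \<Rightarrow> 'a \<times> 'a \<Rightarrow> 'a \<times> 'a \<Rightarrow> real" where
  "unstable_metric S P =
     chain_dist (unstable_groupoid S P) (lam S) (unstable_time S) (unstable_nbhd S)"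


section \<open>Function spaces and the convolution algebra of an equivalence relation\<close>

text \<open>Functions on a carrier are represented by total functions vanishing off it.\<close>

definition compact_support :: "'p topology \<Rightarrow> ('p \<Rightarrow> complex) \<Rightarrow> bool" where
  "compact_support T f \<longleftrightarrow> compactin T (T closure_of {a \<in> topspace T. f a \<noteq> 0})"

definition Cc :: "'p topology \<Rightarrow> ('p \<Rightarrow> complex) set" where
  "Cc T = {f. (\<forall>a. a \<notin> topspace T \<longrightarrow> f a = 0) \<and> continuous_map T euclidean f \<and>
              compact_support T f}"

definition Lip_c :: "'p set \<Rightarrow> ('p \<Rightarrow> 'p \<Rightarrow> real) \<Rightarrow> ('p \<Rightarrow> complex) set" where
  "Lip_c Z D = {f. (\<forall>a. a \<notin> Z \<longrightarrow> f a = 0) \<and>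
                   (\<exists>L. \<forall>a\<in>Z. \<forall>b\<in>Z. cmod (f a - f b) \<le> L * D a b) \<and>
                   compact_support (Metric_space.mtopology Z D) f}"

definition conv ::
  "('a \<times> 'a) set \<Rightarrow> ('a \<times> 'a \<Rightarrow> complex) \<Rightarrow> ('a \<times> 'a \<Rightarrow> complex) \<Rightarrow> 'a \<times> 'a \<Rightarrow> complex" where
  "conv G f g = (\<lambda>(v, w). if (v, w) \<in> G
     then \<Sum>\<^sub>\<infinity>z\<in>{z. (v, z) \<in> G}. f (v, z) * g (z, w) else 0)"

definition invol :: "('a \<times> 'a \<Rightarrow> complex) \<Rightarrow> 'a \<times> 'a \<Rightarrow> complex" where
  "invol f = (\<lambda>(v, w). cnj (f (w, v)))"

definition conv_star_subalgebra ::
  "('a \<times> 'a) set \<Rightarrow> ('a \<times> 'a \<Rightarrow> complex) set \<Rightarrow> ('a \<times> 'a \<Rightarrow> complex) set \<Rightarrow> bool" where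
  "conv_star_subalgebra G A B \<longleftrightarrow> A \<subseteq> B \<and> (\<lambda>_. 0) \<in> A \<and>
     (\<forall>f\<in>A. \<forall>g\<in>A. (\<lambda>a. f a + g a) \<in> A) \<and> (\<forall>c. \<forall>f\<in>A. (\<lambda>a. c * f a) \<in> A) \<and>
     (\<forall>f\<in>A. \<forall>g\<in>A. conv G f g \<in> A) \<and> (\<forall>f\<in>A. invol f \<in> A)"


section \<open>Bounded operators on \<open>\<ell>\<^sup>2(I)\<close>\<close>

type_synonym 'i operator = "('i \<Rightarrow> complex) \<Rightarrow> ('i \<Rightarrow> complex)"

definition l2 :: "'i set \<Rightarrow> ('i \<Rightarrow> complex) set" where
  "l2 I = {\<xi>. (\<forall>x. x \<notin> I \<longrightarrow> \<xi> x = 0) \<and> (\<lambda>x. (cmod (\<xi> x))\<^sup>2) summable_on I}"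

definition l2_norm :: "'i set \<Rightarrow> ('i \<Rightarrow> complex) \<Rightarrow> real" where
  "l2_norm I \<xi> = sqrt (\<Sum>\<^sub>\<infinity>x\<in>I. (cmod (\<xi> x))\<^sup>2)"

definition l2_inner :: "'i set \<Rightarrow> ('i \<Rightarrow> complex) \<Rightarrow> ('i \<Rightarrow> complex) \<Rightarrow> complex" where
  "l2_inner I \<xi> \<eta> = (\<Sum>\<^sub>\<infinity>x\<in>I. cnj (\<xi> x) * \<eta> x)"

text \<open>Operators are normalised to be \<open>0\<close> off \<open>l2 I\<close>, so that equality of operators is
  equality of functions.\<close>

definition bounded_ops :: "'i set \<Rightarrow> 'i operator set" where
  "bounded_ops I = {T. (\<forall>\<xi>. \<xi> \<notin> l2 I \<longrightarrow> T \<xi> = (\<lambda>_. 0)) \<and> T ` l2 I \<subseteq> l2 I \<and>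
     (\<forall>\<xi>\<in>l2 I. \<forall>\<eta>\<in>l2 I. T (\<lambda>x. \<xi> x + \<eta> x) = (\<lambda>x. T \<xi> x + T \<eta> x)) \<and>
     (\<forall>c. \<forall>\<xi>\<in>l2 I. T (\<lambda>x. c * \<xi> x) = (\<lambda>x. c * T \<xi> x)) \<and>
     (\<exists>C. \<forall>\<xi>\<in>l2 I. l2_norm I (T \<xi>) \<le> C * l2_norm I \<xi>)}"

definition op_norm :: "'i set \<Rightarrow> 'i operator \<Rightarrow> real" where
  "op_norm I T = (SUP \<xi>\<in>{\<xi> \<in> l2 I. l2_norm I \<xi> \<le> 1}. l2_norm I (T \<xi>))"

definition op_dist :: "'i set \<Rightarrow> 'i operator \<Rightarrow> 'i operator \<Rightarrow> real" where
  "op_dist I T U = op_norm I (\<lambda>\<xi> x. T \<xi> x - U \<xi> x)"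

definition op_closure :: "'i set \<Rightarrow> 'i operator set \<Rightarrow> 'i operator set" where
  "op_closure I A = {T \<in> bounded_ops I. \<forall>e>0. \<exists>U\<in>A. op_dist I T U < e}"

definition op_adjoint :: "'i set \<Rightarrow> 'i operator \<Rightarrow> 'i operator" where
  "op_adjoint I T = (THE U. U \<in> bounded_ops I \<and>
     (\<forall>\<xi>\<in>l2 I. \<forall>\<eta>\<in>l2 I. l2_inner I (U \<xi>) \<eta> = l2_inner I \<xi> (T \<eta>)))"

definition op_star_subalgebra :: "'i set \<Rightarrow> 'i operator set \<Rightarrow> bool" where
  "op_star_subalgebra I A \<longleftrightarrow> A \<subseteq> bounded_ops I \<and> (\<lambda>_ _. 0) \<in> A \<and>
     (\<forall>T\<in>A. \<forall>U\<in>A. (\<lambda>\<xi> x. T \<xi> x + U \<xi> x) \<in> A) \<and> (\<forall>c. \<forall>T\<in>A. (\<lambda>\<xi> x. c * T \<xi> x) \<in> A) \<and>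
     (\<forall>T\<in>A. \<forall>U\<in>A. T \<circ> U \<in> A) \<and> (\<forall>T\<in>A. op_adjoint I T \<in> A)"

definition dense_star_subalgebra :: "'i set \<Rightarrow> 'i operator set \<Rightarrow> 'i operator set \<Rightarrow> bool" where
  "dense_star_subalgebra I A B \<longleftrightarrow> op_star_subalgebra I A \<and> A \<subseteq> B \<and> B \<subseteq> op_closure I A"


section \<open>Groupoid algebras and their automorphisms\<close>

definition rep :: "('a \<times> 'a) set \<Rightarrow> 'a set \<Rightarrow> ('a \<times> 'a \<Rightarrow> complex) \<Rightarrow> 'a operator" where
  "rep G I f = (\<lambda>\<xi> v. if \<xi> \<in> l2 I \<and> v \<in> I
     then \<Sum>\<^sub>\<infinity>z\<in>{z. (v, z) \<in> G}. f (v, z) * \<xi> z else 0)"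

definition groupoid_algebra ::
  "('a \<times> 'a) set \<Rightarrow> ('a \<times> 'a) topology \<Rightarrow> 'a set \<Rightarrow> 'a operator set" where
  "groupoid_algebra G T I = op_closure I (rep G I ` Cc T)"

definition alpha ::
  "('a \<times> 'a) set \<Rightarrow> ('a \<Rightarrow> 'a) \<Rightarrow> ('a \<times> 'a \<Rightarrow> complex) \<Rightarrow> 'a \<times> 'a \<Rightarrow> complex" where
  "alpha G ginv f = (\<lambda>(v, w). if (v, w) \<in> G then f (ginv v, ginv w) else 0)"

text \<open>The extension by continuity of \<open>alpha\<close> from the image of \<open>Cc T\<close> to its norm closure.\<close>

definition alpha_ext ::
  "('a \<times> 'a) set \<Rightarrow> ('a \<times> 'a) topology \<Rightarrow> 'a set \<Rightarrow> ('a \<Rightarrow> 'a) \<Rightarrow> 'a operator \<Rightarrow> 'a operator" where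
  "alpha_ext G T I ginv a = (THE b. b \<in> bounded_ops I \<and>
     (\<forall>F::nat \<Rightarrow> ('a \<times> 'a \<Rightarrow> complex). (\<forall>n. F n \<in> Cc T) \<longrightarrow>
        (\<lambda>n. op_dist I (rep G I (F n)) a) \<longlonglongrightarrow> 0 \<longrightarrow>
        (\<lambda>n. op_dist I (rep G I (alpha G ginv (F n))) b) \<longlonglongrightarrow> 0))"


section \<open>Crossed products by the integers\<close>

definition aut_power :: "'b set \<Rightarrow> ('b \<Rightarrow> 'b) \<Rightarrow> int \<Rightarrow> 'b \<Rightarrow> 'b" where
  "aut_power A \<sigma> n = (if 0 \<le> n then \<sigma> ^^ nat n else inv_into A \<sigma> ^^ nat (- n))"

text \<open>Let \<open>\<sigma>\<close> be an automorphism of a C*-algebra \<open>A\<close> of operators on \<open>\<ell>\<^sup>2(I)\<close>. The crossed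
  product by the action of \<open>\<int>\<close> generated by \<open>\<sigma>\<close> is formed in the regular representation on
  \<open>\<ell>\<^sup>2(\<int> \<times> I)\<close>, where \<open>a\<close> acts by \<open>(a \<xi>)(n) = \<sigma>\<^sup>-\<^sup>n(a) \<xi>(n)\<close> and the canonical unitary \<open>u\<close>
  by \<open>(u \<xi>)(n) = \<xi>(n - 1)\<close>, so that \<open>u a u\<^sup>* = \<sigma>(a)\<close>. Since \<open>\<int>\<close> is amenable, this reduced
  crossed product is also the full one. The operator \<open>u\<^sup>j\<close> is \<open>unitary_power I j\<close>.\<close>

definition regular_rep ::
  "'i set \<Rightarrow> 'i operator set \<Rightarrow> ('i operator \<Rightarrow> 'i operator) \<Rightarrow> 'i operator
     \<Rightarrow> (int \<times> 'i) operator" where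
  "regular_rep I A \<sigma> a = (\<lambda>\<xi> (n, x). if \<xi> \<in> l2 (UNIV \<times> I)
     then aut_power A \<sigma> (- n) a (\<lambda>y. \<xi> (n, y)) x else 0)"

definition unitary_power :: "'i set \<Rightarrow> int \<Rightarrow> (int \<times> 'i) operator" where
  "unitary_power I j = (\<lambda>\<xi> (n, x). if \<xi> \<in> l2 (UNIV \<times> I) then \<xi> (n - j, x) else 0)"

text \<open>The finite sums \<open>\<Sum>\<^sub>j b\<^sub>j u\<^sup>j\<close> with coefficients in a subset \<open>B\<close> of \<open>A\<close>.\<close>

definition alg_crossed_product ::
  "'i set \<Rightarrow> 'i operator set \<Rightarrow> ('i operator \<Rightarrow> 'i operator) \<Rightarrow> 'i operator set
     \<Rightarrow> (int \<times> 'i) operator set" where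
  "alg_crossed_product I A \<sigma> B =
     {(\<lambda>\<xi> y. \<Sum>j\<in>J. regular_rep I A \<sigma> (b j) (unitary_power I j \<xi>) y) | J b.
        finite J \<and> (\<forall>j\<in>J. b j \<in> B)}"

definition crossed_product ::
  "'i set \<Rightarrow> 'i operator set \<Rightarrow> ('i operator \<Rightarrow> 'i operator) \<Rightarrow> (int \<times> 'i) operator set" where
  "crossed_product I A \<sigma> = op_closure (UNIV \<times> I) (alg_crossed_product I A \<sigma> A)"


section \<open>The algebras of a Smale space\<close>

definition homoclinic :: "'a smale \<Rightarrow> 'a set \<Rightarrow> 'a set \<Rightarrow> 'a set" where
  "homoclinic S P Q = stable_of S P \<inter> unstable_of S Q"

abbreviation rep_s ::
  "'a smale \<Rightarrow> 'a set \<Rightarrow> 'a set \<Rightarrow> ('a \<times> 'a \<Rightarrow> complex) \<Rightarrow> 'a operator" where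
  "rep_s S P Q \<equiv> rep (stable_groupoid S Q) (homoclinic S P Q)"

abbreviation rep_u ::
  "'a smale \<Rightarrow> 'a set \<Rightarrow> 'a set \<Rightarrow> ('a \<times> 'a \<Rightarrow> complex) \<Rightarrow> 'a operator" where
  "rep_u S P Q \<equiv> rep (unstable_groupoid S P) (homoclinic S P Q)"

definition stable_algebra :: "'a smale \<Rightarrow> 'a set \<Rightarrow> 'a set \<Rightarrow> 'a operator set" where
  "stable_algebra S P Q =
     groupoid_algebra (stable_groupoid S Q) (stable_topology S Q) (homoclinic S P Q)"

definition unstable_algebra :: "'a smale \<Rightarrow> 'a set \<Rightarrow> 'a set \<Rightarrow> 'a operator set" where
  "unstable_algebra S P Q =
     groupoid_algebra (unstable_groupoid S P) (unstable_topology S P) (homoclinic S P Q)"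

definition alpha_s ::
  "'a smale \<Rightarrow> 'a set \<Rightarrow> ('a \<times> 'a \<Rightarrow> complex) \<Rightarrow> 'a \<times> 'a \<Rightarrow> complex" where
  "alpha_s S Q = alpha (stable_groupoid S Q) (hinv S)"

definition alpha_u ::
  "'a smale \<Rightarrow> 'a set \<Rightarrow> ('a \<times> 'a \<Rightarrow> complex) \<Rightarrow> 'a \<times> 'a \<Rightarrow> complex" where
  "alpha_u S P = alpha (unstable_groupoid S P) (hinv S)"

definition aut_s :: "'a smale \<Rightarrow> 'a set \<Rightarrow> 'a set \<Rightarrow> 'a operator \<Rightarrow> 'a operator" where
  "aut_s S P Q =
     alpha_ext (stable_groupoid S Q) (stable_topology S Q) (homoclinic S P Q) (hinv S)"

definition aut_u :: "'a smale \<Rightarrow> 'a set \<Rightarrow> 'a set \<Rightarrow> 'a operator \<Rightarrow> 'a operator" where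
  "aut_u S P Q =
     alpha_ext (unstable_groupoid S P) (unstable_topology S P) (homoclinic S P Q) (hinv S)"

definition stable_ruelle :: "'a smale \<Rightarrow> 'a set \<Rightarrow> 'a set \<Rightarrow> (int \<times> 'a) operator set" where
  "stable_ruelle S P Q =
     crossed_product (homoclinic S P Q) (stable_algebra S P Q) (aut_s S P Q)"

definition unstable_ruelle :: "'a smale \<Rightarrow> 'a set \<Rightarrow> 'a set \<Rightarrow> (int \<times> 'a) operator set" where
  "unstable_ruelle S P Q =
     crossed_product (homoclinic S P Q) (unstable_algebra S P Q) (aut_u S P Q)"

text \<open>In the following definitions \<open>S\<close> is the given Smale space \<open>(X, d, \<phi>)\<close> and \<open>S'\<close> is
  \<open>(X, d', \<phi>)\<close>, which only enters through the groupoid metric.\<close>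

definition Lip_s :: "'a smale \<Rightarrow> 'a smale \<Rightarrow> 'a set \<Rightarrow> ('a \<times> 'a \<Rightarrow> complex) set" where
  "Lip_s S S' Q = Lip_c (stable_groupoid S Q) (stable_metric S' Q)"

definition Lip_u :: "'a smale \<Rightarrow> 'a smale \<Rightarrow> 'a set \<Rightarrow> ('a \<times> 'a \<Rightarrow> complex) set" where
  "Lip_u S S' P = Lip_c (unstable_groupoid S P) (unstable_metric S' P)"

definition Lambda_s ::
  "'a smale \<Rightarrow> 'a smale \<Rightarrow> 'a set \<Rightarrow> 'a set \<Rightarrow> (int \<times> 'a) operator set" where
  "Lambda_s S S' P Q =
     alg_crossed_product (homoclinic S P Q) (stable_algebra S P Q) (aut_s S P Q)
       (rep_s S P Q ` Lip_s S S' Q)"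

definition Lambda_u ::
  "'a smale \<Rightarrow> 'a smale \<Rightarrow> 'a set \<Rightarrow> 'a set \<Rightarrow> (int \<times> 'a) operator set" where
  "Lambda_u S S' P Q =
     alg_crossed_product (homoclinic S P Q) (unstable_algebra S P Q) (aut_u S P Q)
       (rep_u S P Q ` Lip_u S S' P)"

end

theory Submission
  imports Defs
begin

text \<open>Everything is reduced to one relation between pairs \<open>a = (v, w)\<close> and \<open>b = (v', w')\<close> of
  the groupoid: \<open>a\<close> and \<open>b\<close> form a rectangle of size \<open>r\<close> at time \<open>k\<close> if, after \<open>k\<close> iterations, \<open>v\<close>
  and \<open>v'\<close>, as well as \<open>w\<close> and \<open>w'\<close>, have \<open>r\<close>-close backward orbits, while \<open>v\<close> and \<open>w\<close>, as well as
  \<open>v'\<close> and \<open>w'\<close>, have \<open>r\<close>-close forward orbits. For small \<open>r\<close> closeness of forward or backward orbits is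
  the same as lying on a common local stable or unstable set, and such orbits contract
  exponentially. Hence rectangles at late times are thin at time \<open>0\<close>, and they form neighbourhood
  bases for the holonomy topology (\<open>generator_in_rectangle\<close>, \<open>rectangle_in_generator\<close>). As rectangles are
  defined by distances along orbits only, and any two metrics for the same compact topology are
  uniformly equivalent, it does not matter which Smale structure they are measured in.

  The covers defining the groupoid metric are comparable to rectangles as well
  (\<open>R_imp_rectangle\<close>, \<open>rectangle_imp_R\<close>). Self-similarity bounds expansion from above by the
  contraction constant, so that one level of the covers absorbs the factor \<open>3\<close> lost in triangle
  inequalities; this is the hypothesis of Frink's metrization lemma, which makes the chain distance a
  metric comparable to the covers (locale \<open>refining_covers\<close>). It follows that the metric topology is the
  holonomy topology (\<open>stable_topology_eq_mtopology\<close>), that the relatively compact sets are those contained in one of an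
  explicit increasing sequence of compact sets (\<open>compactin_compact_part\<close>, \<open>compact_imp_compact_part\<close>), and that
  the Lipschitz functions among the compactly supported ones are those whose variation over rectangles at time \<open>k\<close> is \<open>O((1/2)\<^bsup>k/L\<^esup>)\<close>, where \<open>L\<close> is the number of
  iterations per level (\<open>Lip_rectangle\<close>, \<open>Lip_if_rectangle\<close>).

  In this form closure under the operations can be read off. For a product \<open>f * g\<close> and a rectangle
  with sides \<open>(v, z)\<close>, \<open>(v', z')\<close> the local product structure matches the intermediate points \<open>w\<close> of one
  sum with the intermediate points \<open>w'\<close> of the other, such that \<open>(v, w)\<close>, \<open>(v', w')\<close> and \<open>(w, z)\<close>, \<open>(w', z')\<close>
  are again rectangles; as rows have boundedly many entries, the sums differ by
  \<open>O((1/2)\<^bsup>k/L\<^esup>)\<close> (\<open>Lip_conv\<close>). The homeomorphism shifts the time of a rectangle by one, which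
  gives invariance under the automorphism.

  For density, a compactly supported continuous function is approximated uniformly by Lipschitz functions
  supported in one fixed compact set (\<open>Lip_approximates\<close>). There the number of nonzero entries per row and
  column is bounded, so Schur's test turns uniform approximation into approximation in operator norm.
  The automorphism is implemented on \<open>\<ell>\<^sup>2\<close> by the permutation unitary of the homeomorphism, hence
  it extends to the norm closure and its powers are conjugations; density then passes to
  the finite sums \<open>\<Sum>a\<^sub>ju\<^sup>j\<close> (\<open>crossed_product_data.crossed_product_dense\<close>). Faithfulness on Lipschitz functions
  holds because the entries of the matrix in rows indexed by homoclinic points are values of the
  function, and irreducibility makes these rows dense in the groupoid (\<open>homoclinic_dense\<close>).

  The unstable half is the stable half of the Smale space with inverted homeomorphism and
  reversed bracket.\<close>

section \<open>The Hilbert space and its operators\<close>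

lemma l2_norm_nonneg [simp]: "0 \<le> l2_norm I \<xi>"
  by (simp add: l2_norm_def infsum_nonneg)

lemma l2_norm_power2: "(l2_norm I \<xi>)\<^sup>2 = (\<Sum>\<^sub>\<infinity>x\<in>I. (cmod (\<xi> x))\<^sup>2)"
  by (simp add: l2_norm_def infsum_nonneg)

lemma l2_finite_sum_le:
  assumes "\<xi> \<in> l2 I" "finite F" "F \<subseteq> I"
  shows "(\<Sum>x\<in>F. (cmod (\<xi> x))\<^sup>2) \<le> (l2_norm I \<xi>)\<^sup>2"
  using assms unfolding l2_norm_power2 l2_def by (intro finite_sum_le_infsum) auto

lemma l2_outside: "\<xi> \<in> l2 I \<Longrightarrow> x \<notin> I \<Longrightarrow> \<xi> x = 0"
  by (simp add: l2_def)

text \<open>Membership and norm bounds are read off from finite partial sums, so that operators can be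
  estimated with finite sums.\<close>
lemma l2_if_finite_sums_le:
  assumes "\<And>x. x \<notin> I \<Longrightarrow> \<xi> x = 0" "c \<ge> 0"
    and "\<And>F. finite F \<Longrightarrow> F \<subseteq> I \<Longrightarrow> (\<Sum>x\<in>F. (cmod (\<xi> x))\<^sup>2) \<le> c\<^sup>2"
  shows "\<xi> \<in> l2 I" "l2_norm I \<xi> \<le> c"
proof -
  have s: "(\<lambda>x. (cmod (\<xi> x))\<^sup>2) summable_on I"
    by (rule nonneg_bdd_above_summable_on) (use assms in \<open>auto simp: bdd_above_def\<close>)
  then show "\<xi> \<in> l2 I" using assms(1) by (auto simp: l2_def)
  have "(\<Sum>\<^sub>\<infinity>x\<in>I. (cmod (\<xi> x))\<^sup>2) \<le> c\<^sup>2"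
    by (rule infsum_le_finite_sums[OF s]) (use assms in auto)
  then show "l2_norm I \<xi> \<le> c"
    unfolding l2_norm_def using assms(2) by (simp add: real_le_lsqrt)
qed

lemma l2_zero [simp]: "(\<lambda>_. 0) \<in> l2 I" "l2_norm I (\<lambda>_. 0) = 0"
  by (auto simp: l2_def l2_norm_def)

lemma l2_add:
  assumes "\<xi> \<in> l2 I" "\<eta> \<in> l2 I"
  shows "(\<lambda>x. \<xi> x + \<eta> x) \<in> l2 I" "l2_norm I (\<lambda>x. \<xi> x + \<eta> x) \<le> l2_norm I \<xi> + l2_norm I \<eta>"
proof -
  have *: "(\<Sum>x\<in>F. (cmod (\<xi> x + \<eta> x))\<^sup>2) \<le> (l2_norm I \<xi> + l2_norm I \<eta>)\<^sup>2"
    if F: "finite F" "F \<subseteq> I" for F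
  proof -
    have n: "L2_set (\<lambda>x. cmod (\<zeta> x)) F \<le> l2_norm I \<zeta>" if "\<zeta> \<in> l2 I" for \<zeta>
      unfolding L2_set_def using l2_finite_sum_le[OF that F]
      by (simp add: real_le_lsqrt)
    have "L2_set (\<lambda>x. cmod (\<xi> x + \<eta> x)) F \<le> L2_set (\<lambda>x. cmod (\<xi> x) + cmod (\<eta> x)) F"
      by (intro L2_set_mono) (auto simp: norm_triangle_ineq)
    also have "\<dots> \<le> L2_set (\<lambda>x. cmod (\<xi> x)) F + L2_set (\<lambda>x. cmod (\<eta> x)) F"
      by (rule L2_set_triangle_ineq)
    also have "\<dots> \<le> l2_norm I \<xi> + l2_norm I \<eta>"
      using n assms by (intro add_mono) auto
    finally have "(L2_set (\<lambda>x. cmod (\<xi> x + \<eta> x)) F)\<^sup>2 \<le> (l2_norm I \<xi> + l2_norm I \<eta>)\<^sup>2"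
      by (intro power_mono) (auto simp: L2_set_nonneg)
    then show ?thesis by (simp add: L2_set_def sum_nonneg)
  qed
  show "(\<lambda>x. \<xi> x + \<eta> x) \<in> l2 I" "l2_norm I (\<lambda>x. \<xi> x + \<eta> x) \<le> l2_norm I \<xi> + l2_norm I \<eta>"
    by (rule l2_if_finite_sums_le; use * assms in \<open>auto simp: l2_def\<close>)+
qed

lemma l2_scale:
  assumes "\<xi> \<in> l2 I"
  shows "(\<lambda>x. c * \<xi> x) \<in> l2 I" "l2_norm I (\<lambda>x. c * \<xi> x) = cmod c * l2_norm I \<xi>"
  using assms
  by (auto simp: l2_def l2_norm_def norm_mult power_mult_distrib summable_on_cmult_right
      infsum_cmult_right' real_sqrt_mult)

lemma l2_diff:
  assumes "\<xi> \<in> l2 I" "\<eta> \<in> l2 I"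
  shows "(\<lambda>x. \<xi> x - \<eta> x) \<in> l2 I"
  using l2_add(1)[OF assms(1) l2_scale(1)[OF assms(2), of "-1"]] by simp

lemma l2_norm_minus_commute: "l2_norm I (\<lambda>x. \<xi> x - \<eta> x) = l2_norm I (\<lambda>x. \<eta> x - \<xi> x)"
  by (simp add: l2_norm_def norm_minus_commute)

lemma l2_component_le:
  assumes "\<xi> \<in> l2 I"
  shows "cmod (\<xi> x) \<le> l2_norm I \<xi>"
proof (cases "x \<in> I")
  case True
  then show ?thesis using l2_finite_sum_le[OF assms, of "{x}"]
    by (simp add: power2_le_iff_abs_le)
qed (simp add: l2_outside[OF assms])

lemma l2_delta: "x \<in> I \<Longrightarrow> (\<lambda>y. if y = x then 1 else 0) \<in> l2 I"
  by (rule l2_if_finite_sums_le(1)[where c = 1]) (auto simp: if_distrib[of cmod] if_distrib[of "\<lambda>t. t\<^sup>2"] sum.delta cong: if_cong)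

lemma l2_inner_summable:
  assumes "\<xi> \<in> l2 I" "\<eta> \<in> l2 I"
  shows "(\<lambda>x. cnj (\<xi> x) * \<eta> x) summable_on I"
proof (rule abs_summable_summable, rule summable_on_comparison_test)
  show "(\<lambda>x. (cmod (\<xi> x))\<^sup>2 + (cmod (\<eta> x))\<^sup>2) summable_on I"
    using assms by (auto simp: l2_def intro: summable_on_add)
  fix x
  have "2 * cmod (\<xi> x) * cmod (\<eta> x) \<le> (cmod (\<xi> x))\<^sup>2 + (cmod (\<eta> x))\<^sup>2"
    by (rule sum_squares_bound)
  moreover have "0 \<le> cmod (\<xi> x) * cmod (\<eta> x)" by simp
  ultimately have "cmod (\<xi> x) * cmod (\<eta> x) \<le> (cmod (\<xi> x))\<^sup>2 + (cmod (\<eta> x))\<^sup>2" by linarith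
  then show "cmod (cnj (\<xi> x) * \<eta> x) \<le> (cmod (\<xi> x))\<^sup>2 + (cmod (\<eta> x))\<^sup>2"
    by (simp add: norm_mult)
qed auto

subsection \<open>Bounded operators\<close>

lemma bounded_opsD:
  assumes "T \<in> bounded_ops I"
  shows "\<xi> \<notin> l2 I \<Longrightarrow> T \<xi> = (\<lambda>_. 0)" "\<xi> \<in> l2 I \<Longrightarrow> T \<xi> \<in> l2 I" "T \<xi> \<in> l2 I"
    "\<xi> \<in> l2 I \<Longrightarrow> \<eta> \<in> l2 I \<Longrightarrow> T (\<lambda>x. \<xi> x + \<eta> x) = (\<lambda>x. T \<xi> x + T \<eta> x)"
    "\<xi> \<in> l2 I \<Longrightarrow> T (\<lambda>x. c * \<xi> x) = (\<lambda>x. c * T \<xi> x)"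
    "\<exists>C\<ge>0. \<forall>\<xi>\<in>l2 I. l2_norm I (T \<xi>) \<le> C * l2_norm I \<xi>"
proof -
  show 1: "\<xi> \<notin> l2 I \<Longrightarrow> T \<xi> = (\<lambda>_. 0)" and 2: "\<xi> \<in> l2 I \<Longrightarrow> T \<xi> \<in> l2 I"
    "\<xi> \<in> l2 I \<Longrightarrow> \<eta> \<in> l2 I \<Longrightarrow> T (\<lambda>x. \<xi> x + \<eta> x) = (\<lambda>x. T \<xi> x + T \<eta> x)"
    "\<xi> \<in> l2 I \<Longrightarrow> T (\<lambda>x. c * \<xi> x) = (\<lambda>x. c * T \<xi> x)"
    using assms by (auto simp: bounded_ops_def)
  show "T \<xi> \<in> l2 I" using 1 2 by (cases "\<xi> \<in> l2 I") auto
  obtain C where C: "\<forall>\<xi>\<in>l2 I. l2_norm I (T \<xi>) \<le> C * l2_norm I \<xi>"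
    using assms by (auto simp: bounded_ops_def)
  have "l2_norm I (T \<xi>) \<le> max C 0 * l2_norm I \<xi>" if "\<xi> \<in> l2 I" for \<xi>
    using C that by (meson l2_norm_nonneg max.cobounded1 mult_right_mono order_trans)
  then show "\<exists>C\<ge>0. \<forall>\<xi>\<in>l2 I. l2_norm I (T \<xi>) \<le> C * l2_norm I \<xi>"
    by (intro exI[of _ "max C 0"]) auto
qed

lemma bounded_opsI:
  assumes "\<And>\<xi>. \<xi> \<notin> l2 I \<Longrightarrow> T \<xi> = (\<lambda>_. 0)"
    and "\<And>\<xi>. \<xi> \<in> l2 I \<Longrightarrow> T \<xi> \<in> l2 I"
    and "\<And>\<xi> \<eta>. \<xi> \<in> l2 I \<Longrightarrow> \<eta> \<in> l2 I \<Longrightarrow> T (\<lambda>x. \<xi> x + \<eta> x) = (\<lambda>x. T \<xi> x + T \<eta> x)"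
    and "\<And>c \<xi>. \<xi> \<in> l2 I \<Longrightarrow> T (\<lambda>x. c * \<xi> x) = (\<lambda>x. c * T \<xi> x)"
    and "\<And>\<xi>. \<xi> \<in> l2 I \<Longrightarrow> l2_norm I (T \<xi>) \<le> C * l2_norm I \<xi>"
  shows "T \<in> bounded_ops I"
  unfolding bounded_ops_def image_subset_iff using assms by blast

lemma bounded_ops_at_zero: "T \<in> bounded_ops I \<Longrightarrow> T (\<lambda>_. 0) = (\<lambda>_. 0)"
  using bounded_opsD(5)[of T I "\<lambda>_. 0" 0] by simp

lemma bounded_ops_zero: "(\<lambda>_ _. 0) \<in> bounded_ops I"
  by (rule bounded_opsI[where C = 0]) auto

lemma bounded_ops_add:
  assumes "T \<in> bounded_ops I" "U \<in> bounded_ops I"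
  shows "(\<lambda>\<xi> x. T \<xi> x + U \<xi> x) \<in> bounded_ops I"
proof -
  obtain C where C: "\<forall>\<xi>\<in>l2 I. l2_norm I (T \<xi>) \<le> C * l2_norm I \<xi>"
    using bounded_opsD(6)[OF assms(1)] by auto
  obtain D where D: "\<forall>\<xi>\<in>l2 I. l2_norm I (U \<xi>) \<le> D * l2_norm I \<xi>"
    using bounded_opsD(6)[OF assms(2)] by auto
  show ?thesis
  proof (rule bounded_opsI[where C = "C + D"])
    fix \<xi> assume x: "\<xi> \<in> l2 I"
    show "l2_norm I (\<lambda>x. T \<xi> x + U \<xi> x) \<le> (C + D) * l2_norm I \<xi>"
      using l2_add(2)[OF bounded_opsD(2)[OF assms(1) x] bounded_opsD(2)[OF assms(2) x]] C D x
      by (smt (verit) distrib_right)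
  qed (simp_all add: bounded_opsD(1)[OF assms(1)] bounded_opsD(1)[OF assms(2)]
      bounded_opsD(4)[OF assms(1)] bounded_opsD(4)[OF assms(2)]
      bounded_opsD(5)[OF assms(1)] bounded_opsD(5)[OF assms(2)]
      l2_add bounded_opsD(2)[OF assms(1)] bounded_opsD(2)[OF assms(2)] algebra_simps)
qed

lemma bounded_ops_scale:
  assumes "T \<in> bounded_ops I"
  shows "(\<lambda>\<xi> x. c * T \<xi> x) \<in> bounded_ops I"
proof -
  obtain C where C: "\<forall>\<xi>\<in>l2 I. l2_norm I (T \<xi>) \<le> C * l2_norm I \<xi>"
    using bounded_opsD(6)[OF assms(1)] by auto
  show ?thesis
  proof (rule bounded_opsI[where C = "cmod c * C"])
    fix \<xi> assume x: "\<xi> \<in> l2 I"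
    show "l2_norm I (\<lambda>x. c * T \<xi> x) \<le> cmod c * C * l2_norm I \<xi>"
      using C x by (simp add: l2_scale(2)[OF bounded_opsD(2)[OF assms x]] mult.assoc mult_left_mono)
  qed (simp_all add: bounded_opsD(1,4,5)[OF assms] l2_scale bounded_opsD(2)[OF assms] algebra_simps)
qed

lemma bounded_ops_diff:
  assumes "T \<in> bounded_ops I" "U \<in> bounded_ops I"
  shows "(\<lambda>\<xi> x. T \<xi> x - U \<xi> x) \<in> bounded_ops I"
  using bounded_ops_add[OF assms(1) bounded_ops_scale[OF assms(2), of "-1"]] by simp

lemma bounded_ops_comp:
  assumes "T \<in> bounded_ops I" "U \<in> bounded_ops I"
  shows "T \<circ> U \<in> bounded_ops I"
proof -
  obtain C where C: "C \<ge> 0" "\<forall>\<xi>\<in>l2 I. l2_norm I (T \<xi>) \<le> C * l2_norm I \<xi>"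
    using bounded_opsD(6)[OF assms(1)] by auto
  obtain D where D: "\<forall>\<xi>\<in>l2 I. l2_norm I (U \<xi>) \<le> D * l2_norm I \<xi>"
    using bounded_opsD(6)[OF assms(2)] by auto
  show ?thesis
  proof (rule bounded_opsI[where C = "C * D"])
    fix \<xi> assume x: "\<xi> \<in> l2 I"
    have "l2_norm I (T (U \<xi>)) \<le> C * l2_norm I (U \<xi>)"
      using C bounded_opsD(2)[OF assms(2) x] by blast
    also have "\<dots> \<le> C * (D * l2_norm I \<xi>)" using C D x by (simp add: mult_left_mono)
    finally show "l2_norm I ((T \<circ> U) \<xi>) \<le> C * D * l2_norm I \<xi>" by (simp add: mult.assoc)
  qed (simp_all add: bounded_opsD(1)[OF assms(2)] bounded_ops_at_zero[OF assms(1)]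
      bounded_opsD(2,4,5)[OF assms(1)] bounded_opsD(2,4,5)[OF assms(2)])
qed

lemma op_norm_le:
  assumes "\<And>\<xi>. \<xi> \<in> l2 I \<Longrightarrow> l2_norm I (T \<xi>) \<le> C * l2_norm I \<xi>" "C \<ge> 0"
  shows "op_norm I T \<le> C"
  unfolding op_norm_def
proof (rule cSUP_least)
  have "(\<lambda>_. 0) \<in> {\<xi> \<in> l2 I. l2_norm I \<xi> \<le> 1}" by simp
  then show "{\<xi> \<in> l2 I. l2_norm I \<xi> \<le> 1} \<noteq> {}" by blast
  fix \<xi> assume "\<xi> \<in> {\<xi> \<in> l2 I. l2_norm I \<xi> \<le> 1}"
  then show "l2_norm I (T \<xi>) \<le> C"
    using assms(1)[of \<xi>] mult_left_mono[of "l2_norm I \<xi>" 1 C] assms(2) by auto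
qed

lemma op_norm_bound:
  assumes "T \<in> bounded_ops I" "\<xi> \<in> l2 I"
  shows "l2_norm I (T \<xi>) \<le> op_norm I T * l2_norm I \<xi>"
proof -
  obtain C where C: "C \<ge> 0" "\<forall>\<xi>\<in>l2 I. l2_norm I (T \<xi>) \<le> C * l2_norm I \<xi>"
    using bounded_opsD(6)[OF assms(1)] by auto
  have bdd: "bdd_above ((\<lambda>\<xi>. l2_norm I (T \<xi>)) ` {\<xi> \<in> l2 I. l2_norm I \<xi> \<le> 1})"
    unfolding bdd_above_def
  proof (intro exI[of _ C] ballI)
    fix y assume "y \<in> (\<lambda>\<xi>. l2_norm I (T \<xi>)) ` {\<xi> \<in> l2 I. l2_norm I \<xi> \<le> 1}"
    then obtain \<xi> where "\<xi> \<in> l2 I" "l2_norm I \<xi> \<le> 1" "y = l2_norm I (T \<xi>)" by auto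
    then show "y \<le> C" using C mult_left_mono[of "l2_norm I \<xi>" 1 C] by force
  qed
  show ?thesis
  proof (cases "l2_norm I \<xi> = 0")
    case True
    then show ?thesis using C(2) assms(2) by fastforce
  next
    case False
    define n where "n = l2_norm I \<xi>"
    have n: "n > 0" using False l2_norm_nonneg[of I \<xi>] by (simp add: n_def less_eq_real_def)
    define c where "c = complex_of_real (1 / n)"
    have cn: "cmod c = 1 / n" using n by (simp add: c_def norm_divide)
    have 1: "(\<lambda>x. c * \<xi> x) \<in> l2 I" "l2_norm I (\<lambda>x. c * \<xi> x) \<le> 1"
      using l2_scale[OF assms(2), of c] cn n by (auto simp: n_def)
    have "l2_norm I (T (\<lambda>x. c * \<xi> x)) \<le> op_norm I T"
      unfolding op_norm_def by (rule cSUP_upper[OF _ bdd]) (use 1 in auto)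
    then have "1 / n * l2_norm I (T \<xi>) \<le> op_norm I T"
      using bounded_opsD(5)[OF assms(1,2), of c]
        l2_scale(2)[OF bounded_opsD(2)[OF assms(1,2)], of c] cn by simp
    then show ?thesis using n by (simp add: field_simps n_def)
  qed
qed

lemma op_norm_nonneg: "T \<in> bounded_ops I \<Longrightarrow> 0 \<le> op_norm I T"
  unfolding op_norm_def
proof (rule cSUP_upper2[of _ _ "\<lambda>_. 0"])
  assume T: "T \<in> bounded_ops I"
  obtain C where C: "C \<ge> 0" "\<forall>\<xi>\<in>l2 I. l2_norm I (T \<xi>) \<le> C * l2_norm I \<xi>"
    using bounded_opsD(6)[OF T] by auto
  show "bdd_above ((\<lambda>\<xi>. l2_norm I (T \<xi>)) ` {\<xi> \<in> l2 I. l2_norm I \<xi> \<le> 1})"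
    unfolding bdd_above_def
  proof (intro exI[of _ C] ballI)
    fix y assume "y \<in> (\<lambda>\<xi>. l2_norm I (T \<xi>)) ` {\<xi> \<in> l2 I. l2_norm I \<xi> \<le> 1}"
    then obtain \<xi> where "\<xi> \<in> l2 I" "l2_norm I \<xi> \<le> 1" "y = l2_norm I (T \<xi>)" by auto
    then show "y \<le> C" using C mult_left_mono[of "l2_norm I \<xi>" 1 C] by force
  qed
qed auto

lemma op_dist_bound:
  assumes "T \<in> bounded_ops I" "U \<in> bounded_ops I" "\<xi> \<in> l2 I"
  shows "l2_norm I (\<lambda>x. T \<xi> x - U \<xi> x) \<le> op_dist I T U * l2_norm I \<xi>"
  unfolding op_dist_def using op_norm_bound[OF bounded_ops_diff[OF assms(1,2)] assms(3)] .

lemma op_dist_nonneg: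
  assumes "T \<in> bounded_ops I" "U \<in> bounded_ops I"
  shows "0 \<le> op_dist I T U"
  unfolding op_dist_def using op_norm_nonneg[OF bounded_ops_diff[OF assms]] .

lemma op_dist_le:
  assumes "\<And>\<xi>. \<xi> \<in> l2 I \<Longrightarrow> l2_norm I (\<lambda>x. T \<xi> x - U \<xi> x) \<le> C * l2_norm I \<xi>" "C \<ge> 0"
  shows "op_dist I T U \<le> C"
  unfolding op_dist_def by (rule op_norm_le[OF assms])

lemma op_dist_self [simp]: "op_dist I T T = 0"
proof -
  have "(\<lambda>_. 0) \<in> {\<xi> \<in> l2 I. l2_norm I \<xi> \<le> 1}" by simp
  then have "{\<xi> \<in> l2 I. l2_norm I \<xi> \<le> 1} \<noteq> {}" by blast
  then show ?thesis by (simp add: op_dist_def op_norm_def)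
qed

lemma op_dist_triangle:
  assumes "T \<in> bounded_ops I" "U \<in> bounded_ops I" "V \<in> bounded_ops I"
  shows "op_dist I T V \<le> op_dist I T U + op_dist I U V"
proof (rule op_dist_le)
  fix \<xi> assume x: "\<xi> \<in> l2 I"
  have "l2_norm I (\<lambda>x. T \<xi> x - V \<xi> x) = l2_norm I (\<lambda>x. (T \<xi> x - U \<xi> x) + (U \<xi> x - V \<xi> x))"
    by simp
  also have "\<dots> \<le> l2_norm I (\<lambda>x. T \<xi> x - U \<xi> x) + l2_norm I (\<lambda>x. U \<xi> x - V \<xi> x)"
    by (rule l2_add(2)[OF l2_diff l2_diff]; rule bounded_opsD(2)[OF _ x]; rule assms)
  also have "\<dots> \<le> (op_dist I T U + op_dist I U V) * l2_norm I \<xi>"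
    using op_dist_bound[OF assms(1,2) x] op_dist_bound[OF assms(2,3) x] by (simp add: algebra_simps)
  finally show "l2_norm I (\<lambda>x. T \<xi> x - V \<xi> x) \<le> (op_dist I T U + op_dist I U V) * l2_norm I \<xi>" .
qed (simp add: op_dist_nonneg assms)

lemma op_dist_commute: "op_dist I T U = op_dist I U T"
  unfolding op_dist_def op_norm_def by (subst l2_norm_minus_commute) simp

lemma op_dist_zero_imp_eq:
  assumes "T \<in> bounded_ops I" "U \<in> bounded_ops I" "op_dist I T U \<le> 0"
  shows "T = U"
proof (rule ext)
  fix \<xi> show "T \<xi> = U \<xi>"
  proof (cases "\<xi> \<in> l2 I")
    case True
    have "l2_norm I (\<lambda>x. T \<xi> x - U \<xi> x) \<le> 0"
      using op_dist_bound[OF assms(1,2) True] assms(3)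
      by (meson l2_norm_nonneg mult_nonpos_nonneg order_trans)
    then have "cmod (T \<xi> x - U \<xi> x) \<le> 0" for x
      using l2_component_le[OF bounded_opsD(2)[OF bounded_ops_diff[OF assms(1,2)] True], of x]
        \<open>l2_norm I (\<lambda>x. T \<xi> x - U \<xi> x) \<le> 0\<close> by linarith
    then show ?thesis by (auto simp: fun_eq_iff)
  qed (simp add: bounded_opsD(1)[OF assms(1)] bounded_opsD(1)[OF assms(2)])
qed

lemma op_closure_superset: "A \<subseteq> bounded_ops I \<Longrightarrow> A \<subseteq> op_closure I A"
  by (force simp: op_closure_def)

lemma op_closure_bounded: "op_closure I A \<subseteq> bounded_ops I"
  by (auto simp: op_closure_def)

lemma op_closure_trans:
  assumes "A \<subseteq> op_closure I B" "B \<subseteq> bounded_ops I"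
  shows "op_closure I A \<subseteq> op_closure I B"
proof
  fix T assume T: "T \<in> op_closure I A"
  show "T \<in> op_closure I B"
    unfolding op_closure_def
  proof safe
    show Tb: "T \<in> bounded_ops I" using T by (simp add: op_closure_def)
    fix e :: real assume "e > 0"
    then obtain U where U: "U \<in> A" "op_dist I T U < e / 2"
      using T unfolding op_closure_def by (auto dest!: spec[of _ "e / 2"])
    then have "U \<in> op_closure I B" using assms by auto
    then obtain V where V: "V \<in> B" "op_dist I U V < e / 2" "U \<in> bounded_ops I"
      using \<open>e > 0\<close> unfolding op_closure_def by (auto dest!: spec[of _ "e / 2"])
    then show "\<exists>V\<in>B. op_dist I T V < e"
      using op_dist_triangle[OF Tb V(3), of V] U assms(2) by (intro bexI[of _ V]) auto
  qed
qed

lemma op_closure_mono: "A \<subseteq> B \<Longrightarrow> op_closure I A \<subseteq> op_closure I B"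
  by (force simp: op_closure_def)

subsection \<open>Adjoints\<close>

text \<open>The constant \<open>op_adjoint\<close> is a definite description. Exhibiting adjoints explicitly and appealing
  to uniqueness avoids the Riesz representation theorem.\<close>
definition adjoint_pair :: "'i set \<Rightarrow> 'i operator \<Rightarrow> 'i operator \<Rightarrow> bool" where
  "adjoint_pair I T U \<longleftrightarrow> T \<in> bounded_ops I \<and> U \<in> bounded_ops I \<and>
     (\<forall>\<xi>\<in>l2 I. \<forall>\<eta>\<in>l2 I. l2_inner I (U \<xi>) \<eta> = l2_inner I \<xi> (T \<eta>))"

lemma l2_inner_delta:
  assumes "\<xi> \<in> l2 I" "x \<in> I"
  shows "l2_inner I \<xi> (\<lambda>y. if y = x then 1 else 0) = cnj (\<xi> x)"
proof -
  have "l2_inner I \<xi> (\<lambda>y. if y = x then 1 else 0) = infsum (\<lambda>y. cnj (\<xi> y) * (if y = x then 1 else 0)) {x}"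
    unfolding l2_inner_def by (rule infsum_cong_neutral) (use assms in auto)
  then show ?thesis by simp
qed

text \<open>An adjoint is determined by its inner products with point masses.\<close>
lemma op_adjoint_eq:
  assumes "adjoint_pair I T U"
  shows "op_adjoint I T = U"
  unfolding op_adjoint_def
proof (rule the_equality)
  show "U \<in> bounded_ops I \<and> (\<forall>\<xi>\<in>l2 I. \<forall>\<eta>\<in>l2 I. l2_inner I (U \<xi>) \<eta> = l2_inner I \<xi> (T \<eta>))"
    using assms by (simp add: adjoint_pair_def)
  fix V assume V: "V \<in> bounded_ops I \<and> (\<forall>\<xi>\<in>l2 I. \<forall>\<eta>\<in>l2 I. l2_inner I (V \<xi>) \<eta> = l2_inner I \<xi> (T \<eta>))"
  have U: "U \<in> bounded_ops I" using assms by (simp add: adjoint_pair_def)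
  show "V = U"
  proof (intro ext)
    fix \<xi> x
    show "V \<xi> x = U \<xi> x"
    proof (cases "\<xi> \<in> l2 I \<and> x \<in> I")
      case True
      then have "l2_inner I (V \<xi>) (\<lambda>y. if y = x then 1 else 0) = l2_inner I (U \<xi>) (\<lambda>y. if y = x then 1 else 0)"
        using V assms l2_delta[of x I] by (auto simp: adjoint_pair_def)
      then show ?thesis
        using l2_inner_delta[of "V \<xi>" I x] l2_inner_delta[of "U \<xi>" I x] True V U
        by (simp add: bounded_opsD)
    next
      case False
      then show ?thesis using V U l2_outside[of _ I x] bounded_opsD(1,3) by metis
    qed
  qed
qed

lemma l2_inner_add:
  assumes "\<xi> \<in> l2 I" "\<eta> \<in> l2 I" "\<zeta> \<in> l2 I"
  shows "l2_inner I (\<lambda>x. \<xi> x + \<eta> x) \<zeta> = l2_inner I \<xi> \<zeta> + l2_inner I \<eta> \<zeta>"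
    "l2_inner I \<zeta> (\<lambda>x. \<xi> x + \<eta> x) = l2_inner I \<zeta> \<xi> + l2_inner I \<zeta> \<eta>"
  using l2_inner_summable[OF assms(1,3)] l2_inner_summable[OF assms(2,3)]
    l2_inner_summable[OF assms(3,1)] l2_inner_summable[OF assms(3,2)]
  unfolding l2_inner_def
  by (simp_all add: distrib_left distrib_right infsum_add)

lemma adjoint_pair_zero: "adjoint_pair I (\<lambda>_ _. 0) (\<lambda>_ _. 0)"
  by (simp add: adjoint_pair_def bounded_ops_zero l2_inner_def)

lemma adjoint_pair_add:
  assumes "adjoint_pair I T T'" "adjoint_pair I U U'"
  shows "adjoint_pair I (\<lambda>\<xi> x. T \<xi> x + U \<xi> x) (\<lambda>\<xi> x. T' \<xi> x + U' \<xi> x)"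
  using assms unfolding adjoint_pair_def
  by (auto simp: bounded_ops_add l2_inner_add bounded_opsD)

lemma adjoint_pair_comp:
  assumes "adjoint_pair I T T'" "adjoint_pair I U U'"
  shows "adjoint_pair I (T \<circ> U) (U' \<circ> T')"
  using assms unfolding adjoint_pair_def
  by (auto simp: bounded_ops_comp bounded_opsD)

section \<open>The regular representation of an equivalence relation\<close>

lemma infsum_finite_support:
  assumes "finite B" "B \<subseteq> A" "\<And>x. x \<in> A - B \<Longrightarrow> f x = 0"
  shows "infsum f A = sum f B"
proof -
  have "infsum f A = infsum f B"
    by (rule infsum_cong_neutral) (use assms in auto)
  then show ?thesis using assms(1) by simp
qed

definition supp_row :: "('a \<times> 'a) set \<Rightarrow> ('a \<times> 'a \<Rightarrow> complex) \<Rightarrow> 'a \<Rightarrow> 'a set" where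
  "supp_row G f v = {z. (v, z) \<in> G \<and> f (v, z) \<noteq> 0}"

definition supp_col :: "('a \<times> 'a) set \<Rightarrow> ('a \<times> 'a \<Rightarrow> complex) \<Rightarrow> 'a \<Rightarrow> 'a set" where
  "supp_col G f z = {v. (v, z) \<in> G \<and> f (v, z) \<noteq> 0}"

text \<open>The matrices to which Schur's test applies. Compactly supported continuous functions on the groupoid are of this kind.\<close>
definition banded :: "('a \<times> 'a) set \<Rightarrow> nat \<Rightarrow> real \<Rightarrow> ('a \<times> 'a \<Rightarrow> complex) \<Rightarrow> bool" where
  "banded G N M f \<longleftrightarrow> (\<forall>v. finite (supp_row G f v) \<and> card (supp_row G f v) \<le> N) \<and>
     (\<forall>v. finite (supp_col G f v) \<and> card (supp_col G f v) \<le> N) \<and> (\<forall>a\<in>G. cmod (f a) \<le> M) \<and> 0 \<le> M"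

text \<open>Used for the absolute convergence of the double series in the computation of adjoints.\<close>
lemma summable_on_Sigma_fst:
  assumes "\<xi> \<in> l2 I" "\<And>z. finite (R z) \<and> card (R z) \<le> N"
  shows "(\<lambda>(z, v). (cmod (\<xi> z))\<^sup>2) summable_on Sigma I R"
proof (rule nonneg_bdd_above_summable_on)
  show "bdd_above (sum (\<lambda>(z, v). (cmod (\<xi> z))\<^sup>2) ` {F. F \<subseteq> Sigma I R \<and> finite F})"
    unfolding bdd_above_def
  proof (intro exI[of _ "real N * (l2_norm I \<xi>)\<^sup>2"] ballI)
    fix y assume "y \<in> sum (\<lambda>(z, v). (cmod (\<xi> z))\<^sup>2) ` {F. F \<subseteq> Sigma I R \<and> finite F}"
    then obtain F where F: "F \<subseteq> Sigma I R" "finite F" "y = (\<Sum>(z, v)\<in>F. (cmod (\<xi> z))\<^sup>2)"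
      by auto
    have "y \<le> (\<Sum>(z, v)\<in>Sigma (fst ` F) R. (cmod (\<xi> z))\<^sup>2)"
      unfolding F(3) by (rule sum_mono2) (use F assms(2) in \<open>force+\<close>)
    also have "\<dots> = (\<Sum>z\<in>fst ` F. \<Sum>v\<in>R z. (cmod (\<xi> z))\<^sup>2)"
      by (rule sum.Sigma[symmetric]) (use F assms(2) in auto)
    also have "\<dots> \<le> (\<Sum>z\<in>fst ` F. real N * (cmod (\<xi> z))\<^sup>2)"
      by (rule sum_mono) (use assms(2) in \<open>simp add: mult_right_mono\<close>)
    also have "\<dots> = real N * (\<Sum>z\<in>fst ` F. (cmod (\<xi> z))\<^sup>2)"
      by (simp add: sum_distrib_left)
    also have "\<dots> \<le> real N * (l2_norm I \<xi>)\<^sup>2"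
      by (intro mult_left_mono l2_finite_sum_le assms) (use F in auto)
    finally show "y \<le> real N * (l2_norm I \<xi>)\<^sup>2" .
  qed
qed auto

text \<open>The set \<open>I\<close> is a union of equivalence classes, so a matrix supported on \<open>G\<close> can be cut down to
  \<open>\<ell>\<^sup>2(I)\<close>.\<close>
locale invariant_relation =
  fixes G :: "('a \<times> 'a) set" and I :: "'a set"
  assumes G_sym: "(v, w) \<in> G \<Longrightarrow> (w, v) \<in> G"
    and G_trans: "(v, w) \<in> G \<Longrightarrow> (w, z) \<in> G \<Longrightarrow> (v, z) \<in> G"
    and I_invariant: "v \<in> I \<Longrightarrow> (v, w) \<in> G \<Longrightarrow> w \<in> I"
begin

lemma rep_apply:
  assumes "finite B" "supp_row G f v \<subseteq> B" "\<And>z. z \<in> B \<Longrightarrow> (v, z) \<in> G" "\<xi> \<in> l2 I" "v \<in> I"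
  shows "rep G I f \<xi> v = (\<Sum>z\<in>B. f (v, z) * \<xi> z)"
  using assms unfolding rep_def
  by (auto simp: supp_row_def intro!: infsum_finite_support)

lemma rep_apply_row:
  assumes "banded G N M f" "\<xi> \<in> l2 I" "v \<in> I"
  shows "rep G I f \<xi> v = (\<Sum>z\<in>supp_row G f v. f (v, z) * \<xi> z)"
  using assms by (intro rep_apply) (auto simp: banded_def supp_row_def)

lemma conv_apply:
  assumes "finite B" "supp_row G f v \<subseteq> B" "\<And>z. z \<in> B \<Longrightarrow> (v, z) \<in> G" "(v, w) \<in> G"
  shows "conv G f g (v, w) = (\<Sum>z\<in>B. f (v, z) * g (z, w))"
  using assms unfolding conv_def
  by (auto simp: supp_row_def intro!: infsum_finite_support)

lemma rep_outside: "\<xi> \<notin> l2 I \<Longrightarrow> rep G I f \<xi> = (\<lambda>_. 0)" "v \<notin> I \<Longrightarrow> rep G I f \<xi> v = 0"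
  by (auto simp: rep_def)

lemma banded_invol:
  assumes "banded G N M f"
  shows "banded G N M (invol f)"
proof -
  have "supp_row G (invol f) v = supp_col G f v" "supp_col G (invol f) v = supp_row G f v" for v
    unfolding supp_row_def supp_col_def using G_sym by (auto simp: invol_def)
  then show ?thesis using assms G_sym by (auto simp: banded_def invol_def)
qed

text \<open>Schur's test: the Cauchy-Schwarz inequality is applied in each row, and after interchanging the sums
  each column is met by at most \<open>N\<close> rows.\<close>
lemma rep_l2:
  assumes f: "banded G N M f" and x: "\<xi> \<in> l2 I"
  shows "rep G I f \<xi> \<in> l2 I" "l2_norm I (rep G I f \<xi>) \<le> real N * M * l2_norm I \<xi>"
proof -
  have M: "M \<ge> 0" using f by (simp add: banded_def)
  have *: "(\<Sum>v\<in>F. (cmod (rep G I f \<xi> v))\<^sup>2) \<le> (real N * M * l2_norm I \<xi>)\<^sup>2"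
    if F: "finite F" "F \<subseteq> I" for F
  proof -
    define Z where "Z = (\<Union>v\<in>F. supp_row G f v)"
    have Z: "finite Z" "Z \<subseteq> I"
      using f F I_invariant by (auto simp: Z_def banded_def supp_row_def)
    have "(cmod (rep G I f \<xi> v))\<^sup>2 \<le> M\<^sup>2 * real N * (\<Sum>z | z \<in> Z \<and> z \<in> supp_row G f v. (cmod (\<xi> z))\<^sup>2)"
      if v: "v \<in> F" for v
    proof -
      have R: "finite (supp_row G f v)" "card (supp_row G f v) \<le> N" using f by (auto simp: banded_def)
      have "cmod (rep G I f \<xi> v) \<le> (\<Sum>z\<in>supp_row G f v. M * cmod (\<xi> z))"
        unfolding rep_apply_row[OF f x subsetD[OF F(2) v]]
        by (rule sum_norm_le) (use f in \<open>auto simp: norm_mult supp_row_def banded_def intro!: mult_right_mono\<close>)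
      then have "(cmod (rep G I f \<xi> v))\<^sup>2 \<le> (\<Sum>z\<in>supp_row G f v. M * cmod (\<xi> z))\<^sup>2"
        by (rule power_mono) simp
      also have "\<dots> \<le> (\<Sum>z\<in>supp_row G f v. (M * cmod (\<xi> z))\<^sup>2) * real (card (supp_row G f v))"
        using sum_squared_le_sum_of_squares[of "\<lambda>z. M * cmod (\<xi> z)" "supp_row G f v"] R by simp
      also have "\<dots> \<le> (\<Sum>z\<in>supp_row G f v. (M * cmod (\<xi> z))\<^sup>2) * real N"
        using R by (intro mult_left_mono) (auto intro!: sum_nonneg)
      also have "\<dots> = M\<^sup>2 * real N * (\<Sum>z\<in>supp_row G f v. (cmod (\<xi> z))\<^sup>2)"
        by (simp add: power_mult_distrib sum_distrib_left mult_ac)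
      also have "supp_row G f v = {z. z \<in> Z \<and> z \<in> supp_row G f v}" using v by (auto simp: Z_def)
      finally show ?thesis .
    qed
    then have "(\<Sum>v\<in>F. (cmod (rep G I f \<xi> v))\<^sup>2)
        \<le> (\<Sum>v\<in>F. M\<^sup>2 * real N * (\<Sum>z | z \<in> Z \<and> z \<in> supp_row G f v. (cmod (\<xi> z))\<^sup>2))"
      by (rule sum_mono)
    also have "\<dots> = M\<^sup>2 * real N * (\<Sum>z\<in>Z. \<Sum>v | v \<in> F \<and> z \<in> supp_row G f v. (cmod (\<xi> z))\<^sup>2)"
      by (simp add: sum_distrib_left[symmetric] sum.swap_restrict[OF F(1) Z(1)])
    also have "\<dots> \<le> M\<^sup>2 * real N * (\<Sum>z\<in>Z. real N * (cmod (\<xi> z))\<^sup>2)"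
    proof (intro mult_left_mono sum_mono)
      fix z
      have "card {v. v \<in> F \<and> z \<in> supp_row G f v} \<le> card (supp_col G f z)"
        using f by (intro card_mono) (auto simp: banded_def supp_row_def supp_col_def)
      also have "\<dots> \<le> N" using f by (simp add: banded_def)
      finally show "(\<Sum>v | v \<in> F \<and> z \<in> supp_row G f v. (cmod (\<xi> z))\<^sup>2) \<le> real N * (cmod (\<xi> z))\<^sup>2"
        by (simp add: mult_right_mono)
    qed simp
    also have "\<dots> = (real N * M)\<^sup>2 * (\<Sum>z\<in>Z. (cmod (\<xi> z))\<^sup>2)"
      by (simp add: sum_distrib_left power2_eq_square mult_ac)
    also have "\<dots> \<le> (real N * M)\<^sup>2 * (l2_norm I \<xi>)\<^sup>2"
      by (intro mult_left_mono l2_finite_sum_le x Z) simp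
    finally show ?thesis by (simp add: power_mult_distrib)
  qed
  show "rep G I f \<xi> \<in> l2 I" "l2_norm I (rep G I f \<xi>) \<le> real N * M * l2_norm I \<xi>"
    by (rule l2_if_finite_sums_le; use * M in \<open>auto simp: rep_outside\<close>)+
qed

lemma rep_bounded:
  assumes f: "banded G N M f"
  shows "rep G I f \<in> bounded_ops I"
proof (rule bounded_opsI[where C = "real N * M"])
  fix \<xi> \<eta> assume x: "\<xi> \<in> l2 I" "\<eta> \<in> l2 I"
  show "rep G I f (\<lambda>x. \<xi> x + \<eta> x) = (\<lambda>x. rep G I f \<xi> x + rep G I f \<eta> x)"
  proof
    fix v show "rep G I f (\<lambda>x. \<xi> x + \<eta> x) v = rep G I f \<xi> v + rep G I f \<eta> v"
      using rep_apply_row[OF f] x l2_add(1)[OF x] rep_outside(2)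
      by (cases "v \<in> I") (simp_all add: distrib_left sum.distrib)
  qed
next
  fix c \<xi> assume x: "\<xi> \<in> l2 I"
  show "rep G I f (\<lambda>x. c * \<xi> x) = (\<lambda>x. c * rep G I f \<xi> x)"
  proof
    fix v show "rep G I f (\<lambda>x. c * \<xi> x) v = c * rep G I f \<xi> v"
      using rep_apply_row[OF f] x l2_scale(1)[OF x] rep_outside(2)
      by (cases "v \<in> I") (simp_all add: sum_distrib_left mult_ac)
  qed
qed (use rep_l2[OF f] rep_outside in auto)

lemma rep_add:
  assumes f: "banded G N M f" and g: "banded G N' M' g"
  shows "rep G I (\<lambda>a. f a + g a) = (\<lambda>\<xi> x. rep G I f \<xi> x + rep G I g \<xi> x)"
proof (intro ext)
  fix \<xi> v
  let ?B = "supp_row G f v \<union> supp_row G g v"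
  have B: "finite ?B" "supp_row G (\<lambda>a. f a + g a) v \<subseteq> ?B" "\<And>z. z \<in> ?B \<Longrightarrow> (v, z) \<in> G"
    using f g by (auto simp: banded_def supp_row_def)
  show "rep G I (\<lambda>a. f a + g a) \<xi> v = rep G I f \<xi> v + rep G I g \<xi> v"
  proof (cases "\<xi> \<in> l2 I \<and> v \<in> I")
    case True
    have "rep G I f \<xi> v = (\<Sum>z\<in>?B. f (v, z) * \<xi> z)" "rep G I g \<xi> v = (\<Sum>z\<in>?B. g (v, z) * \<xi> z)"
      "rep G I (\<lambda>a. f a + g a) \<xi> v = (\<Sum>z\<in>?B. (f (v, z) + g (v, z)) * \<xi> z)"
      using True B by (intro rep_apply; auto)+
    then show ?thesis by (simp add: distrib_right sum.distrib)
  qed (auto simp: rep_def)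
qed

lemma rep_scale:
  assumes f: "banded G N M f"
  shows "rep G I (\<lambda>a. c * f a) = (\<lambda>\<xi> x. c * rep G I f \<xi> x)"
proof (intro ext)
  fix \<xi> v
  show "rep G I (\<lambda>a. c * f a) \<xi> v = c * rep G I f \<xi> v"
  proof (cases "\<xi> \<in> l2 I \<and> v \<in> I")
    case True
    have "rep G I (\<lambda>a. c * f a) \<xi> v = (\<Sum>z\<in>supp_row G f v. (c * f (v, z)) * \<xi> z)"
      using True f by (intro rep_apply) (auto simp: banded_def supp_row_def)
    then show ?thesis using rep_apply_row[OF f] True by (simp add: sum_distrib_left mult_ac)
  qed (auto simp: rep_def)
qed

lemma rep_conv:
  assumes f: "banded G N M f" and g: "banded G N' M' g"
  shows "rep G I (conv G f g) = rep G I f \<circ> rep G I g"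
proof (intro ext)
  fix \<xi> v
  show "rep G I (conv G f g) \<xi> v = (rep G I f \<circ> rep G I g) \<xi> v"
  proof (cases "\<xi> \<in> l2 I \<and> v \<in> I")
    case True
    then have x: "\<xi> \<in> l2 I" and v: "v \<in> I" by auto
    define R where "R = supp_row G f v"
    define Z where "Z = (\<Union>w\<in>R. supp_row G g w)"
    have fin: "finite R" "finite Z" using f g by (auto simp: R_def Z_def banded_def)
    have RG: "(v, w) \<in> G" if "w \<in> R" for w using that by (auto simp: R_def supp_row_def)
    have ZG: "(v, z) \<in> G" if "z \<in> Z" for z
      using that RG G_trans by (fastforce simp: Z_def supp_row_def)
    have c: "conv G f g (v, z) = (\<Sum>w\<in>R. f (v, w) * g (w, z))" if "(v, z) \<in> G" for z
      using that RG fin by (intro conv_apply) (auto simp: R_def)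
    have sub: "supp_row G (conv G f g) v \<subseteq> Z"
    proof
      fix z assume z: "z \<in> supp_row G (conv G f g) v"
      then have "(\<Sum>w\<in>R. f (v, w) * g (w, z)) \<noteq> 0" "(v, z) \<in> G" using c by (auto simp: supp_row_def)
      then obtain w where w: "w \<in> R" "g (w, z) \<noteq> 0"
        by (metis (no_types, lifting) mult_zero_right sum.neutral)
      then have "(w, z) \<in> G" using RG G_sym G_trans \<open>(v, z) \<in> G\<close> by blast
      then show "z \<in> Z" using w by (auto simp: Z_def supp_row_def)
    qed
    have inner: "rep G I g \<xi> w = (\<Sum>z\<in>Z. g (w, z) * \<xi> z)" if w: "w \<in> R" for w
    proof (rule rep_apply[OF fin(2) _ _ x])
      show "supp_row G g w \<subseteq> Z" using w by (auto simp: Z_def)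
      show "(w, z) \<in> G" if "z \<in> Z" for z using ZG[OF that] RG[OF w] G_sym G_trans by blast
      show "w \<in> I" using RG[OF w] v I_invariant by blast
    qed
    have "rep G I (conv G f g) \<xi> v = (\<Sum>z\<in>Z. conv G f g (v, z) * \<xi> z)"
      using fin sub ZG x v by (intro rep_apply)
    also have "\<dots> = (\<Sum>z\<in>Z. \<Sum>w\<in>R. f (v, w) * (g (w, z) * \<xi> z))"
      using c ZG by (simp add: sum_distrib_right mult.assoc)
    also have "\<dots> = (\<Sum>w\<in>R. f (v, w) * rep G I g \<xi> w)"
      by (subst sum.swap) (simp add: inner sum_distrib_left)
    also have "\<dots> = rep G I f (rep G I g \<xi>) v"
      using rep_apply_row[OF f rep_l2(1)[OF g x] v] by (simp add: R_def)
    finally show ?thesis by simp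
  next
    case False
    then show ?thesis using bounded_ops_at_zero[OF rep_bounded[OF f]] by (auto simp: rep_def)
  qed
qed

text \<open>Both inner products are the same double series, summed by columns and by rows. It converges
  absolutely as its terms are bounded by \<open>M (|\<xi>\<^sub>z|\<^sup>2 + |\<eta>\<^sub>v|\<^sup>2)\<close> and each row and column
  has at most \<open>N\<close> of them.\<close>
lemma rep_adjoint:
  assumes f: "banded G N M f"
  shows "adjoint_pair I (rep G I f) (rep G I (invol f))"
  unfolding adjoint_pair_def
proof (intro conjI ballI rep_bounded[OF f] rep_bounded[OF banded_invol[OF f]])
  fix \<xi> \<eta> assume x: "\<xi> \<in> l2 I" "\<eta> \<in> l2 I"
  define \<Phi> where "\<Phi> z v = cnj (\<xi> z) * f (z, v) * \<eta> v" for z v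
  have M: "M \<ge> 0" using f by (simp add: banded_def)
  have bij: "bij_betw prod.swap (Sigma I (supp_row G f)) (Sigma I (supp_col G f))"
    by (rule bij_betwI[where g = prod.swap])
      (auto simp: supp_row_def supp_col_def intro: I_invariant I_invariant[OF _ G_sym])
  have s1: "(\<lambda>(z, v). (cmod (\<xi> z))\<^sup>2) summable_on Sigma I (supp_row G f)"
    using f by (intro summable_on_Sigma_fst[OF x(1)]) (auto simp: banded_def)
  have "(\<lambda>(v, z). (cmod (\<eta> v))\<^sup>2) summable_on Sigma I (supp_col G f)"
    using f by (intro summable_on_Sigma_fst[OF x(2)]) (auto simp: banded_def)
  then have s2: "(\<lambda>(z, v). (cmod (\<eta> v))\<^sup>2) summable_on Sigma I (supp_row G f)"
    using summable_on_reindex_bij_betw[OF bij, of "\<lambda>(v, z). (cmod (\<eta> v))\<^sup>2"]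
    by (simp add: case_prod_unfold)
  have s: "(\<lambda>(z, v). \<Phi> z v) summable_on Sigma I (supp_row G f)"
  proof (rule abs_summable_summable, rule summable_on_comparison_test)
    show "(\<lambda>p. M * ((case p of (z, v) \<Rightarrow> (cmod (\<xi> z))\<^sup>2) + (case p of (z, v) \<Rightarrow> (cmod (\<eta> v))\<^sup>2)))
        summable_on Sigma I (supp_row G f)"
      by (intro summable_on_cmult_right summable_on_add s1 s2)
    fix p assume p: "p \<in> Sigma I (supp_row G f)"
    obtain z v where zv: "p = (z, v)" by fastforce
    have "2 * cmod (\<xi> z) * cmod (\<eta> v) \<le> (cmod (\<xi> z))\<^sup>2 + (cmod (\<eta> v))\<^sup>2"
      by (rule sum_squares_bound)
    moreover have "0 \<le> cmod (\<xi> z) * cmod (\<eta> v)" by simp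
    ultimately have 1: "cmod (\<xi> z) * cmod (\<eta> v) \<le> (cmod (\<xi> z))\<^sup>2 + (cmod (\<eta> v))\<^sup>2" by linarith
    have "cmod (\<Phi> z v) = cmod (f (z, v)) * (cmod (\<xi> z) * cmod (\<eta> v))"
      by (simp add: \<Phi>_def norm_mult)
    also have "\<dots> \<le> M * ((cmod (\<xi> z))\<^sup>2 + (cmod (\<eta> v))\<^sup>2)"
      using p zv f M 1 by (intro mult_mono) (auto simp: banded_def supp_row_def)
    finally show "norm (case p of (z, v) \<Rightarrow> \<Phi> z v)
      \<le> M * ((case p of (z, v) \<Rightarrow> (cmod (\<xi> z))\<^sup>2) + (case p of (z, v) \<Rightarrow> (cmod (\<eta> v))\<^sup>2))"
      by (simp add: zv)
  qed auto
  have s': "(\<lambda>(v, z). \<Phi> z v) summable_on Sigma I (supp_col G f)"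
    using s summable_on_reindex_bij_betw[OF bij, of "\<lambda>(v, z). \<Phi> z v"]
    by (simp add: case_prod_unfold)
  have fin: "finite (supp_row G f v)" "finite (supp_col G f v)" for v using f by (auto simp: banded_def)
  have "l2_inner I (rep G I (invol f) \<xi>) \<eta> = (\<Sum>\<^sub>\<infinity>v\<in>I. \<Sum>\<^sub>\<infinity>z\<in>supp_col G f v. \<Phi> z v)"
    unfolding l2_inner_def
  proof (rule infsum_cong)
    fix v assume v: "v \<in> I"
    have "supp_row G (invol f) v = supp_col G f v"
      unfolding supp_row_def supp_col_def using G_sym by (auto simp: invol_def)
    then have "rep G I (invol f) \<xi> v = (\<Sum>z\<in>supp_col G f v. cnj (f (z, v)) * \<xi> z)"
      using rep_apply_row[OF banded_invol[OF f] x(1) v] by (simp add: invol_def)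
    then show "cnj (rep G I (invol f) \<xi> v) * \<eta> v = (\<Sum>\<^sub>\<infinity>z\<in>supp_col G f v. \<Phi> z v)"
      using fin by (simp add: \<Phi>_def sum_distrib_right mult.commute[of _ "cnj _"])
  qed
  also have "\<dots> = infsum (\<lambda>(v, z). \<Phi> z v) (Sigma I (supp_col G f))"
    by (rule infsum_Sigma'_banach[OF s'])
  also have "\<dots> = infsum (\<lambda>(z, v). \<Phi> z v) (Sigma I (supp_row G f))"
    using infsum_reindex_bij_betw[OF bij, of "\<lambda>(v, z). \<Phi> z v"] by (simp add: case_prod_unfold)
  also have "\<dots> = (\<Sum>\<^sub>\<infinity>z\<in>I. \<Sum>\<^sub>\<infinity>v\<in>supp_row G f z. \<Phi> z v)"
    by (rule infsum_Sigma'_banach[OF s, symmetric])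
  also have "\<dots> = l2_inner I \<xi> (rep G I f \<eta>)"
    unfolding l2_inner_def
  proof (rule infsum_cong)
    fix z assume "z \<in> I"
    then show "(\<Sum>\<^sub>\<infinity>v\<in>supp_row G f z. \<Phi> z v) = cnj (\<xi> z) * rep G I f \<eta> z"
      using fin rep_apply_row[OF f x(2)] by (simp add: \<Phi>_def sum_distrib_left mult_ac)
  qed
  finally show "l2_inner I (rep G I (invol f) \<xi>) \<eta> = l2_inner I \<xi> (rep G I f \<eta>)" .
qed

text \<open>Matrix entries can be recovered from the operator; this is the source of faithfulness.\<close>
lemma rep_delta:
  assumes "(v, w) \<in> G" "v \<in> I"
  shows "rep G I f (\<lambda>y. if y = w then 1 else 0) v = f (v, w)"
proof -
  have "(\<Sum>\<^sub>\<infinity>z\<in>{z. (v, z) \<in> G}. f (v, z) * (if z = w then 1 else 0))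
    = (\<Sum>z\<in>{w}. f (v, z) * (if z = w then 1 else 0))"
    by (rule infsum_finite_support) (use assms in auto)
  then show ?thesis
    using assms l2_delta[of w I] I_invariant[OF assms(2,1)] by (simp add: rep_def)
qed

lemma op_dist_rep_le:
  assumes f: "banded G N M f" and g: "banded G N' M' g"
    and d: "banded G K e (\<lambda>a. f a - g a)"
  shows "op_dist I (rep G I f) (rep G I g) \<le> real K * e"
proof (rule op_dist_le)
  have "rep G I f = (\<lambda>\<xi> x. rep G I (\<lambda>a. f a - g a) \<xi> x + rep G I g \<xi> x)"
    using rep_add[OF d g] by simp
  then have "(\<lambda>x. rep G I f \<xi> x - rep G I g \<xi> x) = rep G I (\<lambda>a. f a - g a) \<xi>" for \<xi>
    by (simp add: fun_eq_iff)
  then show "l2_norm I (\<lambda>x. rep G I f \<xi> x - rep G I g \<xi> x) \<le> real K * e * l2_norm I \<xi>"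
    if "\<xi> \<in> l2 I" for \<xi> using rep_l2(2)[OF d that] by simp
  show "0 \<le> real K * e" using d by (simp add: banded_def)
qed

end

section \<open>Crossed products by a unitarily implemented automorphism\<close>

lemma bounded_ops_apply_diff:
  assumes "T \<in> bounded_ops I" "\<xi> \<in> l2 I" "\<eta> \<in> l2 I"
  shows "T (\<lambda>x. \<xi> x - \<eta> x) = (\<lambda>x. T \<xi> x - T \<eta> x)"
  using bounded_opsD(4)[OF assms(1,2) l2_scale(1)[OF assms(3), of "-1"]]
    bounded_opsD(5)[OF assms(1,3), of "-1"] by simp

lemma l2_sum:
  assumes "finite K" "\<And>k. k \<in> K \<Longrightarrow> \<xi> k \<in> l2 I"
  shows "(\<lambda>x. \<Sum>k\<in>K. \<xi> k x) \<in> l2 I"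
  using assms by (induction K rule: finite_induct) (auto simp: l2_add)

lemma bounded_ops_apply_sum:
  assumes T: "T \<in> bounded_ops I" and "finite K" "\<And>k. k \<in> K \<Longrightarrow> \<xi> k \<in> l2 I"
  shows "T (\<lambda>x. \<Sum>k\<in>K. \<xi> k x) = (\<lambda>x. \<Sum>k\<in>K. T (\<xi> k) x)"
  using assms(2,3)
proof (induction K rule: finite_induct)
  case empty
  then show ?case using bounded_ops_at_zero[OF T] by simp
next
  case (insert k K)
  then have "(\<lambda>x. \<Sum>k\<in>K. \<xi> k x) \<in> l2 I" by (intro l2_sum) auto
  then show ?case
    using insert bounded_opsD(4)[OF T, of "\<xi> k" "\<lambda>x. \<Sum>k\<in>K. \<xi> k x"] by simp
qed

lemma adjoint_pair_sum:
  assumes "finite K" "\<And>k. k \<in> K \<Longrightarrow> adjoint_pair I (T k) (U k)"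
  shows "adjoint_pair I (\<lambda>\<xi> x. \<Sum>k\<in>K. T k \<xi> x) (\<lambda>\<xi> x. \<Sum>k\<in>K. U k \<xi> x)"
  using assms
  by (induction K rule: finite_induct) (auto simp: adjoint_pair_zero intro: adjoint_pair_add)

lemma bounded_ops_sum:
  assumes "finite K" "\<And>k. k \<in> K \<Longrightarrow> T k \<in> bounded_ops I"
  shows "(\<lambda>\<xi> x. \<Sum>k\<in>K. T k \<xi> x) \<in> bounded_ops I"
  using assms
  by (induction K rule: finite_induct) (auto simp: bounded_ops_zero intro: bounded_ops_add)

lemma op_dist_sum_le:
  assumes "finite K" "\<And>k. k \<in> K \<Longrightarrow> T k \<in> bounded_ops I" "\<And>k. k \<in> K \<Longrightarrow> U k \<in> bounded_ops I"
  shows "op_dist I (\<lambda>\<xi> x. \<Sum>k\<in>K. T k \<xi> x) (\<lambda>\<xi> x. \<Sum>k\<in>K. U k \<xi> x) \<le> (\<Sum>k\<in>K. op_dist I (T k) (U k))"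
  using assms
proof (induction K rule: finite_induct)
  case (insert k K)
  let ?T = "\<lambda>\<xi> x. \<Sum>k\<in>K. T k \<xi> x" and ?U = "\<lambda>\<xi> x. \<Sum>k\<in>K. U k \<xi> x"
  have b: "?T \<in> bounded_ops I" "?U \<in> bounded_ops I" "T k \<in> bounded_ops I" "U k \<in> bounded_ops I"
    using insert by (auto intro: bounded_ops_sum)
  have "op_dist I (\<lambda>\<xi> x. T k \<xi> x + ?T \<xi> x) (\<lambda>\<xi> x. U k \<xi> x + ?U \<xi> x) \<le> op_dist I (T k) (U k) + op_dist I ?T ?U"
  proof (rule op_dist_le)
    fix \<xi> assume x: "\<xi> \<in> l2 I"
    have "l2_norm I (\<lambda>x. (T k \<xi> x + ?T \<xi> x) - (U k \<xi> x + ?U \<xi> x))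
      = l2_norm I (\<lambda>x. (T k \<xi> x - U k \<xi> x) + (?T \<xi> x - ?U \<xi> x))" by (simp add: algebra_simps)
    also have "\<dots> \<le> l2_norm I (\<lambda>x. T k \<xi> x - U k \<xi> x) + l2_norm I (\<lambda>x. ?T \<xi> x - ?U \<xi> x)"
      using b[THEN bounded_opsD(2), OF x] by (intro l2_add(2) l2_diff)
    also have "\<dots> \<le> (op_dist I (T k) (U k) + op_dist I ?T ?U) * l2_norm I \<xi>"
      using op_dist_bound[OF b(3,4) x] op_dist_bound[OF b(1,2) x] by (simp add: algebra_simps)
    finally show "l2_norm I (\<lambda>x. (T k \<xi> x + ?T \<xi> x) - (U k \<xi> x + ?U \<xi> x))
      \<le> (op_dist I (T k) (U k) + op_dist I ?T ?U) * l2_norm I \<xi>" .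
  qed (intro add_nonneg_nonneg op_dist_nonneg b)
  then show ?case using insert by simp
qed simp

subsection \<open>Slicewise operators on l2 of a product with the integers\<close>

lemma l2_slice:
  assumes "\<xi> \<in> l2 (UNIV \<times> I)"
  shows "(\<lambda>y. \<xi> (n, y)) \<in> l2 I"
proof (rule l2_if_finite_sums_le(1)[where c = "l2_norm (UNIV \<times> I) \<xi>"])
  fix F assume F: "finite F" "F \<subseteq> I"
  have "(\<Sum>p\<in>Pair n ` F. (cmod (\<xi> p))\<^sup>2) \<le> (l2_norm (UNIV \<times> I) \<xi>)\<^sup>2"
    by (rule l2_finite_sum_le[OF assms]) (use F in auto)
  then show "(\<Sum>x\<in>F. (cmod (\<xi> (n, x)))\<^sup>2) \<le> (l2_norm (UNIV \<times> I) \<xi>)\<^sup>2"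
    by (simp add: sum.reindex inj_on_def)
qed (use l2_outside[OF assms] in auto)

lemma l2_slice_norms:
  fixes \<xi> :: "int \<times> 'i \<Rightarrow> complex"
  assumes "\<xi> \<in> l2 (UNIV \<times> I)" "finite F"
  shows "(\<Sum>n\<in>F. (l2_norm I (\<lambda>y. \<xi> (n, y)))\<^sup>2) \<le> (l2_norm (UNIV \<times> I) \<xi>)\<^sup>2"
proof -
  have s: "(\<lambda>(n, x). (cmod (\<xi> (n, x)))\<^sup>2) summable_on Sigma UNIV (\<lambda>_. I)"
    using assms(1) by (simp add: l2_def case_prod_unfold)
  have "(\<Sum>n\<in>F. \<Sum>\<^sub>\<infinity>x\<in>I. (cmod (\<xi> (n, x)))\<^sup>2) \<le> (\<Sum>\<^sub>\<infinity>n. \<Sum>\<^sub>\<infinity>x\<in>I. (cmod (\<xi> (n, x)))\<^sup>2)"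
    by (rule finite_sum_le_infsum[OF summable_on_Sigma_banach[OF s] assms(2)])
      (auto intro: infsum_nonneg)
  also have "\<dots> = infsum (\<lambda>(n, x). (cmod (\<xi> (n, x)))\<^sup>2) (Sigma UNIV (\<lambda>_. I))"
    by (rule infsum_Sigma'_banach[OF s])
  finally show ?thesis
    by (simp add: l2_norm_power2 case_prod_unfold)
qed

text \<open>Operators on \<open>\<ell>\<^sup>2(\<int> \<times> I)\<close> that preserve each fibre \<open>{n} \<times> I\<close>. The coefficients of the crossed product
  are represented by such operators.\<close>
definition slicewise :: "'i set \<Rightarrow> (int \<Rightarrow> 'i operator) \<Rightarrow> (int \<times> 'i) operator" where
  "slicewise I c = (\<lambda>\<xi> (n, x). if \<xi> \<in> l2 (UNIV \<times> I) then c n (\<lambda>y. \<xi> (n, y)) x else 0)"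

lemma slicewise_l2:
  assumes c: "\<And>n. c n \<in> bounded_ops I"
    and C: "\<And>n \<xi>. \<xi> \<in> l2 I \<Longrightarrow> l2_norm I (c n \<xi>) \<le> C * l2_norm I \<xi>" "0 \<le> C"
    and x: "\<xi> \<in> l2 (UNIV \<times> I)"
  shows "slicewise I c \<xi> \<in> l2 (UNIV \<times> I)" "l2_norm (UNIV \<times> I) (slicewise I c \<xi>) \<le> C * l2_norm (UNIV \<times> I) \<xi>"
proof -
  let ?J = "UNIV \<times> I :: (int \<times> _) set"
  have *: "(\<Sum>p\<in>F. (cmod (slicewise I c \<xi> p))\<^sup>2) \<le> (C * l2_norm ?J \<xi>)\<^sup>2"
    if F: "finite F" "F \<subseteq> ?J" for F
  proof -
    have "(\<Sum>p\<in>F. (cmod (slicewise I c \<xi> p))\<^sup>2) \<le> (\<Sum>p\<in>fst ` F \<times> snd ` F. (cmod (slicewise I c \<xi> p))\<^sup>2)"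
      by (rule sum_mono2) (use F in force)+
    also have "\<dots> = (\<Sum>n\<in>fst ` F. \<Sum>x\<in>snd ` F. (cmod (c n (\<lambda>y. \<xi> (n, y)) x))\<^sup>2)"
      using x by (simp add: slicewise_def sum.cartesian_product case_prod_unfold)
    also have "\<dots> \<le> (\<Sum>n\<in>fst ` F. (l2_norm I (c n (\<lambda>y. \<xi> (n, y))))\<^sup>2)"
      by (intro sum_mono l2_finite_sum_le bounded_opsD(3)[OF c]) (use F in auto)
    also have "\<dots> \<le> (\<Sum>n\<in>fst ` F. (C * l2_norm I (\<lambda>y. \<xi> (n, y)))\<^sup>2)"
      by (intro sum_mono power_mono C l2_slice[OF x]) simp
    also have "\<dots> = C\<^sup>2 * (\<Sum>n\<in>fst ` F. (l2_norm I (\<lambda>y. \<xi> (n, y)))\<^sup>2)"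
      by (simp add: power_mult_distrib sum_distrib_left)
    also have "\<dots> \<le> C\<^sup>2 * (l2_norm ?J \<xi>)\<^sup>2"
      by (intro mult_left_mono l2_slice_norms[OF x]) (use F in auto)
    finally show ?thesis by (simp add: power_mult_distrib)
  qed
  have out: "slicewise I c \<xi> p = 0" if "p \<notin> ?J" for p
    using that x l2_outside[OF bounded_opsD(3)[OF c]] by (auto simp: slicewise_def split: prod.splits)
  show "slicewise I c \<xi> \<in> l2 ?J" "l2_norm ?J (slicewise I c \<xi>) \<le> C * l2_norm ?J \<xi>"
    by (rule l2_if_finite_sums_le; use * out C in auto)+
qed

lemma slicewise_bounded:
  assumes c: "\<And>n. c n \<in> bounded_ops I"
    and C: "\<And>n \<xi>. \<xi> \<in> l2 I \<Longrightarrow> l2_norm I (c n \<xi>) \<le> C * l2_norm I \<xi>" "0 \<le> C"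
  shows "slicewise I c \<in> bounded_ops (UNIV \<times> I)"
proof (rule bounded_opsI)
  show "slicewise I c \<xi> \<in> l2 (UNIV \<times> I)" "l2_norm (UNIV \<times> I) (slicewise I c \<xi>) \<le> C * l2_norm (UNIV \<times> I) \<xi>"
    if "\<xi> \<in> l2 (UNIV \<times> I)" for \<xi> using slicewise_l2[OF c C that] by auto
qed (auto simp: slicewise_def fun_eq_iff l2_add l2_scale bounded_opsD(4)[OF c l2_slice l2_slice]
      bounded_opsD(5)[OF c l2_slice])

lemma slicewise_adjoint:
  assumes c: "\<And>n. adjoint_pair I (c n) (c' n)"
    and C: "\<And>n \<xi>. \<xi> \<in> l2 I \<Longrightarrow> l2_norm I (c n \<xi>) \<le> C * l2_norm I \<xi>" "0 \<le> C"
    and C': "\<And>n \<xi>. \<xi> \<in> l2 I \<Longrightarrow> l2_norm I (c' n \<xi>) \<le> C' * l2_norm I \<xi>" "0 \<le> C'"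
  shows "adjoint_pair (UNIV \<times> I) (slicewise I c) (slicewise I c')"
  unfolding adjoint_pair_def
proof (intro conjI ballI)
  have cb: "c n \<in> bounded_ops I" "c' n \<in> bounded_ops I" for n
    using c[of n] by (auto simp: adjoint_pair_def)
  show b: "slicewise I c \<in> bounded_ops (UNIV \<times> I)" "slicewise I c' \<in> bounded_ops (UNIV \<times> I)"
    using slicewise_bounded[OF cb(1) C] slicewise_bounded[OF cb(2) C'] by auto
  fix \<xi> \<eta> :: "int \<times> 'a \<Rightarrow> complex" assume x: "\<xi> \<in> l2 (UNIV \<times> I)" "\<eta> \<in> l2 (UNIV \<times> I)"
  have split: "l2_inner (UNIV \<times> I) \<alpha> \<beta> = (\<Sum>\<^sub>\<infinity>n. l2_inner I (\<lambda>y. \<alpha> (n, y)) (\<lambda>y. \<beta> (n, y)))"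
    if "\<alpha> \<in> l2 (UNIV \<times> I)" "\<beta> \<in> l2 (UNIV \<times> I)" for \<alpha> \<beta> :: "int \<times> 'a \<Rightarrow> complex"
    unfolding l2_inner_def
    using infsum_Sigma_banach[OF l2_inner_summable[OF that]] by simp
  have "l2_inner (UNIV \<times> I) (slicewise I c' \<xi>) \<eta>
      = (\<Sum>\<^sub>\<infinity>n. l2_inner I (c' n (\<lambda>y. \<xi> (n, y))) (\<lambda>y. \<eta> (n, y)))"
    using split[OF bounded_opsD(2)[OF b(2) x(1)] x(2)] x by (simp add: slicewise_def)
  also have "\<dots> = (\<Sum>\<^sub>\<infinity>n. l2_inner I (\<lambda>y. \<xi> (n, y)) (c n (\<lambda>y. \<eta> (n, y))))"
    using c l2_slice[OF x(1)] l2_slice[OF x(2)] by (simp add: adjoint_pair_def)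
  also have "\<dots> = l2_inner (UNIV \<times> I) \<xi> (slicewise I c \<eta>)"
    using split[OF x(1) bounded_opsD(2)[OF b(1) x(2)]] x by (simp add: slicewise_def)
  finally show "l2_inner (UNIV \<times> I) (slicewise I c' \<xi>) \<eta> = l2_inner (UNIV \<times> I) \<xi> (slicewise I c \<eta>)" .
qed

lemma bij_shift: "bij_betw (\<lambda>(n::int, x). (n - j, x)) (UNIV \<times> I) (UNIV \<times> I)"
  by (rule bij_betwI[where g = "\<lambda>(n, x). (n + j, x)"]) auto

lemma unitary_power_l2:
  assumes "\<xi> \<in> l2 (UNIV \<times> I)"
  shows "unitary_power I j \<xi> \<in> l2 (UNIV \<times> I)"
    "l2_norm (UNIV \<times> I) (unitary_power I j \<xi>) = l2_norm (UNIV \<times> I) \<xi>"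
proof -
  have eq: "unitary_power I j \<xi> p = \<xi> ((\<lambda>(n, x). (n - j, x)) p)" for p
    using assms by (simp add: unitary_power_def case_prod_unfold)
  show "l2_norm (UNIV \<times> I) (unitary_power I j \<xi>) = l2_norm (UNIV \<times> I) \<xi>"
    unfolding l2_norm_def eq
    using infsum_reindex_bij_betw[OF bij_shift, of "\<lambda>p. (cmod (\<xi> p))\<^sup>2" j I] by simp
  have "(\<lambda>p. (cmod (unitary_power I j \<xi> p))\<^sup>2) summable_on UNIV \<times> I"
    unfolding eq
    using summable_on_reindex_bij_betw[OF bij_shift, of "\<lambda>p. (cmod (\<xi> p))\<^sup>2" j I] assms
    by (simp add: l2_def)
  then show "unitary_power I j \<xi> \<in> l2 (UNIV \<times> I)"
    using assms by (auto simp: l2_def eq)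
qed

lemma unitary_power_bounded: "unitary_power I j \<in> bounded_ops (UNIV \<times> I)"
proof (rule bounded_opsI[where C = 1])
  fix \<xi> :: "int \<times> 'a \<Rightarrow> complex" assume "\<xi> \<in> l2 (UNIV \<times> I)"
  then show "unitary_power I j \<xi> \<in> l2 (UNIV \<times> I)"
    "l2_norm (UNIV \<times> I) (unitary_power I j \<xi>) \<le> 1 * l2_norm (UNIV \<times> I) \<xi>"
    using unitary_power_l2[of \<xi> I j] by auto
qed (auto simp: unitary_power_def fun_eq_iff l2_add l2_scale)

lemma unitary_power_add: "unitary_power I i \<circ> unitary_power I j = unitary_power I (i + j)"
proof (rule ext)
  fix \<xi> show "(unitary_power I i \<circ> unitary_power I j) \<xi> = unitary_power I (i + j) \<xi>"
    using unitary_power_l2(1)[of \<xi> I j] unitary_power_bounded[THEN bounded_ops_at_zero, of I i]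
    by (cases "\<xi> \<in> l2 (UNIV \<times> I)") (auto simp: unitary_power_def fun_eq_iff algebra_simps)
qed

lemma unitary_power_adjoint: "adjoint_pair (UNIV \<times> I) (unitary_power I j) (unitary_power I (- j))"
  unfolding adjoint_pair_def
proof (intro conjI ballI unitary_power_bounded)
  fix \<xi> \<eta> :: "int \<times> 'a \<Rightarrow> complex" assume x: "\<xi> \<in> l2 (UNIV \<times> I)" "\<eta> \<in> l2 (UNIV \<times> I)"
  have "l2_inner (UNIV \<times> I) \<xi> (unitary_power I j \<eta>)
    = infsum (\<lambda>p. cnj (unitary_power I (- j) \<xi> ((\<lambda>(n, x). (n - j, x)) p)) * \<eta> ((\<lambda>(n, x). (n - j, x)) p)) (UNIV \<times> I)"
    unfolding l2_inner_def using x by (intro infsum_cong) (auto simp: unitary_power_def)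
  also have "\<dots> = l2_inner (UNIV \<times> I) (unitary_power I (- j) \<xi>) \<eta>"
    unfolding l2_inner_def by (rule infsum_reindex_bij_betw[OF bij_shift])
  finally show "l2_inner (UNIV \<times> I) (unitary_power I (- j) \<xi>) \<eta> = l2_inner (UNIV \<times> I) \<xi> (unitary_power I j \<eta>)" ..
qed

subsection \<open>Conjugation by a one-parameter group of unitaries\<close>

text \<open>A unitary representation of \<open>\<int>\<close> and the automorphisms \<open>Ad n\<close> that it implements.\<close>
locale unitary_group =
  fixes I :: "'i set" and W :: "int \<Rightarrow> 'i operator"
  assumes W_bounded: "W n \<in> bounded_ops I"
    and W_add: "W m \<circ> W n = W (m + n)"
    and W_zero: "\<xi> \<in> l2 I \<Longrightarrow> W 0 \<xi> = \<xi>"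
    and W_norm: "\<xi> \<in> l2 I \<Longrightarrow> l2_norm I (W n \<xi>) = l2_norm I \<xi>"
    and W_adjoint: "adjoint_pair I (W n) (W (- n))"
begin

definition Ad :: "int \<Rightarrow> 'i operator \<Rightarrow> 'i operator" where
  "Ad n a = W n \<circ> a \<circ> W (- n)"

lemma W_l2: "W n \<xi> \<in> l2 I"
  using bounded_opsD(3)[OF W_bounded] .

lemma W_norm_le: "l2_norm I (W n \<xi>) \<le> l2_norm I \<xi>"
  using W_norm[of \<xi> n] bounded_opsD(1)[OF W_bounded, of \<xi> n] by (cases "\<xi> \<in> l2 I") auto

lemma Ad_bounded: "a \<in> bounded_ops I \<Longrightarrow> Ad n a \<in> bounded_ops I"
  unfolding Ad_def by (intro bounded_ops_comp W_bounded)

lemma Ad_Ad: "Ad m (Ad n a) = Ad (m + n) a"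
proof -
  have "Ad m (Ad n a) = (W m \<circ> W n) \<circ> a \<circ> (W (- n) \<circ> W (- m))"
    by (simp add: Ad_def comp_assoc)
  moreover have "- n + - m = - (m + n)" by simp
  ultimately show ?thesis by (simp only: W_add Ad_def)
qed

lemma Ad_zero:
  assumes "a \<in> bounded_ops I"
  shows "Ad 0 a = a"
proof
  fix \<xi> show "Ad 0 a \<xi> = a \<xi>"
    using W_zero[OF bounded_opsD(3)[OF assms]] W_zero[of \<xi>] bounded_opsD(1)[OF W_bounded, of \<xi> 0]
      bounded_opsD(1)[OF assms, of \<xi>] bounded_ops_at_zero[OF assms] bounded_ops_at_zero[OF W_bounded]
    by (cases "\<xi> \<in> l2 I") (auto simp: Ad_def)
qed

lemma Ad_comp:
  assumes "b \<in> bounded_ops I"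
  shows "Ad n (a \<circ> b) = Ad n a \<circ> Ad n b"
proof
  fix \<xi>
  have "W (- n) (W n \<eta>) = W 0 \<eta>" for \<eta> using W_add[of "- n" n] by (metis add.left_inverse comp_apply)
  then show "Ad n (a \<circ> b) \<xi> = (Ad n a \<circ> Ad n b) \<xi>"
    using W_zero[OF bounded_opsD(3)[OF assms]] by (simp add: Ad_def)
qed

lemma Ad_add:
  assumes "a \<in> bounded_ops I" "b \<in> bounded_ops I"
  shows "Ad n (\<lambda>\<xi> x. a \<xi> x + b \<xi> x) = (\<lambda>\<xi> x. Ad n a \<xi> x + Ad n b \<xi> x)"
  using bounded_opsD(4)[OF W_bounded bounded_opsD(3)[OF assms(1)] bounded_opsD(3)[OF assms(2)]]
  by (simp add: Ad_def fun_eq_iff)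

lemma Ad_scale:
  assumes "a \<in> bounded_ops I"
  shows "Ad n (\<lambda>\<xi> x. c * a \<xi> x) = (\<lambda>\<xi> x. c * Ad n a \<xi> x)"
  using bounded_opsD(5)[OF W_bounded bounded_opsD(3)[OF assms]]
  by (simp add: Ad_def fun_eq_iff)

lemma Ad_op_dist:
  assumes a: "a \<in> bounded_ops I" and b: "b \<in> bounded_ops I"
  shows "op_dist I (Ad n a) (Ad n b) \<le> op_dist I a b"
proof (rule op_dist_le[OF _ op_dist_nonneg[OF a b]])
  fix \<xi> assume x: "\<xi> \<in> l2 I"
  let ?\<eta> = "W (- n) \<xi>"
  have "l2_norm I (\<lambda>x. Ad n a \<xi> x - Ad n b \<xi> x) = l2_norm I (W n (\<lambda>x. a ?\<eta> x - b ?\<eta> x))"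
    using bounded_ops_apply_diff[OF W_bounded bounded_opsD(3)[OF a] bounded_opsD(3)[OF b]]
    by (simp add: Ad_def)
  also have "\<dots> \<le> l2_norm I (\<lambda>x. a ?\<eta> x - b ?\<eta> x)" by (rule W_norm_le)
  also have "\<dots> \<le> op_dist I a b * l2_norm I ?\<eta>" by (rule op_dist_bound[OF a b W_l2])
  finally show "l2_norm I (\<lambda>x. Ad n a \<xi> x - Ad n b \<xi> x) \<le> op_dist I a b * l2_norm I \<xi>"
    using W_norm[OF x] by simp
qed

lemma Ad_norm_bound:
  assumes a: "a \<in> bounded_ops I" and x: "\<xi> \<in> l2 I"
  shows "l2_norm I (Ad n a \<xi>) \<le> op_norm I a * l2_norm I \<xi>"
  using W_norm_le[of n "a (W (- n) \<xi>)"] op_norm_bound[OF a W_l2, of "- n" \<xi>] W_norm[OF x, of "- n"]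
  by (simp add: Ad_def)

lemma Ad_adjoint:
  assumes "adjoint_pair I a b"
  shows "adjoint_pair I (Ad n a) (Ad n b)"
  using adjoint_pair_comp[OF adjoint_pair_comp[OF W_adjoint[of n] assms] W_adjoint[of "- n"]]
  by (simp add: Ad_def comp_assoc)

end

text \<open>An automorphism of the norm closure of \<open>B\<close> that is implemented by a unitary normalising \<open>B\<close>.
  This makes all powers of the automorphism, and with them the regular representation, explicit.\<close>
locale crossed_product_data = unitary_group +
  fixes A B :: "'a operator set" and \<sigma> :: "'a operator \<Rightarrow> 'a operator"
  assumes B_bounded: "B \<subseteq> bounded_ops I" and B_zero: "(\<lambda>_ _. 0) \<in> B"
    and B_add: "T \<in> B \<Longrightarrow> U \<in> B \<Longrightarrow> (\<lambda>\<xi> x. T \<xi> x + U \<xi> x) \<in> B"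
    and B_scale: "T \<in> B \<Longrightarrow> (\<lambda>\<xi> x. c * T \<xi> x) \<in> B"
    and B_comp: "T \<in> B \<Longrightarrow> U \<in> B \<Longrightarrow> T \<circ> U \<in> B"
    and B_adjoint: "T \<in> B \<Longrightarrow> \<exists>U\<in>B. adjoint_pair I T U"
    and A_closure: "A = op_closure I B"
    and \<sigma>_Ad: "a \<in> A \<Longrightarrow> \<sigma> a = Ad 1 a"
    and Ad_B_generators: "T \<in> B \<Longrightarrow> Ad 1 T \<in> B" "T \<in> B \<Longrightarrow> Ad (- 1) T \<in> B"
begin

lemma A_bounded: "a \<in> A \<Longrightarrow> a \<in> bounded_ops I"
  using op_closure_bounded A_closure by auto

lemma B_subset_A: "B \<subseteq> A"
  unfolding A_closure by (rule op_closure_superset[OF B_bounded])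

lemma Ad_B: "T \<in> B \<Longrightarrow> Ad n T \<in> B"
proof (induction n rule: int_induct[where k = 0])
  case base then show ?case using Ad_zero B_bounded by auto
next
  case (step1 i)
  then show ?case using Ad_B_generators(1)[of "Ad i T"] by (simp add: Ad_Ad add.commute)
next
  case (step2 i)
  then show ?case using Ad_B_generators(2)[of "Ad i T"] by (simp add: Ad_Ad)
qed

lemma Ad_A:
  assumes "a \<in> A" shows "Ad n a \<in> A"
  unfolding A_closure op_closure_def
proof safe
  have a: "a \<in> bounded_ops I" using assms by (rule A_bounded)
  show "Ad n a \<in> bounded_ops I" by (rule Ad_bounded[OF a])
  fix e :: real assume "e > 0"
  then obtain U where "U \<in> B" "op_dist I a U < e" using assms unfolding A_closure op_closure_def by auto
  then show "\<exists>U\<in>B. op_dist I (Ad n a) U < e"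
    using Ad_op_dist[OF a, of U n] Ad_B B_bounded by (intro bexI[of _ "Ad n U"]) auto
qed

text \<open>Negative powers are defined by a set-theoretic inverse on \<open>A\<close>; it is \<open>Ad (- 1)\<close> because \<open>Ad 1\<close>
  is injective and both conjugations preserve \<open>A\<close>.\<close>
lemma aut_power_eq_Ad:
  assumes "a \<in> A" shows "aut_power A \<sigma> n a = Ad n a"
proof (cases "0 \<le> n")
  case True
  have "(\<sigma> ^^ k) a = Ad (int k) a" for k
  proof (induction k)
    case 0 then show ?case using Ad_zero A_bounded assms by simp
  next
    case (Suc k)
    then show ?case using \<sigma>_Ad[OF Ad_A[OF assms]] by (simp add: Ad_Ad)
  qed
  then show ?thesis using True by (simp add: aut_power_def)
next
  case False
  have inj: "inj_on \<sigma> A"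
  proof (rule inj_onI)
    fix x y assume "x \<in> A" "y \<in> A" "\<sigma> x = \<sigma> y"
    then have "Ad (- 1) (Ad 1 x) = Ad (- 1) (Ad 1 y)" using \<sigma>_Ad by simp
    then show "x = y" using \<open>x \<in> A\<close> \<open>y \<in> A\<close> by (simp add: Ad_Ad Ad_zero A_bounded)
  qed
  have inv: "inv_into A \<sigma> x = Ad (- 1) x" if "x \<in> A" for x
    by (rule inv_into_f_eq[OF inj]) (use that in \<open>auto simp: Ad_A \<sigma>_Ad Ad_Ad Ad_zero A_bounded\<close>)
  have "(inv_into A \<sigma> ^^ k) a = Ad (- int k) a" for k
  proof (induction k)
    case 0 then show ?case using Ad_zero A_bounded assms by simp
  next
    case (Suc k)
    have "- 1 + - int k = - int (Suc k)" by simp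
    then show ?case using Suc inv[OF Ad_A[OF assms]] by (simp only: funpow.simps comp_apply Ad_Ad)
  qed
  then show ?thesis using False by (simp add: aut_power_def)
qed

abbreviation R where "R \<equiv> regular_rep I A \<sigma>"
abbreviation u where "u \<equiv> unitary_power I"
abbreviation J where "J \<equiv> (UNIV :: int set) \<times> I"
abbreviation L where "L \<equiv> alg_crossed_product I A \<sigma> B"

lemma R_slicewise: "a \<in> A \<Longrightarrow> R a = slicewise I (\<lambda>n. Ad (- n) a)"
  by (simp add: regular_rep_def slicewise_def aut_power_eq_Ad fun_eq_iff)

lemma R_bounded: "a \<in> A \<Longrightarrow> R a \<in> bounded_ops J"
  unfolding R_slicewise
  by (rule slicewise_bounded[where C = "op_norm I a"])
    (auto simp: A_bounded Ad_bounded Ad_norm_bound op_norm_nonneg)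

lemma R_adjoint:
  assumes "a \<in> A" "b \<in> A" "adjoint_pair I a b"
  shows "adjoint_pair J (R a) (R b)"
  unfolding R_slicewise[OF assms(1)] R_slicewise[OF assms(2)]
  by (rule slicewise_adjoint[where C = "op_norm I a" and C' = "op_norm I b"])
    (auto simp: A_bounded Ad_bounded Ad_norm_bound op_norm_nonneg Ad_adjoint assms)

lemma op_dist_R:
  assumes "a \<in> A" "b \<in> A"
  shows "op_dist J (R a) (R b) \<le> op_dist I a b"
proof (rule op_dist_le)
  have ab: "a \<in> bounded_ops I" "b \<in> bounded_ops I" using assms A_bounded by auto
  let ?c = "\<lambda>n. \<lambda>\<xi> x. Ad (- n) a \<xi> x - Ad (- n) b \<xi> x"
  show nn: "0 \<le> op_dist I a b" using ab by (rule op_dist_nonneg)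
  fix \<xi> assume x: "\<xi> \<in> l2 J"
  have "l2_norm J (slicewise I ?c \<xi>) \<le> op_dist I a b * l2_norm J \<xi>"
  proof (rule slicewise_l2(2)[OF _ _ nn x])
    show "?c n \<in> bounded_ops I" for n by (intro bounded_ops_diff Ad_bounded ab)
    show "l2_norm I (?c n \<eta>) \<le> op_dist I a b * l2_norm I \<eta>" if "\<eta> \<in> l2 I" for n \<eta>
      using op_dist_bound[OF Ad_bounded[OF ab(1)] Ad_bounded[OF ab(2)] that, of "- n" "- n"]
        mult_right_mono[OF Ad_op_dist[OF ab, of "- n"] l2_norm_nonneg[of I \<eta>]] by linarith
  qed
  also have "slicewise I ?c \<xi> = (\<lambda>p. R a \<xi> p - R b \<xi> p)"
    using x by (auto simp: R_slicewise assms slicewise_def fun_eq_iff)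
  finally show "l2_norm J (\<lambda>p. R a \<xi> p - R b \<xi> p) \<le> op_dist I a b * l2_norm J \<xi>" .
qed

lemma R_zero: "R (\<lambda>_ _. 0) = (\<lambda>_ _. 0)"
  using B_zero B_subset_A bounded_ops_at_zero[OF W_bounded]
  by (subst R_slicewise) (auto simp: slicewise_def Ad_def fun_eq_iff)

lemma R_add:
  assumes "a \<in> B" "b \<in> B"
  shows "R (\<lambda>\<xi> x. a \<xi> x + b \<xi> x) \<xi> p = R a \<xi> p + R b \<xi> p"
  using assms B_add[OF assms] B_subset_A B_bounded
  by (cases p) (simp add: R_slicewise subset_iff slicewise_def Ad_add)

lemma R_scale:
  assumes "a \<in> B"
  shows "R (\<lambda>\<xi> x. c * a \<xi> x) \<xi> p = c * R a \<xi> p"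
  using assms B_scale[OF assms] B_subset_A B_bounded
  by (cases p) (simp add: R_slicewise subset_iff slicewise_def Ad_scale)

lemma R_comp:
  assumes "a \<in> B" "b \<in> B"
  shows "R a \<circ> R b = R (a \<circ> b)"
proof (rule ext)
  fix \<xi>
  have ab: "a \<in> A" "b \<in> A" "a \<circ> b \<in> A" "b \<in> bounded_ops I"
    using assms B_comp B_subset_A B_bounded by auto
  show "(R a \<circ> R b) \<xi> = R (a \<circ> b) \<xi>"
  proof (cases "\<xi> \<in> l2 J")
    case True
    have "R b \<xi> \<in> l2 J" using R_bounded[OF ab(2)] True by (rule bounded_opsD)
    then show ?thesis using True ab
      by (auto simp: R_slicewise slicewise_def fun_eq_iff Ad_comp)
  next
    case False
    then show ?thesis using R_bounded[THEN bounded_opsD(1)] R_bounded[THEN bounded_ops_at_zero] ab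
      by simp
  qed
qed

text \<open>The covariance relation of the crossed product, from which the closure properties of the finite sums follow.\<close>
lemma u_R:
  assumes "a \<in> A"
  shows "u j \<circ> R a = R (Ad j a) \<circ> u j"
proof (rule ext)
  fix \<xi>
  show "(u j \<circ> R a) \<xi> = (R (Ad j a) \<circ> u j) \<xi>"
  proof (cases "\<xi> \<in> l2 J")
    case True
    have "R a \<xi> \<in> l2 J" "u j \<xi> \<in> l2 J"
      using R_bounded[OF assms] unitary_power_bounded True by (auto intro: bounded_opsD)
    then show ?thesis using True assms
      by (auto simp: R_slicewise Ad_A slicewise_def fun_eq_iff unitary_power_def Ad_Ad)
  next
    case False
    then show ?thesis
      using R_bounded[THEN bounded_opsD(1)] R_bounded[THEN bounded_ops_at_zero] assms Ad_A
        bounded_opsD(1)[OF unitary_power_bounded False, of j]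
        bounded_ops_at_zero[OF unitary_power_bounded[of I j]]
      by simp
  qed
qed

lemma monomial_bounded: "a \<in> A \<Longrightarrow> R a \<circ> u j \<in> bounded_ops J"
  by (intro bounded_ops_comp R_bounded unitary_power_bounded)

lemma alg_crossed_product_bounded: "alg_crossed_product I A \<sigma> A \<subseteq> bounded_ops J"
  using monomial_bounded by (auto simp: alg_crossed_product_def comp_def intro!: bounded_ops_sum)

lemma L_intro:
  assumes "finite K" "\<And>j. j \<in> K \<Longrightarrow> b j \<in> B"
  shows "(\<lambda>\<xi> y. \<Sum>j\<in>K. R (b j) (u j \<xi>) y) \<in> L"
  unfolding alg_crossed_product_def
  by (rule CollectI, rule exI[of _ K], rule exI[of _ b]) (use assms in simp)

lemma L_monomial:
  assumes "b \<in> B" shows "R b \<circ> u j \<in> L"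
  unfolding alg_crossed_product_def
  by (rule CollectI, rule exI[of _ "{j}"], rule exI[of _ "\<lambda>_. b"]) (use assms in \<open>auto simp: fun_eq_iff\<close>)

lemma L_add:
  assumes "T \<in> L" "U \<in> L" shows "(\<lambda>\<xi> y. T \<xi> y + U \<xi> y) \<in> L"
proof -
  obtain K b where T: "finite K" "\<And>j. j \<in> K \<Longrightarrow> b j \<in> B" "T = (\<lambda>\<xi> y. \<Sum>j\<in>K. R (b j) (u j \<xi>) y)"
    using assms(1) unfolding alg_crossed_product_def by blast
  obtain K' b' where U: "finite K'" "\<And>j. j \<in> K' \<Longrightarrow> b' j \<in> B" "U = (\<lambda>\<xi> y. \<Sum>j\<in>K'. R (b' j) (u j \<xi>) y)"
    using assms(2) unfolding alg_crossed_product_def by blast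
  define c where "c j = (if j \<in> K then b j else (\<lambda>_ _. 0))" for j
  define c' where "c' j = (if j \<in> K' then b' j else (\<lambda>_ _. 0))" for j
  have cB: "c j \<in> B" "c' j \<in> B" for j using T U B_zero by (auto simp: c_def c'_def)
  have "T = (\<lambda>\<xi> y. \<Sum>j\<in>K \<union> K'. R (c j) (u j \<xi>) y)"
    unfolding T(3) by (intro ext sum.mono_neutral_cong_left) (use T U in \<open>auto simp: c_def R_zero\<close>)
  moreover have "U = (\<lambda>\<xi> y. \<Sum>j\<in>K \<union> K'. R (c' j) (u j \<xi>) y)"
    unfolding U(3) by (intro ext sum.mono_neutral_cong_left) (use T U in \<open>auto simp: c'_def R_zero\<close>)
  ultimately have "(\<lambda>\<xi> y. T \<xi> y + U \<xi> y) = (\<lambda>\<xi> y. \<Sum>j\<in>K \<union> K'. R (\<lambda>\<xi> x. c j \<xi> x + c' j \<xi> x) (u j \<xi>) y)"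
    by (simp only: R_add[OF cB] sum.distrib)
  also have "\<dots> \<in> L"
    by (rule L_intro[of "K \<union> K'" "\<lambda>j \<xi> x. c j \<xi> x + c' j \<xi> x"]) (use T U cB B_add in auto)
  finally show ?thesis .
qed

lemma L_zero: "(\<lambda>_ _. 0) \<in> L"
  unfolding alg_crossed_product_def by (rule CollectI, rule exI[of _ "{}"]) auto

lemma L_sum:
  assumes "finite K" "\<And>k. k \<in> K \<Longrightarrow> T k \<in> L"
  shows "(\<lambda>\<xi> y. \<Sum>k\<in>K. T k \<xi> y) \<in> L"
  using assms by (induction K rule: finite_induct) (auto simp: L_zero L_add)

lemma L_scale:
  assumes "T \<in> L" shows "(\<lambda>\<xi> y. c * T \<xi> y) \<in> L"
proof -
  obtain K b where T: "finite K" "\<And>j. j \<in> K \<Longrightarrow> b j \<in> B" "T = (\<lambda>\<xi> y. \<Sum>j\<in>K. R (b j) (u j \<xi>) y)"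
    using assms(1) unfolding alg_crossed_product_def by blast
  then have "(\<lambda>\<xi> y. c * T \<xi> y) = (\<lambda>\<xi> y. \<Sum>j\<in>K. R (\<lambda>\<xi> x. c * b j \<xi> x) (u j \<xi>) y)"
    using R_scale by (simp add: sum_distrib_left)
  also have "\<dots> \<in> L"
    by (rule L_intro[of K "\<lambda>j \<xi> x. c * b j \<xi> x"]) (use T B_scale in auto)
  finally show ?thesis .
qed

text \<open>By covariance \<open>(a u\<^sup>i) (b u\<^sup>j) = a \<sigma>\<^sup>i(b) u\<^bsup>i+j\<^esup>\<close>, and the powers of \<open>\<sigma>\<close> preserve \<open>B\<close>.\<close>
lemma L_comp:
  assumes "T \<in> L" "U \<in> L" shows "T \<circ> U \<in> L"
proof -
  obtain K b where T: "finite K" "\<And>j. j \<in> K \<Longrightarrow> b j \<in> B" "T = (\<lambda>\<xi> y. \<Sum>j\<in>K. R (b j) (u j \<xi>) y)"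
    using assms(1) unfolding alg_crossed_product_def by blast
  obtain K' b' where U: "finite K'" "\<And>j. j \<in> K' \<Longrightarrow> b' j \<in> B" "U = (\<lambda>\<xi> y. \<Sum>j\<in>K'. R (b' j) (u j \<xi>) y)"
    using assms(2) unfolding alg_crossed_product_def by blast
  have bd: "R (b j) \<circ> u j \<in> bounded_ops J" if "j \<in> K" for j
    using T B_subset_A that by (auto intro: monomial_bounded)
  have bd': "R (b' j) \<circ> u j \<in> bounded_ops J" if "j \<in> K'" for j
    using U B_subset_A that by (auto intro: monomial_bounded)
  have "(T \<circ> U) = (\<lambda>\<xi> y. \<Sum>i\<in>K. (\<Sum>j\<in>K'. ((R (b i) \<circ> u i) \<circ> (R (b' j) \<circ> u j)) \<xi> y))"
  proof (rule ext)
    fix \<xi>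
    have "(R (b i) \<circ> u i) (U \<xi>) = (\<lambda>y. \<Sum>j\<in>K'. (R (b i) \<circ> u i) ((R (b' j) \<circ> u j) \<xi>) y)" if "i \<in> K" for i
      using bounded_ops_apply_sum[OF bd[OF that] U(1), of "\<lambda>j. (R (b' j) \<circ> u j) \<xi>"] bd'[THEN bounded_opsD(3)]
      by (simp add: U(3))
    then show "(T \<circ> U) \<xi> = (\<lambda>y. \<Sum>i\<in>K. (\<Sum>j\<in>K'. ((R (b i) \<circ> u i) \<circ> (R (b' j) \<circ> u j)) \<xi> y))"
      by (simp add: T(3) fun_eq_iff)
  qed
  moreover have "(R (b i) \<circ> u i) \<circ> (R (b' j) \<circ> u j) \<in> L" if "i \<in> K" "j \<in> K'" for i j
  proof -
    have B: "b i \<in> B" "b' j \<in> B" using T U that by auto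
    have "(R (b i) \<circ> u i) \<circ> (R (b' j) \<circ> u j) = R (b i) \<circ> (u i \<circ> R (b' j)) \<circ> u j"
      by (simp add: comp_assoc)
    also have "\<dots> = (R (b i) \<circ> R (Ad i (b' j))) \<circ> (u i \<circ> u j)"
      using B B_subset_A by (subst u_R) (auto simp: comp_assoc)
    also have "\<dots> = R (b i \<circ> Ad i (b' j)) \<circ> u (i + j)"
      using B Ad_B by (simp add: R_comp unitary_power_add)
    finally show ?thesis using B Ad_B B_comp by (simp add: L_monomial)
  qed
  then have "(\<lambda>\<xi> y. \<Sum>i\<in>K. (\<Sum>j\<in>K'. ((R (b i) \<circ> u i) \<circ> (R (b' j) \<circ> u j)) \<xi> y)) \<in> L"
    by (intro L_sum[OF T(1)] L_sum[OF U(1)])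
  ultimately show ?thesis by simp
qed

text \<open>By covariance \<open>(a u\<^sup>j)\<^sup>* = u\<^bsup>-j\<^esup> a\<^sup>* = \<sigma>\<^bsup>-j\<^esup>(a\<^sup>*) u\<^bsup>-j\<^esup>\<close>.\<close>
lemma L_adjoint:
  assumes "T \<in> L" shows "\<exists>U\<in>L. adjoint_pair J T U"
proof -
  obtain K b where T: "finite K" "\<And>j. j \<in> K \<Longrightarrow> b j \<in> B" "T = (\<lambda>\<xi> y. \<Sum>j\<in>K. R (b j) (u j \<xi>) y)"
    using assms(1) unfolding alg_crossed_product_def by blast
  have "\<exists>V\<in>L. adjoint_pair J (R (b j) \<circ> u j) V" if "j \<in> K" for j
  proof -
    obtain b' where b': "b' \<in> B" "adjoint_pair I (b j) b'" using T B_adjoint \<open>j \<in> K\<close> by blast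
    have "adjoint_pair J (R (b j) \<circ> u j) (u (- j) \<circ> R b')"
      using T b' B_subset_A that by (intro adjoint_pair_comp R_adjoint unitary_power_adjoint) auto
    moreover have "u (- j) \<circ> R b' \<in> L"
      using b' B_subset_A Ad_B L_monomial by (subst u_R) auto
    ultimately show ?thesis by blast
  qed
  then obtain V where V: "\<And>j. j \<in> K \<Longrightarrow> V j \<in> L \<and> adjoint_pair J (R (b j) \<circ> u j) (V j)" by metis
  have "adjoint_pair J (\<lambda>\<xi> y. \<Sum>j\<in>K. (R (b j) \<circ> u j) \<xi> y) (\<lambda>\<xi> y. \<Sum>j\<in>K. V j \<xi> y)"
    by (rule adjoint_pair_sum[OF T(1)]) (use V in blast)
  then show ?thesis using T V L_sum[OF T(1), of V] by (auto simp: comp_def)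
qed

lemma L_star_subalgebra: "op_star_subalgebra J L"
  unfolding op_star_subalgebra_def
proof (intro conjI ballI allI L_zero L_add L_scale L_comp)
  have "L \<subseteq> alg_crossed_product I A \<sigma> A"
    using B_subset_A by (force simp: alg_crossed_product_def)
  then show "L \<subseteq> bounded_ops J" using alg_crossed_product_bounded by blast
  show "op_adjoint J T \<in> L" if "T \<in> L" for T
    using L_adjoint[OF that] op_adjoint_eq by fastforce
qed

text \<open>The regular representation is contractive and a sum has finitely many coefficients, so it suffices to
  approximate each coefficient.\<close>
lemma alg_crossed_product_approx: "alg_crossed_product I A \<sigma> A \<subseteq> op_closure J L"
proof
  fix T assume T: "T \<in> alg_crossed_product I A \<sigma> A"
  then obtain K a where K: "finite K" "\<And>j. j \<in> K \<Longrightarrow> a j \<in> A" "T = (\<lambda>\<xi> y. \<Sum>j\<in>K. R (a j) (u j \<xi>) y)"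
    unfolding alg_crossed_product_def by blast
  show "T \<in> op_closure J L"
    unfolding op_closure_def
  proof safe
    show "T \<in> bounded_ops J" using T alg_crossed_product_bounded by blast
    fix e :: real assume e: "e > 0"
    \<comment> \<open>The summand \<open>1\<close> covers the empty sum.\<close>
    let ?e = "e / (real (card K) + 1)"
    have "?e > 0" using e by simp
    then have "\<exists>b\<in>B. op_dist I (a j) b < ?e" if "j \<in> K" for j
      using K(2)[OF that] unfolding A_closure op_closure_def by blast
    then obtain b where b: "\<And>j. j \<in> K \<Longrightarrow> b j \<in> B \<and> op_dist I (a j) (b j) < ?e" by metis
    have bA: "b j \<in> A" if "j \<in> K" for j using b that B_subset_A by auto
    let ?U = "\<lambda>\<xi> y. \<Sum>j\<in>K. (R (b j) \<circ> u j) \<xi> y"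
    have "?U \<in> L" unfolding comp_def by (rule L_intro) (use K(1) b in auto)
    have "op_dist J (R (a j) \<circ> u j) (R (b j) \<circ> u j) \<le> ?e" if j: "j \<in> K" for j
    proof (rule op_dist_le)
      fix \<xi> assume x: "\<xi> \<in> l2 J"
      have "l2_norm J (\<lambda>y. R (a j) (u j \<xi>) y - R (b j) (u j \<xi>) y) \<le> op_dist J (R (a j)) (R (b j)) * l2_norm J \<xi>"
        using op_dist_bound[OF R_bounded[OF K(2)[OF j]] R_bounded[OF bA[OF j]] unitary_power_l2(1)[OF x], of j]
          unitary_power_l2(2)[OF x] by simp
      also have "\<dots> \<le> ?e * l2_norm J \<xi>"
        using op_dist_R[OF K(2)[OF j] bA[OF j]] b[OF j] by (intro mult_right_mono) auto
      finally show "l2_norm J (\<lambda>y. (R (a j) \<circ> u j) \<xi> y - (R (b j) \<circ> u j) \<xi> y) \<le> ?e * l2_norm J \<xi>"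
        by simp
    qed (use \<open>?e > 0\<close> in auto)
    then have "(\<Sum>j\<in>K. op_dist J (R (a j) \<circ> u j) (R (b j) \<circ> u j)) \<le> real (card K) * ?e"
      by (rule sum_bounded_above)
    also have "\<dots> < e" using e by (simp add: field_simps)
    finally have "op_dist J (\<lambda>\<xi> y. \<Sum>j\<in>K. (R (a j) \<circ> u j) \<xi> y) ?U < e"
      using op_dist_sum_le[OF K(1), of "\<lambda>j. R (a j) \<circ> u j" J "\<lambda>j. R (b j) \<circ> u j"] K bA monomial_bounded
      by fastforce
    then show "\<exists>U\<in>L. op_dist J T U < e"
      using \<open>?U \<in> L\<close> K(3) by (intro bexI[of _ ?U]) (auto simp: comp_def)
  qed
qed

theorem crossed_product_dense: "dense_star_subalgebra J L (crossed_product I A \<sigma>)"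
  unfolding dense_star_subalgebra_def crossed_product_def
proof (intro conjI L_star_subalgebra)
  have "L \<subseteq> alg_crossed_product I A \<sigma> A"
    using B_subset_A by (force simp: alg_crossed_product_def)
  then show "L \<subseteq> op_closure J (alg_crossed_product I A \<sigma> A)"
    using op_closure_superset[OF alg_crossed_product_bounded] by blast
  show "op_closure J (alg_crossed_product I A \<sigma> A) \<subseteq> op_closure J L"
    by (rule op_closure_trans[OF alg_crossed_product_approx])
      (use L_star_subalgebra in \<open>simp add: op_star_subalgebra_def\<close>)
qed

end

section \<open>Dense star-subalgebras of groupoid algebras and their crossed products\<close>

text \<open>The properties of a function class \<open>L\<close> that make the operator algebra work. In \<open>L_approx\<close> the band width
  \<open>K\<close> is chosen before \<open>e\<close>: a uniform approximation with growing supports would not converge in operator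
  norm. The maps \<open>\<psi>\<close> and \<open>\<phi>\<close> are mutually inverse on \<open>Y\<close> only.\<close>
locale dense_convolution_algebra = invariant_relation G I
  for G :: "('a \<times> 'a) set" and I :: "'a set" +
  fixes Y :: "'a set" and T :: "('a \<times> 'a) topology" and L :: "('a \<times> 'a \<Rightarrow> complex) set"
    and \<psi> \<phi> :: "'a \<Rightarrow> 'a"
  assumes topspace_T: "topspace T = G"
    and Cc_banded: "f \<in> Cc T \<Longrightarrow> \<exists>N M. banded G N M f"
    and L_subset: "L \<subseteq> Cc T" and L_zero: "(\<lambda>_. 0) \<in> L"
    and L_add: "f \<in> L \<Longrightarrow> g \<in> L \<Longrightarrow> (\<lambda>a. f a + g a) \<in> L"
    and L_scale: "f \<in> L \<Longrightarrow> (\<lambda>a. c * f a) \<in> L"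
    and L_conv: "f \<in> L \<Longrightarrow> g \<in> L \<Longrightarrow> conv G f g \<in> L"
    and L_invol: "f \<in> L \<Longrightarrow> invol f \<in> L"
    and L_approx: "f \<in> Cc T \<Longrightarrow> \<exists>K. \<forall>e>0. \<exists>g\<in>L. banded G K e (\<lambda>a. f a - g a)"
    and G_Y: "G \<subseteq> Y \<times> Y" and I_Y: "I \<subseteq> Y"
    and inverse: "v \<in> Y \<Longrightarrow> \<phi> (\<psi> v) = v" "v \<in> Y \<Longrightarrow> \<psi> (\<phi> v) = v"
    and G_maps: "(v, w) \<in> G \<Longrightarrow> (\<psi> v, \<psi> w) \<in> G" "(v, w) \<in> G \<Longrightarrow> (\<phi> v, \<phi> w) \<in> G"
    and I_maps: "v \<in> I \<Longrightarrow> \<psi> v \<in> I" "v \<in> I \<Longrightarrow> \<phi> v \<in> I"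
    and L_alpha: "f \<in> L \<Longrightarrow> alpha G \<psi> f \<in> L" "f \<in> L \<Longrightarrow> alpha G \<phi> f \<in> L"
begin

definition iter :: "int \<Rightarrow> 'a \<Rightarrow> 'a" where
  "iter n = (if 0 \<le> n then \<psi> ^^ nat n else \<phi> ^^ nat (- n))"

lemma iter_generators: "iter 0 = id" "iter 1 = \<psi>" "iter (- 1) = \<phi>"
  by (auto simp: iter_def)

lemma iter_maps: "v \<in> I \<Longrightarrow> iter n v \<in> I" "(v, w) \<in> G \<Longrightarrow> (iter n v, iter n w) \<in> G"
proof -
  have "(\<psi> ^^ k) v \<in> I" "(\<phi> ^^ k) v \<in> I" if "v \<in> I" for k v
    by (induction k) (use that I_maps in auto)
  then show "v \<in> I \<Longrightarrow> iter n v \<in> I" by (simp add: iter_def)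
  have "((\<psi> ^^ k) v, (\<psi> ^^ k) w) \<in> G" "((\<phi> ^^ k) v, (\<phi> ^^ k) w) \<in> G" if "(v, w) \<in> G" for k
    by (induction k) (use that G_maps in auto)
  then show "(v, w) \<in> G \<Longrightarrow> (iter n v, iter n w) \<in> G" by (simp add: iter_def)
qed

lemma iter_Suc: "v \<in> I \<Longrightarrow> iter (n + 1) v = \<psi> (iter n v)"
proof (cases "0 \<le> n")
  case True
  then have "nat (n + 1) = Suc (nat n)" by simp
  then show ?thesis using True by (simp add: iter_def)
next
  case False
  assume v: "v \<in> I"
  define k where "k = nat (- 1 - n)"
  then have k: "n = - 1 - int k" using False by simp
  have "iter (- int k) v \<in> I" using iter_maps v by simp
  then have "\<psi> (\<phi> (iter (- int k) v)) = iter (- int k) v" using inverse I_Y by blast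
  moreover have "iter (- int k) v = (\<phi> ^^ k) v" by (auto simp: iter_def)
  moreover have "iter n v = \<phi> ((\<phi> ^^ k) v)"
    using k by (simp add: iter_def nat_add_distrib)
  ultimately show ?thesis using k by simp
qed

lemma iter_add: "v \<in> I \<Longrightarrow> iter m (iter n v) = iter (m + n) v"
proof (induction m rule: int_induct[where k = 0])
  case base then show ?case by (simp add: iter_generators)
next
  case (step1 i)
  then show ?case using iter_Suc[of "iter n v" i] iter_Suc[of v "i + n"] iter_maps
    by (simp add: algebra_simps)
next
  case (step2 i)
  have 1: "iter i (iter n v) = \<psi> (iter (i - 1) (iter n v))" "iter (i + n) v = \<psi> (iter (i - 1 + n) v)"
    using iter_Suc[of "iter n v" "i - 1"] iter_Suc[of v "i - 1 + n"] iter_maps step2(3)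
    by (simp_all add: algebra_simps)
  have "\<phi> (\<psi> x) = x" if "x \<in> I" for x using that inverse I_Y by blast
  then show ?case using 1 step2 iter_maps by metis
qed

lemma bij_iter: "bij_betw (iter n) I I"
  by (rule bij_betwI[where g = "iter (- n)"]) (auto simp: iter_maps iter_add iter_generators)

text \<open>The permutation unitary \<open>\<xi> \<mapsto> \<xi> \<circ> \<psi>\<^sup>n\<close>.\<close>
definition W :: "int \<Rightarrow> 'a operator" where
  "W n = (\<lambda>\<xi> x. if \<xi> \<in> l2 I \<and> x \<in> I then \<xi> (iter n x) else 0)"

lemma W_isometry:
  assumes "\<xi> \<in> l2 I"
  shows "W n \<xi> \<in> l2 I" "l2_norm I (W n \<xi>) = l2_norm I \<xi>"
proof -
  have eq: "(\<lambda>x. (cmod (W n \<xi> x))\<^sup>2) summable_on I \<longleftrightarrow> (\<lambda>x. (cmod (\<xi> (iter n x)))\<^sup>2) summable_on I"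
    "(\<Sum>\<^sub>\<infinity>x\<in>I. (cmod (W n \<xi> x))\<^sup>2) = (\<Sum>\<^sub>\<infinity>x\<in>I. (cmod (\<xi> (iter n x)))\<^sup>2)"
    using assms by (auto simp: W_def intro!: summable_on_cong infsum_cong)
  show "l2_norm I (W n \<xi>) = l2_norm I \<xi>"
    unfolding l2_norm_def eq
    using infsum_reindex_bij_betw[OF bij_iter, of "\<lambda>p. (cmod (\<xi> p))\<^sup>2"] by simp
  show "W n \<xi> \<in> l2 I"
    using assms eq(1) summable_on_reindex_bij_betw[OF bij_iter, of "\<lambda>p. (cmod (\<xi> p))\<^sup>2"]
    by (auto simp: l2_def) (auto simp: W_def)
qed

lemma W_in_bounded_ops: "W n \<in> bounded_ops I"
  by (rule bounded_opsI[where C = 1]) (use W_isometry in \<open>auto simp: W_def l2_add l2_scale\<close>)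

sublocale unitary_group I W
proof
  show "W n \<in> bounded_ops I" for n by (rule W_in_bounded_ops)
  show "W m \<circ> W n = W (m + n)" for m n
  proof (rule ext)
    fix \<xi> show "(W m \<circ> W n) \<xi> = W (m + n) \<xi>"
      using W_isometry(1)[of \<xi> n] bounded_ops_at_zero[OF W_in_bounded_ops, of m]
      by (cases "\<xi> \<in> l2 I") (auto simp: W_def iter_maps iter_add add.commute fun_eq_iff)
  qed
  show "W 0 \<xi> = \<xi>" if "\<xi> \<in> l2 I" for \<xi>
    using that by (auto simp: W_def iter_generators l2_outside)
  show "l2_norm I (W n \<xi>) = l2_norm I \<xi>" if "\<xi> \<in> l2 I" for n \<xi> by (rule W_isometry[OF that])
  show "adjoint_pair I (W n) (W (- n))" for n
    unfolding adjoint_pair_def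
  proof (intro conjI ballI W_in_bounded_ops)
    fix \<xi> \<eta> assume x: "\<xi> \<in> l2 I" "\<eta> \<in> l2 I"
    have "l2_inner I \<xi> (W n \<eta>) = (\<Sum>\<^sub>\<infinity>x\<in>I. cnj (W (- n) \<xi> (iter n x)) * \<eta> (iter n x))"
      unfolding l2_inner_def using x
      by (intro infsum_cong) (auto simp: W_def iter_maps iter_add iter_generators)
    also have "\<dots> = l2_inner I (W (- n) \<xi>) \<eta>"
      unfolding l2_inner_def by (rule infsum_reindex_bij_betw[OF bij_iter])
    finally show "l2_inner I (W (- n) \<xi>) \<eta> = l2_inner I \<xi> (W n \<eta>)" ..
  qed
qed

text \<open>As \<open>\<psi>\<^sup>n\<close> maps equivalence classes bijectively to equivalence classes, conjugation by its permutation unitary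
  transports a matrix along \<open>\<psi>\<^sup>n\<close>.\<close>
lemma rep_alpha:
  assumes f: "banded G N M f"
  shows "rep G I (alpha G (iter n) f) = Ad n (rep G I f)"
proof (intro ext)
  fix \<xi> v
  show "rep G I (alpha G (iter n) f) \<xi> v = Ad n (rep G I f) \<xi> v"
  proof (cases "\<xi> \<in> l2 I \<and> v \<in> I")
    case True
    then have x: "\<xi> \<in> l2 I" and v: "v \<in> I" by auto
    have bij: "bij_betw (iter n) {z. (v, z) \<in> G} {z. (iter n v, z) \<in> G}"
    proof (rule bij_betwI[where g = "iter (- n)"])
      show "iter n \<in> {z. (v, z) \<in> G} \<rightarrow> {z. (iter n v, z) \<in> G}" using iter_maps by auto
      show "iter (- n) \<in> {z. (iter n v, z) \<in> G} \<rightarrow> {z. (v, z) \<in> G}"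
        using iter_maps(2)[of "iter n v" _ "- n"] v by (auto simp: iter_add iter_generators)
    qed (use v I_invariant I_invariant[OF iter_maps(1)[OF v]] in \<open>auto simp: iter_add iter_generators\<close>)
    have "Ad n (rep G I f) \<xi> v = rep G I f (W (- n) \<xi>) (iter n v)"
      using v rep_l2(1)[OF f W_isometry(1)[OF x]] by (simp add: Ad_def W_def)
    also have "\<dots> = (\<Sum>\<^sub>\<infinity>z\<in>{z. (iter n v, z) \<in> G}. f (iter n v, z) * W (- n) \<xi> z)"
      using W_isometry(1)[OF x] iter_maps(1)[OF v] by (simp add: rep_def)
    also have "\<dots> = (\<Sum>\<^sub>\<infinity>z\<in>{z. (v, z) \<in> G}. f (iter n v, iter n z) * W (- n) \<xi> (iter n z))"
      by (rule infsum_reindex_bij_betw[OF bij, symmetric])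
    also have "\<dots> = rep G I (alpha G (iter n) f) \<xi> v"
      using x v I_invariant[OF v] unfolding rep_def
      by (auto simp: W_def alpha_def iter_maps iter_add iter_generators intro!: infsum_cong)
    finally show ?thesis ..
  next
    case False
    have "Ad n (rep G I f) \<in> bounded_ops I" by (intro Ad_bounded rep_bounded[OF f])
    then have "Ad n (rep G I f) \<xi> v = 0"
      using False bounded_opsD(1) l2_outside[OF bounded_opsD(3)] by metis
    then show ?thesis using False by (auto simp: rep_def)
  qed
qed

lemma L_banded: "f \<in> L \<Longrightarrow> \<exists>N M. banded G N M f"
  using Cc_banded L_subset by blast

abbreviation A where "A \<equiv> groupoid_algebra G T I"
abbreviation B where "B \<equiv> rep G I ` L"

lemma rep_Cc_bounded: "rep G I ` Cc T \<subseteq> bounded_ops I"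
  using Cc_banded rep_bounded by blast

text \<open>Schur's test turns the approximation of a function by functions in \<open>L\<close> with entrywise error \<open>e / (K + 1)\<close>
  and band width \<open>K\<close> into an approximation in operator norm.\<close>
lemma A_eq: "A = op_closure I B"
proof
  show "op_closure I B \<subseteq> A"
    unfolding groupoid_algebra_def using L_subset by (intro op_closure_mono) auto
  have "rep G I ` Cc T \<subseteq> op_closure I B"
  proof
    fix S assume "S \<in> rep G I ` Cc T"
    then obtain f where f: "f \<in> Cc T" "S = rep G I f" by blast
    obtain N M where fb: "banded G N M f" using Cc_banded f by blast
    obtain K where K: "\<And>e. e > 0 \<Longrightarrow> \<exists>g\<in>L. banded G K e (\<lambda>a. f a - g a)" using L_approx[OF f(1)] by blast
    show "S \<in> op_closure I B"
      unfolding op_closure_def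
    proof safe
      show "S \<in> bounded_ops I" using rep_bounded[OF fb] f by simp
      fix e :: real assume e: "e > 0"
      then obtain g where g: "g \<in> L" "banded G K (e / (real K + 1)) (\<lambda>a. f a - g a)"
        using K[of "e / (real K + 1)"] by auto
      obtain N' M' where gb: "banded G N' M' g" using L_banded g by blast
      have "op_dist I (rep G I f) (rep G I g) \<le> real K * (e / (real K + 1))"
        by (rule op_dist_rep_le[OF fb gb g(2)])
      also have "\<dots> < e" using e by (simp add: field_simps)
      finally show "\<exists>U\<in>B. op_dist I S U < e" using g f by auto
    qed
  qed
  moreover have "B \<subseteq> bounded_ops I" using rep_Cc_bounded L_subset by blast
  ultimately show "A \<subseteq> op_closure I B"
    unfolding groupoid_algebra_def by (rule op_closure_trans)
qed

text \<open>Conjugation by a unitary is contractive and agrees with \<open>alpha\<close> on the image of \<open>Cc T\<close>, so it satisfies the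
  defining property of the extension, and any other solution agrees with it on limits of sequences.\<close>
lemma alpha_ext_eq_Ad:
  assumes a: "a \<in> A"
  shows "alpha_ext G T I \<psi> a = Ad 1 a"
  unfolding alpha_ext_def
proof (rule the_equality)
  have ab: "a \<in> bounded_ops I" using a op_closure_bounded unfolding groupoid_algebra_def by blast
  have rep: "rep G I (F n) \<in> bounded_ops I" "rep G I (alpha G \<psi> (F n)) = Ad 1 (rep G I (F n))"
    if "\<forall>n. F n \<in> Cc T" for F :: "nat \<Rightarrow> _" and n
    using that Cc_banded rep_bounded rep_alpha[of _ _ _ 1] unfolding iter_generators by blast+
  show "Ad 1 a \<in> bounded_ops I \<and>
     (\<forall>F::nat \<Rightarrow> ('a \<times> 'a \<Rightarrow> complex). (\<forall>n. F n \<in> Cc T) \<longrightarrow>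
        (\<lambda>n. op_dist I (rep G I (F n)) a) \<longlonglongrightarrow> 0 \<longrightarrow>
        (\<lambda>n. op_dist I (rep G I (alpha G \<psi> (F n))) (Ad 1 a)) \<longlonglongrightarrow> 0)"
  proof (intro conjI allI impI Ad_bounded ab)
    fix F :: "nat \<Rightarrow> ('a \<times> 'a \<Rightarrow> complex)"
    assume F: "\<forall>n. F n \<in> Cc T" and lim: "(\<lambda>n. op_dist I (rep G I (F n)) a) \<longlonglongrightarrow> 0"
    show "(\<lambda>n. op_dist I (rep G I (alpha G \<psi> (F n))) (Ad 1 a)) \<longlonglongrightarrow> 0"
      by (rule tendsto_sandwich[OF _ _ tendsto_const lim])
        (intro always_eventually allI; simp add: rep[OF F] ab op_dist_nonneg Ad_bounded Ad_op_dist)+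
  qed
  fix b assume b: "b \<in> bounded_ops I \<and>
     (\<forall>F::nat \<Rightarrow> ('a \<times> 'a \<Rightarrow> complex). (\<forall>n. F n \<in> Cc T) \<longrightarrow>
        (\<lambda>n. op_dist I (rep G I (F n)) a) \<longlonglongrightarrow> 0 \<longrightarrow>
        (\<lambda>n. op_dist I (rep G I (alpha G \<psi> (F n))) b) \<longlonglongrightarrow> 0)"
  have "\<exists>f\<in>Cc T. op_dist I a (rep G I f) < 1 / real (Suc n)" for n
    using a unfolding groupoid_algebra_def op_closure_def by (auto dest!: spec[of _ "1 / real (Suc n)"])
  then obtain F where F: "\<And>n. F n \<in> Cc T" "\<And>n. op_dist I a (rep G I (F n)) < 1 / real (Suc n)" by metis
  have F': "\<forall>n. F n \<in> Cc T" using F by simp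
  have lim: "(\<lambda>n. op_dist I (rep G I (F n)) a) \<longlonglongrightarrow> 0"
  proof (rule tendsto_sandwich[OF _ _ tendsto_const LIMSEQ_inverse_real_of_nat])
    show "\<forall>\<^sub>F n in sequentially. 0 \<le> op_dist I (rep G I (F n)) a"
      using rep(1)[OF F'] ab by (simp add: op_dist_nonneg)
    show "\<forall>\<^sub>F n in sequentially. op_dist I (rep G I (F n)) a \<le> inverse (real (Suc n))"
      using F(2) by (intro always_eventually allI) (simp add: op_dist_commute[of I _ a] less_imp_le inverse_eq_divide)
  qed
  have l1: "(\<lambda>n. op_dist I (Ad 1 (rep G I (F n))) b) \<longlonglongrightarrow> 0"
  proof -
    have "(\<lambda>n. op_dist I (rep G I (alpha G \<psi> (F n))) b) \<longlonglongrightarrow> 0" using b F' lim by blast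
    then show ?thesis unfolding rep(2)[OF F'] .
  qed
  have l2: "(\<lambda>n. op_dist I (Ad 1 (rep G I (F n))) (Ad 1 a)) \<longlonglongrightarrow> 0"
    by (rule tendsto_sandwich[OF _ _ tendsto_const lim])
      (intro always_eventually allI; simp add: rep[OF F'] ab op_dist_nonneg Ad_bounded Ad_op_dist)+
  have "op_dist I b (Ad 1 a) \<le> 0"
  proof (rule LIMSEQ_le_const)
    show "(\<lambda>n. op_dist I (Ad 1 (rep G I (F n))) b + op_dist I (Ad 1 (rep G I (F n))) (Ad 1 a)) \<longlonglongrightarrow> 0"
      using tendsto_add[OF l1 l2] by simp
    have "op_dist I b (Ad 1 a) \<le> op_dist I (Ad 1 (rep G I (F n))) b + op_dist I (Ad 1 (rep G I (F n))) (Ad 1 a)" for n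
      using op_dist_triangle[of b I "Ad 1 (rep G I (F n))" "Ad 1 a"] b ab rep(1)[OF F']
      by (simp add: Ad_bounded op_dist_commute[of I b])
    then show "\<exists>N. \<forall>n\<ge>N. op_dist I b (Ad 1 a)
      \<le> op_dist I (Ad 1 (rep G I (F n))) b + op_dist I (Ad 1 (rep G I (F n))) (Ad 1 a)" by blast
  qed
  then show "b = Ad 1 a" using b ab Ad_bounded op_dist_zero_imp_eq by blast
qed

lemma crossed_product_data: "crossed_product_data I W A B (alpha_ext G T I \<psi>)"
proof
  show "B \<subseteq> bounded_ops I" using rep_Cc_bounded L_subset by blast
  have "rep G I (\<lambda>_. 0) = (\<lambda>_ _. 0)" by (auto simp: rep_def fun_eq_iff)
  then show "(\<lambda>_ _. 0) \<in> B" using imageI[OF L_zero, of "rep G I"] by simp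
  show "A = op_closure I B" by (rule A_eq)
  show "alpha_ext G T I \<psi> a = Ad 1 a" if "a \<in> A" for a by (rule alpha_ext_eq_Ad[OF that])
  fix S assume "S \<in> B"
  then obtain f where f: "f \<in> L" "S = rep G I f" by blast
  obtain N M where fb: "banded G N M f" using L_banded f by blast
  show "(\<lambda>\<xi> x. c * S \<xi> x) \<in> B" for c
    unfolding f(2) rep_scale[OF fb, of c, symmetric] by (intro image_eqI[OF refl] L_scale f(1))
  show "\<exists>U\<in>B. adjoint_pair I S U" using rep_adjoint[OF fb] f L_invol by blast
  show "Ad 1 S \<in> B" "Ad (- 1) S \<in> B"
    unfolding f(2) rep_alpha[OF fb, symmetric] iter_generators
    by (intro image_eqI[OF refl] L_alpha f(1))+
  fix U assume "U \<in> B"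
  then obtain g where g: "g \<in> L" "U = rep G I g" by blast
  obtain N' M' where gb: "banded G N' M' g" using L_banded g by blast
  show "(\<lambda>\<xi> x. S \<xi> x + U \<xi> x) \<in> B"
    unfolding f(2) g(2) rep_add[OF fb gb, symmetric] by (intro image_eqI[OF refl] L_add f(1) g(1))
  show "S \<circ> U \<in> B" 
    unfolding f(2) g(2) rep_conv[OF fb gb, symmetric] by (intro image_eqI[OF refl] L_conv f(1) g(1))
qed

theorem convolution_subalgebra: "conv_star_subalgebra G L (Cc T)"
  unfolding conv_star_subalgebra_def
  by (intro conjI ballI allI L_subset L_zero L_add L_scale L_conv L_invol)

theorem rep_dense: "dense_star_subalgebra I B A"
  unfolding dense_star_subalgebra_def op_star_subalgebra_def
proof (intro conjI ballI allI)
  note data = crossed_product_data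
  show "B \<subseteq> bounded_ops I" "(\<lambda>_ _. 0) \<in> B"
    by (rule crossed_product_data.B_bounded[OF data], rule crossed_product_data.B_zero[OF data])
  show "(\<lambda>\<xi> x. S \<xi> x + U \<xi> x) \<in> B" "S \<circ> U \<in> B" if "S \<in> B" "U \<in> B" for S U
    by (rule crossed_product_data.B_add[OF data that], rule crossed_product_data.B_comp[OF data that])
  show "(\<lambda>\<xi> x. c * S \<xi> x) \<in> B" if "S \<in> B" for S c
    by (rule crossed_product_data.B_scale[OF data that])
  show "op_adjoint I S \<in> B" if "S \<in> B" for S
    using crossed_product_data.B_adjoint[OF data that] op_adjoint_eq by metis
  show "B \<subseteq> A" by (rule crossed_product_data.B_subset_A[OF data])
  show "A \<subseteq> op_closure I B" using A_eq by (rule equalityD1)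
qed

theorem crossed_product_dense:
  "dense_star_subalgebra (UNIV \<times> I) (alg_crossed_product I A (alpha_ext G T I \<psi>) B)
     (crossed_product I A (alpha_ext G T I \<psi>))"
  by (rule crossed_product_data.crossed_product_dense[OF crossed_product_data])

theorem alpha_image: "alpha G \<psi> ` L = L"
proof
  show "alpha G \<psi> ` L \<subseteq> L" using L_alpha by blast
  show "L \<subseteq> alpha G \<psi> ` L"
  proof
    fix f assume f: "f \<in> L"
    have "alpha G \<psi> (alpha G \<phi> f) = f"
    proof
      fix p :: "'a \<times> 'a"
      obtain v w where p: "p = (v, w)" by fastforce
      have "f \<in> Cc T" using f L_subset by blast
      then have "f p = 0" if "p \<notin> G" using that topspace_T unfolding Cc_def by blast
      then show "alpha G \<psi> (alpha G \<phi> f) p = f p"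
        using G_maps G_Y inverse by (auto simp: p alpha_def)
    qed
    then show "f \<in> alpha G \<psi> ` L" using imageI[OF L_alpha(2)[OF f], of "alpha G \<psi>"] by simp
  qed
qed

end

section \<open>Metrization of a refining sequence of covers\<close>

lemma dyadic_bracket:
  assumes "0 < x" "x < 1"
  shows "\<exists>n. (1 / 2) ^ Suc n \<le> x \<and> x < (1 / 2 :: real) ^ n"
proof -
  define n where "n = (LEAST n. (1 / 2 :: real) ^ Suc n \<le> x)"
  obtain k where "(1 / 2 :: real) ^ k < x" using real_arch_pow_inv[OF assms(1), of "1 / 2"] by auto
  then have "(1 / 2 :: real) ^ Suc k \<le> x"
    using power_decreasing[of k "Suc k" "1 / 2 :: real"] by linarith
  then have 1: "(1 / 2 :: real) ^ Suc n \<le> x" unfolding n_def by (rule LeastI)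
  have "x < (1 / 2) ^ n"
  proof (cases n)
    case 0 then show ?thesis using assms by simp
  next
    case (Suc m)
    then have "\<not> (1 / 2 :: real) ^ Suc m \<le> x"
      using not_less_Least[of m "\<lambda>n. (1 / 2 :: real) ^ Suc n \<le> x"] by (simp add: n_def)
    then show ?thesis using Suc by simp
  qed
  then show ?thesis using 1 by blast
qed

text \<open>The assumption \<open>R_refine\<close>, that two links of level \<open>n + 1\<close> make up one link of level \<open>n\<close>, is the
  hypothesis of Frink's metrization lemma.\<close>
locale refining_covers =
  fixes G :: "'p set" and l :: real and N :: "'p \<Rightarrow> nat" and V :: "nat \<Rightarrow> 'p \<Rightarrow> 'p set"
  fixes R :: "nat \<Rightarrow> 'p \<Rightarrow> 'p \<Rightarrow> bool"
  defines "R n a b \<equiv> \<exists>U\<in>covers G l N V n. a \<in> U \<and> b \<in> U"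
  assumes R_refl: "a \<in> G \<Longrightarrow> R n a a"
    and R_refine: "a \<in> G \<Longrightarrow> b \<in> G \<Longrightarrow> c \<in> G \<Longrightarrow> R (Suc n) a b \<Longrightarrow> R (Suc n) b c \<Longrightarrow> R n a c"
    and R_separates: "a \<in> G \<Longrightarrow> b \<in> G \<Longrightarrow> (\<And>n. R n a b) \<Longrightarrow> a = b"
begin

abbreviation r where "r \<equiv> pre_dist G l N V"
abbreviation D where "D \<equiv> chain_dist G l N V"

lemma R_sym: "R n a b \<Longrightarrow> R n b a"
  by (auto simp: R_def)

lemma R_zero: "a \<in> G \<Longrightarrow> b \<in> G \<Longrightarrow> R 0 a b"
  by (auto simp: R_def covers_def)

lemma R_mono: "a \<in> G \<Longrightarrow> b \<in> G \<Longrightarrow> R n a b \<Longrightarrow> m \<le> n \<Longrightarrow> R m a b"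
proof (induction "n - m" arbitrary: n)
  case (Suc k)
  then obtain n' where n': "n = Suc n'" by (cases n) auto
  then have "R n' a b" using Suc R_refine[of a b b n'] R_refl by auto
  then show ?case using Suc(1)[of n'] Suc(2-) n' by simp
qed simp

lemma r_def: "r a b = Inf {(1 / 2) ^ n | n. R n a b}"
  by (simp add: pre_dist_def R_def)

lemma r_le: "R n a b \<Longrightarrow> r a b \<le> (1 / 2) ^ n"
  unfolding r_def by (rule cInf_lower) (auto intro!: bdd_belowI[of _ 0])

lemma r_nonneg: "a \<in> G \<Longrightarrow> b \<in> G \<Longrightarrow> 0 \<le> r a b"
  unfolding r_def by (rule cInf_greatest) (use R_zero in auto)

lemma r_sym: "r a b = r b a"
  unfolding r_def using R_sym by metis

lemma R_if_r_less:
  assumes "a \<in> G" "b \<in> G" "r a b < (1 / 2) ^ n"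
  shows "R (Suc n) a b"
proof -
  have ne: "{(1 / 2 :: real) ^ n | n. R n a b} \<noteq> {}" using R_zero assms by blast
  obtain m where m: "R m a b" "(1 / 2 :: real) ^ m < (1 / 2) ^ n"
    using cInf_lessD[OF ne] assms(3) unfolding r_def by blast
  then have "n < m" using power_decreasing[of m n "1 / 2 :: real"] by (cases "n < m") auto
  then show ?thesis using R_mono[OF assms(1,2) m(1)] by simp
qed

lemma r_refl: "a \<in> G \<Longrightarrow> r a a = 0"
proof -
  assume a: "a \<in> G"
  have "r a a \<le> 0"
  proof (rule LIMSEQ_le_const)
    show "(\<lambda>n. (1 / 2 :: real) ^ n) \<longlonglongrightarrow> 0" by (rule LIMSEQ_realpow_zero) auto
    show "\<exists>N. \<forall>n\<ge>N. r a a \<le> (1 / 2) ^ n" using r_le R_refl[OF a] by blast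
  qed
  then show ?thesis using r_nonneg[OF a a] by simp
qed

text \<open>Refinement of the covers, read on the dyadic scale.\<close>
lemma r_quasi:
  assumes "a \<in> G" "b \<in> G" "c \<in> G"
  shows "r a c \<le> 2 * max (r a b) (r b c)"
proof -
  define t where "t = max (r a b) (r b c)"
  have t: "0 \<le> t" using r_nonneg[OF assms(1,2)] by (simp add: t_def)
  have *: "r a c \<le> (1 / 2) ^ n" if "t < (1 / 2) ^ n" for n
  proof -
    have "R (Suc n) a b" "R (Suc n) b c"
      using that assms by (auto simp: t_def intro!: R_if_r_less)
    then show ?thesis using R_refine assms r_le by blast
  qed
  consider "t = 0" | "0 < t" "t < 1" | "1 \<le> t" using t by linarith
  then have "r a c \<le> 2 * t"
  proof cases
    case 1
    have "r a c \<le> 0"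
    proof (rule LIMSEQ_le_const)
      show "(\<lambda>n. (1 / 2 :: real) ^ n) \<longlonglongrightarrow> 0" by (rule LIMSEQ_realpow_zero) auto
      show "\<exists>N. \<forall>n\<ge>N. r a c \<le> (1 / 2) ^ n" using * 1 by simp
    qed
    then show ?thesis using 1 by simp
  next
    case 2
    then obtain n where "(1 / 2) ^ Suc n \<le> t" "t < (1 / 2) ^ n" using dyadic_bracket by blast
    then show ?thesis using *[of n] by simp
  next
    case 3
    then show ?thesis using r_le[OF R_zero[OF assms(1,3)]] by simp
  qed
  then show ?thesis by (simp add: t_def)
qed

text \<open>Frink's chain estimate. Let \<open>p\<close> be the last index from which the distance to \<open>c n\<close> is at least half of
  \<open>r (c m) (c n)\<close>. By the quasi-metric inequality the distance from \<open>c m\<close> to \<open>c (Suc p)\<close> is also at least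
  half of it. The induction hypothesis applies to the chains from \<open>m\<close> to \<open>Suc p\<close> and from \<open>p\<close> to \<open>n\<close>; their
  common edge is counted twice, and this is paid for by subtracting the end terms.\<close>
lemma chain_long:
  assumes "Suc (Suc m) \<le> n" "\<And>i. m \<le> i \<Longrightarrow> i \<le> n \<Longrightarrow> c i \<in> G"
  shows "r (c m) (c n) \<le> 2 * (2 * (\<Sum>i=m..<n. r (c i) (c (Suc i)))
     - r (c m) (c (Suc m)) - r (c (n - 1)) (c n))"
  using assms
proof (induction "n - m" arbitrary: m n rule: less_induct)
  case less
  let ?r = "\<lambda>i. r (c i) (c (Suc i))"
  have G: "c i \<in> G" if "m \<le> i" "i \<le> n" for i using less that by blast
  have nn: "0 \<le> ?r i" if "m \<le> i" "i < n" for i using G that by (intro r_nonneg) auto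
  have last: "r (c (n - 1)) (c n) = ?r (n - 1)" using less(2) by (cases n) auto
  have ends: "?r m + ?r (n - 1) \<le> (\<Sum>i=m..<n. ?r i)"
  proof -
    have "(\<Sum>i\<in>{m, n - 1}. ?r i) \<le> (\<Sum>i=m..<n. ?r i)"
      by (rule sum_mono2) (use less(2) nn in auto)
    then show ?thesis using less(2) by auto
  qed
  define S where "S = {p \<in> {m..<n}. r (c m) (c n) \<le> 2 * r (c p) (c n)}"
  have mS: "m \<in> S" using less(2) r_nonneg[OF G G, of m n] by (auto simp: S_def)
  have fin: "finite S" by (simp add: S_def)
  define p where "p = Max S"
  have p: "p \<in> S" "\<And>q. q \<in> S \<Longrightarrow> q \<le> p" using Max_in[OF fin] mS Max_ge[OF fin] by (auto simp: p_def)
  then have pb: "m \<le> p" "p < n" "r (c m) (c n) \<le> 2 * r (c p) (c n)" by (auto simp: S_def)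
  show ?case
  proof (cases "Suc p = n")
    case True
    then have "r (c m) (c n) \<le> 2 * ?r (n - 1)" using pb by auto
    then show ?thesis using ends nn[of m] less(2) unfolding last by auto
  next
    case False
    then have "Suc p \<notin> S" "Suc p < n" using p(2)[of "Suc p"] pb by auto
    then have "\<not> r (c m) (c n) \<le> 2 * r (c (Suc p)) (c n)" using pb by (auto simp: S_def)
    then have 2: "r (c m) (c n) \<le> 2 * r (c m) (c (Suc p))"
      using r_quasi[OF G G G, of m "Suc p" n] pb by (auto simp: max_def split: if_splits)
    show ?thesis
    proof (cases "p = m")
      case True
      moreover have "0 \<le> ?r (n - 1)" by (rule nn) (use less(2) in auto)
      ultimately show ?thesis using 2 ends unfolding last by auto
    next
      case False
      then have l: "Suc (Suc m) \<le> Suc p" "Suc (Suc p) \<le> n" using pb \<open>Suc p < n\<close> by auto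
      have a: "r (c m) (c (Suc p)) \<le> 2 * (2 * (\<Sum>i=m..<Suc p. ?r i) - ?r m - ?r p)"
        using less(1)[of "Suc p" m] l less(2) G pb by auto
      have b: "r (c p) (c n) \<le> 2 * (2 * (\<Sum>i=p..<n. ?r i) - ?r p - ?r (n - 1))"
        using less(1)[of n p] l less(2) G pb False unfolding last by auto
      have "(\<Sum>i=m..<n. ?r i) = (\<Sum>i=m..<p. ?r i) + (\<Sum>i=p..<n. ?r i)"
        using sum.atLeastLessThan_concat[of m p n ?r] pb by simp
      moreover have "(\<Sum>i=m..<Suc p. ?r i) = (\<Sum>i=m..<p. ?r i) + ?r p"
        using pb by simp
      ultimately show ?thesis using a b 2 pb(3) unfolding last by argo
    qed
  qed
qed

lemma chain_lower_bound:
  assumes "m \<le> n" "\<And>i. m \<le> i \<Longrightarrow> i \<le> n \<Longrightarrow> c i \<in> G"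
  shows "r (c m) (c n) \<le> 4 * (\<Sum>i=m..<n. r (c i) (c (Suc i)))"
proof -
  consider "n = m" | "n = Suc m" | "Suc (Suc m) \<le> n" using assms(1) by linarith
  then show ?thesis
  proof cases
    case 1 then show ?thesis using r_refl assms by simp
  next
    case 2 then show ?thesis using r_nonneg[of "c m" "c n"] assms by simp
  next
    case 3
    have "0 \<le> r (c m) (c (Suc m))" "0 \<le> r (c (n - 1)) (c n)" using 3 assms(2) by (auto intro!: r_nonneg)
    moreover have "r (c m) (c n) \<le> 2 * (2 * (\<Sum>i=m..<n. r (c i) (c (Suc i)))
     - r (c m) (c (Suc m)) - r (c (n - 1)) (c n))" by (rule chain_long[OF 3 assms(2)])
    ultimately show ?thesis by argo
  qed
qed

definition chain_sums :: "'p \<Rightarrow> 'p \<Rightarrow> real set" where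
  "chain_sums a b = {(\<Sum>i=1..<n. r (c i) (c (Suc i))) | n c.
     n \<ge> 1 \<and> c 1 = a \<and> c n = b \<and> (\<forall>i\<in>{1..n}. c i \<in> G)}"

lemma D_eq: "a \<in> G \<Longrightarrow> b \<in> G \<Longrightarrow> D a b = Inf (chain_sums a b)"
  by (simp add: chain_dist_def chain_sums_def)

lemma r_in_chain_sums: "a \<in> G \<Longrightarrow> b \<in> G \<Longrightarrow> r a b \<in> chain_sums a b"
  unfolding chain_sums_def
  by (rule CollectI, rule exI[of _ 2], rule exI[of _ "\<lambda>i. if i = 1 then a else b"])
    (auto simp: numeral_2_eq_2)

lemma chain_sums_lower: "s \<in> chain_sums a b \<Longrightarrow> r a b / 4 \<le> s"
proof -
  assume "s \<in> chain_sums a b"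
  then obtain n c where c: "s = (\<Sum>i=1..<n. r (c i) (c (Suc i)))" "n \<ge> 1" "c 1 = a" "c n = b"
    "\<forall>i\<in>{1..n}. c i \<in> G" unfolding chain_sums_def by blast
  then show ?thesis using chain_lower_bound[of 1 n c] by simp
qed

lemma bdd_chain_sums: "bdd_below (chain_sums a b)"
  using chain_sums_lower by (intro bdd_belowI)

lemma D_le_r: "a \<in> G \<Longrightarrow> b \<in> G \<Longrightarrow> D a b \<le> r a b"
  using cInf_lower[OF r_in_chain_sums bdd_chain_sums] by (simp add: D_eq)

lemma r_le_D: "a \<in> G \<Longrightarrow> b \<in> G \<Longrightarrow> r a b / 4 \<le> D a b"
  unfolding D_eq by (rule cInf_greatest) (use r_in_chain_sums chain_sums_lower in blast)+

lemma chain_sums_rev: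
  assumes "s \<in> chain_sums a b" shows "s \<in> chain_sums b a"
proof -
  obtain n c where c: "s = (\<Sum>i=1..<n. r (c i) (c (Suc i)))" "n \<ge> 1" "c 1 = a" "c n = b"
    "\<forall>i\<in>{1..n}. c i \<in> G" using assms unfolding chain_sums_def by blast
  define c' where "c' i = c (Suc n - i)" for i
  have "s = (\<Sum>i=1..<n. r (c' i) (c' (Suc i)))"
    unfolding c(1)
  proof (rule sum.reindex_bij_witness[of _ "\<lambda>i. n - i" "\<lambda>i. n - i"])
    fix i assume "i \<in> {1..<n}"
    then have "Suc n - (n - i) = Suc i" "Suc n - Suc (n - i) = i" by auto
    then show "r (c' (n - i)) (c' (Suc (n - i))) = r (c i) (c (Suc i))"
      by (simp add: c'_def r_sym)
  qed auto
  moreover have "c' i \<in> G" if "i \<in> {1..n}" for i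
  proof -
    have "Suc n - i \<in> {1..n}" using that by auto
    then show ?thesis using c(5) by (simp add: c'_def)
  qed
  moreover have "c' 1 = b" "c' n = a" using c by (auto simp: c'_def)
  ultimately show ?thesis unfolding chain_sums_def using c(2) by blast
qed

lemma chain_sums_append:
  assumes "s \<in> chain_sums a b" "t \<in> chain_sums b d" shows "s + t \<in> chain_sums a d"
proof -
  obtain n c where c: "s = (\<Sum>i=1..<n. r (c i) (c (Suc i)))" "n \<ge> 1" "c 1 = a" "c n = b"
    "\<forall>i\<in>{1..n}. c i \<in> G" using assms(1) unfolding chain_sums_def by blast
  obtain m e where e: "t = (\<Sum>i=1..<m. r (e i) (e (Suc i)))" "m \<ge> 1" "e 1 = b" "e m = d"
    "\<forall>i\<in>{1..m}. e i \<in> G" using assms(2) unfolding chain_sums_def by blast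
  define f where "f i = (if i \<le> n then c i else e (Suc i - n))" for i
  have "(\<Sum>i=1..<n + m - 1. r (f i) (f (Suc i))) = (\<Sum>i=1..<n. r (f i) (f (Suc i))) + (\<Sum>i=n..<n + m - 1. r (f i) (f (Suc i)))"
    by (rule sum.atLeastLessThan_concat[symmetric]) (use c e in auto)
  also have "(\<Sum>i=1..<n. r (f i) (f (Suc i))) = s"
    unfolding c(1) by (rule sum.cong) (auto simp: f_def)
  also have "(\<Sum>i=n..<n + m - 1. r (f i) (f (Suc i))) = t"
    unfolding e(1)
  proof (rule sum.reindex_bij_witness[of _ "\<lambda>i. i + n - 1" "\<lambda>i. Suc i - n"])
    fix i assume i: "i \<in> {n..<n + m - 1}"
    have "f i = e (Suc i - n)"
      using i c(4) e(3) by (cases "i = n") (auto simp: f_def)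
    moreover have "f (Suc i) = e (Suc (Suc i - n))"
      using i by (auto simp: f_def Suc_diff_le)
    ultimately show "r (e (Suc i - n)) (e (Suc (Suc i - n))) = r (f i) (f (Suc i))" by simp
  qed (use c(2) in auto)
  finally have "s + t = (\<Sum>i=1..<n + m - 1. r (f i) (f (Suc i)))" by simp
  moreover have "f 1 = a" using c by (auto simp: f_def)
  moreover have "f (n + m - 1) = d"
    using c e by (cases "m = 1") (auto simp: f_def)
  moreover have "f i \<in> G" if "i \<in> {1..n + m - 1}" for i
  proof (cases "i \<le> n")
    case False
    then have "Suc i - n \<in> {1..m}" using that by auto
    then show ?thesis using e(5) False by (simp add: f_def)
  qed (use c that in \<open>auto simp: f_def\<close>)
  moreover have "n + m - 1 \<ge> 1" using c e by simp
  ultimately show ?thesis unfolding chain_sums_def by blast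
qed

lemma D_triangle:
  assumes "a \<in> G" "b \<in> G" "c \<in> G"
  shows "D a c \<le> D a b + D b c"
proof -
  have *: "D a c \<le> s + t" if "s \<in> chain_sums a b" "t \<in> chain_sums b c" for s t
    unfolding D_eq[OF assms(1,3)]
    by (rule cInf_lower[OF chain_sums_append[OF that] bdd_chain_sums])
  have "D a c - t \<le> D a b" if "t \<in> chain_sums b c" for t
    unfolding D_eq[OF assms(1,2)]
    by (rule cInf_greatest) (use r_in_chain_sums assms *[OF _ that] in force)+
  then have "D a c - D a b \<le> t" if "t \<in> chain_sums b c" for t using that by force
  then have "D a c - D a b \<le> D b c"
    unfolding D_eq[OF assms(2,3)] D_eq[OF assms(1,2)] D_eq[OF assms(1,3)]
    by (intro cInf_greatest) (use r_in_chain_sums assms in auto)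
  then show ?thesis by simp
qed

theorem metric: "Metric_space G D"
proof
  show "0 \<le> D a b" for a b
  proof (cases "a \<in> G \<and> b \<in> G")
    case True
    then show ?thesis using r_nonneg[of a b] r_le_D[of a b] by simp
  qed (auto simp: chain_dist_def)
  show "D a b = D b a" for a b
  proof (cases "a \<in> G \<and> b \<in> G")
    case True
    have "chain_sums a b = chain_sums b a" using chain_sums_rev by blast
    then show ?thesis using True by (simp add: D_eq)
  qed (auto simp: chain_dist_def)
  show "D a b = 0 \<longleftrightarrow> a = b" if "a \<in> G" "b \<in> G" for a b
  proof
    assume "D a b = 0"
    then have "r a b \<le> 0" using r_le_D[OF that] by simp
    then have "r a b < (1 / 2) ^ n" for n by (smt (verit) zero_less_power half_gt_zero)
    then have "R (Suc n) a b" for n using R_if_r_less that by blast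
    then have "R n a b" for n using R_mono[OF that, of "Suc n" n] by simp
    then show "a = b" by (rule R_separates[OF that])
  next
    assume "a = b"
    then show "D a b = 0" using r_refl[of a] D_le_r[of a a] r_le_D[of a a] that by simp
  qed
  show "D a c \<le> D a b + D b c" if "a \<in> G" "b \<in> G" "c \<in> G" for a b c
    by (rule D_triangle[OF that])
qed

theorem D_le: "a \<in> G \<Longrightarrow> b \<in> G \<Longrightarrow> R n a b \<Longrightarrow> D a b \<le> (1 / 2) ^ n"
  using D_le_r[of a b] r_le[of n a b] by simp

theorem R_if_D_less: "a \<in> G \<Longrightarrow> b \<in> G \<Longrightarrow> D a b < (1 / 2) ^ n / 4 \<Longrightarrow> R n a b"
  using r_le_D[of a b] R_if_r_less[of a b n] R_mono[of a b "Suc n" n] by force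

end

section \<open>Local stable and unstable sets of a Smale space\<close>

text \<open>Stable and unstable sets are interchanged. Facts about unstable sets and backward orbits are
  obtained from those about stable sets and forward orbits through this construction.\<close>
definition inverse_smale :: "'a smale \<Rightarrow> 'a smale" where
  "inverse_smale S = S\<lparr>hom := hinv S, brk := \<lambda>x y. brk S y x\<rparr>"

lemma inverse_smale_simps [simp]:
  "pts (inverse_smale S) = pts S" "dst (inverse_smale S) = dst S" "hom (inverse_smale S) = hinv S"
  "brk (inverse_smale S) x y = brk S y x" "eps (inverse_smale S) = eps S"
  "eps' (inverse_smale S) = eps' S" "lam (inverse_smale S) = lam S"
  "top_of (inverse_smale S) = top_of S"
  "local_stable (inverse_smale S) = local_unstable S"
  "local_unstable (inverse_smale S) = local_stable S"
  by (auto simp: inverse_smale_def top_of_def local_stable_def local_unstable_def fun_eq_iff)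

text \<open>A description of local stable sets by orbits, without the bracket. Unlike membership in
  \<open>local_stable\<close> it is monotone in \<open>r\<close>, obeys a triangle inequality and needs no smallness condition to make
  sense; up to the choice of radii the two agree for small \<open>r\<close>.\<close>
definition forward_close :: "'a smale \<Rightarrow> real \<Rightarrow> 'a \<Rightarrow> 'a \<Rightarrow> bool" where
  "forward_close S r x y \<longleftrightarrow> x \<in> pts S \<and> y \<in> pts S \<and>
     (\<forall>i. dst S ((hom S ^^ i) x) ((hom S ^^ i) y) \<le> r)"

definition backward_close :: "'a smale \<Rightarrow> real \<Rightarrow> 'a \<Rightarrow> 'a \<Rightarrow> bool" where
  "backward_close S r x y \<longleftrightarrow> x \<in> pts S \<and> y \<in> pts S \<and>
     (\<forall>i. dst S ((hinv S ^^ i) x) ((hinv S ^^ i) y) \<le> r)"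

locale smale =
  fixes S :: "'a smale"
  assumes smale_space: "smale_space S"
begin

abbreviation X where "X \<equiv> pts S"
abbreviation d where "d \<equiv> dst S"
abbreviation \<phi> where "\<phi> \<equiv> hom S"
abbreviation \<psi> where "\<psi> \<equiv> hinv S"
abbreviation br where "br \<equiv> brk S"

sublocale Metric_space X d
  using smale_space by (simp add: smale_space_def)

lemma top_of_eq: "top_of S = mtopology" by (simp add: top_of_def)

lemma compact: "compact_space mtopology"
  and homeo: "homeomorphic_map mtopology mtopology \<phi>"
  and eps_pos: "0 < eps S" and lam_gt1: "1 < lam S"
  and eps'_pos: "0 < eps' S" and eps'_le: "eps' S \<le> eps S / 2"
  using smale_space unfolding smale_space_def top_of_eq by blast+

lemma br_cont: "continuous_map (subtopology (prod_topology mtopology mtopology) {(x, y). brk_def_at S x y})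
       mtopology (\<lambda>(x, y). br x y)"
  using smale_space unfolding smale_space_def top_of_eq by blast

lemma br_idem: "x \<in> X \<Longrightarrow> br x x = x"
  using smale_space unfolding smale_space_def by blast

lemma br_in: "x \<in> X \<Longrightarrow> y \<in> X \<Longrightarrow> d x y \<le> eps S \<Longrightarrow> br x y \<in> X"
proof -
  assume "x \<in> X" "y \<in> X" "d x y \<le> eps S"
  then have "(x, y) \<in> topspace (subtopology (prod_topology mtopology mtopology) {(x, y). brk_def_at S x y})"
    by (simp add: brk_def_at_def)
  then have "(\<lambda>(x, y). br x y) (x, y) \<in> topspace mtopology"
    using continuous_map_image_subset_topspace[OF br_cont] by blast
  then show ?thesis by simp
qed

lemma br_left:
  assumes "x \<in> X" "y \<in> X" "z \<in> X" "d y z \<le> eps S" "d x (br y z) \<le> eps S" "d x z \<le> eps S"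
  shows "br x (br y z) = br x z"
proof -
  have "\<forall>x y z. brk_def_at S y z \<and> brk_def_at S x (br y z) \<and> brk_def_at S x z
        \<longrightarrow> br x (br y z) = br x z"
    using smale_space unfolding smale_space_def by blast
  then show ?thesis using assms br_in by (simp add: brk_def_at_def)
qed

lemma br_right:
  assumes "x \<in> X" "y \<in> X" "z \<in> X" "d x y \<le> eps S" "d (br x y) z \<le> eps S" "d x z \<le> eps S"
  shows "br (br x y) z = br x z"
proof -
  have "\<forall>x y z. brk_def_at S x y \<and> brk_def_at S (br x y) z \<and> brk_def_at S x z
        \<longrightarrow> br (br x y) z = br x z"
    using smale_space unfolding smale_space_def by blast
  then show ?thesis using assms br_in by (simp add: brk_def_at_def)
qed

lemma br_hom:
  assumes "x \<in> X" "y \<in> X" "d x y \<le> eps S" "\<phi> x \<in> X" "\<phi> y \<in> X" "d (\<phi> x) (\<phi> y) \<le> eps S"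
  shows "\<phi> (br x y) = br (\<phi> x) (\<phi> y)"
proof -
  have "\<forall>x y. brk_def_at S x y \<and> brk_def_at S (\<phi> x) (\<phi> y)
        \<longrightarrow> \<phi> (br x y) = br (\<phi> x) (\<phi> y)"
    using smale_space unfolding smale_space_def by blast
  then show ?thesis using assms by (simp add: brk_def_at_def)
qed

lemma contraction:
  assumes "x \<in> X" "0 < e" "e \<le> eps S"
  shows "y \<in> local_stable S x e \<Longrightarrow> z \<in> local_stable S x e \<Longrightarrow> d (\<phi> y) (\<phi> z) \<le> inverse (lam S) * d y z"
    and "y \<in> local_unstable S x e \<Longrightarrow> z \<in> local_unstable S x e \<Longrightarrow> d (\<psi> y) (\<psi> z) \<le> inverse (lam S) * d y z"
proof -
  have "\<forall>x\<in>X. \<forall>e. 0 < e \<and> e \<le> eps S \<longrightarrow>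
        (\<forall>y\<in>local_stable S x e. \<forall>z\<in>local_stable S x e. d (\<phi> y) (\<phi> z) \<le> inverse (lam S) * d y z) \<and>
        (\<forall>y\<in>local_unstable S x e. \<forall>z\<in>local_unstable S x e. d (\<psi> y) (\<psi> z) \<le> inverse (lam S) * d y z)"
    using smale_space unfolding smale_space_def by blast
  then show "y \<in> local_stable S x e \<Longrightarrow> z \<in> local_stable S x e \<Longrightarrow> d (\<phi> y) (\<phi> z) \<le> inverse (lam S) * d y z"
    and "y \<in> local_unstable S x e \<Longrightarrow> z \<in> local_unstable S x e \<Longrightarrow> d (\<psi> y) (\<psi> z) \<le> inverse (lam S) * d y z"
    using assms by blast+
qed

lemma bracket_near:
  assumes "x \<in> X" "y \<in> X" "d x y \<le> eps' S"
  shows "d x (br x y) < eps S / 2" "d y (br x y) < eps S / 2"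
proof -
  have "\<forall>x\<in>X. \<forall>y\<in>X. d x y \<le> eps' S \<longrightarrow> d x (br x y) < eps S / 2 \<and> d y (br x y) < eps S / 2"
    using smale_space unfolding smale_space_def by blast
  then show "d x (br x y) < eps S / 2" "d y (br x y) < eps S / 2" using assms by blast+
qed

lemma bij_hom: "bij_betw \<phi> X X"
  using homeomorphic_imp_injective_map[OF homeo] homeomorphic_imp_surjective_map[OF homeo]
  by (simp add: bij_betw_def)

lemma hom_in [simp]: "x \<in> X \<Longrightarrow> \<phi> x \<in> X"
  using bij_hom bij_betwE by blast

lemma hinv_in [simp]: "x \<in> X \<Longrightarrow> \<psi> x \<in> X"
  using bij_betwE[OF bij_betw_inv_into[OF bij_hom]] by (simp add: hinv_def)

lemma hinv_hom [simp]: "x \<in> X \<Longrightarrow> \<psi> (\<phi> x) = x"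
  unfolding hinv_def by (rule bij_betw_inv_into_left[OF bij_hom])

lemma hom_hinv [simp]: "x \<in> X \<Longrightarrow> \<phi> (\<psi> x) = x"
  unfolding hinv_def by (rule bij_betw_inv_into_right[OF bij_hom])

lemma pow_in [simp]: "x \<in> X \<Longrightarrow> (\<phi> ^^ n) x \<in> X" "x \<in> X \<Longrightarrow> (\<psi> ^^ n) x \<in> X"
  by (induction n) auto

lemma hinv_pow_hom_pow [simp]: "x \<in> X \<Longrightarrow> (\<psi> ^^ n) ((\<phi> ^^ n) x) = x"
proof (induction n)
  case (Suc n)
  have "(\<psi> ^^ Suc n) ((\<phi> ^^ Suc n) x) = (\<psi> ^^ n) (\<psi> (\<phi> ((\<phi> ^^ n) x)))"
    by (simp add: funpow_swap1)
  then show ?case using Suc by simp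
qed simp

lemma hom_pow_hinv_pow [simp]: "x \<in> X \<Longrightarrow> (\<phi> ^^ n) ((\<psi> ^^ n) x) = x"
proof (induction n)
  case (Suc n)
  have "(\<phi> ^^ Suc n) ((\<psi> ^^ Suc n) x) = (\<phi> ^^ n) (\<phi> (\<psi> ((\<psi> ^^ n) x)))"
    by (simp add: funpow_swap1)
  then show ?case using Suc by simp
qed simp

lemma hinv_hom_pow: "x \<in> X \<Longrightarrow> i \<le> n \<Longrightarrow> (\<psi> ^^ i) ((\<phi> ^^ n) x) = (\<phi> ^^ (n - i)) x"
  using hinv_pow_hom_pow[of "(\<phi> ^^ (n - i)) x" i] funpow_add[of i "n - i" \<phi>] by simp

lemma hinv_hom_pow': "x \<in> X \<Longrightarrow> n \<le> i \<Longrightarrow> (\<psi> ^^ i) ((\<phi> ^^ n) x) = (\<psi> ^^ (i - n)) x"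
  using hinv_pow_hom_pow[of x n] funpow_add[of "i - n" n \<psi>] by simp

lemma homeomorphic_hinv: "homeomorphic_map mtopology mtopology \<psi>"
proof -
  obtain g where g: "homeomorphic_maps mtopology mtopology \<phi> g"
    using homeo homeomorphic_map_maps by blast
  have gX: "g x \<in> X" "\<phi> (g x) = x" if "x \<in> X" for x
    using g that homeomorphic_imp_surjective_map[of mtopology mtopology g]
    unfolding homeomorphic_maps_map by auto
  have "g x = \<psi> x" if "x \<in> X" for x
    using gX[OF that] hinv_hom[of "g x"] by simp
  then show ?thesis
    using g homeomorphic_map_eq[of mtopology mtopology g \<psi>] unfolding homeomorphic_maps_map by auto
qed

lemma hinv_inverse_smale [simp]: "x \<in> X \<Longrightarrow> hinv (inverse_smale S) x = \<phi> x"
proof -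
  assume x: "x \<in> X"
  have inj: "inj_on \<psi> X" using bij_betw_inv_into[OF bij_hom] by (simp add: hinv_def bij_betw_def)
  have "inv_into X \<psi> x = \<phi> x" by (rule inv_into_f_eq[OF inj]) (use x in auto)
  then show ?thesis by (simp add: hinv_def[of "inverse_smale S"])
qed

lemma hinv_pow_inverse_smale [simp]: "x \<in> X \<Longrightarrow> (hinv (inverse_smale S) ^^ n) x = (\<phi> ^^ n) x"
  by (induction n) auto

theorem smale_inverse: "smale (inverse_smale S)"
proof
  have swap: "continuous_map (subtopology (prod_topology mtopology mtopology) {(x, y). brk_def_at (inverse_smale S) x y})
       (subtopology (prod_topology mtopology mtopology) {(x, y). brk_def_at S x y}) (\<lambda>(x, y). (y, x))"
    unfolding continuous_map_in_subtopology
  proof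
    show "continuous_map (subtopology (prod_topology mtopology mtopology) {(x, y). brk_def_at (inverse_smale S) x y})
       (prod_topology mtopology mtopology) (\<lambda>(x, y). (y, x))"
      by (intro continuous_map_from_subtopology)
        (simp add: continuous_map_pairwise case_prod_unfold comp_def continuous_map_fst continuous_map_snd)
  qed (auto simp: brk_def_at_def commute)
  have cont: "continuous_map (subtopology (prod_topology mtopology mtopology) {(x, y). brk_def_at (inverse_smale S) x y})
       mtopology (\<lambda>(x, y). brk (inverse_smale S) x y)"
    using continuous_map_compose[OF swap br_cont] by (simp add: comp_def case_prod_unfold)
  have hom: "\<psi> (br y x) = br (\<psi> y) (\<psi> x)"
    if "x \<in> X" "y \<in> X" "d x y \<le> eps S" "d (\<psi> x) (\<psi> y) \<le> eps S" for x y
  proof -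
    have "\<phi> (br (\<psi> y) (\<psi> x)) = br y x"
      using br_hom[of "\<psi> y" "\<psi> x"] that by (simp add: commute)
    then show ?thesis using hinv_hom[OF br_in[of "\<psi> y" "\<psi> x"]] that by (simp add: commute)
  qed
  have ls: "y \<in> X" if "y \<in> local_stable S x e" for x y e using that by (simp add: local_stable_def)
  show "smale_space (inverse_smale S)"
    unfolding smale_space_def inverse_smale_simps top_of_eq
  proof (intro conjI allI impI ballI)
    show "Metric_space X d" by unfold_locales
    show "continuous_map (subtopology (prod_topology mtopology mtopology) {(x, y). brk_def_at (inverse_smale S) x y})
       mtopology (\<lambda>(x, y). br y x)" using cont by simp
    show "compact_space mtopology" "homeomorphic_map mtopology mtopology \<psi>" "0 < eps S" "1 < lam S"
      "0 < eps' S" "eps' S \<le> eps S / 2"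
      by (fact compact homeomorphic_hinv eps_pos lam_gt1 eps'_pos eps'_le)+
    show "infinite X" using smale_space by (simp add: smale_space_def)
    show "br x x = x" if "x \<in> X" for x using that br_idem by simp
    show "br (br z y) x = br z x"
      if "brk_def_at (inverse_smale S) y z \<and> brk_def_at (inverse_smale S) x (br z y) \<and> brk_def_at (inverse_smale S) x z" for x y z
      using that br_right[of z y x] by (auto simp: brk_def_at_def commute)
    show "br z (br y x) = br z x"
      if "brk_def_at (inverse_smale S) x y \<and> brk_def_at (inverse_smale S) (br y x) z \<and> brk_def_at (inverse_smale S) x z" for x y z
      using that br_left[of z y x] by (auto simp: brk_def_at_def commute)
    show "\<psi> (br y x) = br (\<psi> y) (\<psi> x)"
      if "brk_def_at (inverse_smale S) x y \<and> brk_def_at (inverse_smale S) (\<psi> x) (\<psi> y)" for x y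
      using that hom by (auto simp: brk_def_at_def)
    show "d x (br y x) < eps S / 2" "d y (br y x) < eps S / 2"
      if "x \<in> X" "y \<in> X" "d x y \<le> eps' S" for x y
      using bracket_near[of y x] that by (auto simp: commute)
    show "d (\<psi> y) (\<psi> z) \<le> inverse (lam S) * d y z"
      if "x \<in> X" "0 < e \<and> e \<le> eps S" "y \<in> local_unstable S x e" "z \<in> local_unstable S x e" for x e y z
      using contraction that by blast
    show "d (hinv (inverse_smale S) y) (hinv (inverse_smale S) z) \<le> inverse (lam S) * d y z"
      if "x \<in> X" "0 < e \<and> e \<le> eps S" "y \<in> local_stable S x e" "z \<in> local_stable S x e" for x e y z
      using contraction(1)[OF that(1) _ _ that(3,4)] that(2) ls[OF that(3)] ls[OF that(4)] by simp
  qed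
qed

lemma subsequence:
  fixes \<sigma> :: "nat \<Rightarrow> 'a"
  assumes "\<And>n. \<sigma> n \<in> X"
  shows "\<exists>l r. l \<in> X \<and> strict_mono r \<and> (\<lambda>n. d (\<sigma> (r n)) l) \<longlonglongrightarrow> 0"
proof -
  have "range \<sigma> \<subseteq> X" using assms by auto
  then obtain l r where l: "l \<in> X" "strict_mono r" and lim: "limitin mtopology (\<sigma> \<circ> r) l sequentially"
    using compact[unfolded compact_space_sequentially, rule_format, of \<sigma>] by auto
  have "(\<lambda>n. d (\<sigma> (r n)) l) \<longlonglongrightarrow> 0"
    using lim unfolding limitin_metric tendsto_iff by (auto simp: dist_real_def elim: eventually_mono)
  then show ?thesis using l by blast
qed

lemma limitin_iff: "limitin mtopology \<sigma> l sequentially \<longleftrightarrow>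
   l \<in> X \<and> (\<forall>\<^sub>F n in sequentially. \<sigma> n \<in> X) \<and> (\<lambda>n. d (\<sigma> n) l) \<longlonglongrightarrow> 0"
proof
  assume L: "limitin mtopology \<sigma> l sequentially"
  then have "\<forall>\<^sub>F n in sequentially. \<sigma> n \<in> X" unfolding limitin_metric
    by (auto dest!: spec[of _ 1] elim: eventually_mono)
  moreover have "(\<lambda>n. d (\<sigma> n) l) \<longlonglongrightarrow> 0" using L
    unfolding limitin_metric tendsto_iff by (auto simp: dist_real_def elim: eventually_mono)
  ultimately show "l \<in> X \<and> (\<forall>\<^sub>F n in sequentially. \<sigma> n \<in> X) \<and> (\<lambda>n. d (\<sigma> n) l) \<longlonglongrightarrow> 0"
    using L by (simp add: limitin_metric)
next
  assume R: "l \<in> X \<and> (\<forall>\<^sub>F n in sequentially. \<sigma> n \<in> X) \<and> (\<lambda>n. d (\<sigma> n) l) \<longlonglongrightarrow> 0"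
  then show "limitin mtopology \<sigma> l sequentially"
    unfolding limitin_metric tendsto_iff by (auto simp: dist_real_def intro: eventually_conj)
qed

lemma hom_pow_limit:
  assumes "\<And>n. \<sigma> n \<in> X" "l \<in> X" "(\<lambda>n. d (\<sigma> n) l) \<longlonglongrightarrow> 0"
  shows "(\<lambda>n. d ((\<phi> ^^ k) (\<sigma> n)) ((\<phi> ^^ k) l)) \<longlonglongrightarrow> 0"
proof (induction k)
  case (Suc k)
  have "continuous_map mtopology mtopology \<phi>" using homeo by (rule homeomorphic_imp_continuous_map)
  moreover have "limitin mtopology (\<lambda>n. (\<phi> ^^ k) (\<sigma> n)) ((\<phi> ^^ k) l) sequentially"
    using Suc assms unfolding limitin_iff by simp
  ultimately have "limitin mtopology (\<phi> \<circ> (\<lambda>n. (\<phi> ^^ k) (\<sigma> n))) (\<phi> ((\<phi> ^^ k) l)) sequentially"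
    by (rule continuous_map_limit)
  then show ?case unfolding limitin_iff by simp
qed (use assms in simp)

text \<open>Otherwise a sequence of pairs with brackets at a distance from them would accumulate at some \<open>(l, l)\<close>, in
  contradiction to \<open>[l, l] = l\<close> and continuity.\<close>
lemma bracket_small:
  assumes "0 < r"
  shows "\<exists>\<gamma>>0. \<forall>x\<in>X. \<forall>y\<in>X. d x y \<le> \<gamma> \<longrightarrow> d x (br x y) \<le> r \<and> d y (br x y) \<le> r"
proof (rule ccontr)
  assume neg: "\<not> ?thesis"
  have "\<exists>x y. x \<in> X \<and> y \<in> X \<and> d x y \<le> min (eps S) (inverse (real (Suc n))) \<and> \<not> (d x (br x y) \<le> r \<and> d y (br x y) \<le> r)" for n
  proof -
    have "min (eps S) (inverse (real (Suc n))) > 0" using eps_pos by simp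
    then show ?thesis using neg by blast
  qed
  then obtain x y where xy: "\<And>n. x n \<in> X" "\<And>n. y n \<in> X" "\<And>n. d (x n) (y n) \<le> min (eps S) (inverse (real (Suc n)))"
    "\<And>n. \<not> (d (x n) (br (x n) (y n)) \<le> r \<and> d (y n) (br (x n) (y n)) \<le> r)" by metis
  obtain l s where l: "l \<in> X" "strict_mono s" "(\<lambda>n. d (x (s n)) l) \<longlonglongrightarrow> 0"
    using subsequence[of x] xy by blast
  have t: "(\<lambda>n. inverse (real (Suc (s n)))) \<longlonglongrightarrow> 0"
    using LIMSEQ_subseq_LIMSEQ[OF LIMSEQ_inverse_real_of_nat l(2)] by (simp add: comp_def)
  have ly: "(\<lambda>n. d (y (s n)) l) \<longlonglongrightarrow> 0"
  proof (rule tendsto_sandwich[OF _ _ tendsto_const])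
    show "(\<lambda>n. inverse (real (Suc (s n))) + d (x (s n)) l) \<longlonglongrightarrow> 0" using tendsto_add[OF t l(3)] by simp
    have "d (y (s n)) l \<le> inverse (real (Suc (s n))) + d (x (s n)) l" for n
      using triangle[OF xy(2) xy(1) l(1), of "s n" "s n"] xy(3)[of "s n"] by (simp add: commute)
    then show "\<forall>\<^sub>F n in sequentially. d (y (s n)) l \<le> inverse (real (Suc (s n))) + d (x (s n)) l" by simp
  qed simp
  have "limitin (subtopology (prod_topology mtopology mtopology) {(x, y). brk_def_at S x y})
      (\<lambda>n. (x (s n), y (s n))) (l, l) sequentially"
    unfolding limitin_subtopology limitin_pairwise limitin_iff comp_def
    using xy l ly eps_pos by (auto simp: brk_def_at_def)
  then have "limitin mtopology ((\<lambda>(x, y). br x y) \<circ> (\<lambda>n. (x (s n), y (s n)))) (case (l, l) of (x, y) \<Rightarrow> br x y) sequentially"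
    by (rule continuous_map_limit[OF br_cont])
  then have b: "(\<lambda>n. d (br (x (s n)) (y (s n))) l) \<longlonglongrightarrow> 0"
    unfolding limitin_iff by (simp add: br_idem l)
  have bX: "br (x n) (y n) \<in> X" for n using xy by (intro br_in) auto
  have *: "\<forall>\<^sub>F n in sequentially. d (z (s n)) (br (x (s n)) (y (s n))) \<le> r"
    if "\<And>n. z n \<in> X" "(\<lambda>n. d (z (s n)) l) \<longlonglongrightarrow> 0" for z
  proof -
    have "\<forall>\<^sub>F n in sequentially. d (z (s n)) l + d (br (x (s n)) (y (s n))) l < r"
      using order_tendstoD(2)[OF tendsto_add[OF that(2) b], of r] assms by simp
    then show ?thesis
    proof eventually_elim
      case (elim n)
      then show ?case
        using triangle[OF that(1) l(1) bX, of "s n" "s n"] by (simp add: commute)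
    qed
  qed
  have "\<forall>\<^sub>F n in sequentially. False"
    using *[OF xy(1) l(3)] *[OF xy(2) ly] by eventually_elim (use xy(4) in blast)
  then show False by simp
qed

lemma br_hom_pow:
  assumes "x \<in> X" "y \<in> X" "\<And>j. j \<le> m \<Longrightarrow> d ((\<phi> ^^ j) x) ((\<phi> ^^ j) y) \<le> eps S"
  shows "(\<phi> ^^ m) (br x y) = br ((\<phi> ^^ m) x) ((\<phi> ^^ m) y)"
  using assms(3)
proof (induction m)
  case (Suc m)
  then have "(\<phi> ^^ m) (br x y) = br ((\<phi> ^^ m) x) ((\<phi> ^^ m) y)" by simp
  then show ?case using br_hom[of "(\<phi> ^^ m) x" "(\<phi> ^^ m) y"] assms(1,2) Suc(2)[of m] Suc(2)[of "Suc m"] by simp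
qed simp

lemma hom_pow_inj: "x \<in> X \<Longrightarrow> y \<in> X \<Longrightarrow> (\<phi> ^^ m) x = (\<phi> ^^ m) y \<Longrightarrow> x = y"
  by (metis hinv_pow_hom_pow)

text \<open>A bracket known at time \<open>m\<close> is brought back to time \<open>0\<close>. Equivariance is applied one step at a time, so the
  orbits have to stay within \<open>eps S\<close> of each other throughout.\<close>
lemma br_pull:
  assumes "x \<in> X" "y \<in> X" "\<And>j. j \<le> m \<Longrightarrow> d ((\<phi> ^^ j) x) ((\<phi> ^^ j) y) \<le> eps S"
    "br ((\<phi> ^^ m) x) ((\<phi> ^^ m) y) = (\<phi> ^^ m) z" "z \<in> X"
  shows "br x y = z"
proof (rule hom_pow_inj[of _ _ m])
  show "br x y \<in> X" using assms(3)[of 0] assms(1,2) br_in by simp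
  show "(\<phi> ^^ m) (br x y) = (\<phi> ^^ m) z" using br_hom_pow[OF assms(1-3)] assms(4) by simp
qed (rule assms)

lemma local_stable_center: "x \<in> X \<Longrightarrow> 0 < e \<Longrightarrow> x \<in> local_stable S x e"
  by (simp add: local_stable_def br_idem)

lemma local_stable_sym:
  assumes "x \<in> X" "y \<in> local_stable S x e" "e \<le> eps S"
  shows "x \<in> local_stable S y e"
  using assms br_right[of x y x] eps_pos by (auto simp: local_stable_def br_idem commute)

lemma local_stable_trans:
  assumes "x \<in> X" "y \<in> local_stable S x (eps S)" "z \<in> local_stable S y (eps S)" "d x z < e" "e \<le> eps S"
  shows "z \<in> local_stable S x e"
  using assms br_right[of x y z] by (auto simp: local_stable_def)

lemma local_stable_mono:
  assumes "y \<in> local_stable S x e" "d x y < e'" shows "y \<in> local_stable S x e'"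
  using assms by (auto simp: local_stable_def)

lemma local_stable_step:
  assumes "x \<in> X" "y \<in> local_stable S x e" "e \<le> eps S"
  shows "\<phi> y \<in> local_stable S (\<phi> x) e" "d (\<phi> x) (\<phi> y) \<le> d x y / lam S"
proof -
  have y: "y \<in> X" "d x y < e" "br x y = y" using assms by (auto simp: local_stable_def)
  have e: "0 < e" using le_less_trans[OF nonneg y(2)] .
  show le: "d (\<phi> x) (\<phi> y) \<le> d x y / lam S"
    using contraction(1)[OF assms(1) e assms(3) local_stable_center[OF assms(1) e] assms(2)]
    by (simp add: divide_inverse mult.commute)
  also have "\<dots> \<le> d x y / 1" using lam_gt1 by (intro divide_left_mono) auto
  finally have l: "d (\<phi> x) (\<phi> y) \<le> d x y" by simp
  then have "br (\<phi> x) (\<phi> y) = \<phi> y"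
    using br_hom[of x y] assms y by simp
  then show "\<phi> y \<in> local_stable S (\<phi> x) e" using y l by (simp add: local_stable_def)
qed

lemma local_stable_iter:
  assumes "x \<in> X" "y \<in> local_stable S x e" "e \<le> eps S"
  shows "(\<phi> ^^ n) y \<in> local_stable S ((\<phi> ^^ n) x) e" "d ((\<phi> ^^ n) x) ((\<phi> ^^ n) y) \<le> d x y / lam S ^ n"
proof -
  have "(\<phi> ^^ n) y \<in> local_stable S ((\<phi> ^^ n) x) e \<and> d ((\<phi> ^^ n) x) ((\<phi> ^^ n) y) \<le> d x y / lam S ^ n"
  proof (induction n)
    case (Suc n)
    then have "d ((\<phi> ^^ Suc n) x) ((\<phi> ^^ Suc n) y) \<le> d ((\<phi> ^^ n) x) ((\<phi> ^^ n) y) / lam S"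
      "(\<phi> ^^ Suc n) y \<in> local_stable S ((\<phi> ^^ Suc n) x) e"
      using local_stable_step[of "(\<phi> ^^ n) x" "(\<phi> ^^ n) y" e] assms by auto
    moreover have "d ((\<phi> ^^ n) x) ((\<phi> ^^ n) y) / lam S \<le> (d x y / lam S ^ n) / lam S"
      using Suc lam_gt1 by (intro divide_right_mono) auto
    ultimately show ?case by (simp add: mult.commute)
  qed (use assms in simp)
  then show "(\<phi> ^^ n) y \<in> local_stable S ((\<phi> ^^ n) x) e" "d ((\<phi> ^^ n) x) ((\<phi> ^^ n) y) \<le> d x y / lam S ^ n"
    by auto
qed

lemma div_lam_pow_le: "0 \<le> t \<Longrightarrow> t / lam S ^ n \<le> t"
  using lam_gt1 by (simp add: divide_le_eq mult_le_cancel_left1 one_le_power)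

lemma div_lam_pow_tendsto: "(\<lambda>n. t / lam S ^ n) \<longlonglongrightarrow> 0"
proof -
  have "(\<lambda>n. t * (inverse (lam S)) ^ n) \<longlonglongrightarrow> t * 0"
    by (intro tendsto_mult tendsto_const LIMSEQ_realpow_zero) (use lam_gt1 in \<open>auto simp: field_simps\<close>)
  then show ?thesis by (simp add: divide_inverse power_inverse)
qed

lemma div_lam_pow_small: "0 < r \<Longrightarrow> \<exists>K. \<forall>k\<ge>K. t / lam S ^ k \<le> r"
  using order_tendstoD(2)[OF div_lam_pow_tendsto, of r t] unfolding eventually_sequentially
  by (meson less_imp_le)

lemma forward_close_if_local_stable:
  assumes "x \<in> X" "y \<in> local_stable S x e" "e \<le> eps S" "d x y \<le> r"
  shows "forward_close S r x y"
  unfolding forward_close_def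
proof (intro conjI allI)
  fix i show "d ((\<phi> ^^ i) x) ((\<phi> ^^ i) y) \<le> r"
    using local_stable_iter(2)[OF assms(1-3), of i] div_lam_pow_le[of "d x y" i] assms(4)
    by auto
qed (use assms in \<open>auto simp: local_stable_def\<close>)

text \<open>The forward orbit of \<open>z = [x, y]\<close> stays on the local unstable sets of the forward orbit of \<open>y\<close>, at bounded
  distance. Going back \<open>n\<close> steps divides this distance by \<open>\<lambda>\<^sup>n\<close>, hence \<open>z = y\<close>.\<close>
lemma br_eq_if_forward_close:
  assumes "forward_close S r x y" "r \<le> eps' S"
  shows "br x y = y"
proof -
  have X: "x \<in> X" "y \<in> X" and cl: "\<And>i. d ((\<phi> ^^ i) x) ((\<phi> ^^ i) y) \<le> eps' S"
    using assms order_trans by (auto simp: forward_close_def)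
  have ee: "eps' S \<le> eps S" using eps'_le eps_pos by simp
  define z where "z = br x y"
  have z: "z \<in> X" unfolding z_def using cl[of 0] ee by (intro br_in X) simp
  have zn: "(\<phi> ^^ n) z = br ((\<phi> ^^ n) x) ((\<phi> ^^ n) y)" for n
    unfolding z_def by (rule br_hom_pow[OF X]) (use cl ee order_trans in blast)
  have near: "d ((\<phi> ^^ n) y) ((\<phi> ^^ n) z) < eps S / 2" for n
    using bracket_near(2)[of "(\<phi> ^^ n) x" "(\<phi> ^^ n) y"] X cl zn by simp
  have lu: "(\<phi> ^^ n) z \<in> local_unstable S ((\<phi> ^^ n) y) (eps S)" for n
    unfolding local_unstable_def zn
  proof (intro CollectI conjI)
    have "d (br ((\<phi> ^^ n) x) ((\<phi> ^^ n) y)) ((\<phi> ^^ n) y) \<le> eps S" "d ((\<phi> ^^ n) x) ((\<phi> ^^ n) y) \<le> eps S"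
      using near[of n] zn[of n] eps_pos cl[of n] ee by (simp_all add: commute)
    then show "br (br ((\<phi> ^^ n) x) ((\<phi> ^^ n) y)) ((\<phi> ^^ n) y) = br ((\<phi> ^^ n) x) ((\<phi> ^^ n) y)"
      by (intro br_right) (use X in auto)
    show "br ((\<phi> ^^ n) x) ((\<phi> ^^ n) y) \<in> X" using zn[of n] z by (metis pow_in(1))
    show "d ((\<phi> ^^ n) y) (br ((\<phi> ^^ n) x) ((\<phi> ^^ n) y)) < eps S"
      using near[of n] zn[of n] eps_pos by simp
  qed
  have "d y z \<le> (eps S / 2) / lam S ^ n" for n
  proof -
    have "d ((\<psi> ^^ n) ((\<phi> ^^ n) y)) ((\<psi> ^^ n) ((\<phi> ^^ n) z)) \<le> d ((\<phi> ^^ n) y) ((\<phi> ^^ n) z) / lam S ^ n"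
      using smale.local_stable_iter(2)[OF smale_inverse, of "(\<phi> ^^ n) y" "(\<phi> ^^ n) z" "eps S" n] lu[of n] X
      by simp
    also have "\<dots> \<le> (eps S / 2) / lam S ^ n"
      using near[of n] lam_gt1 by (intro divide_right_mono) auto
    finally show ?thesis using X z by simp
  qed
  then have "d y z \<le> 0" by (intro LIMSEQ_le_const[OF div_lam_pow_tendsto[of "eps S / 2"]]) auto
  then have "d y z = 0" using nonneg[of y z] by linarith
  then show ?thesis using zero[OF X(2) z] z_def by simp
qed

lemma local_stable_if_forward_close:
  assumes "forward_close S r x y" "r \<le> eps' S" "d x y < e"
  shows "y \<in> local_stable S x e"
  using assms br_eq_if_forward_close[OF assms(1,2)] by (simp add: local_stable_def forward_close_def)

lemma forward_close_contract:
  assumes "forward_close S r x y" "r \<le> eps' S"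
  shows "d ((\<phi> ^^ n) x) ((\<phi> ^^ n) y) \<le> d x y / lam S ^ n"
proof (rule local_stable_iter(2)[OF _ local_stable_if_forward_close[OF assms, of "eps S"]])
  have "d x y \<le> r" using assms(1) by (auto simp: forward_close_def dest: spec[of _ 0])
  then show "d x y < eps S" using assms(2) eps'_le eps_pos by linarith
qed (use assms in \<open>auto simp: forward_close_def\<close>)

lemma forward_closeD:
  "forward_close S r x y \<Longrightarrow> x \<in> X" "forward_close S r x y \<Longrightarrow> y \<in> X"
  "forward_close S r x y \<Longrightarrow> d ((\<phi> ^^ i) x) ((\<phi> ^^ i) y) \<le> r"
  "forward_close S r x y \<Longrightarrow> d x y \<le> r"
  by (auto simp: forward_close_def dest: spec[of _ 0])

lemma forward_close_sym: "forward_close S r x y \<Longrightarrow> forward_close S r y x"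
  by (simp add: forward_close_def commute)

lemma forward_close_mono: "forward_close S r x y \<Longrightarrow> r \<le> r' \<Longrightarrow> forward_close S r' x y"
  unfolding forward_close_def using order_trans by blast

lemma forward_close_trans: "forward_close S r x y \<Longrightarrow> forward_close S r' y z \<Longrightarrow> forward_close S (r + r') x z"
  unfolding forward_close_def
  using triangle[OF pow_in(1) pow_in(1) pow_in(1)] by (smt (verit, del_insts))

lemma forward_close_pow: "forward_close S r x y \<Longrightarrow> forward_close S r ((\<phi> ^^ n) x) ((\<phi> ^^ n) y)"
  by (auto simp: forward_close_def) (metis comp_apply funpow_add)

lemma forward_close_shrink:
  assumes "forward_close S r x y" "r \<le> eps' S"
  shows "forward_close S (d x y) x y"
  using forward_close_contract[OF assms] div_lam_pow_le[OF nonneg[of x y]] assms(1)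
  by (auto simp: forward_close_def intro: order_trans)

lemma forward_close_pow_contract:
  assumes "forward_close S r x y" "r \<le> eps' S"
  shows "forward_close S (r / lam S ^ n) ((\<phi> ^^ n) x) ((\<phi> ^^ n) y)"
proof -
  have "d ((\<phi> ^^ n) x) ((\<phi> ^^ n) y) \<le> r / lam S ^ n"
    using forward_close_contract[OF assms, of n] divide_right_mono[OF forward_closeD(4)[OF assms(1)], of "lam S ^ n"]
      lam_gt1 by auto
  then show ?thesis
    using forward_close_shrink[OF forward_close_pow[OF assms(1)] assms(2)] forward_close_mono by blast
qed

lemma forward_close_extend:
  assumes "x \<in> X" "y \<in> X" "forward_close S r ((\<phi> ^^ n) x) ((\<phi> ^^ n) y)"
    "\<And>j. j < n \<Longrightarrow> d ((\<phi> ^^ j) x) ((\<phi> ^^ j) y) \<le> r"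
  shows "forward_close S r x y"
  unfolding forward_close_def
proof (intro conjI allI assms(1,2))
  fix i show "d ((\<phi> ^^ i) x) ((\<phi> ^^ i) y) \<le> r"
    using assms(4)[of i] forward_closeD(3)[OF assms(3), of "i - n"] funpow_add[of "i - n" n \<phi>]
    by (cases "i < n") auto
qed

text \<open>The facts below are those on forward orbits in the inverse Smale space.\<close>
lemma backward_inverse: "backward_close S = forward_close (inverse_smale S)"
  by (simp add: backward_close_def forward_close_def fun_eq_iff)

lemmas backward_closeD = smale.forward_closeD[OF smale_inverse, folded backward_inverse, simplified]
lemmas backward_close_sym = smale.forward_close_sym[OF smale_inverse, folded backward_inverse]
lemmas backward_close_mono = smale.forward_close_mono[OF smale_inverse, folded backward_inverse]
lemmas backward_close_trans = smale.forward_close_trans[OF smale_inverse, folded backward_inverse]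
lemmas backward_close_pow = smale.forward_close_pow[OF smale_inverse, folded backward_inverse, simplified]
lemmas backward_close_contract = smale.forward_close_contract[OF smale_inverse, folded backward_inverse, simplified]
lemmas backward_close_shrink = smale.forward_close_shrink[OF smale_inverse, folded backward_inverse, simplified]
lemmas backward_close_pow_contract = smale.forward_close_pow_contract[OF smale_inverse, folded backward_inverse, simplified]
lemmas br_eq_if_backward_close = smale.br_eq_if_forward_close[OF smale_inverse, folded backward_inverse, simplified]
lemmas local_unstable_if_backward_close = smale.local_stable_if_forward_close[OF smale_inverse, folded backward_inverse, simplified]
lemmas backward_close_if_local_unstable = smale.forward_close_if_local_stable[OF smale_inverse, folded backward_inverse, simplified]
lemmas local_unstable_iter = smale.local_stable_iter[OF smale_inverse, simplified]
lemmas local_unstable_center = smale.local_stable_center[OF smale_inverse, simplified]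
lemmas local_unstable_sym = smale.local_stable_sym[OF smale_inverse, simplified]
lemmas local_unstable_trans = smale.local_stable_trans[OF smale_inverse, simplified]
lemmas local_unstable_mono = smale.local_stable_mono[OF smale_inverse, simplified]

text \<open>The point \<open>[y, x]\<close> equals \<open>x\<close> by closeness of the forward orbits and \<open>y\<close> by closeness of the backward orbits.\<close>
lemma expansive:
  assumes "forward_close S r x y" "backward_close S r x y" "r \<le> eps' S"
  shows "x = y"
  using br_eq_if_forward_close[OF forward_close_sym[OF assms(1)] assms(3)]
    br_eq_if_backward_close[OF assms(2,3)] by simp

text \<open>The bracket of \<open>x\<close> and \<open>y\<close> lies on a local stable set of \<open>x\<close> and on a local unstable set of \<open>y\<close>, and it is close
  to both if they are close to each other.\<close>
lemma local_product:
  assumes "0 < r"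
  shows "\<exists>\<gamma>>0. \<forall>x\<in>X. \<forall>y\<in>X. d x y \<le> \<gamma> \<longrightarrow> forward_close S r x (br x y) \<and> backward_close S r y (br x y)"
proof -
  define r' where "r' = min r (eps S / 2)"
  have "0 < r'" using assms eps_pos by (simp add: r'_def)
  then obtain \<gamma> where \<gamma>: "\<gamma> > 0" "\<And>x y. x \<in> X \<Longrightarrow> y \<in> X \<Longrightarrow> d x y \<le> \<gamma> \<Longrightarrow> d x (br x y) \<le> r' \<and> d y (br x y) \<le> r'"
    using bracket_small by metis
  show ?thesis
  proof (intro exI[of _ "min \<gamma> (eps S)"] conjI ballI impI)
    show "0 < min \<gamma> (eps S)" using \<gamma>(1) eps_pos by simp
    fix x y assume xy: "x \<in> X" "y \<in> X" "d x y \<le> min \<gamma> (eps S)"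
    then have n: "d x (br x y) \<le> r'" "d y (br x y) \<le> r'" and le: "d x y \<le> eps S" using \<gamma> by auto
    have b: "br x y \<in> X" using xy by (intro br_in) auto
    have lt: "d x (br x y) < eps S" "d y (br x y) < eps S" using n eps_pos by (auto simp: r'_def)
    have "br x (br x y) = br x y" by (rule br_left) (use xy b lt in auto)
    then have "br x y \<in> local_stable S x (eps S)" using b lt by (simp add: local_stable_def)
    then show "forward_close S r x (br x y)"
      using xy n by (intro forward_close_if_local_stable) (auto simp: r'_def)
    have "br (br x y) y = br x y" by (rule br_right) (use xy b lt in \<open>auto simp: commute\<close>)
    then have "br x y \<in> local_unstable S y (eps S)" using b lt by (simp add: local_unstable_def)
    then show "backward_close S r y (br x y)"
      using xy n by (intro backward_close_if_local_unstable) (auto simp: r'_def)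
  qed
qed

end

section \<open>Stable and unstable equivalence\<close>

text \<open>At time \<open>k\<close> the pairs \<open>a\<close> and \<open>b\<close> are opposite stable sides of a rectangle of size \<open>r\<close> with two unstable sides.
  The relation is symmetric in \<open>a\<close> and \<open>b\<close> and involves neither brackets nor a centre, so that
  holonomy neighbourhoods, the covers and the metrics of different Smale structures can all be compared with it.\<close>
definition rectangle :: "'a smale \<Rightarrow> real \<Rightarrow> nat \<Rightarrow> 'a \<times> 'a \<Rightarrow> 'a \<times> 'a \<Rightarrow> bool" where
  "rectangle S r k a b \<longleftrightarrow> a \<in> pts S \<times> pts S \<and> b \<in> pts S \<times> pts S \<and>
     backward_close S r ((hom S ^^ k) (fst a)) ((hom S ^^ k) (fst b)) \<and>
     backward_close S r ((hom S ^^ k) (snd a)) ((hom S ^^ k) (snd b)) \<and>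
     forward_close S r ((hom S ^^ k) (fst a)) ((hom S ^^ k) (snd a)) \<and>
     forward_close S r ((hom S ^^ k) (fst b)) ((hom S ^^ k) (snd b))"

text \<open>The generating family of \<open>stable_topology\<close>.\<close>
definition stable_generators :: "'a smale \<Rightarrow> 'a set \<Rightarrow> ('a \<times> 'a) set set" where
  "stable_generators S Q = {{(stable_holonomy S N v z, z) | z. z \<in> local_unstable S w \<eta>} | v w N \<eta>.
        (v, w) \<in> stable_groupoid S Q \<and>
        (hom S ^^ N) w \<in> local_stable S ((hom S ^^ N) v) (eps' S / 2) \<and>
        0 < \<eta> \<and> \<eta> \<le> eps S / 2 \<and>
        (hom S ^^ N) ` local_unstable S w \<eta> \<subseteq> local_unstable S ((hom S ^^ N) w) (eps' S / 2)}"

lemma stable_set_inverse_smale [simp]: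
  "stable_set (inverse_smale S) = unstable_set S" "stable_of (inverse_smale S) = unstable_of S"
  by (auto simp: stable_set_def unstable_set_def stable_of_def unstable_of_def fun_eq_iff)

lemma orbit_invariant:
  assumes "periodic_orbit S P" "bij_betw (hom S) (pts S) (pts S)"
  shows "P \<subseteq> pts S" "finite P" "P \<noteq> {}" "hom S ` P \<subseteq> P" "hinv S ` P \<subseteq> P"
proof -
  obtain p k where p: "p \<in> pts S" "k > 0" "(hom S ^^ k) p = p" "P = {(hom S ^^ i) p | i. i < k}"
    using assms(1) by (auto simp: periodic_orbit_def)
  have inX: "(hom S ^^ i) p \<in> pts S" for i
    by (induction i) (use p bij_betwE[OF assms(2)] in auto)
  show "P \<subseteq> pts S" using inX p(4) by auto
  show "finite P" "P \<noteq> {}" using p by auto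
  show "hom S ` P \<subseteq> P"
  proof safe
    fix q assume "q \<in> P"
    then obtain i where i: "i < k" "q = (hom S ^^ i) p" using p(4) by auto
    show "hom S q \<in> P"
    proof (cases "Suc i = k")
      case True
      then have "hom S q = (hom S ^^ 0) p" using i p(3) by auto
      then show ?thesis using p(2,4) by blast
    next
      case False
      then have "hom S q = (hom S ^^ Suc i) p" "Suc i < k" using i by auto
      then show ?thesis using p(4) by blast
    qed
  qed
  have inv: "hinv S (hom S x) = x" if "x \<in> pts S" for x
    unfolding hinv_def by (rule bij_betw_inv_into_left[OF assms(2) that])
  show "hinv S ` P \<subseteq> P"
  proof safe
    fix q assume "q \<in> P"
    then obtain i where i: "i < k" "q = (hom S ^^ i) p" using p(4) by auto
    show "hinv S q \<in> P"
    proof (cases i)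
      case 0
      obtain m where m: "k = Suc m" using p(2) by (cases k) auto
      then have "q = hom S ((hom S ^^ m) p)" using i 0 p(3) by simp
      then have "hinv S q = (hom S ^^ m) p" using inv[OF inX] by simp
      then show ?thesis using p(4) m by auto
    next
      case (Suc m)
      then have "hinv S q = (hom S ^^ m) p" using i inv[OF inX[of m]] by simp
      then show ?thesis using p(4) i Suc by auto
    qed
  qed
qed

context smale
begin

lemma stable_setD:
  assumes "w \<in> stable_set S v"
  shows "w \<in> X" "(\<lambda>n. d ((\<phi> ^^ n) v) ((\<phi> ^^ n) w)) \<longlonglongrightarrow> 0"
  using assms by (auto simp: stable_set_def)

lemma stable_set_eventually:
  assumes "v \<in> X" "w \<in> stable_set S v" "0 < r"
  shows "\<exists>N. \<forall>k\<ge>N. forward_close S r ((\<phi> ^^ k) v) ((\<phi> ^^ k) w)"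
proof -
  obtain N where N: "\<And>n. n \<ge> N \<Longrightarrow> d ((\<phi> ^^ n) v) ((\<phi> ^^ n) w) < r"
    using order_tendstoD(2)[OF stable_setD(2)[OF assms(2)] assms(3)] by (auto simp: eventually_sequentially)
  have "forward_close S r ((\<phi> ^^ k) v) ((\<phi> ^^ k) w)" if "k \<ge> N" for k
    unfolding forward_close_def
  proof (intro conjI allI)
    fix i
    have "d ((\<phi> ^^ (i + k)) v) ((\<phi> ^^ (i + k)) w) < r" using N that by simp
    then show "d ((\<phi> ^^ i) ((\<phi> ^^ k) v)) ((\<phi> ^^ i) ((\<phi> ^^ k) w)) \<le> r" by (simp add: funpow_add)
  qed (use assms stable_setD in auto)
  then show ?thesis by blast
qed

lemma stable_set_if_tendsto:
  assumes "w \<in> X" "\<And>n. d ((\<phi> ^^ (n + k)) v) ((\<phi> ^^ (n + k)) w) \<le> t / lam S ^ n"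
  shows "w \<in> stable_set S v"
proof -
  have "(\<lambda>n. d ((\<phi> ^^ (n + k)) v) ((\<phi> ^^ (n + k)) w)) \<longlonglongrightarrow> 0"
    by (rule tendsto_sandwich[OF _ _ tendsto_const div_lam_pow_tendsto[of t]]) (use assms(2) in auto)
  then show ?thesis using assms(1) LIMSEQ_offset[of "\<lambda>n. d ((\<phi> ^^ n) v) ((\<phi> ^^ n) w)" k 0]
    by (simp add: stable_set_def)
qed

lemma stable_set_if_forward_close:
  assumes "w \<in> X" "forward_close S r ((\<phi> ^^ k) v) ((\<phi> ^^ k) w)" "r \<le> eps' S"
  shows "w \<in> stable_set S v"
  using forward_close_contract[OF assms(2,3)]
  by (intro stable_set_if_tendsto[OF assms(1)]) (simp add: funpow_add)

lemma stable_set_if_local_stable: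
  assumes "v \<in> X" "w \<in> local_stable S v e" "e \<le> eps S"
  shows "w \<in> stable_set S v"
  using local_stable_iter(2)[OF assms] assms(2)
  by (intro stable_set_if_tendsto[where k = 0 and t = "d v w"]) (auto simp: local_stable_def)

lemma stable_set_sym: "v \<in> X \<Longrightarrow> w \<in> stable_set S v \<Longrightarrow> v \<in> stable_set S w"
  by (simp add: stable_set_def commute)

lemma stable_set_trans:
  assumes "u \<in> X" "v \<in> stable_set S u" "w \<in> stable_set S v"
  shows "w \<in> stable_set S u"
proof -
  have "(\<lambda>n. d ((\<phi> ^^ n) u) ((\<phi> ^^ n) w)) \<longlonglongrightarrow> 0"
  proof (rule tendsto_sandwich[OF _ _ tendsto_const])
    show "(\<lambda>n. d ((\<phi> ^^ n) u) ((\<phi> ^^ n) v) + d ((\<phi> ^^ n) v) ((\<phi> ^^ n) w)) \<longlonglongrightarrow> 0"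
      using tendsto_add[OF stable_setD(2)[OF assms(2)] stable_setD(2)[OF assms(3)]] by simp
    show "\<forall>\<^sub>F n in sequentially. d ((\<phi> ^^ n) u) ((\<phi> ^^ n) w) \<le> d ((\<phi> ^^ n) u) ((\<phi> ^^ n) v) + d ((\<phi> ^^ n) v) ((\<phi> ^^ n) w)"
      using assms stable_setD(1) by (intro always_eventually allI triangle) auto
  qed simp
  then show ?thesis using stable_setD(1)[OF assms(3)] by (simp add: stable_set_def)
qed

lemma stable_set_refl: "v \<in> X \<Longrightarrow> v \<in> stable_set S v"
  by (simp add: stable_set_def)

lemma stable_set_pow:
  assumes "v \<in> X" "w \<in> stable_set S v"
  shows "(\<phi> ^^ n) w \<in> stable_set S ((\<phi> ^^ n) v)" "(\<psi> ^^ n) w \<in> stable_set S ((\<psi> ^^ n) v)"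
proof -
  have w: "w \<in> X" using assms stable_setD by blast
  obtain N where N: "\<And>k. k \<ge> N \<Longrightarrow> forward_close S (eps' S) ((\<phi> ^^ k) v) ((\<phi> ^^ k) w)"
    using stable_set_eventually[OF assms eps'_pos] by blast
  have "forward_close S (eps' S) ((\<phi> ^^ N) ((\<phi> ^^ n) v)) ((\<phi> ^^ N) ((\<phi> ^^ n) w))"
    using N[of "N + n"] by (simp add: funpow_add)
  then show "(\<phi> ^^ n) w \<in> stable_set S ((\<phi> ^^ n) v)"
    using w by (intro stable_set_if_forward_close[OF _ _ order_refl]) auto
  have "(\<phi> ^^ (N + n)) ((\<psi> ^^ n) x) = (\<phi> ^^ N) x" if "x \<in> X" for x
    using that by (simp add: funpow_add)
  then have "forward_close S (eps' S) ((\<phi> ^^ (N + n)) ((\<psi> ^^ n) v)) ((\<phi> ^^ (N + n)) ((\<psi> ^^ n) w))"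
    using N[of N] assms(1) w by simp
  then show "(\<psi> ^^ n) w \<in> stable_set S ((\<psi> ^^ n) v)"
    using w by (intro stable_set_if_forward_close[OF _ _ order_refl]) auto
qed

lemmas unstable_setD = smale.stable_setD[OF smale_inverse, simplified]
lemmas unstable_set_eventually = smale.stable_set_eventually[OF smale_inverse, folded backward_inverse, simplified]
lemmas unstable_set_if_backward_close = smale.stable_set_if_forward_close[OF smale_inverse, folded backward_inverse, simplified]
lemmas unstable_set_if_local_unstable = smale.stable_set_if_local_stable[OF smale_inverse, simplified]
lemmas unstable_set_trans = smale.stable_set_trans[OF smale_inverse, simplified]
lemma unstable_set_pow:
  assumes "v \<in> X" "w \<in> unstable_set S v"
  shows "(\<phi> ^^ n) w \<in> unstable_set S ((\<phi> ^^ n) v)" "(\<psi> ^^ n) w \<in> unstable_set S ((\<psi> ^^ n) v)"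
  using smale.stable_set_pow[OF smale_inverse, of v w n] assms unstable_setD(1)[OF assms(2)] by simp_all

lemma unstable_set_of_pow:
  assumes "v \<in> X" "w \<in> X" "(\<phi> ^^ n) w \<in> unstable_set S ((\<phi> ^^ n) v)"
  shows "w \<in> unstable_set S v"
  using unstable_set_pow(2)[OF _ assms(3), of n] assms by simp

lemma stable_set_of_pow:
  assumes "v \<in> X" "w \<in> X" "(\<phi> ^^ n) w \<in> stable_set S ((\<phi> ^^ n) v)"
  shows "w \<in> stable_set S v"
  using stable_set_pow(2)[OF _ assms(3), of n] assms by simp

lemma unstable_of_subset: "unstable_of S Q \<subseteq> X"
  using unstable_setD(1) by (auto simp: unstable_of_def)

lemma unstable_of_closed:
  assumes "Q \<subseteq> X" "y \<in> unstable_of S Q" "z \<in> unstable_set S y"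
  shows "z \<in> unstable_of S Q"
  using assms unstable_set_trans unfolding unstable_of_def by blast

lemma unstable_of_backward_close:
  assumes "Q \<subseteq> X" "y \<in> unstable_of S Q" "z \<in> X" "r \<le> eps' S"
    and c: "backward_close S r ((\<phi> ^^ k) y) ((\<phi> ^^ k) z)"
  shows "z \<in> unstable_of S Q"
proof -
  have y: "y \<in> X" using assms unstable_of_subset by blast
  have "(\<phi> ^^ k) z \<in> unstable_set S ((\<phi> ^^ k) y)"
    using unstable_set_if_backward_close[of "(\<phi> ^^ k) z" r 0 "(\<phi> ^^ k) y"] c assms by simp
  then have "z \<in> unstable_set S y" using unstable_set_of_pow y assms(3) by blast
  then show ?thesis by (rule unstable_of_closed[OF assms(1,2)])
qed

lemma stable_groupoidD:
  assumes "(v, w) \<in> stable_groupoid S Q"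
  shows "v \<in> unstable_of S Q" "w \<in> unstable_of S Q" "w \<in> stable_set S v" "v \<in> X" "w \<in> X"
  using assms unstable_of_subset by (auto simp: stable_groupoid_def)

lemma stable_groupoid_sym: "(v, w) \<in> stable_groupoid S Q \<Longrightarrow> (w, v) \<in> stable_groupoid S Q"
proof -
  assume a: "(v, w) \<in> stable_groupoid S Q"
  note vw = stable_groupoidD[OF a]
  show ?thesis using vw(1,2) stable_set_sym[OF vw(4,3)] by (simp add: stable_groupoid_def)
qed

lemma stable_groupoid_trans:
  "(v, w) \<in> stable_groupoid S Q \<Longrightarrow> (w, z) \<in> stable_groupoid S Q \<Longrightarrow> (v, z) \<in> stable_groupoid S Q"
proof -
  assume a: "(v, w) \<in> stable_groupoid S Q" "(w, z) \<in> stable_groupoid S Q"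
  note vw = stable_groupoidD[OF a(1)] and wz = stable_groupoidD[OF a(2)]
  show ?thesis using vw(1) wz(2) stable_set_trans[OF vw(4,3) wz(3)] by (simp add: stable_groupoid_def)
qed

lemma rectangle_in_groupoid:
  assumes "Q \<subseteq> X" "a \<in> stable_groupoid S Q" "rectangle S r k a b" "r \<le> eps' S"
  shows "b \<in> stable_groupoid S Q"
proof -
  obtain v w v' w' where ab: "a = (v, w)" "b = (v', w')" by fastforce
  have vw: "v \<in> unstable_of S Q" "w \<in> unstable_of S Q" using assms(2) stable_groupoidD ab by blast+
  have r: "v' \<in> X" "w' \<in> X" "backward_close S r ((\<phi> ^^ k) v) ((\<phi> ^^ k) v')"
    "backward_close S r ((\<phi> ^^ k) w) ((\<phi> ^^ k) w')" "forward_close S r ((\<phi> ^^ k) v') ((\<phi> ^^ k) w')"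
    using assms(3) by (auto simp: rectangle_def ab)
  show ?thesis
    using unstable_of_backward_close[OF assms(1) vw(1) r(1) assms(4) r(3)]
      unstable_of_backward_close[OF assms(1) vw(2) r(2) assms(4) r(4)]
      stable_set_if_forward_close[OF r(2,5) assms(4)]
    by (simp add: stable_groupoid_def ab)
qed

lemma hom_pow_continuous:
  assumes "x \<in> X" "0 < s"
  shows "\<exists>\<eta>>0. \<forall>z\<in>X. d x z < \<eta> \<longrightarrow> (\<forall>j\<le>k. d ((\<phi> ^^ j) x) ((\<phi> ^^ j) z) \<le> s)"
proof (rule ccontr)
  assume neg: "\<not> ?thesis"
  have "\<exists>z. z \<in> X \<and> d x z < inverse (real (Suc n)) \<and> (\<exists>j\<le>k. s < d ((\<phi> ^^ j) x) ((\<phi> ^^ j) z))" for n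
    using neg by (auto simp: not_le dest!: spec[of _ "inverse (real (Suc n))"])
  then obtain z where z: "\<And>n. z n \<in> X" "\<And>n. d x (z n) < inverse (real (Suc n))"
    "\<And>n. \<exists>j\<le>k. s < d ((\<phi> ^^ j) x) ((\<phi> ^^ j) (z n))" by metis
  have lim: "(\<lambda>n. d (z n) x) \<longlonglongrightarrow> 0"
    by (rule tendsto_sandwich[OF _ _ tendsto_const LIMSEQ_inverse_real_of_nat])
      (use z(2) in \<open>auto simp: commute[of _ x] less_imp_le\<close>)
  have "\<forall>\<^sub>F n in sequentially. \<forall>j\<in>{..k}. d ((\<phi> ^^ j) (z n)) ((\<phi> ^^ j) x) < s"
    using order_tendstoD(2)[OF hom_pow_limit[OF z(1) assms(1) lim] assms(2)]
    by (intro eventually_ball_finite) auto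
  then have "\<forall>\<^sub>F n in sequentially. False"
  proof eventually_elim
    case (elim n)
    obtain j where "j \<le> k" "s < d ((\<phi> ^^ j) x) ((\<phi> ^^ j) (z n))" using z(3) by blast
    then show ?case using bspec[OF elim, of j] commute[of "(\<phi> ^^ j) x" "(\<phi> ^^ j) (z n)"] by simp
  qed
  then show False by simp
qed

lemma bracket_local:
  assumes "x \<in> X" "y \<in> X" "d x y \<le> eps S" "d x (br x y) < e" "d y (br x y) < e" "e \<le> eps S"
  shows "br x y \<in> X" "br x y \<in> local_stable S x e" "br x y \<in> local_unstable S y e"
proof -
  show b: "br x y \<in> X" by (intro br_in assms)
  have "br x (br x y) = br x y" by (rule br_left) (use assms b in auto)
  then show "br x y \<in> local_stable S x e" using b assms by (simp add: local_stable_def)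
  have "br (br x y) y = br x y" by (rule br_right) (use assms b in \<open>auto simp: commute\<close>)
  then show "br x y \<in> local_unstable S y e" using b assms by (simp add: local_unstable_def)
qed

lemma generator_subset:
  assumes "Q \<subseteq> X" "B \<in> stable_generators S Q"
  shows "B \<subseteq> stable_groupoid S Q"
proof
  fix b assume "b \<in> B"
  then obtain v w N \<eta> z where B: "b = (stable_holonomy S N v z, z)" "z \<in> local_unstable S w \<eta>"
    "(v, w) \<in> stable_groupoid S Q" "(\<phi> ^^ N) w \<in> local_stable S ((\<phi> ^^ N) v) (eps' S / 2)"
    "0 < \<eta>" "\<eta> \<le> eps S / 2" "(\<phi> ^^ N) ` local_unstable S w \<eta> \<subseteq> local_unstable S ((\<phi> ^^ N) w) (eps' S / 2)"
    using assms(2) unfolding stable_generators_def by blast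
  note vw = stable_groupoidD[OF B(3)]
  have zX: "z \<in> X" using B(2) by (simp add: local_unstable_def)
  have "d ((\<phi> ^^ N) v) ((\<phi> ^^ N) w) < eps' S / 2" "d ((\<phi> ^^ N) w) ((\<phi> ^^ N) z) < eps' S / 2"
    using B by (auto simp: local_stable_def local_unstable_def)
  then have dzv: "d ((\<phi> ^^ N) z) ((\<phi> ^^ N) v) \<le> eps' S"
    using triangle[of "(\<phi> ^^ N) z" "(\<phi> ^^ N) w" "(\<phi> ^^ N) v"] zX vw by (simp add: commute)
  define \<beta> where "\<beta> = br ((\<phi> ^^ N) z) ((\<phi> ^^ N) v)"
  have "d ((\<phi> ^^ N) z) \<beta> < eps S / 2" "d ((\<phi> ^^ N) v) \<beta> < eps S / 2"
    using bracket_near[OF _ _ dzv] zX vw by (auto simp: \<beta>_def)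
  then have \<beta>: "\<beta> \<in> X" "\<beta> \<in> local_stable S ((\<phi> ^^ N) z) (eps S / 2)" "\<beta> \<in> local_unstable S ((\<phi> ^^ N) v) (eps S / 2)"
    using bracket_local[of "(\<phi> ^^ N) z" "(\<phi> ^^ N) v" "eps S / 2"] zX vw dzv eps'_le eps_pos
    by (auto simp: \<beta>_def)
  have h: "stable_holonomy S N v z = (\<psi> ^^ N) \<beta>" by (simp add: stable_holonomy_def \<beta>_def)
  have hX: "(\<psi> ^^ N) \<beta> \<in> X" "(\<phi> ^^ N) ((\<psi> ^^ N) \<beta>) = \<beta>" using \<beta> by auto
  have "\<beta> \<in> unstable_set S ((\<phi> ^^ N) v)" "\<beta> \<in> stable_set S ((\<phi> ^^ N) z)"
    using unstable_set_if_local_unstable[OF _ \<beta>(3)] stable_set_if_local_stable[OF _ \<beta>(2)] vw zX eps_pos by auto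
  then have "(\<psi> ^^ N) \<beta> \<in> unstable_set S v" "(\<psi> ^^ N) \<beta> \<in> stable_set S z"
    using unstable_set_of_pow[OF vw(4) hX(1)] stable_set_of_pow[OF zX hX(1)] hX(2) by metis+
  moreover have "z \<in> unstable_set S w"
    using unstable_set_if_local_unstable[OF vw(5) B(2)] B(6) eps_pos by simp
  ultimately show "b \<in> stable_groupoid S Q"
    using B(1) h unstable_of_closed[OF assms(1) vw(1)] unstable_of_closed[OF assms(1) vw(2)]
      stable_set_sym[OF zX] by (simp add: stable_groupoid_def)
qed

text \<open>At a late time \<open>k\<close> the two coordinates of \<open>a\<close> are very close. On a disc around \<open>w\<close> so small that it is
  still small at time \<open>k\<close>, the local product structure makes the holonomy at time \<open>k\<close> a small displacement.\<close>
lemma generator_in_rectangle: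
  assumes "a \<in> stable_groupoid S Q" "0 < r"
  shows "\<exists>k\<ge>k0. \<exists>B\<in>stable_generators S Q. a \<in> B \<and> (\<forall>b\<in>B. rectangle S r k a b)"
proof -
  obtain v w where a: "a = (v, w)" by fastforce
  note vw = stable_groupoidD[OF assms(1)[unfolded a]]
  define \<rho> where "\<rho> = min r (eps' S / 2)"
  have \<rho>: "0 < \<rho>" "\<rho> \<le> r" "\<rho> \<le> eps' S / 2" using assms eps'_pos by (auto simp: \<rho>_def)
  obtain \<gamma> where \<gamma>: "0 < \<gamma>" "\<And>x y. x \<in> X \<Longrightarrow> y \<in> X \<Longrightarrow> d x y \<le> \<gamma> \<Longrightarrow>
      forward_close S \<rho> x (br x y) \<and> backward_close S \<rho> y (br x y)"
    using local_product[OF \<rho>(1)] by blast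
  define s where "s = min (\<gamma> / 2) (\<rho> / 4)"
  have s: "0 < s" "2 * s \<le> \<gamma>" "s < \<rho>" "s < eps' S / 2" using \<gamma> \<rho> by (auto simp: s_def)
  have ee: "eps' S \<le> eps S / 2" "0 < eps S" by (rule eps'_le, rule eps_pos)
  obtain k1 where k1: "\<And>k. k \<ge> k1 \<Longrightarrow> forward_close S s ((\<phi> ^^ k) v) ((\<phi> ^^ k) w)"
    using stable_set_eventually[OF vw(4,3) s(1)] by blast
  define k where "k = max k0 k1"
  have fc: "forward_close S s ((\<phi> ^^ k) v) ((\<phi> ^^ k) w)" using k1 by (simp add: k_def)
  have dvw: "d ((\<phi> ^^ k) v) ((\<phi> ^^ k) w) \<le> s" using forward_closeD(4)[OF fc] .
  obtain \<eta>' where \<eta>': "0 < \<eta>'" "\<And>z j. z \<in> X \<Longrightarrow> d w z < \<eta>' \<Longrightarrow> j \<le> k \<Longrightarrow> d ((\<phi> ^^ j) w) ((\<phi> ^^ j) z) \<le> s"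
    using hom_pow_continuous[OF vw(5) s(1), of k] by blast
  define \<eta> where "\<eta> = min \<eta>' (eps S / 2)"
  have lu: "(\<phi> ^^ k) z \<in> local_unstable S ((\<phi> ^^ k) w) (eps' S / 2)" "d ((\<phi> ^^ k) w) ((\<phi> ^^ k) z) \<le> s"
    if "z \<in> local_unstable S w \<eta>" for z
  proof -
    have z: "z \<in> X" "d w z < \<eta>'" "br z w = z" using that by (auto simp: local_unstable_def \<eta>_def)
    have dj: "d ((\<phi> ^^ j) w) ((\<phi> ^^ j) z) \<le> s" if "j \<le> k" for j using \<eta>'(2)[OF z(1,2) that] .
    then show "d ((\<phi> ^^ k) w) ((\<phi> ^^ k) z) \<le> s" by simp
    have "(\<phi> ^^ k) (br z w) = br ((\<phi> ^^ k) z) ((\<phi> ^^ k) w)"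
    proof (rule br_hom_pow[OF z(1) vw(5)])
      show "d ((\<phi> ^^ j) z) ((\<phi> ^^ j) w) \<le> eps S" if "j \<le> k" for j
        using dj[OF that] s ee by (simp add: commute)
    qed
    then show "(\<phi> ^^ k) z \<in> local_unstable S ((\<phi> ^^ k) w) (eps' S / 2)"
      using z dj[of k] s by (simp add: local_unstable_def)
  qed
  define B where "B = {(stable_holonomy S k v z, z) | z. z \<in> local_unstable S w \<eta>}"
  have ls: "(\<phi> ^^ k) w \<in> local_stable S ((\<phi> ^^ k) v) (eps' S / 2)"
    by (rule local_stable_if_forward_close[OF fc]) (use s dvw ee in auto)
  have "0 < \<eta>" "\<eta> \<le> eps S / 2" using \<eta>' ee by (auto simp: \<eta>_def)
  then have "B \<in> stable_generators S Q"
    unfolding stable_generators_def B_def using assms(1)[unfolded a] ls lu(1) by blast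
  moreover have "a \<in> B"
  proof -
    have "br ((\<phi> ^^ k) w) ((\<phi> ^^ k) v) = (\<phi> ^^ k) v"
      by (rule br_eq_if_forward_close[OF forward_close_sym[OF fc]]) (use s ee eps'_pos in linarith)
    then have "stable_holonomy S k v w = v" using vw by (simp add: stable_holonomy_def)
    moreover have "w \<in> local_unstable S w \<eta>" using local_unstable_center[OF vw(5) \<open>0 < \<eta>\<close>] .
    ultimately show ?thesis unfolding B_def a by force
  qed
  moreover have "rectangle S r k a b" if "b \<in> B" for b
  proof -
    obtain z where z: "b = (stable_holonomy S k v z, z)" "z \<in> local_unstable S w \<eta>" using \<open>b \<in> B\<close> unfolding B_def by blast
    have zX: "z \<in> X" using z by (simp add: local_unstable_def)
    have "d ((\<phi> ^^ k) z) ((\<phi> ^^ k) v) \<le> \<gamma>"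
      using triangle[of "(\<phi> ^^ k) z" "(\<phi> ^^ k) w" "(\<phi> ^^ k) v"] zX vw lu(2)[OF z(2)] dvw s
      by (simp add: commute)
    then have f: "forward_close S \<rho> ((\<phi> ^^ k) z) (br ((\<phi> ^^ k) z) ((\<phi> ^^ k) v))"
      "backward_close S \<rho> ((\<phi> ^^ k) v) (br ((\<phi> ^^ k) z) ((\<phi> ^^ k) v))"
      using \<gamma>(2) zX vw by auto
    have bX: "br ((\<phi> ^^ k) z) ((\<phi> ^^ k) v) \<in> X" using f(1) by (rule forward_closeD)
    have "backward_close S (eps' S / 2) ((\<phi> ^^ k) w) ((\<phi> ^^ k) z)"
      using backward_close_if_local_unstable[OF _ lu(1)[OF z(2)], of "eps' S / 2"] lu(2)[OF z(2)] vw s ee by simp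
    then have "backward_close S s ((\<phi> ^^ k) w) ((\<phi> ^^ k) z)"
      using backward_close_shrink[of "eps' S / 2"] backward_close_mono lu(2)[OF z(2)] eps'_pos by fastforce
    then show ?thesis
      unfolding rectangle_def z(1) a
      using f fc s \<rho> bX zX vw
      by (auto simp: stable_holonomy_def intro: forward_close_mono backward_close_mono forward_close_sym)
  qed
  ultimately show ?thesis using k_def by (intro exI[of _ k]) auto
qed

lemma backward_close_earlier:
  assumes "x \<in> X" "y \<in> X" "backward_close S r ((\<phi> ^^ k) x) ((\<phi> ^^ k) y)" "r \<le> eps' S" "j \<le> k"
  shows "backward_close S (r / lam S ^ (k - j)) ((\<phi> ^^ j) x) ((\<phi> ^^ j) y)"
  using backward_close_pow_contract[OF assms(3,4), of "k - j"] hinv_hom_pow[of _ "k - j" k] assms by simp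

text \<open>If \<open>k\<close> is large, contraction of backward orbits makes a rectangle at time \<open>k\<close> thin at the times \<open>0\<close> and \<open>N\<close>. So
  the second coordinate of \<open>b\<close> stays in the disc, and the first one on the local unstable set of \<open>v\<close> at time \<open>N\<close>.
  That it is the bracket required by the holonomy is clear at time \<open>k\<close>, where the coordinates of \<open>b\<close> are
  forward close, and is pulled back to time \<open>N\<close>.\<close>
lemma rectangle_in_generator:
  assumes "B \<in> stable_generators S Q" "a \<in> B" "0 < r" "r \<le> eps' S / 4"
  shows "\<exists>K. \<forall>k\<ge>K. \<forall>b. rectangle S r k a b \<longrightarrow> b \<in> B"
proof -
  obtain v w N \<eta> where B: "B = {(stable_holonomy S N v z, z) | z. z \<in> local_unstable S w \<eta>}"
    "(v, w) \<in> stable_groupoid S Q" "(\<phi> ^^ N) w \<in> local_stable S ((\<phi> ^^ N) v) (eps' S / 2)"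
    "0 < \<eta>" "\<eta> \<le> eps S / 2" "(\<phi> ^^ N) ` local_unstable S w \<eta> \<subseteq> local_unstable S ((\<phi> ^^ N) w) (eps' S / 2)"
    using assms(1) unfolding stable_generators_def by blast
  note vw = stable_groupoidD[OF B(2)]
  obtain w0 where w0: "a = (stable_holonomy S N v w0, w0)" "w0 \<in> local_unstable S w \<eta>" using assms B by auto
  have ee: "eps' S \<le> eps S / 2" "0 < eps S" by (rule eps'_le, rule eps_pos)
  have w0X: "w0 \<in> X" "d w w0 < \<eta>" using w0 by (auto simp: local_unstable_def)
  have "d ((\<phi> ^^ N) v) ((\<phi> ^^ N) w) < eps' S / 2" "d ((\<phi> ^^ N) w) ((\<phi> ^^ N) w0) < eps' S / 2"
    using B w0 by (auto simp: local_stable_def local_unstable_def)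
  then have dwv: "d ((\<phi> ^^ N) w0) ((\<phi> ^^ N) v) \<le> eps' S"
    using triangle[of "(\<phi> ^^ N) w0" "(\<phi> ^^ N) w" "(\<phi> ^^ N) v"] w0X vw by (simp add: commute)
  define \<beta> where "\<beta> = br ((\<phi> ^^ N) w0) ((\<phi> ^^ N) v)"
  have near: "d ((\<phi> ^^ N) w0) \<beta> < eps S / 2" "d ((\<phi> ^^ N) v) \<beta> < eps S / 2"
    using bracket_near[OF _ _ dwv] w0X vw by (auto simp: \<beta>_def)
  then have \<beta>: "\<beta> \<in> X" "\<beta> \<in> local_stable S ((\<phi> ^^ N) w0) (eps S / 2)" "\<beta> \<in> local_unstable S ((\<phi> ^^ N) v) (eps S / 2)"
    using bracket_local[of "(\<phi> ^^ N) w0" "(\<phi> ^^ N) v" "eps S / 2"] w0X vw dwv ee by (auto simp: \<beta>_def)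
  define v0 where "v0 = (\<psi> ^^ N) \<beta>"
  have v0: "v0 \<in> X" "(\<phi> ^^ N) v0 = \<beta>" "a = (v0, w0)" using \<beta> w0 by (auto simp: v0_def \<beta>_def stable_holonomy_def)
  \<comment> \<open>The room left for \<open>w1\<close> in the disc, and for \<open>v1\<close> at time \<open>N\<close> in the range of the bracket.\<close>
  define t where "t = min (\<eta> - d w w0) (eps S / 2 - d ((\<phi> ^^ N) v) \<beta>) / 2"
  have t: "0 < t" "t < \<eta> - d w w0" "t < eps S / 2 - d ((\<phi> ^^ N) v) \<beta>" using w0X near by (auto simp: t_def)
  obtain K where K: "\<And>k. k \<ge> K \<Longrightarrow> r / lam S ^ k \<le> t" using div_lam_pow_small[OF t(1)] by blast
  have r: "r \<le> eps' S" using assms eps'_pos by simp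
  have "b \<in> B" if k: "k \<ge> N + K" and rect: "rectangle S r k a b" for k b
  proof -
    obtain v1 w1 where b: "b = (v1, w1)" by fastforce
    have R: "v1 \<in> X" "w1 \<in> X" "backward_close S r ((\<phi> ^^ k) v0) ((\<phi> ^^ k) v1)"
      "backward_close S r ((\<phi> ^^ k) w0) ((\<phi> ^^ k) w1)" "forward_close S r ((\<phi> ^^ k) v1) ((\<phi> ^^ k) w1)"
      using rect by (auto simp: rectangle_def b v0(3))
    have Dv: "d ((\<phi> ^^ j) v0) ((\<phi> ^^ j) v1) \<le> r / lam S ^ (k - j)" and Dw: "d ((\<phi> ^^ j) w0) ((\<phi> ^^ j) w1) \<le> r / lam S ^ (k - j)"
      if "j \<le> k" for j
      using backward_close_earlier[OF v0(1) R(1,3) r that] backward_close_earlier[OF w0X(1) R(2,4) r that]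
      by (auto dest: backward_closeD(4))
    have le_r: "r / lam S ^ n \<le> r" for n using div_lam_pow_le assms by simp
    have "backward_close S r w0 w1"
      using backward_close_earlier[OF w0X(1) R(2,4) r, of 0] le_r backward_close_mono by fastforce
    then have "w1 \<in> local_unstable S w0 (eps S)"
      using local_unstable_if_backward_close[OF _ r, of w0 w1 "eps S"] backward_closeD(4) r ee by fastforce
    moreover have "d w0 w1 \<le> t" using Dw[of 0] K[of k] k by simp
    then have "d w w1 < \<eta>" using triangle[of w w0 w1] vw w0X R t by simp
    ultimately have w1: "w1 \<in> local_unstable S w \<eta>"
      using local_unstable_trans[OF vw(5) local_unstable_mono[OF w0(2), of "eps S"]] w0X B ee by simp
    have "backward_close S r \<beta> ((\<phi> ^^ N) v1)"
      using backward_close_earlier[OF v0(1) R(1,3) r, of N] le_r backward_close_mono k v0 by fastforce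
    then have "(\<phi> ^^ N) v1 \<in> local_unstable S \<beta> (eps S)"
      using local_unstable_if_backward_close[OF _ r, of \<beta> "(\<phi> ^^ N) v1" "eps S"] backward_closeD(4) r ee by fastforce
    moreover have "d \<beta> ((\<phi> ^^ N) v1) \<le> t" using Dv[of N] K[of "k - N"] k v0 by (simp add: le_diff_conv2)
    then have d1: "d ((\<phi> ^^ N) v) ((\<phi> ^^ N) v1) < eps S / 2"
      using triangle[of "(\<phi> ^^ N) v" \<beta> "(\<phi> ^^ N) v1"] vw \<beta> R t by simp
    ultimately have "(\<phi> ^^ N) v1 \<in> local_unstable S ((\<phi> ^^ N) v) (eps S / 2)"
      using local_unstable_trans[OF _ local_unstable_mono[OF \<beta>(3), of "eps S"], of "(\<phi> ^^ N) v1" "eps S / 2"] near vw ee by simp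
    then have u: "br ((\<phi> ^^ N) v1) ((\<phi> ^^ N) v) = (\<phi> ^^ N) v1" by (simp add: local_unstable_def)
    have dj: "d ((\<phi> ^^ (N + j)) w1) ((\<phi> ^^ (N + j)) v1) \<le> eps S" if "N + j \<le> k" for j
    proof -
      have "d ((\<phi> ^^ (N + j)) w0) ((\<phi> ^^ (N + j)) v0) \<le> eps S / 2"
        using local_stable_iter(2)[OF _ \<beta>(2), of j] div_lam_pow_le[OF nonneg[of "(\<phi> ^^ N) w0" \<beta>], of j] near(1) w0X ee v0
        by (simp add: add.commute[of N] funpow_add)
      moreover have "d ((\<phi> ^^ (N + j)) v0) ((\<phi> ^^ (N + j)) v1) \<le> r" "d ((\<phi> ^^ (N + j)) w0) ((\<phi> ^^ (N + j)) w1) \<le> r"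
        using Dv[OF that] Dw[OF that] le_r order_trans by blast+
      moreover have "d ((\<phi> ^^ (N + j)) w1) ((\<phi> ^^ (N + j)) v1) \<le> d ((\<phi> ^^ (N + j)) w1) ((\<phi> ^^ (N + j)) w0)
          + d ((\<phi> ^^ (N + j)) w0) ((\<phi> ^^ (N + j)) v1)"
        "d ((\<phi> ^^ (N + j)) w0) ((\<phi> ^^ (N + j)) v1) \<le> d ((\<phi> ^^ (N + j)) w0) ((\<phi> ^^ (N + j)) v0)
          + d ((\<phi> ^^ (N + j)) v0) ((\<phi> ^^ (N + j)) v1)"
        by (rule triangle; simp add: R(1,2) v0(1) w0X(1))+
      ultimately show ?thesis
        using assms ee commute[of "(\<phi> ^^ (N + j)) w1" "(\<phi> ^^ (N + j)) w0"] by linarith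
    qed
    have kN: "(\<phi> ^^ (k - N)) ((\<phi> ^^ N) x) = (\<phi> ^^ k) x" for x
      using k funpow_add[of "k - N" N \<phi>] by simp
    have s: "br ((\<phi> ^^ N) w1) ((\<phi> ^^ N) v1) = (\<phi> ^^ N) v1"
    proof (rule br_pull[where m = "k - N"])
      show "d ((\<phi> ^^ j) ((\<phi> ^^ N) w1)) ((\<phi> ^^ j) ((\<phi> ^^ N) v1)) \<le> eps S" if "j \<le> k - N" for j
        using dj[of j] that k by (simp add: add.commute[of N] funpow_add)
      show "br ((\<phi> ^^ (k - N)) ((\<phi> ^^ N) w1)) ((\<phi> ^^ (k - N)) ((\<phi> ^^ N) v1)) = (\<phi> ^^ (k - N)) ((\<phi> ^^ N) v1)"
        unfolding kN by (rule br_eq_if_forward_close[OF forward_close_sym[OF R(5)] r])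
    qed (use R in auto)
    have "br (br ((\<phi> ^^ N) w1) ((\<phi> ^^ N) v1)) ((\<phi> ^^ N) v) = br ((\<phi> ^^ N) w1) ((\<phi> ^^ N) v)"
    proof (rule br_right)
      show "d ((\<phi> ^^ N) w1) ((\<phi> ^^ N) v1) \<le> eps S" using dj[of 0] k by simp
      show "d (br ((\<phi> ^^ N) w1) ((\<phi> ^^ N) v1)) ((\<phi> ^^ N) v) \<le> eps S" using s d1 ee by (simp add: commute)
      have "d ((\<phi> ^^ N) w0) ((\<phi> ^^ N) w1) \<le> r" using Dw[of N] le_r[of "k - N"] k by simp
      then show "d ((\<phi> ^^ N) w1) ((\<phi> ^^ N) v) \<le> eps S"
        using triangle[of "(\<phi> ^^ N) w1" "(\<phi> ^^ N) w0" "(\<phi> ^^ N) v"] dwv R w0X vw assms ee by (simp add: commute)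
    qed (use R vw in auto)
    then have "br ((\<phi> ^^ N) w1) ((\<phi> ^^ N) v) = (\<phi> ^^ N) v1" by (simp only: s u)
    then have "stable_holonomy S N v w1 = v1" using R(1) by (simp add: stable_holonomy_def)
    then show ?thesis unfolding B(1) b using w1 by force
  qed
  then show ?thesis by blast
qed

end

section \<open>The groupoid metric of a self-similar Smale space\<close>

locale self_similar_smale = smale +
  fixes Q :: "'a set"
  assumes self_similar: "self_similar S" and orbit: "periodic_orbit S Q"
begin

abbreviation G where "G \<equiv> stable_groupoid S Q"
abbreviation time where "time \<equiv> stable_time S"

lemma Q_invariant: "Q \<subseteq> X" "finite Q" "Q \<noteq> {}" "\<phi> ` Q \<subseteq> Q" "\<psi> ` Q \<subseteq> Q"
  using orbit_invariant[OF orbit bij_hom] by auto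

lemma hom_pow_lipschitz:
  assumes "x \<in> X" "y \<in> X"
  shows "d ((\<phi> ^^ n) x) ((\<phi> ^^ n) y) \<le> lam S ^ n * d x y"
proof (induction n)
  case (Suc n)
  have "d ((\<phi> ^^ Suc n) x) ((\<phi> ^^ Suc n) y) \<le> lam S * d ((\<phi> ^^ n) x) ((\<phi> ^^ n) y)"
    using self_similar assms by (simp add: self_similar_def)
  also have "\<dots> \<le> lam S * (lam S ^ n * d x y)" using Suc lam_gt1 by (intro mult_left_mono) auto
  finally show ?case by (simp add: mult.assoc)
qed simp

lemma groupoid_cases:
  assumes "a \<in> G"
  shows "fst a \<in> X" "snd a \<in> X" "a \<in> X \<times> X" "snd a \<in> stable_set S (fst a)"
    "fst a \<in> unstable_of S Q" "snd a \<in> unstable_of S Q"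
  using stable_groupoidD[of "fst a" "snd a" Q] assms by (auto simp: mem_Times_iff)

lemma time_local_stable:
  assumes "a \<in> G" "time a \<le> j"
  shows "(\<phi> ^^ j) (snd a) \<in> local_stable S ((\<phi> ^^ j) (fst a)) (eps' S / 2)"
proof -
  note a = groupoid_cases[OF assms(1)]
  obtain N where N: "\<And>k. k \<ge> N \<Longrightarrow> forward_close S (eps' S / 4) ((\<phi> ^^ k) (fst a)) ((\<phi> ^^ k) (snd a))"
    using stable_set_eventually[OF a(1,4), of "eps' S / 4"] eps'_pos by auto
  have "(\<phi> ^^ N) (snd a) \<in> local_stable S ((\<phi> ^^ N) (fst a)) (eps' S / 2)"
    using local_stable_if_forward_close[OF N[OF order_refl], of "eps' S / 2"] forward_closeD(4)[OF N[OF order_refl]] eps'_pos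
    by simp
  then have l: "(\<phi> ^^ time a) (snd a) \<in> local_stable S ((\<phi> ^^ time a) (fst a)) (eps' S / 2)"
    unfolding stable_time_def by (rule LeastI)
  have "(\<phi> ^^ (j - time a)) ((\<phi> ^^ time a) x) = (\<phi> ^^ j) x" for x
    using assms(2) funpow_add[of "j - time a" "time a" \<phi>] by simp
  then show ?thesis
    using local_stable_iter(1)[OF _ l, of "j - time a"] a eps'_le eps_pos eps'_pos by simp
qed

lemma time_dist:
  assumes "a \<in> G" "time a \<le> j"
  shows "d ((\<phi> ^^ j) (fst a)) ((\<phi> ^^ j) (snd a)) < eps' S / 2"
  using time_local_stable[OF assms] by (simp add: local_stable_def)

lemma time_le:
  assumes "a \<in> G" "forward_close S r ((\<phi> ^^ j) (fst a)) ((\<phi> ^^ j) (snd a))" "r < eps' S / 2"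
  shows "time a \<le> j"
  unfolding stable_time_def
  using local_stable_if_forward_close[OF assms(2), of "eps' S / 2"] forward_closeD(4)[OF assms(2)] assms(3) eps'_pos
  by (intro Least_le) simp

text \<open>The members of the covers, with the exponent as an independent parameter.\<close>
definition V :: "'a \<times> 'a \<Rightarrow> nat \<Rightarrow> ('a \<times> 'a) set" where
  "V a m = {(stable_holonomy S m (fst a) z, z) | z. z \<in> local_unstable S (snd a) (inverse (lam S) ^ m * eps' S / 4)}"

text \<open>The number of additional iterations per level of the covers, enough to contract by the factor \<open>3\<close>.\<close>
definition L where "L = nat \<lceil>log (lam S) 3\<rceil>"

lemma L_pos: "0 < L"
proof -
  have "0 < log (lam S) 3" using lam_gt1 by simp
  then show ?thesis by (simp add: L_def)
qed

lemma three_le_lam_pow: "L \<le> i \<Longrightarrow> 3 \<le> lam S ^ i"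
proof -
  assume i: "L \<le> i"
  have "log (lam S) 3 \<le> real L" unfolding L_def by linarith
  then have "3 \<le> lam S powr real L" using lam_gt1 by (simp add: log_le_iff)
  also have "\<dots> = lam S ^ L" using lam_gt1 by (simp add: powr_realpow)
  also have "\<dots> \<le> lam S ^ i" using lam_gt1 i by (intro power_increasing) auto
  finally show ?thesis .
qed

text \<open>The exponent of the neighbourhood of \<open>a\<close> in the cover of index \<open>n + 1\<close>. The shift by one is that of
  \<open>level\<close>, whose first two values are exceptional.\<close>
definition depth :: "'a \<times> 'a \<Rightarrow> nat \<Rightarrow> nat" where
  "depth a n = max (time a) 1 + n * L"

lemma time_le_depth: "time a \<le> depth a n"
  by (simp add: depth_def)

lemma depth_Suc: "depth a (Suc n) = depth a n + L"
  by (simp add: depth_def)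

lemma nbhd_eq: "stable_nbhd S (level (lam S) time a (Suc n)) a = V a (depth a n)"
proof -
  have "max (time a) (level (lam S) time a (Suc n)) = depth a n"
    by (cases n) (auto simp: depth_def L_def)
  then show ?thesis by (simp add: stable_nbhd_def V_def Let_def)
qed

lemma covers_Suc: "covers G (lam S) time (stable_nbhd S) (Suc n) = {V a (depth a n) | a. a \<in> G}"
  by (simp add: covers_def nbhd_eq del: level.simps)

lemma small_le: "inverse (lam S) ^ m * eps' S / 4 \<le> eps' S / 4"
  using lam_gt1 eps'_pos by (simp add: field_simps one_le_power)

text \<open>Self-similarity bounds the expansion in \<open>m\<close> steps by \<open>\<lambda>\<^sup>m\<close>, so the disc of radius \<open>\<lambda>\<^sup>-\<^sup>m \<epsilon>'/4\<close> has radius at most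
  \<open>\<epsilon>'/4\<close> up to time \<open>m\<close>. Therefore the bracket at time \<open>m\<close> is defined and its backward orbit stays in local
  stable and unstable sets down to the entry time.\<close>
lemma V_facts:
  assumes "a \<in> G" "b \<in> V a m" "time a \<le> m"
  shows "fst b \<in> X" "snd b \<in> X" "snd b \<in> local_unstable S (snd a) (inverse (lam S) ^ m * eps' S / 4)"
    and "j \<le> m \<Longrightarrow> d ((\<phi> ^^ j) (snd a)) ((\<phi> ^^ j) (snd b)) < (eps' S / 4) / lam S ^ (m - j)"
    and "j \<le> m \<Longrightarrow> (\<phi> ^^ j) (snd b) \<in> local_unstable S ((\<phi> ^^ j) (snd a)) (eps' S / 4)"
    and "time a \<le> j \<Longrightarrow> j \<le> m \<Longrightarrow> (\<phi> ^^ j) (fst b) \<in> local_stable S ((\<phi> ^^ j) (snd b)) (eps S / 2)"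
    and "time a \<le> j \<Longrightarrow> j \<le> m \<Longrightarrow> (\<phi> ^^ j) (fst b) \<in> local_unstable S ((\<phi> ^^ j) (fst a)) (eps S / 2)"
proof -
  note aX = groupoid_cases[OF assms(1)]
  have ee: "eps' S \<le> eps S / 2" "0 < eps S" "0 < eps' S" by (rule eps'_le, rule eps_pos, rule eps'_pos)
  obtain z where z: "b = (stable_holonomy S m (fst a) z, z)" "z \<in> local_unstable S (snd a) (inverse (lam S) ^ m * eps' S / 4)"
    using assms(2) by (auto simp: V_def)
  have zX: "z \<in> X" "br z (snd a) = z" and dz: "d (snd a) z < inverse (lam S) ^ m * eps' S / 4"
    using z by (auto simp: local_unstable_def)
  show "snd b \<in> X" "snd b \<in> local_unstable S (snd a) (inverse (lam S) ^ m * eps' S / 4)" using z zX by auto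
  have dj: "d ((\<phi> ^^ j) (snd a)) ((\<phi> ^^ j) z) < (eps' S / 4) / lam S ^ (m - j)" if "j \<le> m" for j
  proof -
    have "d ((\<phi> ^^ j) (snd a)) ((\<phi> ^^ j) z) \<le> lam S ^ j * d (snd a) z" by (rule hom_pow_lipschitz[OF aX(2) zX(1)])
    also have "\<dots> < lam S ^ j * (inverse (lam S) ^ m * eps' S / 4)"
      using dz lam_gt1 by (intro mult_strict_left_mono) auto
    also have "lam S ^ j * (inverse (lam S) ^ m * eps' S / 4) = (eps' S / 4) / lam S ^ (m - j)"
    proof -
      have "lam S ^ m = lam S ^ j * lam S ^ (m - j)" using that by (simp flip: power_add)
      moreover have "0 < lam S ^ j" "0 < lam S ^ (m - j)" using lam_gt1 by auto
      ultimately show ?thesis using lam_gt1 by (simp add: field_simps)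
    qed
    finally show ?thesis .
  qed
  then show "j \<le> m \<Longrightarrow> d ((\<phi> ^^ j) (snd a)) ((\<phi> ^^ j) (snd b)) < (eps' S / 4) / lam S ^ (m - j)" using z by simp
  have dj': "d ((\<phi> ^^ j) (snd a)) ((\<phi> ^^ j) z) < eps' S / 4" if "j \<le> m" for j
    using dj[OF that] div_lam_pow_le[of "eps' S / 4" "m - j"] ee by simp
  have "(\<phi> ^^ j) z \<in> local_unstable S ((\<phi> ^^ j) (snd a)) (eps' S / 4)" if "j \<le> m" for j
  proof -
    have "(\<phi> ^^ j) (br z (snd a)) = br ((\<phi> ^^ j) z) ((\<phi> ^^ j) (snd a))"
    proof (rule br_hom_pow[OF zX(1) aX(2)])
      show "d ((\<phi> ^^ i) z) ((\<phi> ^^ i) (snd a)) \<le> eps S" if "i \<le> j" for i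
        using dj'[of i] that \<open>j \<le> m\<close> ee commute[of "(\<phi> ^^ i) z"] by simp
    qed
    then show ?thesis using zX dj'[OF that] by (simp add: local_unstable_def)
  qed
  then show "j \<le> m \<Longrightarrow> (\<phi> ^^ j) (snd b) \<in> local_unstable S ((\<phi> ^^ j) (snd a)) (eps' S / 4)" using z by simp
  have dza: "d ((\<phi> ^^ j) z) ((\<phi> ^^ j) (fst a)) \<le> eps' S" if "time a \<le> j" "j \<le> m" for j
    using triangle[of "(\<phi> ^^ j) z" "(\<phi> ^^ j) (snd a)" "(\<phi> ^^ j) (fst a)"] dj'[OF that(2)] time_dist[OF assms(1) that(1)]
      zX aX ee commute[of "(\<phi> ^^ j) z" "(\<phi> ^^ j) (snd a)"] commute[of "(\<phi> ^^ j) (snd a)" "(\<phi> ^^ j) (fst a)"] by simp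
  have B: "br ((\<phi> ^^ j) z) ((\<phi> ^^ j) (fst a)) \<in> X"
    "br ((\<phi> ^^ j) z) ((\<phi> ^^ j) (fst a)) \<in> local_stable S ((\<phi> ^^ j) z) (eps S / 2)"
    "br ((\<phi> ^^ j) z) ((\<phi> ^^ j) (fst a)) \<in> local_unstable S ((\<phi> ^^ j) (fst a)) (eps S / 2)"
    if "time a \<le> j" "j \<le> m" for j
    using bracket_local[of "(\<phi> ^^ j) z" "(\<phi> ^^ j) (fst a)" "eps S / 2"] bracket_near[OF _ _ dza[OF that]]
      dza[OF that] zX aX ee by auto
  have fb: "fst b = (\<psi> ^^ m) (br ((\<phi> ^^ m) z) ((\<phi> ^^ m) (fst a)))" using z by (simp add: stable_holonomy_def)
  show fX: "fst b \<in> X" using B(1)[OF assms(3) order_refl] fb by simp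
  have eq: "(\<phi> ^^ j) (fst b) = br ((\<phi> ^^ j) z) ((\<phi> ^^ j) (fst a))" if j: "time a \<le> j" "j \<le> m" for j
  proof (rule br_pull[symmetric, where m = "m - j"])
    have mj: "(\<phi> ^^ (m - j)) ((\<phi> ^^ j) x) = (\<phi> ^^ m) x" for x
      using j funpow_add[of "m - j" j \<phi>] by simp
    show "br ((\<phi> ^^ (m - j)) ((\<phi> ^^ j) z)) ((\<phi> ^^ (m - j)) ((\<phi> ^^ j) (fst a))) = (\<phi> ^^ (m - j)) ((\<phi> ^^ j) (fst b))"
      unfolding mj using fb B(1)[OF assms(3) order_refl] by simp
    show "d ((\<phi> ^^ i) ((\<phi> ^^ j) z)) ((\<phi> ^^ i) ((\<phi> ^^ j) (fst a))) \<le> eps S" if "i \<le> m - j" for i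
      using dza[of "i + j"] j that ee le_diff_conv2[OF j(2), of i] by (simp add: funpow_add)
  qed (use zX aX fX in auto)
  show "time a \<le> j \<Longrightarrow> j \<le> m \<Longrightarrow> (\<phi> ^^ j) (fst b) \<in> local_stable S ((\<phi> ^^ j) (snd b)) (eps S / 2)"
    "time a \<le> j \<Longrightarrow> j \<le> m \<Longrightarrow> (\<phi> ^^ j) (fst b) \<in> local_unstable S ((\<phi> ^^ j) (fst a)) (eps S / 2)"
    using B eq z by auto
qed

lemma V_intro:
  assumes "a \<in> G" "time a \<le> m" "fst b \<in> X" "snd b \<in> local_unstable S (snd a) (inverse (lam S) ^ m * eps' S / 4)"
    "(\<phi> ^^ m) (fst b) \<in> local_unstable S ((\<phi> ^^ m) (fst a)) (eps S)"
    "(\<phi> ^^ m) (fst b) \<in> local_stable S ((\<phi> ^^ m) (snd b)) (eps S)"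
  shows "b \<in> V a m"
proof -
  note aX = groupoid_cases[OF assms(1)]
  have ee: "eps' S \<le> eps S / 2" "0 < eps S" "0 < eps' S" by (rule eps'_le, rule eps_pos, rule eps'_pos)
  have bX: "snd b \<in> X" "d (snd a) (snd b) < inverse (lam S) ^ m * eps' S / 4" using assms(4) by (auto simp: local_unstable_def)
  have "d ((\<phi> ^^ m) (snd a)) ((\<phi> ^^ m) (snd b)) \<le> lam S ^ m * d (snd a) (snd b)" by (rule hom_pow_lipschitz[OF aX(2) bX(1)])
  also have "\<dots> \<le> lam S ^ m * (inverse (lam S) ^ m * eps' S / 4)"
    using bX lam_gt1 by (intro mult_left_mono) auto
  also have "\<dots> = eps' S / 4" using lam_gt1 by (simp add: power_inverse)
  finally have "d ((\<phi> ^^ m) (snd b)) ((\<phi> ^^ m) (fst a)) \<le> eps S"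
    using triangle[of "(\<phi> ^^ m) (snd b)" "(\<phi> ^^ m) (snd a)" "(\<phi> ^^ m) (fst a)"] time_dist[OF assms(1,2)] bX aX ee
      commute[of "(\<phi> ^^ m) (snd b)" "(\<phi> ^^ m) (snd a)"] commute[of "(\<phi> ^^ m) (snd a)" "(\<phi> ^^ m) (fst a)"] by simp
  then have "br (br ((\<phi> ^^ m) (snd b)) ((\<phi> ^^ m) (fst b))) ((\<phi> ^^ m) (fst a)) = br ((\<phi> ^^ m) (snd b)) ((\<phi> ^^ m) (fst a))"
    using assms bX aX by (intro br_right) (auto simp: local_stable_def local_unstable_def commute)
  then have "br ((\<phi> ^^ m) (snd b)) ((\<phi> ^^ m) (fst a)) = (\<phi> ^^ m) (fst b)"
    using assms by (simp add: local_stable_def local_unstable_def)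
  then have "b = (stable_holonomy S m (fst a) (snd b), snd b)"
    using assms(3) by (simp add: stable_holonomy_def prod_eq_iff)
  then show ?thesis unfolding V_def using assms(4) by blast
qed

lemma V_self:
  assumes "a \<in> G" "time a \<le> m" shows "a \<in> V a m"
proof (rule V_intro[OF assms])
  note aX = groupoid_cases[OF assms(1)]
  show "fst a \<in> X" by (rule aX)
  have "0 < inverse (lam S) ^ m * eps' S / 4" using lam_gt1 eps'_pos by simp
  then show "snd a \<in> local_unstable S (snd a) (inverse (lam S) ^ m * eps' S / 4)"
    by (rule local_unstable_center[OF aX(2)])
  show "(\<phi> ^^ m) (fst a) \<in> local_unstable S ((\<phi> ^^ m) (fst a)) (eps S)"
    using local_unstable_center aX eps_pos by simp
  have "(\<phi> ^^ m) (fst a) \<in> local_stable S ((\<phi> ^^ m) (snd a)) (eps' S / 2)"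
    using local_stable_sym[OF _ time_local_stable[OF assms]] aX eps'_le eps'_pos by simp
  then show "(\<phi> ^^ m) (fst a) \<in> local_stable S ((\<phi> ^^ m) (snd a)) (eps S)"
    using eps'_le eps'_pos by (auto simp: local_stable_def)
qed

lemma V_coarser_self:
  assumes "x \<in> G" "b \<in> V x (depth x (Suc n))"
  shows "b \<in> V x (depth x n)"
proof (rule V_intro[OF assms(1) time_le_depth])
  have le: "depth x n \<le> depth x (Suc n)" "time x \<le> depth x (Suc n)" by (auto simp: depth_Suc intro: trans_le_add1[OF time_le_depth])
  note b = V_facts[OF assms le(2)]
  show "fst b \<in> X" by (rule b)
  have "inverse (lam S) ^ depth x (Suc n) * eps' S / 4 \<le> inverse (lam S) ^ depth x n * eps' S / 4"
    using lam_gt1 eps'_pos le(1) by (intro divide_right_mono mult_right_mono power_decreasing) (auto simp: field_simps)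
  then show "snd b \<in> local_unstable S (snd x) (inverse (lam S) ^ depth x n * eps' S / 4)"
    using b(3) by (auto simp: local_unstable_def)
  show "(\<phi> ^^ depth x n) (fst b) \<in> local_unstable S ((\<phi> ^^ depth x n) (fst x)) (eps S)"
    "(\<phi> ^^ depth x n) (fst b) \<in> local_stable S ((\<phi> ^^ depth x n) (snd b)) (eps S)"
    using b(6,7)[OF time_le_depth le(1)] eps_pos by (auto simp: local_unstable_def local_stable_def)
qed

text \<open>If the neighbourhoods of \<open>x\<close> and \<open>y\<close> meet, the deeper one is contained in the neighbourhood of \<open>x\<close> one level up,
  because one level contracts by the factor \<open>3\<close>. For the first coordinates one needs that the bracket relation can be
  transported from the depth of \<open>y\<close> to that of \<open>x\<close>: after the entry time of \<open>y\<close> the coordinates of \<open>b\<close>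
  are close by \<open>V_facts\<close>, and before it they are close to those of \<open>c\<close>,
  which are close to each other.\<close>
lemma V_coarser:
  assumes "x \<in> G" "y \<in> G" "c \<in> V x (depth x (Suc n))" "c \<in> V y (depth y (Suc n))" "b \<in> V y (depth y (Suc n))"
    and le: "depth x (Suc n) \<le> depth y (Suc n)"
  shows "b \<in> V x (depth x n)"
proof -
  define m where "m = depth x n"
  define kx where "kx = depth x (Suc n)"
  define ky where "ky = depth y (Suc n)"
  have k: "kx = m + L" "kx \<le> ky" "time x \<le> m" "time y + L \<le> ky"
    using le time_le_depth by (auto simp: m_def kx_def ky_def depth_Suc)
  have ee: "eps' S \<le> eps S / 2" "0 < eps S" "0 < eps' S" by (rule eps'_le, rule eps_pos, rule eps'_pos)
  have tx: "time x \<le> kx" and ty: "time y \<le> ky" using k by auto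
  note cx = V_facts[OF assms(1,3)[folded kx_def] tx] and cy = V_facts[OF assms(2,4)[folded ky_def] ty]
    and b = V_facts[OF assms(2,5)[folded ky_def] ty]
  note xX = groupoid_cases[OF assms(1)] and yX = groupoid_cases[OF assms(2)]
  have third: "t / lam S ^ i \<le> t / 3" if "0 \<le> t" "L \<le> i" for t i
    using three_le_lam_pow[OF that(2)] that(1) by (intro divide_left_mono) auto
  \<comment> \<open>Second coordinates: three discs of radius \<open>?s kx\<close> fit into one of radius \<open>?s m\<close>.\<close>
  let ?s = "\<lambda>i. inverse (lam S) ^ i * eps' S / 4"
  have sxy: "?s ky \<le> ?s kx"
    using lam_gt1 eps'_pos k by (intro divide_right_mono mult_right_mono power_decreasing) (auto simp: field_simps)
  have small: "?s i \<le> eps S / 8" for i using small_le[of i] ee by linarith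
  have "?s kx = ?s m / lam S ^ L" using k lam_gt1 by (simp add: power_add field_simps)
  then have s3: "3 * ?s kx \<le> ?s m" using third[of "?s m" L] lam_gt1 ee by simp
  have dist: "d (snd x) (snd c) < ?s kx" "d (snd y) (snd c) < ?s kx" "d (snd y) (snd b) < ?s kx"
    using cx(3) cy(3) b(3) sxy by (auto simp: local_unstable_def)
  have dcb: "d (snd c) (snd b) < 2 * ?s kx"
    using triangle[OF cy(2) yX(2) b(2)] dist commute[of "snd c" "snd y"] by linarith
  have "?s ky \<le> eps S" using small[of ky] ee by linarith
  then have "snd y \<in> local_unstable S (snd c) (?s ky)" by (rule local_unstable_sym[OF yX(2) cy(3)])
  then have yc: "snd y \<in> local_unstable S (snd c) (eps S)"
    by (rule local_unstable_mono) (use dist(2) small[of kx] ee commute[of "snd c" "snd y"] in linarith)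
  have "d (snd y) (snd b) < eps S" "d (snd x) (snd c) < eps S" "d (snd c) (snd b) < eps S"
    using dist dcb small[of kx] ee by linarith+
  then have by': "snd b \<in> local_unstable S (snd y) (eps S)" and cx': "snd c \<in> local_unstable S (snd x) (eps S)"
    and bc': "d (snd c) (snd b) < eps S"
    using local_unstable_mono[OF b(3)] local_unstable_mono[OF cx(3)] by blast+
  have "snd b \<in> local_unstable S (snd c) (eps S)"
    by (rule local_unstable_trans[OF cy(2) yc by' bc' order_refl])
  moreover have "d (snd x) (snd b) < ?s m"
    using triangle[OF xX(2) cx(2) b(2)] dist dcb s3 by linarith
  ultimately have S1: "snd b \<in> local_unstable S (snd x) (?s m)"
    using local_unstable_trans[OF xX(2) cx', of "snd b" "?s m"] small[of m] ee by linarith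
  \<comment> \<open>First coordinates: the bracket relation holds at time \<open>ky\<close> and has to be brought back to time \<open>m\<close>.\<close>
  have pow: "(\<psi> ^^ (n - j)) ((\<phi> ^^ n) p) = (\<phi> ^^ j) p" if "j \<le> n" "p \<in> X" for n j p
    using hinv_hom_pow[of p "n - j" n] that by simp
  have half: "q \<in> local_unstable S p (eps S)" if "p \<in> X" "r \<in> X" "p \<in> local_unstable S r (eps S / 2)" "q \<in> local_unstable S r (eps S / 2)" for p q r
  proof (rule local_unstable_trans[OF that(1)])
    show "r \<in> local_unstable S p (eps S)" "q \<in> local_unstable S r (eps S)"
      using local_unstable_sym[OF that(2,3)] that(4) ee by (auto simp: local_unstable_def)
    show "d p q < eps S"
      using triangle[OF that(1,2), of q] that(3,4) commute[of p r] by (auto simp: local_unstable_def)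
  qed simp
  have bc: "(\<phi> ^^ ky) (fst b) \<in> local_unstable S ((\<phi> ^^ ky) (fst c)) (eps S)"
    using half[OF _ _ cy(7)[OF ty order_refl] b(7)[OF ty order_refl]] cy(1) yX(1) by simp
  have bcj: "(\<phi> ^^ j) (fst b) \<in> local_unstable S ((\<phi> ^^ j) (fst c)) (eps S)"
    "d ((\<phi> ^^ j) (fst c)) ((\<phi> ^^ j) (fst b)) \<le> eps S / lam S ^ (ky - j)" if "j \<le> ky" for j
  proof -
    have i: "(\<psi> ^^ (ky - j)) ((\<phi> ^^ ky) (fst b)) \<in> local_unstable S ((\<psi> ^^ (ky - j)) ((\<phi> ^^ ky) (fst c))) (eps S)"
      "d ((\<psi> ^^ (ky - j)) ((\<phi> ^^ ky) (fst c))) ((\<psi> ^^ (ky - j)) ((\<phi> ^^ ky) (fst b))) \<le> d ((\<phi> ^^ ky) (fst c)) ((\<phi> ^^ ky) (fst b)) / lam S ^ (ky - j)"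
      using local_unstable_iter[OF _ bc, of "ky - j"] cy(1) by auto
    then show "(\<phi> ^^ j) (fst b) \<in> local_unstable S ((\<phi> ^^ j) (fst c)) (eps S)" using pow[OF that] cy(1) b(1) by simp
    have "d ((\<phi> ^^ ky) (fst c)) ((\<phi> ^^ ky) (fst b)) / lam S ^ (ky - j) \<le> eps S / lam S ^ (ky - j)"
      using bc lam_gt1 by (intro divide_right_mono) (auto simp: local_unstable_def)
    then show "d ((\<phi> ^^ j) (fst c)) ((\<phi> ^^ j) (fst b)) \<le> eps S / lam S ^ (ky - j)"
      using i(2) pow[OF that] cy(1) b(1) by simp
  qed
  have cxm: "(\<phi> ^^ m) (fst c) \<in> local_unstable S ((\<phi> ^^ m) (fst x)) (eps S / 2)" using cx(7)[of m] k by simp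
  have U1: "(\<phi> ^^ m) (fst b) \<in> local_unstable S ((\<phi> ^^ m) (fst x)) (eps S)"
  proof (rule local_unstable_trans[OF _ _ bcj(1)])
    show "(\<phi> ^^ m) (fst c) \<in> local_unstable S ((\<phi> ^^ m) (fst x)) (eps S)"
      using cxm ee by (auto simp: local_unstable_def)
    have Lm: "L \<le> ky - m" "m \<le> ky" using k by linarith+
    have "d ((\<phi> ^^ m) (fst c)) ((\<phi> ^^ m) (fst b)) \<le> eps S / 3"
      using bcj(2)[OF Lm(2)] third[OF less_imp_le[OF ee(2)] Lm(1)] by linarith
    then show "d ((\<phi> ^^ m) (fst x)) ((\<phi> ^^ m) (fst b)) < eps S"
      using triangle[of "(\<phi> ^^ m) (fst x)" "(\<phi> ^^ m) (fst c)" "(\<phi> ^^ m) (fst b)"] cxm xX cx(1) b(1) ee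
      by (simp add: local_unstable_def)
  qed (use xX k in auto)
  have close: "d ((\<phi> ^^ j) (snd b)) ((\<phi> ^^ j) (fst b)) < eps S" if j: "m \<le> j" "j \<le> ky" for j
  proof (cases "time y \<le> j")
    case True
    then show ?thesis using b(6)[OF True j(2)] ee by (auto simp: local_stable_def)
  next
    case False
    then have jL: "L \<le> ky - j" using k(4) by linarith
    have 1: "d ((\<phi> ^^ j) (fst c)) ((\<phi> ^^ j) (fst b)) \<le> eps S / 3"
      using bcj(2)[OF j(2)] third[OF less_imp_le[OF ee(2)] jL] by linarith
    have 2: "d ((\<phi> ^^ j) (snd c)) ((\<phi> ^^ j) (fst c)) \<le> eps S / 2"
    proof (cases "j \<le> kx")
      case True
      then show ?thesis using cx(6)[of j] j k by (auto simp: local_stable_def)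
    next
      case False
      have "(\<phi> ^^ (j - kx)) ((\<phi> ^^ kx) p) = (\<phi> ^^ j) p" for p
        using False funpow_add[of "j - kx" kx \<phi>] by simp
      then have "(\<phi> ^^ j) (fst c) \<in> local_stable S ((\<phi> ^^ j) (snd c)) (eps S / 2)"
        using local_stable_iter(1)[OF _ cx(6)[OF tx order_refl], of "j - kx"] cx(2) ee by simp
      then show ?thesis by (auto simp: local_stable_def)
    qed
    have 3: "d ((\<phi> ^^ j) (snd y)) ((\<phi> ^^ j) (snd c)) \<le> eps' S / 12" "d ((\<phi> ^^ j) (snd y)) ((\<phi> ^^ j) (snd b)) \<le> eps' S / 12"
    proof -
      have "(eps' S / 4) / lam S ^ (ky - j) \<le> eps' S / 12" using third[OF _ jL, of "eps' S / 4"] ee by linarith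
      then show "d ((\<phi> ^^ j) (snd y)) ((\<phi> ^^ j) (snd c)) \<le> eps' S / 12" "d ((\<phi> ^^ j) (snd y)) ((\<phi> ^^ j) (snd b)) \<le> eps' S / 12"
        using cy(4)[OF j(2)] b(4)[OF j(2)] by linarith+
    qed
    have "d ((\<phi> ^^ j) (snd b)) ((\<phi> ^^ j) (fst b)) \<le> d ((\<phi> ^^ j) (snd b)) ((\<phi> ^^ j) (snd y)) + d ((\<phi> ^^ j) (snd y)) ((\<phi> ^^ j) (fst b))"
      "d ((\<phi> ^^ j) (snd y)) ((\<phi> ^^ j) (fst b)) \<le> d ((\<phi> ^^ j) (snd y)) ((\<phi> ^^ j) (snd c)) + d ((\<phi> ^^ j) (snd c)) ((\<phi> ^^ j) (fst b))"
      "d ((\<phi> ^^ j) (snd c)) ((\<phi> ^^ j) (fst b)) \<le> d ((\<phi> ^^ j) (snd c)) ((\<phi> ^^ j) (fst c)) + d ((\<phi> ^^ j) (fst c)) ((\<phi> ^^ j) (fst b))"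
      by (rule triangle; simp add: b(1,2) cy(1,2) yX(2))+
    then show ?thesis
      using 1 2 3 ee commute[of "(\<phi> ^^ j) (snd b)" "(\<phi> ^^ j) (snd y)"] by linarith
  qed
  have mk: "m \<le> ky" using k by simp
  have "br ((\<phi> ^^ m) (snd b)) ((\<phi> ^^ m) (fst b)) = (\<phi> ^^ m) (fst b)"
  proof (rule br_pull[where m = "ky - m"])
    have eq: "(\<phi> ^^ (ky - m)) ((\<phi> ^^ m) p) = (\<phi> ^^ ky) p" for p
      using mk funpow_add[of "ky - m" m \<phi>] by simp
    show "br ((\<phi> ^^ (ky - m)) ((\<phi> ^^ m) (snd b))) ((\<phi> ^^ (ky - m)) ((\<phi> ^^ m) (fst b))) = (\<phi> ^^ (ky - m)) ((\<phi> ^^ m) (fst b))"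
      unfolding eq using b(6)[OF ty order_refl] by (simp add: local_stable_def)
    show "d ((\<phi> ^^ i) ((\<phi> ^^ m) (snd b))) ((\<phi> ^^ i) ((\<phi> ^^ m) (fst b))) \<le> eps S" if "i \<le> ky - m" for i
      using close[of "i + m"] that mk le_diff_conv2[OF mk, of i] by (simp add: funpow_add)
  qed (use b in auto)
  then have S2: "(\<phi> ^^ m) (fst b) \<in> local_stable S ((\<phi> ^^ m) (snd b)) (eps S)"
    using b close[of m] mk by (simp add: local_stable_def)
  show ?thesis unfolding m_def[symmetric] by (rule V_intro[OF assms(1) k(3) b(1) S1 U1 S2])
qed

definition R where "R n a b \<longleftrightarrow> (\<exists>U\<in>covers G (lam S) time (stable_nbhd S) n. a \<in> U \<and> b \<in> U)"

lemma R_Suc: "R (Suc n) a b \<longleftrightarrow> (\<exists>x\<in>G. a \<in> V x (depth x n) \<and> b \<in> V x (depth x n))"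
  unfolding R_def covers_Suc by blast

lemma R_refine:
  assumes "a \<in> G" "b \<in> G" "c \<in> G" "R (Suc n) a b" "R (Suc n) b c"
  shows "R n a c"
proof (cases n)
  case 0
  then show ?thesis using assms by (simp add: R_def covers_def)
next
  case (Suc n')
  obtain x y where x: "x \<in> G" "a \<in> V x (depth x (Suc n'))" "b \<in> V x (depth x (Suc n'))"
    and y: "y \<in> G" "b \<in> V y (depth y (Suc n'))" "c \<in> V y (depth y (Suc n'))"
    using assms(4,5) unfolding Suc R_Suc by blast
  show ?thesis
  proof (cases "depth x (Suc n') \<le> depth y (Suc n')")
    case True
    then show ?thesis unfolding Suc R_Suc
      using V_coarser_self[OF x(1,2)] V_coarser[OF x(1) y(1) x(3) y(2,3) True] x(1) by blast
  next
    case False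
    then have "depth y (Suc n') \<le> depth x (Suc n')" by simp
    then show ?thesis unfolding Suc R_Suc
      using V_coarser_self[OF y(1,3)] V_coarser[OF y(1) x(1) y(2) x(3,2)] y(1) by blast
  qed
qed

text \<open>Two members of a neighbourhood of depth \<open>m\<close> lie on common unstable sets of size \<open>eps S\<close> at time \<open>m\<close>, hence of
  size \<open>r / 3\<close> at time \<open>m - K\<close>, for \<open>K\<close> depending on \<open>r\<close> only. The fourth side of the rectangle is bounded by
  the sum of the other three.\<close>
lemma R_imp_rectangle:
  assumes "0 < r" "r \<le> eps' S"
  shows "\<exists>K. \<forall>n a b k0. a \<in> G \<longrightarrow> R (Suc n) a b \<longrightarrow>
     forward_close S (r / 3) ((\<phi> ^^ k0) (fst a)) ((\<phi> ^^ k0) (snd a)) \<longrightarrow> k0 + K \<le> n * L \<longrightarrow>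
     (\<exists>t. n * L \<le> t + K \<and> k0 \<le> t \<and> rectangle S r t a b)"
proof -
  obtain K where "\<And>k. k \<ge> K \<Longrightarrow> eps S / lam S ^ k \<le> r / 3"
    using div_lam_pow_small[of "r / 3" "eps S"] assms by auto
  then have K: "eps S / lam S ^ K \<le> r / 3" by simp
  have ee: "eps' S \<le> eps S / 2" "0 < eps S" "0 < eps' S" by (rule eps'_le, rule eps_pos, rule eps'_pos)
  have "\<exists>t. n * L \<le> t + K \<and> k0 \<le> t \<and> rectangle S r t a b"
    if a: "a \<in> G" and R: "R (Suc n) a b" and fc: "forward_close S (r / 3) ((\<phi> ^^ k0) (fst a)) ((\<phi> ^^ k0) (snd a))"
      and kK: "k0 + K \<le> n * L" for n a b k0
  proof -
    obtain x where x: "x \<in> G" "a \<in> V x (depth x n)" "b \<in> V x (depth x n)" using R R_Suc by blast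
    define m where "m = depth x n"
    define t where "t = m - K"
    have t: "n * L \<le> t + K" "k0 \<le> t" "time x \<le> t" "t \<le> m" "m - t = K" "time x \<le> m"
      using kK by (auto simp: t_def m_def depth_def)
    note av = V_facts[OF x(1,2)[folded m_def] t(6)] and bv = V_facts[OF x(1,3)[folded m_def] t(6)]
    note xX = groupoid_cases[OF x(1)]
    have half: "q \<in> local_unstable S p (eps S)" if "p \<in> X" "u \<in> X" "p \<in> local_unstable S u (eps S / 2)" "q \<in> local_unstable S u (eps S / 2)" for p q u
    proof (rule local_unstable_trans[OF that(1)])
      show "u \<in> local_unstable S p (eps S)" "q \<in> local_unstable S u (eps S)"
        using local_unstable_sym[OF that(2,3)] that(4) ee by (auto simp: local_unstable_def)
      show "d p q < eps S"
        using triangle[OF that(1,2), of q] that(3,4) commute[of p u] by (auto simp: local_unstable_def)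
    qed simp
    have bwd: "backward_close S (r / 3) ((\<phi> ^^ t) p) ((\<phi> ^^ t) q)"
      if "p \<in> X" "q \<in> X" "(\<phi> ^^ m) q \<in> local_unstable S ((\<phi> ^^ m) p) (eps S)" for p q
    proof -
      have "(\<psi> ^^ K) ((\<phi> ^^ m) q) \<in> local_unstable S ((\<psi> ^^ K) ((\<phi> ^^ m) p)) (eps S)"
        "d ((\<psi> ^^ K) ((\<phi> ^^ m) p)) ((\<psi> ^^ K) ((\<phi> ^^ m) q)) \<le> d ((\<phi> ^^ m) p) ((\<phi> ^^ m) q) / lam S ^ K"
        using local_unstable_iter[OF _ that(3), of K] that by auto
      moreover have "(\<psi> ^^ K) ((\<phi> ^^ m) p) = (\<phi> ^^ t) p" if "p \<in> X" for p
        using hinv_hom_pow[of p K m] that t(4,5) by (metis diff_diff_cancel diff_le_self)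
      moreover have "d ((\<phi> ^^ m) p) ((\<phi> ^^ m) q) / lam S ^ K \<le> eps S / lam S ^ K"
        using that(3) lam_gt1 by (intro divide_right_mono) (auto simp: local_unstable_def)
      ultimately have l: "(\<phi> ^^ t) q \<in> local_unstable S ((\<phi> ^^ t) p) (eps S)"
        "d ((\<phi> ^^ t) p) ((\<phi> ^^ t) q) \<le> eps S / lam S ^ K"
        using that by auto
      have "d ((\<phi> ^^ t) p) ((\<phi> ^^ t) q) \<le> r / 3" using l(2) K by (rule order_trans)
      then show ?thesis using backward_close_if_local_unstable[OF _ l(1)] that by simp
    qed
    have B1: "backward_close S (r / 3) ((\<phi> ^^ t) (fst a)) ((\<phi> ^^ t) (fst b))"
      using bwd[OF av(1) bv(1) half[OF _ _ av(7)[OF t(6) order_refl] bv(7)[OF t(6) order_refl]]] av(1) xX(1) by simp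
    have s2: "(\<phi> ^^ m) (snd a) \<in> local_unstable S ((\<phi> ^^ m) (snd x)) (eps S / 2)"
      "(\<phi> ^^ m) (snd b) \<in> local_unstable S ((\<phi> ^^ m) (snd x)) (eps S / 2)"
      using av(5)[OF order_refl] bv(5)[OF order_refl] ee by (auto simp: local_unstable_def)
    have B2: "backward_close S (r / 3) ((\<phi> ^^ t) (snd a)) ((\<phi> ^^ t) (snd b))"
      by (rule bwd[OF av(2) bv(2) half[OF pow_in(1)[OF av(2)] pow_in(1)[OF xX(2)] s2]])
    have "forward_close S (r / 3) ((\<phi> ^^ (t - k0)) ((\<phi> ^^ k0) (fst a))) ((\<phi> ^^ (t - k0)) ((\<phi> ^^ k0) (snd a)))"
      by (rule forward_close_pow[OF fc])
    then have F1: "forward_close S (r / 3) ((\<phi> ^^ t) (fst a)) ((\<phi> ^^ t) (snd a))"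
      using t(2) funpow_add[of "t - k0" k0 \<phi>] by simp
    have "d ((\<phi> ^^ t) (snd b)) ((\<phi> ^^ t) (fst b)) \<le> d ((\<phi> ^^ t) (snd b)) ((\<phi> ^^ t) (snd a)) + d ((\<phi> ^^ t) (snd a)) ((\<phi> ^^ t) (fst b))"
      "d ((\<phi> ^^ t) (snd a)) ((\<phi> ^^ t) (fst b)) \<le> d ((\<phi> ^^ t) (snd a)) ((\<phi> ^^ t) (fst a)) + d ((\<phi> ^^ t) (fst a)) ((\<phi> ^^ t) (fst b))"
      by (rule triangle; simp add: av(1,2) bv(1,2))+
    then have "d ((\<phi> ^^ t) (snd b)) ((\<phi> ^^ t) (fst b)) \<le> r"
      using backward_closeD(4)[OF B1] backward_closeD(4)[OF B2] forward_closeD(4)[OF F1]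
        commute[of "(\<phi> ^^ t) (snd b)" "(\<phi> ^^ t) (snd a)"] commute[of "(\<phi> ^^ t) (fst a)" "(\<phi> ^^ t) (snd a)"] by linarith
    then have "forward_close S r ((\<phi> ^^ t) (snd b)) ((\<phi> ^^ t) (fst b))"
      using forward_close_if_local_stable[OF _ bv(6)[OF t(3,4)]] bv(2) ee by simp
    then have "rectangle S r t a b"
      unfolding rectangle_def using B1 B2 F1 av(1,2) bv(1,2) assms
      by (auto simp: mem_Times_iff intro: forward_close_mono backward_close_mono forward_close_sym)
    then show ?thesis using t by blast
  qed
  then show ?thesis by blast
qed

text \<open>The common member of the cover is the neighbourhood of \<open>a\<close> itself.\<close>
lemma rectangle_imp_R:
  assumes "a \<in> G" "rectangle S r k a b" "0 < r" "r \<le> eps' S / 8" "depth a n \<le> k"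
  shows "R (Suc n) a b"
proof -
  define m where "m = depth a n"
  have m: "m \<le> k" "time a \<le> m" using assms(5) time_le_depth by (auto simp: m_def)
  have ee: "eps' S \<le> eps S / 2" "0 < eps S" "0 < eps' S" by (rule eps'_le, rule eps_pos, rule eps'_pos)
  note aX = groupoid_cases[OF assms(1)]
  have r: "r \<le> eps' S" using assms ee by simp
  have b: "fst b \<in> X" "snd b \<in> X" "backward_close S r ((\<phi> ^^ k) (fst a)) ((\<phi> ^^ k) (fst b))"
    "backward_close S r ((\<phi> ^^ k) (snd a)) ((\<phi> ^^ k) (snd b))"
    "forward_close S r ((\<phi> ^^ k) (fst b)) ((\<phi> ^^ k) (snd b))"
    using assms(2) by (auto simp: rectangle_def)
  have le_r: "r / lam S ^ i \<le> r" for i using div_lam_pow_le assms by simp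
  have E1: "backward_close S r ((\<phi> ^^ j) (fst a)) ((\<phi> ^^ j) (fst b))"
    and E2: "backward_close S r ((\<phi> ^^ j) (snd a)) ((\<phi> ^^ j) (snd b))" if "j \<le> k" for j
    using backward_close_earlier[OF aX(1) b(1,3) r that] backward_close_earlier[OF aX(2) b(2,4) r that]
      backward_close_mono[OF _ le_r] by blast+
  have "d (snd a) (snd b) \<le> r / lam S ^ k"
    using backward_close_earlier[OF aX(2) b(2,4) r, of 0] by (auto dest: backward_closeD(4))
  also have "\<dots> \<le> r / lam S ^ m"
    using m lam_gt1 assms by (intro divide_left_mono power_increasing) auto
  also have "\<dots> < (eps' S / 4) / lam S ^ m" using assms lam_gt1 ee by (intro divide_strict_right_mono) auto
  finally have "snd b \<in> local_unstable S (snd a) (inverse (lam S) ^ m * eps' S / 4)"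
    using local_unstable_if_backward_close[OF E2[of 0] r] by (simp add: field_simps)
  moreover have "(\<phi> ^^ m) (fst b) \<in> local_unstable S ((\<phi> ^^ m) (fst a)) (eps S)"
    using local_unstable_if_backward_close[OF E1[OF m(1)] r] backward_closeD(4)[OF E1[OF m(1)]] r ee by simp
  moreover have close: "d ((\<phi> ^^ j) (snd b)) ((\<phi> ^^ j) (fst b)) < eps S" if j: "m \<le> j" "j \<le> k" for j
  proof -
    have "d ((\<phi> ^^ j) (snd b)) ((\<phi> ^^ j) (fst b)) \<le> d ((\<phi> ^^ j) (snd b)) ((\<phi> ^^ j) (snd a)) + d ((\<phi> ^^ j) (snd a)) ((\<phi> ^^ j) (fst b))"
      "d ((\<phi> ^^ j) (snd a)) ((\<phi> ^^ j) (fst b)) \<le> d ((\<phi> ^^ j) (snd a)) ((\<phi> ^^ j) (fst a)) + d ((\<phi> ^^ j) (fst a)) ((\<phi> ^^ j) (fst b))"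
      by (rule triangle; simp add: aX(1,2) b(1,2))+
    then show ?thesis
      using backward_closeD(4)[OF E1[OF j(2)]] backward_closeD(4)[OF E2[OF j(2)]] time_dist[OF assms(1), of j] m j assms ee
        commute[of "(\<phi> ^^ j) (snd b)" "(\<phi> ^^ j) (snd a)"] commute[of "(\<phi> ^^ j) (fst a)" "(\<phi> ^^ j) (snd a)"] by linarith
  qed
  moreover have "br ((\<phi> ^^ m) (snd b)) ((\<phi> ^^ m) (fst b)) = (\<phi> ^^ m) (fst b)"
  proof (rule br_pull[where m = "k - m"])
    have eq: "(\<phi> ^^ (k - m)) ((\<phi> ^^ m) p) = (\<phi> ^^ k) p" for p
      using m funpow_add[of "k - m" m \<phi>] by simp
    show "br ((\<phi> ^^ (k - m)) ((\<phi> ^^ m) (snd b))) ((\<phi> ^^ (k - m)) ((\<phi> ^^ m) (fst b))) = (\<phi> ^^ (k - m)) ((\<phi> ^^ m) (fst b))"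
      unfolding eq by (rule br_eq_if_forward_close[OF forward_close_sym[OF b(5)] r])
    show "d ((\<phi> ^^ i) ((\<phi> ^^ m) (snd b))) ((\<phi> ^^ i) ((\<phi> ^^ m) (fst b))) \<le> eps S" if "i \<le> k - m" for i
      using close[of "i + m"] that m le_diff_conv2[OF m(1), of i] by (simp add: funpow_add)
  qed (use b in auto)
  then have "(\<phi> ^^ m) (fst b) \<in> local_stable S ((\<phi> ^^ m) (snd b)) (eps S)"
    using b close[of m] m by (simp add: local_stable_def)
  ultimately have "b \<in> V a m" by (intro V_intro[OF assms(1) m(2) b(1)])
  then show ?thesis unfolding R_Suc m_def using V_self[OF assms(1) time_le_depth] assms(1) by blast
qed

lemma groupoid_forward_close:
  assumes "a \<in> G" "0 < r"
  shows "\<exists>k0. \<forall>k\<ge>k0. forward_close S r ((\<phi> ^^ k) (fst a)) ((\<phi> ^^ k) (snd a))"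
  using stable_set_eventually[OF groupoid_cases(1,4)[OF assms(1)] assms(2)] .

lemma R_all_imp_eq:
  assumes "a \<in> G" "b \<in> G" "\<And>n. R n a b"
  shows "a = b"
proof -
  obtain k0 where k0: "forward_close S (eps' S / 3) ((\<phi> ^^ k0) (fst a)) ((\<phi> ^^ k0) (snd a))"
    using groupoid_forward_close[OF assms(1), of "eps' S / 3"] eps'_pos by auto
  obtain K where K: "\<And>n. k0 + K \<le> n * L \<Longrightarrow> \<exists>t. n * L \<le> t + K \<and> k0 \<le> t \<and> rectangle S (eps' S) t a b"
    using R_imp_rectangle[OF eps'_pos order_refl] assms(1,3) k0 by blast
  have "d (fst a) (fst b) \<le> eps' S / lam S ^ n \<and> d (snd a) (snd b) \<le> eps' S / lam S ^ n" for n
  proof -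
    have le: "k0 + K + n \<le> (k0 + K + n) * L" using L_pos by simp
    then have "k0 + K \<le> (k0 + K + n) * L" by linarith
    from K[OF this] obtain t where t: "(k0 + K + n) * L \<le> t + K" "rectangle S (eps' S) t a b"
      by blast
    then have nt: "n \<le> t" using le by linarith
    have r: "fst a \<in> X" "fst b \<in> X" "snd a \<in> X" "snd b \<in> X"
      "backward_close S (eps' S) ((\<phi> ^^ t) (fst a)) ((\<phi> ^^ t) (fst b))"
      "backward_close S (eps' S) ((\<phi> ^^ t) (snd a)) ((\<phi> ^^ t) (snd b))"
      using t(2) by (auto simp: rectangle_def)
    have "eps' S / lam S ^ t \<le> eps' S / lam S ^ n"
      using nt lam_gt1 eps'_pos by (intro divide_left_mono power_increasing) auto
    then show ?thesis
      using backward_closeD(4)[OF backward_close_earlier[OF r(1,2,5) order_refl, of 0]]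
        backward_closeD(4)[OF backward_close_earlier[OF r(3,4,6) order_refl, of 0]] by simp
  qed
  then have "d (fst a) (fst b) \<le> 0" "d (snd a) (snd b) \<le> 0"
    by (auto intro!: LIMSEQ_le_const[OF div_lam_pow_tendsto[of "eps' S"]])
  then have "d (fst a) (fst b) = 0" "d (snd a) (snd b) = 0"
    using nonneg[of "fst a" "fst b"] nonneg[of "snd a" "snd b"] by linarith+
  then show ?thesis using groupoid_cases(1,2)[OF assms(1)] groupoid_cases(1,2)[OF assms(2)] by (simp add: prod_eq_iff)
qed

lemma refining: "refining_covers G (lam S) time (stable_nbhd S)"
proof
  show "\<exists>U\<in>covers G (lam S) time (stable_nbhd S) n. a \<in> U \<and> a \<in> U" if "a \<in> G" for a n
  proof (cases n)
    case 0 then show ?thesis using that by (simp add: covers_def)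
  next
    case (Suc n')
    then show ?thesis using that V_self[OF that time_le_depth] unfolding Suc covers_Suc by blast
  qed
  show "\<exists>U\<in>covers G (lam S) time (stable_nbhd S) n. a \<in> U \<and> c \<in> U"
    if "a \<in> G" "b \<in> G" "c \<in> G" "\<exists>U\<in>covers G (lam S) time (stable_nbhd S) (Suc n). a \<in> U \<and> b \<in> U"
      "\<exists>U\<in>covers G (lam S) time (stable_nbhd S) (Suc n). b \<in> U \<and> c \<in> U" for a b c n
    by (rule R_refine[unfolded R_def, OF that])
  show "a = b"
    if "a \<in> G" "b \<in> G" "\<And>n. \<exists>U\<in>covers G (lam S) time (stable_nbhd S) n. a \<in> U \<and> b \<in> U" for a b
    by (rule R_all_imp_eq[unfolded R_def, OF that])
qed

abbreviation D where "D \<equiv> stable_metric S Q"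

lemma metric_D: "Metric_space G D"
  unfolding stable_metric_def by (rule refining_covers.metric[OF refining])

lemma D_le: "a \<in> G \<Longrightarrow> b \<in> G \<Longrightarrow> R n a b \<Longrightarrow> D a b \<le> (1 / 2) ^ n"
  unfolding stable_metric_def R_def by (rule refining_covers.D_le[OF refining])

lemma R_if_D_less: "a \<in> G \<Longrightarrow> b \<in> G \<Longrightarrow> D a b < (1 / 2) ^ n / 4 \<Longrightarrow> R n a b"
  unfolding stable_metric_def R_def by (rule refining_covers.R_if_D_less[OF refining])

end

section \<open>Relatively compact subsets of the groupoid\<close>

context smale
begin

lemmas hinv_pow_limit = smale.hom_pow_limit[OF smale_inverse, simplified]

end

context self_similar_smale
begin

lemma Q_pow: "q \<in> Q \<Longrightarrow> (\<phi> ^^ n) q \<in> Q" "q \<in> Q \<Longrightarrow> (\<psi> ^^ n) q \<in> Q"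
  by (induction n) (use Q_invariant in auto)

text \<open>Small enough that sums of three such radii, and \<open>eps' S / 8\<close> as a sum of two, are within the range where
  closeness of orbits can be compared with local stable and unstable sets.\<close>
abbreviation scale where "scale \<equiv> eps' S / 16"

text \<open>An increasing sequence of compact sets exhausting the groupoid. The conditions on backward orbits say how far
  along the unstable sets of \<open>Q\<close> the coordinates may be.\<close>
definition compact_part :: "nat \<Rightarrow> ('a \<times> 'a) set" where
  "compact_part N = {a \<in> X \<times> X. forward_close S scale ((\<phi> ^^ N) (fst a)) ((\<phi> ^^ N) (snd a)) \<and>
     (\<exists>q\<in>Q. backward_close S scale q ((\<psi> ^^ N) (fst a))) \<and> (\<exists>q\<in>Q. backward_close S scale q ((\<psi> ^^ N) (snd a)))}"

lemma compact_partD: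
  assumes "a \<in> compact_part N"
  shows "fst a \<in> X" "snd a \<in> X" "forward_close S scale ((\<phi> ^^ N) (fst a)) ((\<phi> ^^ N) (snd a))"
    "\<exists>q\<in>Q. backward_close S scale q ((\<psi> ^^ N) (fst a))" "\<exists>q\<in>Q. backward_close S scale q ((\<psi> ^^ N) (snd a))"
  using assms by (auto simp: compact_part_def)

lemma scale_bounds: "0 < scale" "scale \<le> eps' S" "2 * scale \<le> eps' S" "3 * scale \<le> eps' S"
  using eps'_pos by auto

lemma pow_split: "m \<le> n \<Longrightarrow> (\<phi> ^^ (n - m)) ((\<phi> ^^ m) x) = (\<phi> ^^ n) x"
  "m \<le> n \<Longrightarrow> (\<psi> ^^ (n - m)) ((\<psi> ^^ m) x) = (\<psi> ^^ n) x"
  using funpow_add[of "n - m" m \<phi>] funpow_add[of "n - m" m \<psi>] by simp_all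

lemma unstable_of_near_orbit:
  assumes "y \<in> unstable_of S Q" "0 < r"
  shows "\<exists>N. \<forall>n\<ge>N. \<exists>q\<in>Q. backward_close S r q ((\<psi> ^^ n) y)"
proof -
  obtain q where q: "q \<in> Q" "y \<in> unstable_set S q" using assms by (auto simp: unstable_of_def)
  then obtain N where "\<forall>k\<ge>N. backward_close S r ((\<psi> ^^ k) q) ((\<psi> ^^ k) y)"
    using unstable_set_eventually[of q y r] Q_invariant assms by blast
  then show ?thesis using Q_pow(2)[OF q(1)] by blast
qed

lemma unstable_of_if_near_orbit:
  assumes "y \<in> X" "q \<in> Q" "backward_close S r q ((\<psi> ^^ N) y)" "r \<le> eps' S"
  shows "y \<in> unstable_of S Q"
proof -
  have "q \<in> X" using assms Q_invariant by auto
  then have "y \<in> unstable_set S ((\<phi> ^^ N) q)"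
    using unstable_set_if_backward_close[of y r N "(\<phi> ^^ N) q"] assms by simp
  then show ?thesis using Q_pow(1)[OF assms(2)] by (auto simp: unstable_of_def)
qed

lemma compact_part_subset: "compact_part N \<subseteq> G"
proof
  fix a assume a: "a \<in> compact_part N"
  note b = compact_partD[OF a]
  have "snd a \<in> stable_set S (fst a)" by (rule stable_set_if_forward_close[OF b(2,3) scale_bounds(2)])
  moreover have "fst a \<in> unstable_of S Q" "snd a \<in> unstable_of S Q"
    using b(4,5) unstable_of_if_near_orbit[OF b(1) _ _ scale_bounds(2)] unstable_of_if_near_orbit[OF b(2) _ _ scale_bounds(2)]
    by blast+
  ultimately show "a \<in> G" by (simp add: stable_groupoid_def case_prod_unfold)
qed

lemma near_orbit_later:
  assumes "\<exists>q\<in>Q. backward_close S r q ((\<psi> ^^ N) y)" "r \<le> eps' S" "N \<le> N'"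
  shows "\<exists>q\<in>Q. backward_close S (r / lam S ^ (N' - N)) q ((\<psi> ^^ N') y)"
proof -
  obtain q where q: "q \<in> Q" "backward_close S r q ((\<psi> ^^ N) y)" using assms by blast
  have "backward_close S (r / lam S ^ (N' - N)) ((\<psi> ^^ (N' - N)) q) ((\<psi> ^^ N') y)"
    using backward_close_pow_contract[OF q(2) assms(2), of "N' - N"] pow_split(2)[OF assms(3)] by simp
  then show ?thesis using Q_pow(2)[OF q(1)] by blast
qed

lemma near_orbit_mono:
  assumes "\<exists>q\<in>Q. backward_close S scale q ((\<psi> ^^ N) y)" "N \<le> N'"
  shows "\<exists>q\<in>Q. backward_close S scale q ((\<psi> ^^ N') y)"
  using near_orbit_later[OF assms(1) scale_bounds(2) assms(2)] div_lam_pow_le[OF less_imp_le[OF scale_bounds(1)]]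
    backward_close_mono by blast

lemma forward_close_later:
  assumes "forward_close S r ((\<phi> ^^ N) x) ((\<phi> ^^ N) y)" "r \<le> eps' S" "N \<le> N'"
  shows "forward_close S (r / lam S ^ (N' - N)) ((\<phi> ^^ N') x) ((\<phi> ^^ N') y)"
  using forward_close_pow_contract[OF assms(1,2), of "N' - N"] pow_split(1)[OF assms(3)] by simp

lemma forward_close_later':
  assumes "forward_close S r ((\<phi> ^^ N) x) ((\<phi> ^^ N) y)" "N \<le> N'"
  shows "forward_close S r ((\<phi> ^^ N') x) ((\<phi> ^^ N') y)"
  using forward_close_pow[OF assms(1), of "N' - N"] pow_split(1)[OF assms(2)] by simp

lemma compact_part_mono:
  assumes "N \<le> N'" shows "compact_part N \<subseteq> compact_part N'"
proof
  fix a assume a: "a \<in> compact_part N"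
  note b = compact_partD[OF a]
  show "a \<in> compact_part N'"
    using b(1,2) forward_close_later'[OF b(3) assms] near_orbit_mono[OF b(4) assms] near_orbit_mono[OF b(5) assms]
    by (auto simp: compact_part_def mem_Times_iff)
qed

lemma compact_part_exhausts:
  assumes "a \<in> G" shows "\<exists>N. a \<in> compact_part N"
proof -
  note a = groupoid_cases[OF assms]
  obtain N1 where 1: "\<And>n. n \<ge> N1 \<Longrightarrow> \<exists>q\<in>Q. backward_close S scale q ((\<psi> ^^ n) (fst a))"
    using unstable_of_near_orbit[OF a(5) scale_bounds(1)] by blast
  obtain N2 where 2: "\<And>n. n \<ge> N2 \<Longrightarrow> \<exists>q\<in>Q. backward_close S scale q ((\<psi> ^^ n) (snd a))"
    using unstable_of_near_orbit[OF a(6) scale_bounds(1)] by blast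
  obtain N3 where 3: "\<And>n. n \<ge> N3 \<Longrightarrow> forward_close S scale ((\<phi> ^^ n) (fst a)) ((\<phi> ^^ n) (snd a))"
    using groupoid_forward_close[OF assms scale_bounds(1)] by blast
  have "a \<in> compact_part (N1 + N2 + N3)"
    using 1[of "N1 + N2 + N3"] 2[of "N1 + N2 + N3"] 3[of "N1 + N2 + N3"] a by (auto simp: compact_part_def mem_Times_iff)
  then show ?thesis ..
qed

lemma time_compact_part: "a \<in> compact_part N \<Longrightarrow> time a \<le> N"
  using time_le[of a scale N] compact_part_subset compact_partD(3) eps'_pos by auto

lemma compact_part_swap: "(v, w) \<in> compact_part N \<Longrightarrow> (w, v) \<in> compact_part N"
  by (auto simp: compact_part_def forward_close_sym)

lemma rectangleD:
  assumes "rectangle S r k a b"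
  shows "fst a \<in> X" "snd a \<in> X" "fst b \<in> X" "snd b \<in> X"
    "backward_close S r ((\<phi> ^^ k) (fst a)) ((\<phi> ^^ k) (fst b))"
    "backward_close S r ((\<phi> ^^ k) (snd a)) ((\<phi> ^^ k) (snd b))"
    "forward_close S r ((\<phi> ^^ k) (fst a)) ((\<phi> ^^ k) (snd a))"
    "forward_close S r ((\<phi> ^^ k) (fst b)) ((\<phi> ^^ k) (snd b))"
  using assms by (auto simp: rectangle_def)

lemma rectangle_sym: "rectangle S r k a b \<Longrightarrow> rectangle S r k b a"
  by (auto simp: rectangle_def backward_close_sym)

text \<open>Around the rectangle radii add up to at most \<open>3 * scale\<close>, and \<open>L\<close> further iterations divide by \<open>3\<close>.\<close>
lemma rectangle_compact_part:
  assumes a: "a \<in> compact_part N" and r: "rectangle S scale t a b" and "N \<le> t"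
  shows "b \<in> compact_part (N + L)"
proof -
  note aD = compact_partD[OF a] and R = rectangleD[OF r]
  have E1: "backward_close S scale ((\<phi> ^^ j) (fst a)) ((\<phi> ^^ j) (fst b))"
    and E2: "backward_close S scale ((\<phi> ^^ j) (snd a)) ((\<phi> ^^ j) (snd b))" if "j \<le> t" for j
    using backward_close_earlier[OF R(1,3,5) scale_bounds(2) that] backward_close_earlier[OF R(2,4,6) scale_bounds(2) that]
      div_lam_pow_le[OF less_imp_le[OF scale_bounds(1)]] backward_close_mono by blast+
  have "forward_close S (3 * scale) ((\<phi> ^^ N) (fst b)) ((\<phi> ^^ N) (snd b))"
  proof (rule forward_close_extend[where n = "t - N"])
    show "forward_close S (3 * scale) ((\<phi> ^^ (t - N)) ((\<phi> ^^ N) (fst b))) ((\<phi> ^^ (t - N)) ((\<phi> ^^ N) (snd b)))"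
      using forward_close_mono[OF R(8), of "3 * scale"] pow_split(1)[OF assms(3)] scale_bounds by simp
    fix j assume j: "j < t - N"
    then have jt: "j + N \<le> t" by simp
    let ?j = "j + N"
    have "d ((\<phi> ^^ ?j) (fst b)) ((\<phi> ^^ ?j) (snd b)) \<le> d ((\<phi> ^^ ?j) (fst b)) ((\<phi> ^^ ?j) (fst a)) + d ((\<phi> ^^ ?j) (fst a)) ((\<phi> ^^ ?j) (snd b))"
      "d ((\<phi> ^^ ?j) (fst a)) ((\<phi> ^^ ?j) (snd b)) \<le> d ((\<phi> ^^ ?j) (fst a)) ((\<phi> ^^ ?j) (snd a)) + d ((\<phi> ^^ ?j) (snd a)) ((\<phi> ^^ ?j) (snd b))"
      by (rule triangle; simp add: R(1-4))+
    then have "d ((\<phi> ^^ ?j) (fst b)) ((\<phi> ^^ ?j) (snd b)) \<le> 3 * scale"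
      using backward_closeD(4)[OF E1[OF jt]] backward_closeD(4)[OF E2[OF jt]]
        forward_closeD(4)[OF forward_close_later'[OF aD(3), of ?j]] commute[of "(\<phi> ^^ ?j) (fst b)" "(\<phi> ^^ ?j) (fst a)"] by simp
    then show "d ((\<phi> ^^ j) ((\<phi> ^^ N) (fst b))) ((\<phi> ^^ j) ((\<phi> ^^ N) (snd b))) \<le> 3 * scale" by (simp add: funpow_add)
  qed (use R in auto)
  from forward_close_later[OF this scale_bounds(4), of "N + L"]
  have "forward_close S (3 * scale / lam S ^ L) ((\<phi> ^^ (N + L)) (fst b)) ((\<phi> ^^ (N + L)) (snd b))" by simp
  moreover have le3: "t / lam S ^ L \<le> t / 3" if "0 \<le> t" for t
    using three_le_lam_pow[OF order_refl] that by (intro divide_left_mono) auto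
  ultimately have F: "forward_close S scale ((\<phi> ^^ (N + L)) (fst b)) ((\<phi> ^^ (N + L)) (snd b))"
    using forward_close_mono le3[of "3 * scale"] scale_bounds(1) by simp
  have B: "\<exists>q\<in>Q. backward_close S scale q ((\<psi> ^^ (N + L)) y)"
    if x: "\<exists>q\<in>Q. backward_close S scale q ((\<psi> ^^ N) x)" and xy: "backward_close S scale x y" for x y
  proof -
    obtain q where q: "q \<in> Q" "backward_close S (scale / lam S ^ L) q ((\<psi> ^^ (N + L)) x)"
      using near_orbit_later[OF x scale_bounds(2), of "N + L"] by auto
    have "backward_close S (scale / lam S ^ (N + L)) ((\<psi> ^^ (N + L)) x) ((\<psi> ^^ (N + L)) y)"
      by (rule backward_close_pow_contract[OF xy scale_bounds(2)])
    then have "backward_close S (scale / lam S ^ L + scale / lam S ^ (N + L)) q ((\<psi> ^^ (N + L)) y)"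
      by (rule backward_close_trans[OF q(2)])
    moreover have "scale / lam S ^ (N + L) \<le> scale / lam S ^ L"
      using lam_gt1 scale_bounds(1) by (intro divide_left_mono power_increasing) auto
    ultimately have "backward_close S scale q ((\<psi> ^^ (N + L)) y)"
      using backward_close_mono le3[of scale] scale_bounds(1) by fastforce
    then show ?thesis using q by blast
  qed
  show ?thesis
    using B[OF aD(4)] E1[of 0] B[OF aD(5)] E2[of 0] F R by (auto simp: compact_part_def mem_Times_iff)
qed

text \<open>On a compact part the time from which the coordinates are forward close is uniform.\<close>
lemma compact_part_R_rectangle:
  assumes "0 < r" "r \<le> eps' S"
  shows "\<exists>K. \<forall>n a b. a \<in> compact_part N \<longrightarrow> R (Suc n) a b \<longrightarrow> K \<le> n * L \<longrightarrow>
     (\<exists>t. n * L \<le> t + K \<and> N \<le> t \<and> rectangle S r t a b)"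
proof -
  obtain K' where K': "\<And>n a b k0. a \<in> G \<Longrightarrow> R (Suc n) a b \<Longrightarrow>
     forward_close S (r / 3) ((\<phi> ^^ k0) (fst a)) ((\<phi> ^^ k0) (snd a)) \<Longrightarrow> k0 + K' \<le> n * L \<Longrightarrow>
     \<exists>t. n * L \<le> t + K' \<and> k0 \<le> t \<and> rectangle S r t a b"
    using R_imp_rectangle[OF assms] by blast
  obtain j where "\<And>k. k \<ge> j \<Longrightarrow> scale / lam S ^ k \<le> r / 3" using div_lam_pow_small[of "r / 3" scale] assms by auto
  then have j: "scale / lam S ^ j \<le> r / 3" by simp
  have "\<exists>t. n * L \<le> t + (N + j + K') \<and> N \<le> t \<and> rectangle S r t a b"
    if "a \<in> compact_part N" "R (Suc n) a b" "N + j + K' \<le> n * L" for n a b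
  proof -
    have "forward_close S (scale / lam S ^ (N + j - N)) ((\<phi> ^^ (N + j)) (fst a)) ((\<phi> ^^ (N + j)) (snd a))"
      by (rule forward_close_later[OF compact_partD(3)[OF that(1)] scale_bounds(2)]) simp
    then have "forward_close S (r / 3) ((\<phi> ^^ (N + j)) (fst a)) ((\<phi> ^^ (N + j)) (snd a))"
      using forward_close_mono j by simp
    from K'[OF subsetD[OF compact_part_subset that(1)] that(2) this that(3)]
    obtain t where "n * L \<le> t + K'" "N + j \<le> t" "rectangle S r t a b" by blast
    then show ?thesis by (intro exI[of _ t]) auto
  qed
  then show ?thesis by blast
qed

lemma compact_part_neighbourhood: "\<exists>\<rho>>0. \<forall>a\<in>compact_part N. \<forall>b\<in>G. D a b < \<rho> \<longrightarrow> b \<in> compact_part (N + L)"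
proof -
  obtain K where K: "\<And>n a b. a \<in> compact_part N \<Longrightarrow> R (Suc n) a b \<Longrightarrow> K \<le> n * L \<Longrightarrow>
     \<exists>t. n * L \<le> t + K \<and> N \<le> t \<and> rectangle S scale t a b"
    using compact_part_R_rectangle[OF scale_bounds(1,2)] by blast
  have KL: "K \<le> K * L" using L_pos by simp
  show ?thesis
  proof (intro exI[of _ "(1 / 2) ^ Suc K / 4"] conjI ballI impI)
    fix a b assume ab: "a \<in> compact_part N" "b \<in> G" "D a b < (1 / 2) ^ Suc K / 4"
    then have "R (Suc K) a b" using R_if_D_less compact_part_subset by blast
    then show "b \<in> compact_part (N + L)" using K[OF ab(1) _ KL] rectangle_compact_part[OF ab(1)] by blast
  qed simp
qed

text \<open>With the next lemma: rectangles at late times form a neighbourhood basis of the metric.\<close>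
lemma rectangle_imp_D_less:
  assumes "a \<in> G" "0 < \<rho>" "0 < r" "r \<le> eps' S / 8"
  shows "\<exists>K. \<forall>k\<ge>K. \<forall>b\<in>G. rectangle S r k a b \<longrightarrow> D a b < \<rho>"
proof -
  obtain n where n: "(1 / 2 :: real) ^ n < \<rho>" using real_arch_pow_inv[OF assms(2), of "1 / 2"] by auto
  have n': "(1 / 2 :: real) ^ Suc n < \<rho>" using n power_decreasing[of n "Suc n" "1 / 2 :: real"] by linarith
  show ?thesis
  proof (intro exI[of _ "depth a n"] allI impI ballI)
    fix k b assume "depth a n \<le> k" "b \<in> G" "rectangle S r k a b"
    then have "R (Suc n) a b" using rectangle_imp_R[OF assms(1) _ assms(3,4)] by blast
    then show "D a b < \<rho>" using D_le[OF assms(1) \<open>b \<in> G\<close>] n' by (meson le_less_trans)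
  qed
qed

lemma D_less_imp_rectangle:
  assumes "a \<in> G" "0 < r" "r \<le> eps' S"
  shows "\<exists>\<rho>>0. \<forall>b\<in>G. D a b < \<rho> \<longrightarrow> (\<exists>t\<ge>K0. rectangle S r t a b)"
proof -
  obtain N where N: "a \<in> compact_part N" using compact_part_exhausts assms(1) by blast
  obtain K where K: "\<And>n a b. a \<in> compact_part N \<Longrightarrow> R (Suc n) a b \<Longrightarrow> K \<le> n * L \<Longrightarrow>
     \<exists>t. n * L \<le> t + K \<and> N \<le> t \<and> rectangle S r t a b"
    using compact_part_R_rectangle[OF assms(2,3)] by blast
  define n where "n = K + K0"
  have nL: "n \<le> n * L" using L_pos by simp
  show ?thesis
  proof (intro exI[of _ "(1 / 2) ^ Suc n / 4"] conjI ballI impI)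
    fix b assume b: "b \<in> G" "D a b < (1 / 2) ^ Suc n / 4"
    then have "R (Suc n) a b" using R_if_D_less assms(1) by blast
    moreover have "K \<le> n * L" using nL n_def by linarith
    ultimately obtain t where t: "n * L \<le> t + K" "rectangle S r t a b" using K[OF N] by blast
    have "K0 \<le> t" using nL t(1) n_def by linarith
    then show "\<exists>t\<ge>K0. rectangle S r t a b" using t(2) by blast
  qed simp
qed

abbreviation T where "T \<equiv> Metric_space.mtopology G D"

lemma topspace_T: "topspace T = G"
  by (rule Metric_space.topspace_mtopology[OF metric_D])

lemma limitin_T: "limitin T \<sigma> l sequentially \<longleftrightarrow> l \<in> G \<and> (\<forall>\<rho>>0. \<forall>\<^sub>F n in sequentially. \<sigma> n \<in> G \<and> D (\<sigma> n) l < \<rho>)"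
  by (rule Metric_space.limitin_metric[OF metric_D])

lemma D_commute: "D a b = D b a"
  by (rule Metric_space.commute[OF metric_D])

lemma D_nonneg: "0 \<le> D a b"
  by (rule Metric_space.nonneg[OF metric_D])

text \<open>A sequence in \<open>K\<close> leaving every compact part would accumulate at a point, some neighbourhood of which
  lies in a single compact part.\<close>
lemma compact_imp_compact_part:
  assumes "compactin T K"
  shows "\<exists>N. K \<subseteq> compact_part N"
proof (rule ccontr)
  assume "\<not> ?thesis"
  then have "\<exists>a. a \<in> K \<and> a \<notin> compact_part n" for n by blast
  then obtain \<sigma> where \<sigma>: "\<And>n. \<sigma> n \<in> K" "\<And>n. \<sigma> n \<notin> compact_part n" by metis
  have "range \<sigma> \<subseteq> K" using \<sigma> by auto
  then obtain l r where l: "l \<in> K" "strict_mono r" "limitin T (\<sigma> \<circ> r) l sequentially"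
    using assms unfolding Metric_space.compactin_sequentially[OF metric_D] by meson
  obtain N where N: "l \<in> compact_part N" using l(3) compact_part_exhausts limitin_T by blast
  obtain \<rho> where \<rho>: "\<rho> > 0" "\<And>b. b \<in> G \<Longrightarrow> D l b < \<rho> \<Longrightarrow> b \<in> compact_part (N + L)" using compact_part_neighbourhood N by blast
  have "\<forall>\<^sub>F n in sequentially. \<sigma> (r n) \<in> G \<and> D (\<sigma> (r n)) l < \<rho>" using l(3) \<rho>(1) unfolding limitin_T by simp
  then obtain n0 where n0: "\<And>n. n \<ge> n0 \<Longrightarrow> \<sigma> (r n) \<in> G \<and> D (\<sigma> (r n)) l < \<rho>" by (auto simp: eventually_sequentially)
  define n where "n = max n0 (N + L)"
  have "\<sigma> (r n) \<in> compact_part (N + L)" using n0[of n] \<rho>(2) D_commute by (simp add: n_def)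
  moreover have "N + L \<le> r n" using seq_suble[OF l(2), of n] by (simp add: n_def)
  ultimately show False using \<sigma>(2) compact_part_mono by blast
qed

text \<open>Self-similarity controls the iterations up to time \<open>m\<close>; further back, the backward orbits contract.\<close>
lemma backward_close_advance:
  assumes "backward_close S r x y" "r \<le> eps' S"
  shows "backward_close S (lam S ^ m * d x y) ((\<phi> ^^ m) x) ((\<phi> ^^ m) y)"
proof -
  have X: "x \<in> X" "y \<in> X" using assms backward_closeD by auto
  have one: "1 \<le> lam S ^ n" for n using lam_gt1 by (simp add: one_le_power)
  show ?thesis
    unfolding backward_close_def
  proof (intro conjI allI)
    fix i
    show "d ((\<psi> ^^ i) ((\<phi> ^^ m) x)) ((\<psi> ^^ i) ((\<phi> ^^ m) y)) \<le> lam S ^ m * d x y"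
    proof (cases "i \<le> m")
      case True
      have "d ((\<phi> ^^ (m - i)) x) ((\<phi> ^^ (m - i)) y) \<le> lam S ^ (m - i) * d x y" by (rule hom_pow_lipschitz[OF X])
      also have "\<dots> \<le> lam S ^ m * d x y" using lam_gt1 by (intro mult_right_mono power_increasing) auto
      finally show ?thesis using hinv_hom_pow[OF X(1) True] hinv_hom_pow[OF X(2) True] by simp
    next
      case False
      then have mi: "m \<le> i" by simp
      have "d ((\<psi> ^^ (i - m)) x) ((\<psi> ^^ (i - m)) y) \<le> d x y / lam S ^ (i - m)" by (rule backward_close_contract[OF assms])
      also have "\<dots> \<le> d x y" by (rule div_lam_pow_le) simp
      also have "\<dots> \<le> lam S ^ m * d x y" using one[of m] mult_right_mono[of 1 "lam S ^ m" "d x y"] by simp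
      finally show ?thesis using hinv_hom_pow'[OF X(1) mi] hinv_hom_pow'[OF X(2) mi] by simp
    qed
  qed (use X in auto)
qed

text \<open>Points whose backward orbits follow the same orbit in \<open>Q\<close> lie on one unstable set. On it the distance at time \<open>- N\<close>
  controls closeness of backward orbits at a later time \<open>k\<close>.\<close>
lemma same_orbit_close:
  assumes "backward_close S scale q ((\<psi> ^^ N) x)" "backward_close S scale q ((\<psi> ^^ N) y)" "x \<in> X" "y \<in> X"
  shows "backward_close S (lam S ^ (k + N) * d ((\<psi> ^^ N) x) ((\<psi> ^^ N) y)) ((\<phi> ^^ k) x) ((\<phi> ^^ k) y)"
proof -
  have "backward_close S (scale + scale) ((\<psi> ^^ N) x) ((\<psi> ^^ N) y)"
    by (rule backward_close_trans[OF backward_close_sym[OF assms(1)] assms(2)])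
  from backward_close_advance[OF this, of "k + N"]
  show ?thesis using assms(3,4) scale_bounds by (simp add: funpow_add)
qed

text \<open>Limits can be formed in \<open>X\<close> for each coordinate, since the defining conditions are closed. The points of the
  sequence and the limit follow the same point of \<open>Q\<close> in the past, so convergence in \<open>X\<close> implies convergence along
  unstable sets, and the sequence eventually forms rectangles with its limit at any given time.\<close>
lemma compactin_cell:
  assumes q: "q \<in> Q" "q' \<in> Q"
  shows "compactin T {a \<in> X \<times> X. forward_close S scale ((\<phi> ^^ N) (fst a)) ((\<phi> ^^ N) (snd a)) \<and>
     backward_close S scale q ((\<psi> ^^ N) (fst a)) \<and> backward_close S scale q' ((\<psi> ^^ N) (snd a))}" (is "compactin T ?C")
  unfolding Metric_space.compactin_sequentially[OF metric_D]
proof (intro conjI allI impI)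
  have "?C \<subseteq> compact_part N" using q by (auto simp: compact_part_def)
  then show CG: "?C \<subseteq> G" using compact_part_subset by blast
  fix \<sigma> :: "nat \<Rightarrow> 'a \<times> 'a" assume "range \<sigma> \<subseteq> ?C"
  then have \<sigma>: "\<And>n. \<sigma> n \<in> ?C" by auto
  have \<sigma>X: "fst (\<sigma> n) \<in> X" "snd (\<sigma> n) \<in> X" for n using \<sigma>[of n] by auto
  obtain l1 r1 where l1: "l1 \<in> X" "strict_mono r1" "(\<lambda>n. d (fst (\<sigma> (r1 n))) l1) \<longlonglongrightarrow> 0"
    using subsequence[of "\<lambda>n. fst (\<sigma> n)"] \<sigma>X by blast
  obtain l2 r2 where l2: "l2 \<in> X" "strict_mono r2" "(\<lambda>n. d (snd (\<sigma> (r1 (r2 n)))) l2) \<longlonglongrightarrow> 0"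
    using subsequence[of "\<lambda>n. snd (\<sigma> (r1 n))"] \<sigma>X by blast
  define r where "r = r1 \<circ> r2"
  have r: "strict_mono r" unfolding r_def by (rule strict_mono_o[OF l1(2) l2(2)])
  have lim1: "(\<lambda>n. d (fst (\<sigma> (r n))) l1) \<longlonglongrightarrow> 0"
    using LIMSEQ_subseq_LIMSEQ[OF l1(3) l2(2)] by (simp add: r_def comp_def)
  have lim2: "(\<lambda>n. d (snd (\<sigma> (r n))) l2) \<longlonglongrightarrow> 0" using l2(3) by (simp add: r_def)
  define l where "l = (l1, l2)"
  have "l \<in> ?C"
  proof (intro CollectI conjI)
    show "l \<in> X \<times> X" using l1 l2 by (simp add: l_def)
    show "forward_close S scale ((\<phi> ^^ N) (fst l)) ((\<phi> ^^ N) (snd l))"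
      unfolding forward_close_def
    proof (intro conjI allI)
      fix i
      let ?f = "\<phi> ^^ (i + N)"
      have "(\<lambda>n. d (?f (fst (\<sigma> (r n)))) (?f l1) + (scale + d (?f (snd (\<sigma> (r n)))) (?f l2))) \<longlonglongrightarrow> 0 + (scale + 0)"
        by (intro tendsto_add hom_pow_limit tendsto_const lim1 lim2 \<sigma>X l1 l2)
      moreover have "d (?f l1) (?f l2) \<le> d (?f (fst (\<sigma> (r n)))) (?f l1) + (scale + d (?f (snd (\<sigma> (r n)))) (?f l2))" for n
      proof -
        have "d (?f (fst (\<sigma> (r n)))) (?f (snd (\<sigma> (r n)))) \<le> scale"
          using \<sigma>[of "r n"] forward_closeD(3)[of scale "(\<phi> ^^ N) (fst (\<sigma> (r n)))" "(\<phi> ^^ N) (snd (\<sigma> (r n)))" i]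
          by (simp add: funpow_add)
        moreover have "d (?f l1) (?f l2) \<le> d (?f l1) (?f (fst (\<sigma> (r n)))) + d (?f (fst (\<sigma> (r n)))) (?f l2)"
          "d (?f (fst (\<sigma> (r n)))) (?f l2) \<le> d (?f (fst (\<sigma> (r n)))) (?f (snd (\<sigma> (r n)))) + d (?f (snd (\<sigma> (r n)))) (?f l2)"
          using \<sigma>X l1 l2 by (auto intro!: triangle)
        ultimately show ?thesis using commute[of "?f l1" "?f (fst (\<sigma> (r n)))"] by linarith
      qed
      ultimately have "d (?f l1) (?f l2) \<le> 0 + (scale + 0)" by (intro LIMSEQ_le_const) auto
      then show "d ((\<phi> ^^ i) ((\<phi> ^^ N) (fst l))) ((\<phi> ^^ i) ((\<phi> ^^ N) (snd l))) \<le> scale" by (simp add: l_def funpow_add)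
    qed (use l1 l2 in \<open>auto simp: l_def\<close>)
    have B: "backward_close S scale p ((\<psi> ^^ N) y)"
      if p: "p \<in> X" and y: "y \<in> X" and zX: "\<And>n. z n \<in> X" and z: "\<And>n. backward_close S scale p ((\<psi> ^^ N) (z n))"
        and lim: "(\<lambda>n. d (z n) y) \<longlonglongrightarrow> 0" for p y z
      unfolding backward_close_def
    proof (intro conjI allI)
      fix i
      let ?f = "\<psi> ^^ (i + N)"
      have "(\<lambda>n. scale + d (?f (z n)) (?f y)) \<longlonglongrightarrow> scale + 0"
        by (intro tendsto_add tendsto_const hinv_pow_limit lim zX y)
      moreover have "d ((\<psi> ^^ i) p) (?f y) \<le> scale + d (?f (z n)) (?f y)" for n
        using backward_closeD(3)[OF z[of n], of i] triangle[of "(\<psi> ^^ i) p" "?f (z n)" "?f y"] p y zX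
        by (simp add: funpow_add)
      ultimately have "d ((\<psi> ^^ i) p) (?f y) \<le> scale + 0" by (intro LIMSEQ_le_const) auto
      then show "d ((\<psi> ^^ i) p) ((\<psi> ^^ i) ((\<psi> ^^ N) y)) \<le> scale" by (simp add: funpow_add)
    qed (use p y in auto)
    show "backward_close S scale q ((\<psi> ^^ N) (fst l))"
      using B[of q l1 "\<lambda>n. fst (\<sigma> (r n))"] q Q_invariant l1 \<sigma>X \<sigma> lim1 by (auto simp: l_def)
    show "backward_close S scale q' ((\<psi> ^^ N) (snd l))"
      using B[of q' l2 "\<lambda>n. snd (\<sigma> (r n))"] q Q_invariant l2 \<sigma>X \<sigma> lim2 by (auto simp: l_def)
  qed
  then have lC: "fst l \<in> X" "snd l \<in> X" "forward_close S scale ((\<phi> ^^ N) (fst l)) ((\<phi> ^^ N) (snd l))"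
    "backward_close S scale q ((\<psi> ^^ N) (fst l))" "backward_close S scale q' ((\<psi> ^^ N) (snd l))" by auto
  have lG: "l \<in> G" using \<open>l \<in> ?C\<close> CG by blast
  have "limitin T (\<sigma> \<circ> r) l sequentially"
    unfolding limitin_T
  proof (intro conjI allI impI lG)
    fix \<rho> :: real assume "\<rho> > 0"
    obtain K where K: "\<And>k b. k \<ge> K \<Longrightarrow> b \<in> G \<Longrightarrow> rectangle S scale k l b \<Longrightarrow> D l b < \<rho>"
      using rectangle_imp_D_less[OF lG \<open>\<rho> > 0\<close> scale_bounds(1)] eps'_pos by auto
    define k where "k = max K N"
    have ev: "\<forall>\<^sub>F n in sequentially. lam S ^ (k + N) * d ((\<psi> ^^ N) y) ((\<psi> ^^ N) (z n)) < scale"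
      if "y \<in> X" "\<And>n. z n \<in> X" "(\<lambda>n. d (z n) y) \<longlonglongrightarrow> 0" for y z
    proof -
      have "(\<lambda>n. lam S ^ (k + N) * d ((\<psi> ^^ N) (z n)) ((\<psi> ^^ N) y)) \<longlonglongrightarrow> lam S ^ (k + N) * 0"
        by (intro tendsto_mult tendsto_const hinv_pow_limit that)
      from order_tendstoD(2)[OF this, of scale] show ?thesis
        using scale_bounds(1) by (simp add: commute[of _ "(\<psi> ^^ N) y"])
    qed
    have "\<forall>\<^sub>F n in sequentially. lam S ^ (k + N) * d ((\<psi> ^^ N) l1) ((\<psi> ^^ N) (fst (\<sigma> (r n)))) < scale"
      "\<forall>\<^sub>F n in sequentially. lam S ^ (k + N) * d ((\<psi> ^^ N) l2) ((\<psi> ^^ N) (snd (\<sigma> (r n)))) < scale"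
      using ev[OF l1(1) _ lim1] ev[OF l2(1) _ lim2] \<sigma>X by auto
    then show "\<forall>\<^sub>F n in sequentially. (\<sigma> \<circ> r) n \<in> G \<and> D ((\<sigma> \<circ> r) n) l < \<rho>"
    proof eventually_elim
      case (elim n)
      have s: "fst (\<sigma> (r n)) \<in> X" "snd (\<sigma> (r n)) \<in> X" "forward_close S scale ((\<phi> ^^ N) (fst (\<sigma> (r n)))) ((\<phi> ^^ N) (snd (\<sigma> (r n))))"
        "backward_close S scale q ((\<psi> ^^ N) (fst (\<sigma> (r n))))" "backward_close S scale q' ((\<psi> ^^ N) (snd (\<sigma> (r n))))"
        using \<sigma>[of "r n"] by auto
      have "backward_close S scale ((\<phi> ^^ k) (fst l)) ((\<phi> ^^ k) (fst (\<sigma> (r n))))"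
        using backward_close_mono[OF same_orbit_close[OF lC(4) s(4) lC(1) s(1), of k]] elim(1) by (simp add: l_def)
      moreover have "backward_close S scale ((\<phi> ^^ k) (snd l)) ((\<phi> ^^ k) (snd (\<sigma> (r n))))"
        using backward_close_mono[OF same_orbit_close[OF lC(5) s(5) lC(2) s(2), of k]] elim(2) by (simp add: l_def)
      ultimately have "rectangle S scale k l (\<sigma> (r n))"
        unfolding rectangle_def using forward_close_later'[OF lC(3), of k] forward_close_later'[OF s(3), of k] lC(1,2) s(1,2)
        by (simp add: k_def mem_Times_iff)
      moreover have "\<sigma> (r n) \<in> G" using \<sigma> CG by blast
      ultimately show ?case using K[of k "\<sigma> (r n)"] D_commute by (simp add: k_def)
    qed
  qed
  then show "\<exists>l r. l \<in> ?C \<and> strict_mono r \<and> limitin T (\<sigma> \<circ> r) l sequentially"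
    using \<open>l \<in> ?C\<close> r by blast
qed

lemma compactin_compact_part: "compactin T (compact_part N)"
proof -
  let ?C = "\<lambda>q q'. {a \<in> X \<times> X. forward_close S scale ((\<phi> ^^ N) (fst a)) ((\<phi> ^^ N) (snd a)) \<and>
     backward_close S scale q ((\<psi> ^^ N) (fst a)) \<and> backward_close S scale q' ((\<psi> ^^ N) (snd a))}"
  have "compact_part N = \<Union>((\<lambda>(q, q'). ?C q q') ` (Q \<times> Q))" by (auto simp: compact_part_def)
  moreover have "compactin T (\<Union>((\<lambda>(q, q'). ?C q q') ` (Q \<times> Q)))"
    by (rule compactin_Union) (use Q_invariant compactin_cell in auto)
  ultimately show ?thesis by simp
qed

lemma compact_support_iff:
  assumes "\<And>a. a \<notin> G \<Longrightarrow> f a = 0"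
  shows "compact_support T f \<longleftrightarrow> (\<exists>N. \<forall>a. f a \<noteq> 0 \<longrightarrow> a \<in> compact_part N)"
proof
  assume "compact_support T f"
  then obtain N where N: "T closure_of {a \<in> topspace T. f a \<noteq> 0} \<subseteq> compact_part N"
    using compact_imp_compact_part unfolding compact_support_def by blast
  have "{a \<in> topspace T. f a \<noteq> 0} \<subseteq> T closure_of {a \<in> topspace T. f a \<noteq> 0}"
    by (rule closure_of_subset) auto
  then have "a \<in> compact_part N" if "f a \<noteq> 0" for a using that N assms[of a] unfolding topspace_T by blast
  then show "\<exists>N. \<forall>a. f a \<noteq> 0 \<longrightarrow> a \<in> compact_part N" by blast
next
  assume "\<exists>N. \<forall>a. f a \<noteq> 0 \<longrightarrow> a \<in> compact_part N"
  then obtain N where N: "{a \<in> topspace T. f a \<noteq> 0} \<subseteq> compact_part N" by blast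
  have "closedin T (compact_part N)"
    using compactin_imp_closedin[OF Metric_space.Hausdorff_space_mtopology[OF metric_D] compactin_compact_part] .
  then have "T closure_of {a \<in> topspace T. f a \<noteq> 0} \<subseteq> compact_part N" by (rule closure_of_minimal[OF N])
  then show "compact_support T f"
    unfolding compact_support_def by (rule closed_compactin[OF compactin_compact_part]) simp
qed

text \<open>A row is injected into \<open>Q \<times> K\<close>, where \<open>K\<close> is a finite \<open>\<delta>\<close>-net of \<open>X\<close>: the entry \<open>w\<close> is labelled by the point of
  \<open>Q\<close> that it follows in the past and by a point of the net near its position at time \<open>- N\<close>. Entries with equal
  labels are backward close at time \<open>N\<close>; being forward close to \<open>v\<close>, they are forward close to each other,
  and equal by expansivity.\<close>
lemma compact_part_rows: "\<exists>C. \<forall>v. finite {w. (v, w) \<in> compact_part N} \<and> card {w. (v, w) \<in> compact_part N} \<le> C"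
proof -
  \<comment> \<open>Expansion by \<open>lam S ^ (N + N)\<close> from time \<open>- N\<close> to time \<open>N\<close> takes \<open>2 * \<delta>\<close> to \<open>scale\<close>.\<close>
  define \<delta> where "\<delta> = scale / (2 * lam S ^ (N + N))"
  have \<delta>: "0 < \<delta>" "lam S ^ (N + N) * (2 * \<delta>) = scale" using scale_bounds(1) lam_gt1 by (auto simp: \<delta>_def)
  have "compactin mtopology X" using compact by (simp add: compact_space_def)
  then have tb: "mtotally_bounded X" by (rule compactin_imp_mtotally_bounded)
  from tb[unfolded mtotally_bounded_def, rule_format, OF \<delta>(1)]
  obtain K where K: "finite K" "K \<subseteq> X" "X \<subseteq> (\<Union>x\<in>K. mball x \<delta>)" by auto
  have "finite {w. (v, w) \<in> compact_part N} \<and> card {w. (v, w) \<in> compact_part N} \<le> card (Q \<times> K)" for v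
  proof -
    have "\<exists>p. p \<in> Q \<times> K \<and> backward_close S scale (fst p) ((\<psi> ^^ N) w) \<and> d (snd p) ((\<psi> ^^ N) w) < \<delta>" if w: "(v, w) \<in> compact_part N" for w
    proof -
      obtain q where "q \<in> Q" "backward_close S scale q ((\<psi> ^^ N) w)" using compact_partD(5)[OF w] by auto
      moreover have "(\<psi> ^^ N) w \<in> X" using compact_partD(2)[OF w] by simp
      then obtain x where "x \<in> K" "d x ((\<psi> ^^ N) w) < \<delta>" using K(3) by (auto simp: subset_iff)
      ultimately show ?thesis by (intro exI[of _ "(q, x)"]) auto
    qed
    then obtain p where p: "\<And>w. (v, w) \<in> compact_part N \<Longrightarrow> p w \<in> Q \<times> K \<and> backward_close S scale (fst (p w)) ((\<psi> ^^ N) w) \<and> d (snd (p w)) ((\<psi> ^^ N) w) < \<delta>"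
      by metis
    have "inj_on p {w. (v, w) \<in> compact_part N}"
    proof (rule inj_onI)
      fix w w' assume ww: "w \<in> {w. (v, w) \<in> compact_part N}" "w' \<in> {w. (v, w) \<in> compact_part N}" "p w = p w'"
      have wX: "w \<in> X" "w' \<in> X" using ww compact_partD(2) by auto
      have "forward_close S scale ((\<phi> ^^ N) v) ((\<phi> ^^ N) w)" "forward_close S scale ((\<phi> ^^ N) v) ((\<phi> ^^ N) w')"
        using ww compact_partD(3) by fastforce+
      then have F: "forward_close S (scale + scale) ((\<phi> ^^ N) w) ((\<phi> ^^ N) w')"
        using forward_close_trans forward_close_sym by blast
      have "d ((\<psi> ^^ N) w) ((\<psi> ^^ N) w') < 2 * \<delta>"
        using triangle[of "(\<psi> ^^ N) w" "snd (p w)" "(\<psi> ^^ N) w'"] p[of w] p[of w'] ww wX K(2)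
          commute[of "(\<psi> ^^ N) w" "snd (p w)"] by (auto simp: mem_Times_iff subset_iff)
      then have "lam S ^ (N + N) * d ((\<psi> ^^ N) w) ((\<psi> ^^ N) w') \<le> lam S ^ (N + N) * (2 * \<delta>)"
        using lam_gt1 by (intro mult_left_mono) auto
      then have "lam S ^ (N + N) * d ((\<psi> ^^ N) w) ((\<psi> ^^ N) w') \<le> scale" unfolding \<delta>(2) .
      then have "backward_close S scale ((\<phi> ^^ N) w) ((\<phi> ^^ N) w')"
        using backward_close_mono[OF same_orbit_close[OF _ _ wX, of "fst (p w)" N N]] p[of w] p[of w'] ww by simp
      then have "backward_close S (scale + scale) ((\<phi> ^^ N) w) ((\<phi> ^^ N) w')"
        using backward_close_mono scale_bounds(1) by fastforce
      then have "(\<phi> ^^ N) w = (\<phi> ^^ N) w'" using expansive[OF F] scale_bounds(3) by simp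
      then show "w = w'" using hom_pow_inj wX by blast
    qed
    moreover have "p ` {w. (v, w) \<in> compact_part N} \<subseteq> Q \<times> K" using p by blast
    moreover have "finite (Q \<times> K)" using K Q_invariant by simp
    ultimately show ?thesis using card_inj_on_le inj_on_finite by blast
  qed
  then show ?thesis by blast
qed

end

section \<open>Compactly supported Lipschitz functions\<close>

lemma div_shift_le:
  fixes k s L :: nat
  assumes "0 < L" shows "k div L \<le> (k - s) div L + s"
proof -
  have "k \<le> (k - s) + s * L" using assms by (cases L) auto
  then have "k div L \<le> ((k - s) + s * L) div L" by (rule div_le_mono)
  then show ?thesis using assms by simp
qed

lemma half_pow_shift:
  fixes m n s :: nat
  assumes "m \<le> n + s" shows "(1 / 2 :: real) ^ n \<le> 2 ^ s * (1 / 2) ^ m"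
proof -
  have "2 ^ s * (1 / 2 :: real) ^ (n + s) \<le> 2 ^ s * (1 / 2) ^ m"
    using assms by (intro mult_left_mono power_decreasing) auto
  moreover have "2 ^ s * (1 / 2 :: real) ^ (n + s) = (1 / 2) ^ n"
    by (simp add: power_add power_divide)
  ultimately show ?thesis by simp
qed

text \<open>The relation \<open>Rel\<close> is a partial bijection that matches every index of either sum. An index outside its summation set
  has a vanishing term, so the difference is a sum over at most \<open>card A + card A'\<close> matched pairs.\<close>
lemma matched_sums_close:
  fixes F F' :: "'b \<Rightarrow> complex"
  assumes fin: "finite A" "finite A'" and B: "0 \<le> B"
    and tot: "\<And>w. w \<in> A \<Longrightarrow> \<exists>w'. Rel w w'" "\<And>w'. w' \<in> A' \<Longrightarrow> \<exists>w. Rel w w'"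
    and uniq: "\<And>w w' w''. Rel w w' \<Longrightarrow> Rel w w'' \<Longrightarrow> w' = w''" "\<And>w w' w''. Rel w w'' \<Longrightarrow> Rel w' w'' \<Longrightarrow> w = w'"
    and zero: "\<And>w. w \<notin> A \<Longrightarrow> F w = 0" "\<And>w. w \<notin> A' \<Longrightarrow> F' w = 0"
    and est: "\<And>w w'. Rel w w' \<Longrightarrow> w \<in> A \<or> w' \<in> A' \<Longrightarrow> cmod (F w - F' w') \<le> B"
  shows "cmod (sum F A - sum F' A') \<le> real (card A + card A') * B"
proof -
  obtain g where g: "\<And>w'. w' \<in> A' \<Longrightarrow> Rel (g w') w'" using tot(2) by metis
  define C where "C = A \<union> g ` A'"
  have "\<exists>w'. Rel w w'" if "w \<in> C" for w using that tot(1) g by (auto simp: C_def)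
  then obtain h where h: "\<And>w. w \<in> C \<Longrightarrow> Rel w (h w)" by metis
  have finC: "finite C" using fin by (simp add: C_def)
  have inj: "inj_on h C" using h uniq(2) by (metis inj_onI)
  have hg: "h (g w') = w'" if "w' \<in> A'" for w' using that g h uniq(1) by (metis C_def UnI2 imageI)
  have "sum F A = sum F C"
    by (rule sum.mono_neutral_left) (use finC zero in \<open>auto simp: C_def\<close>)
  moreover have "sum F' A' = sum F' (h ` C)"
  proof (rule sum.mono_neutral_left)
    show "A' \<subseteq> h ` C"
    proof
      fix w' assume w': "w' \<in> A'"
      then have "g w' \<in> C" by (simp add: C_def)
      then show "w' \<in> h ` C" using hg[OF w'] by (metis imageI)
    qed
  qed (use finC zero in auto)
  moreover have "sum F' (h ` C) = (\<Sum>w\<in>C. F' (h w))" using inj by (simp add: sum.reindex)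
  ultimately have "sum F A - sum F' A' = (\<Sum>w\<in>C. F w - F' (h w))" by (simp add: sum_subtractf)
  also have "cmod \<dots> \<le> (\<Sum>w\<in>C. B)"
  proof (rule sum_norm_le)
    fix w assume w: "w \<in> C"
    then have "w \<in> A \<or> h w \<in> A'" using hg by (auto simp: C_def)
    then show "cmod (F w - F' (h w)) \<le> B" using est[OF h[OF w]] by blast
  qed
  also have "\<dots> = real (card C) * B" by simp
  also have "\<dots> \<le> real (card A + card A') * B"
  proof (intro mult_right_mono B)
    have "card C \<le> card A + card (g ` A')" unfolding C_def by (rule card_Un_le)
    also have "\<dots> \<le> card A + card A'" using card_image_le[OF fin(2), of g] by simp
    finally show "real (card C) \<le> real (card A + card A')" by simp
  qed
  finally show ?thesis .
qed

context self_similar_smale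
begin

abbreviation Lip where "Lip \<equiv> Lip_c G D"

lemma bounded_if_Cc:
  assumes "f \<in> Cc T" shows "\<exists>M\<ge>0. \<forall>a. cmod (f a) \<le> M"
proof -
  have f: "\<And>a. a \<notin> G \<Longrightarrow> f a = 0" "continuous_map T euclidean f" "compact_support T f"
    using assms topspace_T by (auto simp: Cc_def)
  let ?K = "T closure_of {a \<in> topspace T. f a \<noteq> 0}"
  have "compactin euclidean (f ` ?K)"
    using f(3) image_compactin[OF _ f(2)] by (auto simp: compact_support_def)
  then have "bounded (f ` ?K)" by (simp add: compact_imp_bounded)
  then obtain M where M: "\<And>a. a \<in> ?K \<Longrightarrow> cmod (f a) \<le> M" by (auto simp: bounded_iff)
  have sub: "{a \<in> topspace T. f a \<noteq> 0} \<subseteq> ?K" by (rule closure_of_subset) auto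
  have "cmod (f a) \<le> max M 0" for a
  proof (cases "f a = 0")
    case False
    then have "a \<in> ?K" using f(1)[of a] sub topspace_T by blast
    then show ?thesis using M[of a] by simp
  qed simp
  then show ?thesis by (intro exI[of _ "max M 0"]) auto
qed

lemma Cc_support:
  assumes "f \<in> Cc T" shows "\<exists>N. \<forall>a. f a \<noteq> 0 \<longrightarrow> a \<in> compact_part N"
  using assms compact_support_iff[of f] topspace_T by (auto simp: Cc_def)

lemma LipD:
  assumes "f \<in> Lip"
  shows "a \<notin> G \<Longrightarrow> f a = 0" "\<exists>C. \<forall>a\<in>G. \<forall>b\<in>G. cmod (f a - f b) \<le> C * D a b" "compact_support T f"
  using assms unfolding Lip_c_def by blast+

lemma LipI:
  assumes "\<And>a. a \<notin> G \<Longrightarrow> f a = 0" "\<And>a b. a \<in> G \<Longrightarrow> b \<in> G \<Longrightarrow> cmod (f a - f b) \<le> C * D a b"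
    "compact_support T f"
  shows "f \<in> Lip"
  using assms unfolding Lip_c_def by blast

lemma Lip_subset_Cc: "Lip \<subseteq> Cc T"
proof
  fix f assume fL: "f \<in> Lip"
  obtain C where f: "\<And>a. a \<notin> G \<Longrightarrow> f a = 0" "\<And>a b. a \<in> G \<Longrightarrow> b \<in> G \<Longrightarrow> cmod (f a - f b) \<le> C * D a b"
    "compact_support T f"
    using LipD[OF fL] by blast
  have "openin T {a \<in> topspace T. f a \<in> U}" if U: "open U" for U
    unfolding Metric_space.openin_mtopology[OF metric_D] topspace_T
  proof (intro conjI allI impI)
    fix a assume a: "a \<in> {a \<in> G. f a \<in> U}"
    then obtain e where e: "e > 0" "\<And>y. dist y (f a) < e \<Longrightarrow> y \<in> U" using U by (auto simp: open_dist)
    show "\<exists>r>0. Metric_space.mball G D a r \<subseteq> {a \<in> G. f a \<in> U}"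
    proof (intro exI[of _ "e / (\<bar>C\<bar> + 1)"] conjI subsetI)
      show "0 < e / (\<bar>C\<bar> + 1)" using e by simp
      fix b assume "b \<in> Metric_space.mball G D a (e / (\<bar>C\<bar> + 1))"
      then have b: "b \<in> G" "D a b < e / (\<bar>C\<bar> + 1)" by (auto simp: Metric_space.in_mball[OF metric_D])
      have "dist (f b) (f a) \<le> C * D b a" using f(2)[OF b(1), of a] a by (simp add: dist_norm)
      also have "\<dots> \<le> (\<bar>C\<bar> + 1) * D b a" by (intro mult_right_mono D_nonneg) simp
      also have "\<dots> < e" using b(2) D_commute[of a b] by (simp add: pos_less_divide_eq mult.commute)
      finally show "b \<in> {a \<in> G. f a \<in> U}" using e b by simp
    qed
  qed auto
  then have "continuous_map T euclidean f" by (auto simp: continuous_map_def)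
  then show "f \<in> Cc T" using f topspace_T by (auto simp: Cc_def)
qed

lemma Lip_bounds:
  assumes "f \<in> Lip"
  obtains N M where "\<And>a. f a \<noteq> 0 \<Longrightarrow> a \<in> compact_part N" "0 \<le> M" "\<And>a. cmod (f a) \<le> M"
  using assms Cc_support[of f] bounded_if_Cc[of f] Lip_subset_Cc by blast

lemma Lip_outside: "f \<in> Lip \<Longrightarrow> a \<notin> G \<Longrightarrow> f a = 0"
  by (rule LipD(1))

text \<open>A rectangle at time \<open>k\<close> with a corner pair in the support, whose entry time is bounded, gives a distance of order
  \<open>(1/2)\<^bsup>k/L\<^esup>\<close>. For small \<open>k\<close> the estimate follows from boundedness.\<close>
lemma Lip_rectangle:
  assumes f: "f \<in> Lip"
  shows "\<exists>C\<ge>0. \<forall>a\<in>G. \<forall>b\<in>G. \<forall>k. rectangle S (eps' S / 8) k a b \<longrightarrow> cmod (f a - f b) \<le> C * (1 / 2) ^ (k div L)"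
proof -
  obtain N M where NM: "\<And>a. f a \<noteq> 0 \<Longrightarrow> a \<in> compact_part N" "0 \<le> M" "\<And>a. cmod (f a) \<le> M" using Lip_bounds[OF f] by blast
  obtain C0 where C0: "\<And>a b. a \<in> G \<Longrightarrow> b \<in> G \<Longrightarrow> cmod (f a - f b) \<le> C0 * D a b"
    using LipD(2)[OF f] by blast
  \<comment> \<open>On the support entry times are at most \<open>N\<close>, so \<open>depth a n\<close> is at most \<open>s + n * L\<close>.\<close>
  define s where "s = N + 1"
  define C where "C = max \<bar>C0\<bar> (2 * M) * 2 ^ s"
  have C: "0 \<le> C" "\<bar>C0\<bar> * 2 ^ s \<le> C" "2 * M * 2 ^ s \<le> C"
    using NM(2) by (auto simp: C_def intro!: mult_right_mono)
  have main: "cmod (f a - f b) \<le> C * (1 / 2) ^ (k div L)"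
    if ab: "a \<in> G" "b \<in> G" and r: "rectangle S (eps' S / 8) k a b" and fa: "f a \<noteq> 0" for a b k
  proof (cases "s \<le> k")
    case True
    have "time a \<le> N" using time_compact_part NM(1)[OF fa] by blast
    then have "depth a ((k - s) div L) \<le> s + (k - s)"
      unfolding depth_def by (intro add_mono) (auto simp: s_def)
    then have "depth a ((k - s) div L) \<le> k" using True by simp
    then have "R (Suc ((k - s) div L)) a b" using rectangle_imp_R[OF ab(1) r _ order_refl] eps'_pos by simp
    then have "D a b \<le> (1 / 2) ^ Suc ((k - s) div L)" by (rule D_le[OF ab])
    also have "\<dots> \<le> (1 / 2) ^ ((k - s) div L)" by simp
    also have "\<dots> \<le> 2 ^ s * (1 / 2) ^ (k div L)" by (rule half_pow_shift[OF div_shift_le[OF L_pos]])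
    finally have "\<bar>C0\<bar> * D a b \<le> \<bar>C0\<bar> * (2 ^ s * (1 / 2) ^ (k div L))" by (intro mult_left_mono) auto
    moreover have "C0 * D a b \<le> \<bar>C0\<bar> * D a b" by (intro mult_right_mono D_nonneg) simp
    moreover have "\<bar>C0\<bar> * 2 ^ s * (1 / 2) ^ (k div L) \<le> C * (1 / 2) ^ (k div L)" using C by (intro mult_right_mono) auto
    moreover have "\<bar>C0\<bar> * (2 ^ s * (1 / 2) ^ (k div L)) = \<bar>C0\<bar> * 2 ^ s * (1 / 2) ^ (k div L)" by simp
    ultimately show ?thesis using C0[OF ab] by linarith
  next
    case False
    have "cmod (f a - f b) \<le> 2 * M" using norm_triangle_ineq4[of "f a" "f b"] NM(3)[of a] NM(3)[of b] by simp
    also have "\<dots> \<le> 2 * M * (2 ^ s * (1 / 2) ^ (k div L))"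
    proof -
      have "k div L \<le> 0 + s" using False div_le_dividend[of k L] by linarith
      from half_pow_shift[OF this] show ?thesis using NM(2) mult_left_mono[of 1 _ "2 * M"] by simp
    qed
    also have "\<dots> \<le> C * (1 / 2) ^ (k div L)" using mult_right_mono[OF C(3), of "(1 / 2) ^ (k div L)"] by (simp add: mult.assoc)
    finally show ?thesis .
  qed
  have "cmod (f a - f b) \<le> C * (1 / 2) ^ (k div L)" if "a \<in> G" "b \<in> G" "rectangle S (eps' S / 8) k a b" for a b k
  proof -
    consider "f a \<noteq> 0" | "f b \<noteq> 0" | "f a = 0" "f b = 0" by blast
    then show ?thesis
      using main[OF that] main[OF that(2,1) rectangle_sym[OF that(3)]] C(1)
      by cases (auto simp: norm_minus_commute)
  qed
  then show ?thesis using C(1) by blast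
qed

text \<open>Converse of \<open>Lip_rectangle\<close>, for rectangles of any fixed size: points at distance of order \<open>(1/2)\<^sup>n\<close> are
  contained in a common member of the cover of index \<open>n\<close>, hence form a rectangle at a time not much smaller
  than \<open>n * L\<close>. The freedom in \<open>r\<close> lets the algebraic operations enlarge rectangles.\<close>
lemma Lip_if_rectangle:
  assumes out: "\<And>a. a \<notin> G \<Longrightarrow> f a = 0" and supp: "\<And>a. f a \<noteq> 0 \<Longrightarrow> a \<in> compact_part N" and M: "\<And>a. cmod (f a) \<le> M"
    and r: "0 < r" "r \<le> eps' S" and C: "0 \<le> C"
    and est: "\<And>a b k. a \<in> G \<Longrightarrow> b \<in> G \<Longrightarrow> rectangle S r k a b \<Longrightarrow> cmod (f a - f b) \<le> C * (1 / 2) ^ (k div L)"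
  shows "f \<in> Lip"
proof -
  have M0: "0 \<le> M" using M[of undefined] norm_ge_zero order_trans by blast
  obtain K where K: "\<And>n a b. a \<in> compact_part N \<Longrightarrow> R (Suc n) a b \<Longrightarrow> K \<le> n * L \<Longrightarrow>
     \<exists>t. n * L \<le> t + K \<and> N \<le> t \<and> rectangle S r t a b"
    using compact_part_R_rectangle[OF r] by blast
  \<comment> \<open>The first entry of the maximum takes care of distant points, the second one of those close enough
    to form a rectangle.\<close>
  define C' where "C' = max (2 * M * 2 ^ (K + 1)) (C * 2 ^ K * 4) * 4"
  have C': "0 \<le> C'" "2 * M * 2 ^ (K + 1) * 4 \<le> C'" "C * 2 ^ K * 4 * 4 \<le> C'"
    using M0 C by (auto simp: C'_def le_max_iff_disj)
  have main: "cmod (f a - f b) \<le> C' * D a b" if ab: "a \<in> G" "b \<in> G" and fa: "f a \<noteq> 0" for a b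
  proof -
    define x where "x = 4 * D a b"
    consider "a = b" | "(1 / 2) ^ (K + 1) \<le> x" | "a \<noteq> b" "x < (1 / 2) ^ (K + 1)" by linarith
    then show ?thesis
    proof cases
      case 1
      then show ?thesis using C' D_nonneg by simp
    next
      case 2
      have "1 \<le> 2 ^ (K + 1) * x" using 2 by (simp add: power_divide field_simps)
      then have "2 * M * 1 \<le> 2 * M * (2 ^ (K + 1) * x)" using M0 by (intro mult_left_mono) auto
      also have "\<dots> = 2 * M * 2 ^ (K + 1) * 4 * D a b" by (simp add: x_def)
      also have "\<dots> \<le> C' * D a b" by (intro mult_right_mono C' D_nonneg)
      finally show ?thesis using norm_triangle_ineq4[of "f a" "f b"] M[of a] M[of b] by simp
    next
      case 3
      have "D a b \<noteq> 0" using 3(1) Metric_space.zero[OF metric_D ab] by simp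
      then have x0: "0 < x" using D_nonneg[of a b] by (simp add: x_def)
      have "x < 1" using 3(2) power_le_one[of "1 / 2 :: real" "K + 1"] by simp
      then obtain n' where n': "(1 / 2) ^ Suc n' \<le> x" "x < (1 / 2) ^ n'" using dyadic_bracket x0 by blast
      have "(1 / 2 :: real) ^ Suc n' < (1 / 2) ^ (K + 1)" using n' 3(2) by linarith
      have "K + 1 < Suc n'"
      proof (rule ccontr)
        assume "\<not> K + 1 < Suc n'"
        then have "(1 / 2 :: real) ^ (K + 1) \<le> (1 / 2) ^ Suc n'" by (intro power_decreasing) auto
        then show False using \<open>(1 / 2) ^ Suc n' < (1 / 2) ^ (K + 1)\<close> by linarith
      qed
      then obtain n where n: "n' = Suc n" "K \<le> n" by (cases n') auto
      have "R (Suc n) a b" using R_if_D_less[OF ab] n'(2) n(1) by (simp add: x_def)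
      moreover have "K \<le> n * L" using n(2) L_pos le_trans[OF n(2), of "n * L"] by simp
      ultimately obtain t where t: "n * L \<le> t + K" "rectangle S r t a b" using K[OF supp[OF fa]] by blast
      have "n = (n * L) div L" using L_pos by simp
      also have "\<dots> \<le> (t + K) div L" using t(1) by (rule div_le_mono)
      also have "\<dots> \<le> t div L + K" using div_shift_le[OF L_pos, of "t + K" K] by simp
      finally have "(1 / 2 :: real) ^ (t div L) \<le> 2 ^ K * (1 / 2) ^ n" by (rule half_pow_shift)
      also have "\<dots> = 2 ^ K * 4 * (1 / 2) ^ Suc n'" by (simp add: n)
      also have "\<dots> \<le> 2 ^ K * 4 * x" using n'(1) by (intro mult_left_mono) auto
      finally have "C * (1 / 2) ^ (t div L) \<le> C * (2 ^ K * 4 * x)" using C by (intro mult_left_mono) auto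
      also have "\<dots> = C * 2 ^ K * 4 * 4 * D a b" by (simp add: x_def)
      also have "\<dots> \<le> C' * D a b" by (intro mult_right_mono C' D_nonneg)
      finally show ?thesis using est[OF ab t(2)] by linarith
    qed
  qed
  have "cmod (f a - f b) \<le> C' * D a b" if "a \<in> G" "b \<in> G" for a b
  proof -
    consider "f a \<noteq> 0" | "f b \<noteq> 0" | "f a = 0" "f b = 0" by blast
    then show ?thesis
    proof cases
      case 2
      then show ?thesis using main[OF that(2,1)] D_commute[of a b] by (simp add: norm_minus_commute)
    qed (use main[OF that] C'(1) D_nonneg in auto)
  qed
  moreover have "compact_support T f" using compact_support_iff[of f] out supp by blast
  ultimately show ?thesis using out by (intro LipI)
qed

lemma compact_part_banded: "\<exists>C. \<forall>f M. (\<forall>a. f a \<noteq> 0 \<longrightarrow> a \<in> compact_part N) \<longrightarrow> (\<forall>a. cmod (f a) \<le> M) \<longrightarrow> banded G C M f"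
proof -
  obtain C where C: "\<And>v. finite {w. (v, w) \<in> compact_part N} \<and> card {w. (v, w) \<in> compact_part N} \<le> C" using compact_part_rows by blast
  have "banded G C M f" if f: "\<And>a. f a \<noteq> 0 \<Longrightarrow> a \<in> compact_part N" "\<And>a. cmod (f a) \<le> M" for f M
  proof -
    have "supp_row G f v \<subseteq> {w. (v, w) \<in> compact_part N}" "supp_col G f v \<subseteq> {w. (v, w) \<in> compact_part N}" for v
      using f(1) compact_part_swap by (auto simp: supp_row_def supp_col_def)
    then have "finite (supp_row G f v) \<and> card (supp_row G f v) \<le> C" "finite (supp_col G f v) \<and> card (supp_col G f v) \<le> C" for v
      using C[of v] by (meson finite_subset card_mono order_trans)+
    moreover have "0 \<le> M" using f(2)[of undefined] norm_ge_zero order_trans by blast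
    ultimately show ?thesis using f(2) by (auto simp: banded_def)
  qed
  then show ?thesis by blast
qed

lemma Cc_banded: "f \<in> Cc T \<Longrightarrow> \<exists>N M. banded G N M f"
  using Cc_support[of f] bounded_if_Cc[of f] compact_part_banded by blast

subsection \<open>Algebraic operations\<close>

lemma Lip_zero: "(\<lambda>_. 0) \<in> Lip"
  by (rule Lip_if_rectangle[where M = 0 and r = scale and C = 0 and N = 0]) (use scale_bounds in auto)

lemma Lip_add:
  assumes "f \<in> Lip" "g \<in> Lip" shows "(\<lambda>a. f a + g a) \<in> Lip"
proof -
  obtain N M where f: "\<And>a. f a \<noteq> 0 \<Longrightarrow> a \<in> compact_part N" "0 \<le> M" "\<And>a. cmod (f a) \<le> M" using Lip_bounds[OF assms(1)] by blast
  obtain N' M' where g: "\<And>a. g a \<noteq> 0 \<Longrightarrow> a \<in> compact_part N'" "0 \<le> M'" "\<And>a. cmod (g a) \<le> M'" using Lip_bounds[OF assms(2)] by blast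
  obtain C where C: "\<And>a b. a \<in> G \<Longrightarrow> b \<in> G \<Longrightarrow> cmod (f a - f b) \<le> C * D a b" using LipD(2)[OF assms(1)] by blast
  obtain C' where C': "\<And>a b. a \<in> G \<Longrightarrow> b \<in> G \<Longrightarrow> cmod (g a - g b) \<le> C' * D a b" using LipD(2)[OF assms(2)] by blast
  have "cmod ((f a + g a) - (f b + g b)) \<le> (C + C') * D a b" if "a \<in> G" "b \<in> G" for a b
    using norm_triangle_ineq[of "f a - f b" "g a - g b"] C[OF that] C'[OF that] by (simp add: algebra_simps)
  moreover have "a \<in> compact_part (N + N')" if "f a + g a \<noteq> 0" for a
  proof -
    have "f a \<noteq> 0 \<or> g a \<noteq> 0" using that by auto
    then show ?thesis using f(1)[of a] g(1)[of a] compact_part_mono[of N "N + N'"] compact_part_mono[of N' "N + N'"] by auto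
  qed
  then have "compact_support T (\<lambda>a. f a + g a)"
    using compact_support_iff[of "\<lambda>a. f a + g a"] Lip_outside[OF assms(1)] Lip_outside[OF assms(2)] by auto
  ultimately show ?thesis
    by (intro LipI[where C = "C + C'"]) (simp_all add: Lip_outside[OF assms(1)] Lip_outside[OF assms(2)])
qed

lemma Lip_scale:
  assumes "f \<in> Lip" shows "(\<lambda>a. c * f a) \<in> Lip"
proof -
  obtain N M where f: "\<And>a. f a \<noteq> 0 \<Longrightarrow> a \<in> compact_part N" "0 \<le> M" "\<And>a. cmod (f a) \<le> M" using Lip_bounds[OF assms] by blast
  obtain C where C: "\<And>a b. a \<in> G \<Longrightarrow> b \<in> G \<Longrightarrow> cmod (f a - f b) \<le> C * D a b" using LipD(2)[OF assms] by blast
  have "cmod (c * f a - c * f b) \<le> cmod c * C * D a b" if "a \<in> G" "b \<in> G" for a b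
    using mult_left_mono[OF C[OF that], of "cmod c"] by (simp add: norm_mult[symmetric] right_diff_distrib[symmetric] mult.assoc)
  moreover have "\<exists>N. \<forall>a. c * f a \<noteq> 0 \<longrightarrow> a \<in> compact_part N" using f(1) by (intro exI[of _ N]) auto
  then have "compact_support T (\<lambda>a. c * f a)"
    using compact_support_iff[of "\<lambda>a. c * f a"] Lip_outside[OF assms] by simp
  ultimately show ?thesis
    by (intro LipI[where C = "cmod c * C"]) (simp_all add: Lip_outside[OF assms])
qed

lemma rectangle_flip:
  "rectangle S r k (v, w) (v', w') \<Longrightarrow> rectangle S r k (w, v) (w', v')"
  by (auto simp: rectangle_def forward_close_sym)

lemma Lip_invol:
  assumes "f \<in> Lip" shows "invol f \<in> Lip"
proof -
  obtain N M where f: "\<And>a. f a \<noteq> 0 \<Longrightarrow> a \<in> compact_part N" "0 \<le> M" "\<And>a. cmod (f a) \<le> M" using Lip_bounds[OF assms] by blast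
  obtain C where C: "0 \<le> C" "\<And>a b k. a \<in> G \<Longrightarrow> b \<in> G \<Longrightarrow> rectangle S (eps' S / 8) k a b \<Longrightarrow> cmod (f a - f b) \<le> C * (1 / 2) ^ (k div L)"
    using Lip_rectangle[OF assms] by blast
  show ?thesis
  proof (rule Lip_if_rectangle[where N = N and M = M and r = "eps' S / 8" and C = C])
    fix a assume "a \<notin> G"
    then have "(snd a, fst a) \<notin> G" using stable_groupoid_sym by (metis prod.collapse)
    then show "invol f a = 0" using Lip_outside[OF assms] by (simp add: invol_def case_prod_unfold)
  next
    fix a assume "invol f a \<noteq> 0"
    then have "(snd a, fst a) \<in> compact_part N" using f(1) by (auto simp: invol_def case_prod_unfold)
    then show "a \<in> compact_part N" using compact_part_swap by (metis prod.collapse)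
  next
    fix a b k assume ab: "a \<in> G" "b \<in> G" "rectangle S (eps' S / 8) k a b"
    have "(snd a, fst a) \<in> G" "(snd b, fst b) \<in> G" using ab stable_groupoid_sym by (metis prod.collapse)+
    moreover have "rectangle S (eps' S / 8) k (snd a, fst a) (snd b, fst b)"
      using rectangle_flip[of _ k "fst a" "snd a" "fst b" "snd b"] ab(3) by simp
    ultimately have "cmod (f (snd a, fst a) - f (snd b, fst b)) \<le> C * (1 / 2) ^ (k div L)" by (rule C(2))
    then show "cmod (invol f a - invol f b) \<le> C * (1 / 2) ^ (k div L)"
      by (simp add: invol_def case_prod_unfold flip: complex_cnj_diff)
  qed (use f C eps'_pos in \<open>auto simp: invol_def case_prod_unfold\<close>)
qed

lemma conv_eq_sum:
  assumes "f \<in> Lip" "\<And>a. f a \<noteq> 0 \<Longrightarrow> a \<in> compact_part N" "(v, z) \<in> G"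
  shows "finite {w. f (v, w) * g (w, z) \<noteq> 0}" "conv G f g (v, z) = (\<Sum>w | f (v, w) * g (w, z) \<noteq> 0. f (v, w) * g (w, z))"
proof -
  have sub: "{w. f (v, w) * g (w, z) \<noteq> 0} \<subseteq> {w. (v, w) \<in> compact_part N}" using assms(2) by auto
  then show fin: "finite {w. f (v, w) * g (w, z) \<noteq> 0}" using compact_part_rows finite_subset by meson
  have "(\<Sum>\<^sub>\<infinity>w\<in>{w. (v, w) \<in> G}. f (v, w) * g (w, z)) = (\<Sum>w | f (v, w) * g (w, z) \<noteq> 0. f (v, w) * g (w, z))"
    by (rule infsum_finite_support[OF fin]) (use sub compact_part_subset in auto)
  then show "conv G f g (v, z) = (\<Sum>w | f (v, w) * g (w, z) \<noteq> 0. f (v, w) * g (w, z))"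
    using assms(3) by (simp add: conv_def)
qed

text \<open>The point \<open>w'\<close> is the bracket at time \<open>k\<close> of \<open>v'\<close> and \<open>w\<close>, the projection of \<open>w\<close> along unstable sets to the stable
  set of \<open>v'\<close>.\<close>
lemma rectangle_fill:
  assumes \<gamma>: "\<And>x y. x \<in> X \<Longrightarrow> y \<in> X \<Longrightarrow> d x y \<le> \<gamma> \<Longrightarrow> forward_close S scale x (br x y) \<and> backward_close S scale y (br x y)"
    and "rectangle S r k (v, z) (v', z')" "w \<in> X" "forward_close S r ((\<phi> ^^ k) v) ((\<phi> ^^ k) w)" "2 * r \<le> \<gamma>" "r \<le> scale"
  shows "\<exists>w'\<in>X. forward_close S scale ((\<phi> ^^ k) v') ((\<phi> ^^ k) w') \<and> backward_close S scale ((\<phi> ^^ k) w) ((\<phi> ^^ k) w')"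
proof -
  note R = rectangleD[OF assms(2), simplified]
  have "d ((\<phi> ^^ k) v') ((\<phi> ^^ k) w) \<le> 2 * r"
    using triangle[of "(\<phi> ^^ k) v'" "(\<phi> ^^ k) v" "(\<phi> ^^ k) w"] R(1,3) assms(3)
      backward_closeD(4)[OF R(5)] forward_closeD(4)[OF assms(4)] commute[of "(\<phi> ^^ k) v'" "(\<phi> ^^ k) v"] by simp
  then have b: "forward_close S scale ((\<phi> ^^ k) v') (br ((\<phi> ^^ k) v') ((\<phi> ^^ k) w))"
    "backward_close S scale ((\<phi> ^^ k) w) (br ((\<phi> ^^ k) v') ((\<phi> ^^ k) w))"
    using \<gamma>[of "(\<phi> ^^ k) v'" "(\<phi> ^^ k) w"] R assms by auto
  have bX: "br ((\<phi> ^^ k) v') ((\<phi> ^^ k) w) \<in> X" using forward_closeD(2)[OF b(1)] .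
  show ?thesis
    by (rule bexI[of _ "(\<psi> ^^ k) (br ((\<phi> ^^ k) v') ((\<phi> ^^ k) w))"]) (use b bX in auto)
qed

text \<open>Given a rectangle with sides \<open>(v, z)\<close> and \<open>(v', z')\<close> at time \<open>k\<close>, the relation \<open>Rel\<close> matches the intermediate points
  \<open>w\<close> and \<open>w'\<close> by projecting along unstable sets; it is a partial bijection by expansivity. Matched terms differ by
  \<open>O((1/2)\<^bsup>k/L\<^esup>)\<close> as both factors vary over rectangles, and the number of terms is bounded by \<open>compact_part_rows\<close>.\<close>
lemma Lip_conv:
  assumes f: "f \<in> Lip" and g: "g \<in> Lip" shows "conv G f g \<in> Lip"
proof -
  obtain N1 M1 where f1: "\<And>a. f a \<noteq> 0 \<Longrightarrow> a \<in> compact_part N1" "0 \<le> M1" "\<And>a. cmod (f a) \<le> M1" using Lip_bounds[OF f] by blast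
  obtain N2 M2 where g2: "\<And>a. g a \<noteq> 0 \<Longrightarrow> a \<in> compact_part N2" "0 \<le> M2" "\<And>a. cmod (g a) \<le> M2" using Lip_bounds[OF g] by blast
  obtain C1 where C1: "0 \<le> C1" "\<And>a b k. a \<in> G \<Longrightarrow> b \<in> G \<Longrightarrow> rectangle S (eps' S / 8) k a b \<Longrightarrow> cmod (f a - f b) \<le> C1 * (1 / 2) ^ (k div L)"
    using Lip_rectangle[OF f] by blast
  obtain C2 where C2: "0 \<le> C2" "\<And>a b k. a \<in> G \<Longrightarrow> b \<in> G \<Longrightarrow> rectangle S (eps' S / 8) k a b \<Longrightarrow> cmod (g a - g b) \<le> C2 * (1 / 2) ^ (k div L)"
    using Lip_rectangle[OF g] by blast
  define N where "N = N1 + N2"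
  have fN: "a \<in> compact_part N" if "f a \<noteq> 0" for a using f1(1)[OF that] compact_part_mono[of N1 N] by (auto simp: N_def)
  have gN: "a \<in> compact_part N" if "g a \<noteq> 0" for a using g2(1)[OF that] compact_part_mono[of N2 N] by (auto simp: N_def)
  obtain C where C: "\<And>v. finite {w. (v, w) \<in> compact_part N} \<and> card {w. (v, w) \<in> compact_part N} \<le> C" using compact_part_rows by blast
  define A where "A v z = {w. f (v, w) * g (w, z) \<noteq> 0}" for v z
  have A: "finite (A v z)" "card (A v z) \<le> C" for v z
  proof -
    have "A v z \<subseteq> {w. (v, w) \<in> compact_part N}" using fN by (auto simp: A_def)
    then show "finite (A v z)" "card (A v z) \<le> C" using C[of v] by (meson finite_subset card_mono order_trans)+
  qed
  have conv: "conv G f g (v, z) = (\<Sum>w\<in>A v z. f (v, w) * g (w, z))" if "(v, z) \<in> G" for v z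
    using conv_eq_sum(2)[OF f fN that, of g] by (simp add: A_def)
  define M where "M = real C * (M1 * M2)"
  have M: "0 \<le> M" using f1 g2 by (simp add: M_def)
  have bound: "cmod (conv G f g a) \<le> M" for a
  proof (cases "a \<in> G")
    case True
    obtain v z where a: "a = (v, z)" by fastforce
    have "cmod (conv G f g (v, z)) \<le> (\<Sum>w\<in>A v z. M1 * M2)"
      unfolding conv[OF True[unfolded a]] using f1 g2 by (intro sum_norm_le) (auto simp: norm_mult intro!: mult_mono)
    also have "\<dots> \<le> M" unfolding M_def using A(2)[of v z] f1 g2 by (simp add: mult_right_mono)
    finally show ?thesis by (simp add: a)
  next
    case False
    then show ?thesis using M by (auto simp: conv_def case_prod_unfold)
  qed
  obtain \<gamma> where \<gamma>: "0 < \<gamma>" "\<And>x y. x \<in> X \<Longrightarrow> y \<in> X \<Longrightarrow> d x y \<le> \<gamma> \<Longrightarrow> forward_close S scale x (br x y) \<and> backward_close S scale y (br x y)"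
    using local_product[OF scale_bounds(1)] by blast
  define r where "r = min (\<gamma> / 2) scale"
  have r: "0 < r" "2 * r \<le> \<gamma>" "r \<le> scale" using \<gamma>(1) scale_bounds(1) by (auto simp: r_def)
  obtain K where K: "\<And>k. k \<ge> K \<Longrightarrow> scale / lam S ^ k \<le> r" using div_lam_pow_small[OF r(1)] by blast
  have close: "forward_close S r ((\<phi> ^^ k) v) ((\<phi> ^^ k) w)" if "(v, w) \<in> compact_part N" "N + K \<le> k" for v w k
  proof -
    have "forward_close S (scale / lam S ^ (k - N)) ((\<phi> ^^ k) v) ((\<phi> ^^ k) w)"
      using forward_close_later[OF compact_partD(3)[OF that(1)] scale_bounds(2), of k] that(2) by simp
    moreover have "K \<le> k - N" using that(2) by simp
    ultimately show ?thesis using forward_close_mono K by blast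
  qed
  define E where "E = C1 * M2 + M1 * C2"
  define B where "B = max (2 * M * 2 ^ (N + K)) (real (C + C) * E)"
  have E: "0 \<le> E" using C1 C2 f1 g2 by (simp add: E_def)
  have B: "0 \<le> B" "2 * M * 2 ^ (N + K) \<le> B" "real (C + C) * E \<le> B" using M by (auto simp: B_def le_max_iff_disj)
  show ?thesis
  proof (rule Lip_if_rectangle[where N = "N + L" and M = M and r = r and C = B])
    fix a assume "a \<notin> G"
    then show "conv G f g a = 0" by (auto simp: conv_def case_prod_unfold)
  next
    fix a assume nz: "conv G f g a \<noteq> 0"
    obtain v z where a: "a = (v, z)" by fastforce
    have vz: "(v, z) \<in> G" using nz by (auto simp: a conv_def split: if_splits)
    have "A v z \<noteq> {}" using nz conv[OF vz] by (auto simp: a)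
    then obtain w where "f (v, w) \<noteq> 0" "g (w, z) \<noteq> 0" unfolding A_def by auto
    then have w: "(v, w) \<in> compact_part N" "(w, z) \<in> compact_part N" using fN gN by auto
    have "forward_close S (scale + scale) ((\<phi> ^^ N) v) ((\<phi> ^^ N) z)"
      by (rule forward_close_trans[OF compact_partD(3)[OF w(1), unfolded fst_conv snd_conv] compact_partD(3)[OF w(2), unfolded fst_conv snd_conv]])
    then have "forward_close S ((scale + scale) / lam S ^ (N + L - N)) ((\<phi> ^^ (N + L)) v) ((\<phi> ^^ (N + L)) z)"
      by (rule forward_close_later) (use scale_bounds in auto)
    moreover have "(scale + scale) / lam S ^ L \<le> (scale + scale) / 3"
      using three_le_lam_pow[OF order_refl] scale_bounds(1) by (intro divide_left_mono) auto
    ultimately have "forward_close S scale ((\<phi> ^^ (N + L)) v) ((\<phi> ^^ (N + L)) z)"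
      using forward_close_mono scale_bounds(1) by fastforce
    then show "a \<in> compact_part (N + L)"
      using compact_partD(1,4)[OF w(1)] compact_partD(2,5)[OF w(2)] near_orbit_mono[of N _ "N + L"] by (auto simp: compact_part_def a)
  next
    fix a b k assume ab: "a \<in> G" "b \<in> G" "rectangle S r k a b"
    obtain v z v' z' where p: "a = (v, z)" "b = (v', z')" by fastforce
    show "cmod (conv G f g a - conv G f g b) \<le> B * (1 / 2) ^ (k div L)"
    proof (cases "N + K \<le> k")
      case False
      have "cmod (conv G f g a - conv G f g b) \<le> 2 * M"
        using norm_triangle_ineq4[of "conv G f g a" "conv G f g b"] bound[of a] bound[of b] by simp
      also have "\<dots> \<le> 2 * M * (2 ^ (N + K) * (1 / 2) ^ (k div L))"
      proof -
        have "k div L \<le> 0 + (N + K)" using False div_le_dividend[of k L] by linarith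
        from half_pow_shift[OF this] show ?thesis using M mult_left_mono[of 1 _ "2 * M"] by simp
      qed
      also have "\<dots> \<le> B * (1 / 2) ^ (k div L)" using mult_right_mono[OF B(2), of "(1 / 2) ^ (k div L)"] by (simp add: mult.assoc)
      finally show ?thesis .
    next
      case True
      note R = rectangleD[OF ab(3)[unfolded p], simplified]
      define Rel where "Rel w w' \<longleftrightarrow> w \<in> X \<and> w' \<in> X \<and> forward_close S scale ((\<phi> ^^ k) v) ((\<phi> ^^ k) w) \<and>
        forward_close S scale ((\<phi> ^^ k) v') ((\<phi> ^^ k) w') \<and> backward_close S scale ((\<phi> ^^ k) w) ((\<phi> ^^ k) w')" for w w'
      let ?F = "\<lambda>w. f (v, w) * g (w, z)" and ?F' = "\<lambda>w. f (v', w) * g (w, z')"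
      have step: "cmod (?F w - ?F' w') \<le> E * (1 / 2) ^ (k div L)"
        if rel: "Rel w w'" and wA: "w \<in> A v z \<or> w' \<in> A v' z'" for w w'
      proof -
        have Rw: "w \<in> X" "w' \<in> X" "forward_close S scale ((\<phi> ^^ k) v) ((\<phi> ^^ k) w)"
          "forward_close S scale ((\<phi> ^^ k) v') ((\<phi> ^^ k) w')" "backward_close S scale ((\<phi> ^^ k) w) ((\<phi> ^^ k) w')"
          using rel by (auto simp: Rel_def)
        have s2: "eps' S / 8 = scale + scale" by simp
        have mono: "scale \<le> eps' S / 8" "r \<le> eps' S / 8" "scale + r \<le> eps' S / 8" using r scale_bounds by auto
        have bm: "backward_close S (eps' S / 8) x y" if "backward_close S r x y \<or> backward_close S scale x y" for x y
          using that mono backward_close_mono by blast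
        have fm: "forward_close S (eps' S / 8) x y" if "forward_close S scale x y" for x y
          using that mono forward_close_mono by blast
        have R1: "rectangle S (eps' S / 8) k (v, w) (v', w')"
          unfolding rectangle_def using R Rw bm fm by auto
        have "forward_close S (scale + r) ((\<phi> ^^ k) w) ((\<phi> ^^ k) z)" "forward_close S (scale + r) ((\<phi> ^^ k) w') ((\<phi> ^^ k) z')"
          using forward_close_trans[OF forward_close_sym[OF Rw(3)] R(7)] forward_close_trans[OF forward_close_sym[OF Rw(4)] R(8)] by auto
        then have R2: "rectangle S (eps' S / 8) k (w, z) (w', z')"
          unfolding rectangle_def using R Rw bm forward_close_mono[OF _ mono(3)] by auto
        have le: "eps' S / 8 \<le> eps' S" using eps'_pos by simp
        have G1: "(v, w) \<in> G \<and> (v', w') \<in> G"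
          using wA
        proof
          assume "w \<in> A v z"
          then have "(v, w) \<in> G" using fN compact_part_subset by (auto simp: A_def)
          then show ?thesis using rectangle_in_groupoid[OF Q_invariant(1) _ R1 le] by blast
        next
          assume "w' \<in> A v' z'"
          then have "(v', w') \<in> G" using fN compact_part_subset by (auto simp: A_def)
          then show ?thesis using rectangle_in_groupoid[OF Q_invariant(1) _ rectangle_sym[OF R1] le] by blast
        qed
        have G2: "(w, z) \<in> G" "(w', z') \<in> G"
          using G1 ab p stable_groupoid_sym stable_groupoid_trans by blast+
        have "?F w - ?F' w' = (f (v, w) - f (v', w')) * g (w, z) + f (v', w') * (g (w, z) - g (w', z'))"
          by (simp add: algebra_simps)
        then have "cmod (?F w - ?F' w') \<le> cmod (f (v, w) - f (v', w')) * cmod (g (w, z)) + cmod (f (v', w')) * cmod (g (w, z) - g (w', z'))"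
          using norm_triangle_ineq by (metis norm_mult)
        also have "\<dots> \<le> (C1 * (1 / 2) ^ (k div L)) * M2 + M1 * (C2 * (1 / 2) ^ (k div L))"
          using C1(2)[OF _ _ R1] C2(2)[OF _ _ R2] G1 G2 f1 g2 C1(1) C2(1) by (intro add_mono mult_mono) auto
        finally show ?thesis by (simp add: E_def algebra_simps)
      qed
      have ex: "\<exists>w'. Rel w w'" if "w \<in> A v z" for w
      proof -
        have w: "(v, w) \<in> compact_part N" using that fN by (auto simp: A_def)
        have fc: "forward_close S r ((\<phi> ^^ k) v) ((\<phi> ^^ k) w)" by (rule close[OF w True])
        have wX: "w \<in> X" using compact_partD(2)[OF w] by simp
        show ?thesis
          using rectangle_fill[OF \<gamma>(2) ab(3)[unfolded p] wX fc r(2,3)] forward_close_mono[OF fc r(3)] wX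
          unfolding Rel_def by blast
      qed
      have ex': "\<exists>w. Rel w w'" if "w' \<in> A v' z'" for w'
      proof -
        have w: "(v', w') \<in> compact_part N" using that fN by (auto simp: A_def)
        have fc: "forward_close S r ((\<phi> ^^ k) v') ((\<phi> ^^ k) w')" by (rule close[OF w True])
        have wX: "w' \<in> X" using compact_partD(2)[OF w] by simp
        show ?thesis
          using rectangle_fill[OF \<gamma>(2) rectangle_sym[OF ab(3)[unfolded p]] wX fc r(2,3)] forward_close_mono[OF fc r(3)] wX
            backward_close_sym unfolding Rel_def by blast
      qed
      have eqI: "x = y" if "x \<in> X" "y \<in> X" "forward_close S scale p ((\<phi> ^^ k) x)" "forward_close S scale p ((\<phi> ^^ k) y)"
        "backward_close S scale q ((\<phi> ^^ k) x)" "backward_close S scale q ((\<phi> ^^ k) y)" for x y p q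
      proof -
        have "forward_close S (scale + scale) ((\<phi> ^^ k) x) ((\<phi> ^^ k) y)"
          by (rule forward_close_trans[OF forward_close_sym[OF that(3)] that(4)])
        moreover have "backward_close S (scale + scale) ((\<phi> ^^ k) x) ((\<phi> ^^ k) y)"
          by (rule backward_close_trans[OF backward_close_sym[OF that(5)] that(6)])
        ultimately have "(\<phi> ^^ k) x = (\<phi> ^^ k) y" using expansive scale_bounds(3) by simp
        then show ?thesis using hom_pow_inj that by blast
      qed
      have "cmod (sum ?F (A v z) - sum ?F' (A v' z')) \<le> real (card (A v z) + card (A v' z')) * (E * (1 / 2) ^ (k div L))"
      proof (rule matched_sums_close[where Rel = Rel])
        show "w' = w''" if "Rel w w'" "Rel w w''" for w w' w''
          using that eqI[of w' w'' "(\<phi> ^^ k) v'" "(\<phi> ^^ k) w"] by (simp add: Rel_def)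
        show "w = w'" if "Rel w w''" "Rel w' w''" for w w' w''
          using that eqI[of w w' "(\<phi> ^^ k) v" "(\<phi> ^^ k) w''"] backward_close_sym by (simp add: Rel_def)
      qed (use A ex ex' step E in \<open>auto simp: A_def\<close>)
      also have "\<dots> \<le> real (C + C) * (E * (1 / 2) ^ (k div L))"
        using A(2)[of v z] A(2)[of v' z'] E by (intro mult_right_mono) auto
      also have "\<dots> \<le> B * (1 / 2) ^ (k div L)" using mult_right_mono[OF B(3), of "(1 / 2) ^ (k div L)"] by (simp add: mult.assoc)
      finally show ?thesis using conv[of v z] conv[of v' z'] ab by (simp add: p)
    qed
  qed (use bound r B scale_bounds in auto)
qed

lemma hom_groupoid: "(v, w) \<in> G \<Longrightarrow> (\<phi> v, \<phi> w) \<in> G" "(v, w) \<in> G \<Longrightarrow> (\<psi> v, \<psi> w) \<in> G"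
proof -
  have U: "\<phi> y \<in> unstable_of S Q \<and> \<psi> y \<in> unstable_of S Q" if "y \<in> unstable_of S Q" for y
  proof -
    obtain q where q: "q \<in> Q" "y \<in> unstable_set S q"
      using \<open>y \<in> unstable_of S Q\<close> unfolding unstable_of_def by blast
    then have "\<phi> y \<in> unstable_set S (\<phi> q)" "\<psi> y \<in> unstable_set S (\<psi> q)"
      using unstable_set_pow[of q y 1] Q_invariant(1) by auto
    then show ?thesis using q(1) Q_invariant(4,5) by (auto simp: unstable_of_def)
  qed
  assume "(v, w) \<in> G"
  note vw = stable_groupoidD[OF this]
  have "\<phi> w \<in> stable_set S (\<phi> v)" "\<psi> w \<in> stable_set S (\<psi> v)" using stable_set_pow[OF vw(4,3), of 1] by auto
  then show "(\<phi> v, \<phi> w) \<in> G" "(\<psi> v, \<psi> w) \<in> G" using U[OF vw(1)] U[OF vw(2)] by (auto simp: stable_groupoid_def)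
qed

lemma compact_part_hinv: "v \<in> X \<Longrightarrow> w \<in> X \<Longrightarrow> (\<psi> v, \<psi> w) \<in> compact_part N \<Longrightarrow> (v, w) \<in> compact_part (Suc N)"
proof -
  assume X: "v \<in> X" "w \<in> X" and b: "(\<psi> v, \<psi> w) \<in> compact_part N"
  have e: "(\<phi> ^^ Suc (Suc N)) (\<psi> x) = (\<phi> ^^ Suc N) x" if "x \<in> X" for x
    using that funpow_swap1[of \<phi> "Suc N" "\<psi> x"] by simp
  have e': "(\<psi> ^^ N) (\<psi> x) = (\<psi> ^^ Suc N) x" for x using funpow_swap1[of \<psi> N x] by simp
  show ?thesis
    using forward_close_later'[OF compact_partD(3)[OF b], of "Suc (Suc N)"] compact_partD(4,5)[OF b] X
    unfolding compact_part_def fst_conv snd_conv e[OF X(1)] e[OF X(2)] e' by simp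
qed

lemma compact_part_hom: "v \<in> X \<Longrightarrow> w \<in> X \<Longrightarrow> (\<phi> v, \<phi> w) \<in> compact_part N \<Longrightarrow> (v, w) \<in> compact_part (Suc N)"
proof -
  assume X: "v \<in> X" "w \<in> X" and b: "(\<phi> v, \<phi> w) \<in> compact_part N"
  have e: "(\<psi> ^^ Suc (Suc N)) (\<phi> x) = (\<psi> ^^ Suc N) x" if "x \<in> X" for x
    using that funpow_swap1[of \<psi> "Suc N" "\<phi> x"] by simp
  have e': "(\<phi> ^^ N) (\<phi> x) = (\<phi> ^^ Suc N) x" for x using funpow_swap1[of \<phi> N x] by simp
  have "\<exists>q\<in>Q. backward_close S scale q ((\<psi> ^^ Suc (Suc N)) (\<phi> v))" "\<exists>q\<in>Q. backward_close S scale q ((\<psi> ^^ Suc (Suc N)) (\<phi> w))"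
    using near_orbit_mono[of N _ "Suc (Suc N)"] compact_partD(4,5)[OF b] by auto
  then show ?thesis
    using compact_partD(3)[OF b] X unfolding compact_part_def fst_conv snd_conv e[OF X(1)] e[OF X(2)] e' by simp
qed

text \<open>Applying \<open>\<psi>\<close> to both sides turns a rectangle at time \<open>k\<close> into one at time \<open>k + 1\<close>.\<close>
lemma Lip_alpha_hinv:
  assumes "f \<in> Lip" shows "alpha G \<psi> f \<in> Lip"
proof -
  obtain N M where f: "\<And>a. f a \<noteq> 0 \<Longrightarrow> a \<in> compact_part N" "0 \<le> M" "\<And>a. cmod (f a) \<le> M" using Lip_bounds[OF assms] by blast
  obtain C where C: "0 \<le> C" "\<And>a b k. a \<in> G \<Longrightarrow> b \<in> G \<Longrightarrow> rectangle S (eps' S / 8) k a b \<Longrightarrow> cmod (f a - f b) \<le> C * (1 / 2) ^ (k div L)"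
    using Lip_rectangle[OF assms] by blast
  show ?thesis
  proof (rule Lip_if_rectangle[where N = "Suc N" and M = M and r = "eps' S / 8" and C = C])
    fix a assume "alpha G \<psi> f a \<noteq> 0"
    then have "a \<in> G" "(\<psi> (fst a), \<psi> (snd a)) \<in> compact_part N" using f(1) by (auto simp: alpha_def case_prod_unfold split: if_splits)
    then show "a \<in> compact_part (Suc N)" using compact_part_hinv[of "fst a" "snd a" N] groupoid_cases by simp
  next
    fix a b k assume ab: "a \<in> G" "b \<in> G" "rectangle S (eps' S / 8) k a b"
    obtain v w v' w' where p: "a = (v, w)" "b = (v', w')" by fastforce
    have e: "(\<phi> ^^ Suc k) (\<psi> x) = (\<phi> ^^ k) x" if "x \<in> X" for x
      using that funpow_swap1[of \<phi> k "\<psi> x"] by simp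
    have "rectangle S (eps' S / 8) (Suc k) (\<psi> v, \<psi> w) (\<psi> v', \<psi> w')"
      using rectangleD[OF ab(3)] unfolding p rectangle_def by (simp only: fst_conv snd_conv e hinv_in mem_Times_iff simp_thms)
    then have "cmod (f (\<psi> v, \<psi> w) - f (\<psi> v', \<psi> w')) \<le> C * (1 / 2) ^ (Suc k div L)"
      using C(2) hom_groupoid ab p by blast
    also have "\<dots> \<le> C * (1 / 2) ^ (k div L)"
      by (intro mult_left_mono power_decreasing div_le_mono C) auto
    finally show "cmod (alpha G \<psi> f a - alpha G \<psi> f b) \<le> C * (1 / 2) ^ (k div L)" using ab by (simp add: alpha_def p)
  qed (use f C eps'_pos in \<open>auto simp: alpha_def\<close>)
qed

text \<open>Applying \<open>\<phi>\<close> to both sides turns a rectangle at time \<open>k\<close> into one at time \<open>k - 1\<close>, at the cost of a factor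
  \<open>2\<close> in the estimate.\<close>
lemma Lip_alpha_hom:
  assumes "f \<in> Lip" shows "alpha G \<phi> f \<in> Lip"
proof -
  obtain N M where f: "\<And>a. f a \<noteq> 0 \<Longrightarrow> a \<in> compact_part N" "0 \<le> M" "\<And>a. cmod (f a) \<le> M" using Lip_bounds[OF assms] by blast
  obtain C where C: "0 \<le> C" "\<And>a b k. a \<in> G \<Longrightarrow> b \<in> G \<Longrightarrow> rectangle S (eps' S / 8) k a b \<Longrightarrow> cmod (f a - f b) \<le> C * (1 / 2) ^ (k div L)"
    using Lip_rectangle[OF assms] by blast
  define C' where "C' = max (2 * M) (2 * C)"
  have C': "0 \<le> C'" "2 * M \<le> C'" "2 * C \<le> C'" using C f by (auto simp: C'_def)
  show ?thesis
  proof (rule Lip_if_rectangle[where N = "Suc N" and M = M and r = "eps' S / 8" and C = C'])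
    fix a assume "alpha G \<phi> f a \<noteq> 0"
    then have "a \<in> G" "(\<phi> (fst a), \<phi> (snd a)) \<in> compact_part N" using f(1) by (auto simp: alpha_def case_prod_unfold split: if_splits)
    then show "a \<in> compact_part (Suc N)" using compact_part_hom[of "fst a" "snd a" N] groupoid_cases by simp
  next
    fix a b k assume ab: "a \<in> G" "b \<in> G" "rectangle S (eps' S / 8) k a b"
    obtain v w v' w' where p: "a = (v, w)" "b = (v', w')" by fastforce
    have "cmod (f (\<phi> v, \<phi> w) - f (\<phi> v', \<phi> w')) \<le> C' * (1 / 2) ^ (k div L)"
    proof (cases k)
      case 0
      then show ?thesis
        using norm_triangle_ineq4[of "f (\<phi> v, \<phi> w)" "f (\<phi> v', \<phi> w')"] f(3)[of "(\<phi> v, \<phi> w)"] f(3)[of "(\<phi> v', \<phi> w')"] C' by simp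
    next
      case (Suc j)
      have e: "(\<phi> ^^ j) (\<phi> x) = (\<phi> ^^ k) x" for x using Suc funpow_swap1[of \<phi> j x] by simp
      have "rectangle S (eps' S / 8) j (\<phi> v, \<phi> w) (\<phi> v', \<phi> w')"
        using rectangleD[OF ab(3)] unfolding p rectangle_def by (simp only: fst_conv snd_conv e hom_in mem_Times_iff simp_thms)
      then have "cmod (f (\<phi> v, \<phi> w) - f (\<phi> v', \<phi> w')) \<le> C * (1 / 2) ^ (j div L)"
        using C(2) hom_groupoid ab p by blast
      also have "\<dots> \<le> C * (2 ^ 1 * (1 / 2) ^ (k div L))"
        using div_shift_le[OF L_pos, of k 1] Suc by (intro mult_left_mono half_pow_shift C) simp
      also have "\<dots> \<le> C' * (1 / 2) ^ (k div L)" using mult_right_mono[OF C'(3), of "(1 / 2) ^ (k div L)"] by simp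
      finally show ?thesis .
    qed
    then show "cmod (alpha G \<phi> f a - alpha G \<phi> f b) \<le> C' * (1 / 2) ^ (k div L)" using ab by (simp add: alpha_def p)
  qed (use f C' eps'_pos in \<open>auto simp: alpha_def\<close>)
qed

end

section \<open>Approximation and density\<close>

context self_similar_smale
begin

text \<open>Heine's theorem; one of two points with different values can be chosen in the compact support.\<close>
lemma Cc_uniformly_continuous:
  assumes f: "f \<in> Cc T" and e: "0 < e"
  shows "\<exists>\<rho>>0. \<forall>a\<in>G. \<forall>b\<in>G. D a b < \<rho> \<longrightarrow> cmod (f a - f b) < e"
proof (rule ccontr)
  assume neg: "\<not> ?thesis"
  have fc: "continuous_map T euclidean f" using f by (simp add: Cc_def)
  have "\<exists>a b. a \<in> G \<and> b \<in> G \<and> D a b < inverse (real (Suc n)) \<and> e \<le> cmod (f a - f b) \<and> f a \<noteq> 0" for n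
  proof -
    have "0 < inverse (real (Suc n))" by simp
    then obtain a b where ab: "a \<in> G" "b \<in> G" "D a b < inverse (real (Suc n))" "e \<le> cmod (f a - f b)"
      using neg not_le by blast
    show ?thesis
    proof (cases "f a = 0")
      case True
      then have "f b \<noteq> 0" using ab(4) e by auto
      then show ?thesis using ab D_commute norm_minus_commute by metis
    qed (use ab in blast)
  qed
  then obtain \<alpha> \<beta> where ab: "\<And>n. \<alpha> n \<in> G" "\<And>n. \<beta> n \<in> G" "\<And>n. D (\<alpha> n) (\<beta> n) < inverse (real (Suc n))"
    "\<And>n. e \<le> cmod (f (\<alpha> n) - f (\<beta> n))" "\<And>n. f (\<alpha> n) \<noteq> 0" by metis
  obtain N where "\<And>a. f a \<noteq> 0 \<Longrightarrow> a \<in> compact_part N" using Cc_support[OF f] by blast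
  then have "\<alpha> n \<in> compact_part N" for n using ab(5)[of n] .
  then have "range \<alpha> \<subseteq> compact_part N" by (rule image_subsetI)
  then obtain l r where l: "l \<in> compact_part N" "strict_mono r" "limitin T (\<alpha> \<circ> r) l sequentially"
    using compactin_compact_part[of N] unfolding Metric_space.compactin_sequentially[OF metric_D] by meson
  have lG: "l \<in> G" using l(1) compact_part_subset by blast
  have lb: "limitin T (\<beta> \<circ> r) l sequentially"
    unfolding limitin_T
  proof (intro conjI allI impI lG)
    fix \<rho> :: real assume \<rho>: "\<rho> > 0"
    have "(\<lambda>n. inverse (real (Suc (r n)))) \<longlonglongrightarrow> 0"
      using LIMSEQ_subseq_LIMSEQ[OF LIMSEQ_inverse_real_of_nat l(2)] by (simp add: comp_def)
    then have "\<forall>\<^sub>F n in sequentially. inverse (real (Suc (r n))) < \<rho> / 2" using order_tendstoD(2) \<rho> half_gt_zero by blast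
    moreover have "\<forall>\<^sub>F n in sequentially. (\<alpha> \<circ> r) n \<in> G \<and> D ((\<alpha> \<circ> r) n) l < \<rho> / 2"
      using l(3) \<rho> half_gt_zero unfolding limitin_T by blast
    ultimately show "\<forall>\<^sub>F n in sequentially. (\<beta> \<circ> r) n \<in> G \<and> D ((\<beta> \<circ> r) n) l < \<rho>"
    proof eventually_elim
      case (elim n)
      have "D (\<beta> (r n)) l \<le> D (\<beta> (r n)) (\<alpha> (r n)) + D (\<alpha> (r n)) l"
        by (rule Metric_space.triangle[OF metric_D ab(2) ab(1) lG])
      then show ?case using elim ab(2)[of "r n"] ab(3)[of "r n"] D_commute[of "\<beta> (r n)" "\<alpha> (r n)"] by simp
    qed
  qed
  have "(\<lambda>n. f (\<alpha> (r n)) - f (\<beta> (r n))) \<longlonglongrightarrow> f l - f l"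
    using continuous_map_limit[OF fc l(3)] continuous_map_limit[OF fc lb]
    by (intro tendsto_diff) (simp_all add: comp_def)
  then have "(\<lambda>n. cmod (f (\<alpha> (r n)) - f (\<beta> (r n)))) \<longlonglongrightarrow> 0" using tendsto_norm_zero by simp
  then have "e \<le> 0" by (rule LIMSEQ_le_const) (use ab(4) in blast)
  then show False using e by simp
qed

text \<open>The approximant is \<open>g a = (SUP b. max 0 (p b - n * D a b))\<close> with \<open>n = M / \<rho>\<close>. It is \<open>n\<close>-Lipschitz as a supremum of such
  functions. As \<open>p \<le> M\<close>, only points \<open>b\<close> with \<open>D a b < \<rho>\<close> contribute, so \<open>g\<close> is within \<open>e\<close> of \<open>p\<close> and its support
  is within distance \<open>\<rho>\<close> of that of \<open>p\<close>.\<close>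
lemma real_Lipschitz_approximation:
  fixes p :: "'a \<times> 'a \<Rightarrow> real"
  assumes p: "\<And>a. 0 \<le> p a" "\<And>a. p a \<le> M" "\<And>a. p a \<noteq> 0 \<Longrightarrow> a \<in> compact_part N" and e: "0 \<le> e"
    and \<rho>: "0 < \<rho>" "\<And>a b. a \<in> G \<Longrightarrow> b \<in> G \<Longrightarrow> D a b < \<rho> \<Longrightarrow> p b \<le> p a + e"
      "\<And>a b. a \<in> compact_part N \<Longrightarrow> b \<in> G \<Longrightarrow> D a b < \<rho> \<Longrightarrow> b \<in> compact_part (N + L)"
  shows "\<exists>g. (\<forall>a. g a \<noteq> 0 \<longrightarrow> a \<in> compact_part (N + L)) \<and> (\<forall>a. \<bar>p a - g a\<bar> \<le> e) \<and> (\<lambda>a. complex_of_real (g a)) \<in> Lip"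
proof (cases "G = {}")
  case True
  then have "compact_part N = {}" for N using compact_part_subset by blast
  then have "p a = 0" for a using p(3) by blast
  then show ?thesis by (intro exI[of _ "\<lambda>_. 0"]) (use e Lip_zero in auto)
next
  case False
  define n where "n = M / \<rho>"
  have M: "0 \<le> M" using p(1,2) order_trans by blast
  have n: "0 \<le> n" using M \<rho>(1) by (simp add: n_def)
  define k where "k a b = max 0 (p b - n * D a b)" for a b
  have kb: "0 \<le> k a b" "k a b \<le> M" for a b
    using p(2)[of b] n D_nonneg[of a b] M by (auto simp: k_def) (smt (verit) mult_nonneg_nonneg)
  have bdd: "bdd_above (k a ` G)" for a using kb(2) by (intro bdd_aboveI2)
  define g where "g a = (if a \<in> G then SUP b\<in>G. k a b else 0)" for a
  have gk: "k a b \<le> g a" if "a \<in> G" "b \<in> G" for a b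
    using cSUP_upper[OF that(2) bdd[of a]] that(1) by (simp add: g_def)
  have gle: "g a \<le> x" if "a \<in> G" "\<And>b. b \<in> G \<Longrightarrow> k a b \<le> x" for a x
    unfolding g_def using that False by (auto intro!: cSUP_least)
  have kpos: "D a b < \<rho>" if "p b - n * D a b > 0" for a b
  proof (rule ccontr)
    assume "\<not> D a b < \<rho>"
    then have "n * \<rho> \<le> n * D a b" using n by (intro mult_left_mono) auto
    then show False using that p(2)[of b] \<rho>(1) by (simp add: n_def)
  qed
  have supp: "a \<in> compact_part (N + L)" if "g a \<noteq> 0" for a
  proof -
    have a: "a \<in> G" using that by (auto simp: g_def split: if_splits)
    have "\<exists>b\<in>G. k a b > 0"
    proof (rule ccontr)
      assume "\<not> ?thesis"
      then have "g a \<le> 0" using gle[OF a, of 0] by force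
      moreover have "0 \<le> g a" using gk[OF a a] kb(1)[of a a] by simp
      ultimately show False using that by simp
    qed
    then obtain b where b: "b \<in> G" "p b - n * D a b > 0" by (auto simp: k_def)
    have "p b \<noteq> 0" using b(2) mult_nonneg_nonneg[OF n D_nonneg[of a b]] by linarith
    moreover have "D b a < \<rho>" using kpos[OF b(2)] D_commute[of a b] by simp
    ultimately show ?thesis using \<rho>(3)[OF p(3) a] by blast
  qed
  have approx: "\<bar>p a - g a\<bar> \<le> e" for a
  proof (cases "a \<in> G")
    case True
    have "D a a = 0" using Metric_space.zero[OF metric_D True True] by simp
    then have "p a \<le> g a" using gk[OF True True] by (simp add: k_def)
    moreover have "g a \<le> p a + e"
    proof (rule gle[OF True])
      fix b assume b: "b \<in> G"
      show "k a b \<le> p a + e"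
      proof (cases "p b - n * D a b > 0")
        case True
        then show ?thesis using \<rho>(2)[OF \<open>a \<in> G\<close> b kpos] mult_nonneg_nonneg[OF n D_nonneg[of a b]] by (simp add: k_def)
      next
        case False
        then show ?thesis using p(1)[of a] e by (simp add: k_def)
      qed
    qed
    ultimately show ?thesis by simp
  next
    case False
    then have "p a = 0" using p(3) compact_part_subset by blast
    then show ?thesis using False e by (simp add: g_def)
  qed
  have lip1: "g a \<le> g b + n * D a b" if "a \<in> G" "b \<in> G" for a b
  proof (rule gle[OF that(1)])
    fix x assume x: "x \<in> G"
    have "D b x \<le> D b a + D a x" by (rule Metric_space.triangle[OF metric_D that(2,1) x])
    then have "n * D b x \<le> n * D a b + n * D a x"
      using n D_commute[of a b] mult_left_mono[of "D b x" "D a b + D a x" n] by (simp add: distrib_left)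
    then have "k a x \<le> k b x + n * D a b"
      using mult_nonneg_nonneg[OF n D_nonneg[of a b]] by (auto simp: k_def)
    then show "k a x \<le> g b + n * D a b" using gk[OF that(2) x] by linarith
  qed
  have "(\<lambda>a. complex_of_real (g a)) \<in> Lip"
  proof (rule LipI[where C = n])
    show "cmod (complex_of_real (g a) - complex_of_real (g b)) \<le> n * D a b" if "a \<in> G" "b \<in> G" for a b
    proof -
      have "\<bar>g a - g b\<bar> \<le> n * D a b" using lip1[OF that] lip1[OF that(2,1)] D_commute[of a b] by simp
      then show ?thesis by (metis norm_of_real of_real_diff)
    qed
    show "compact_support T (\<lambda>a. complex_of_real (g a))"
    proof (subst compact_support_iff)
      show "complex_of_real (g a) = 0" if "a \<notin> G" for a using that by (simp add: g_def)
      show "\<exists>N. \<forall>a. complex_of_real (g a) \<noteq> 0 \<longrightarrow> a \<in> compact_part N"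
        by (rule exI[of _ "N + L"]) (use supp of_real_eq_0_iff in blast)
    qed
  qed (simp add: g_def)
  then show ?thesis using supp approx by blast
qed

text \<open>The positive and negative parts of real and imaginary part are approximated separately, with all supports
  in one compact part. Its band width is the constant \<open>K\<close>.\<close>
lemma Lip_approximates:
  assumes f: "f \<in> Cc T"
  shows "\<exists>K. \<forall>e>0. \<exists>g\<in>Lip. banded G K e (\<lambda>a. f a - g a)"
proof -
  obtain N where N: "\<And>a. f a \<noteq> 0 \<Longrightarrow> a \<in> compact_part N" using Cc_support[OF f] by blast
  obtain M where M: "\<And>a. cmod (f a) \<le> M" using bounded_if_Cc[OF f] by blast
  obtain \<rho>0 where \<rho>0: "0 < \<rho>0" "\<And>a b. a \<in> compact_part N \<Longrightarrow> b \<in> G \<Longrightarrow> D a b < \<rho>0 \<Longrightarrow> b \<in> compact_part (N + L)"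
    using compact_part_neighbourhood by blast
  obtain K where K: "\<And>h e. (\<And>a. h a \<noteq> 0 \<Longrightarrow> a \<in> compact_part (N + L)) \<Longrightarrow> (\<And>a. cmod (h a) \<le> e) \<Longrightarrow> banded G K e h"
    using compact_part_banded by blast
  have "\<exists>g\<in>Lip. banded G K e (\<lambda>a. f a - g a)" if e: "e > 0" for e
  proof -
    obtain \<rho>1 where \<rho>1: "0 < \<rho>1" "\<And>a b. a \<in> G \<Longrightarrow> b \<in> G \<Longrightarrow> D a b < \<rho>1 \<Longrightarrow> cmod (f a - f b) < e / 4"
      using Cc_uniformly_continuous[OF f, of "e / 4"] e by auto
    define \<rho> where "\<rho> = min \<rho>0 \<rho>1"
    have ex: "\<exists>g. (\<forall>a. g a \<noteq> 0 \<longrightarrow> a \<in> compact_part (N + L)) \<and> (\<forall>a. \<bar>max 0 (u (f a)) - g a\<bar> \<le> e / 4) \<and> (\<lambda>a. complex_of_real (g a)) \<in> Lip"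
      if u: "\<And>x. \<bar>u x\<bar> \<le> cmod x" "\<And>x y. u x - u y = u (x - y)" for u :: "complex \<Rightarrow> real"
    proof (rule real_Lipschitz_approximation[where M = M and \<rho> = \<rho>])
      show "max 0 (u (f a)) \<le> M" for a using u(1)[of "f a"] M[of a] by (simp add: abs_le_iff)
      show "a \<in> compact_part N" if "max 0 (u (f a)) \<noteq> 0" for a using that u(1)[of "f a"] N[of a] by (cases "f a = 0") auto
      show "0 < \<rho>" using \<rho>0 \<rho>1 by (simp add: \<rho>_def)
      show "max 0 (u (f b)) \<le> max 0 (u (f a)) + e / 4" if "a \<in> G" "b \<in> G" "D a b < \<rho>" for a b
      proof -
        have "u (f b) - u (f a) \<le> cmod (f b - f a)" using u(1)[of "f b - f a"] u(2)[of "f b" "f a"] by (simp add: abs_le_iff)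
        also have "\<dots> \<le> e / 4" using \<rho>1(2)[OF that(1,2)] that(3) by (simp add: \<rho>_def norm_minus_commute)
        finally show ?thesis using e by simp
      qed
      show "b \<in> compact_part (N + L)" if "a \<in> compact_part N" "b \<in> G" "D a b < \<rho>" for a b using \<rho>0(2)[OF that(1,2)] that(3) by (simp add: \<rho>_def)
    qed (use e in auto)
    obtain g1 where g1: "\<And>a. g1 a \<noteq> 0 \<Longrightarrow> a \<in> compact_part (N + L)" "\<And>a. \<bar>max 0 (Re (f a)) - g1 a\<bar> \<le> e / 4" "(\<lambda>a. complex_of_real (g1 a)) \<in> Lip"
      using ex[of Re] abs_Re_le_cmod by auto
    obtain g2 where g2: "\<And>a. g2 a \<noteq> 0 \<Longrightarrow> a \<in> compact_part (N + L)" "\<And>a. \<bar>max 0 (- Re (f a)) - g2 a\<bar> \<le> e / 4" "(\<lambda>a. complex_of_real (g2 a)) \<in> Lip"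
      using ex[of "\<lambda>x. - Re x"] abs_Re_le_cmod by auto
    obtain g3 where g3: "\<And>a. g3 a \<noteq> 0 \<Longrightarrow> a \<in> compact_part (N + L)" "\<And>a. \<bar>max 0 (Im (f a)) - g3 a\<bar> \<le> e / 4" "(\<lambda>a. complex_of_real (g3 a)) \<in> Lip"
      using ex[of Im] abs_Im_le_cmod by auto
    obtain g4 where g4: "\<And>a. g4 a \<noteq> 0 \<Longrightarrow> a \<in> compact_part (N + L)" "\<And>a. \<bar>max 0 (- Im (f a)) - g4 a\<bar> \<le> e / 4" "(\<lambda>a. complex_of_real (g4 a)) \<in> Lip"
      using ex[of "\<lambda>x. - Im x"] abs_Im_le_cmod by auto
    define g where "g a = (complex_of_real (g1 a) + (- 1) * complex_of_real (g2 a)) + (\<i> * complex_of_real (g3 a) + (- \<i>) * complex_of_real (g4 a))" for a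
    have "(\<lambda>a. (complex_of_real (g1 a) + (- 1) * complex_of_real (g2 a)) + (\<i> * complex_of_real (g3 a) + (- \<i>) * complex_of_real (g4 a))) \<in> Lip"
      by (intro Lip_add Lip_scale g1(3) g2(3) g3(3) g4(3))
    then have "g \<in> Lip" by (simp add: g_def[abs_def])
    moreover have "banded G K e (\<lambda>a. f a - g a)"
    proof (rule K)
      fix a assume "f a - g a \<noteq> 0"
      then have "f a \<noteq> 0 \<or> g1 a \<noteq> 0 \<or> g2 a \<noteq> 0 \<or> g3 a \<noteq> 0 \<or> g4 a \<noteq> 0" by (auto simp: g_def)
      then show "a \<in> compact_part (N + L)" using N[of a] compact_part_mono[of N "N + L"] g1(1)[of a] g2(1)[of a] g3(1)[of a] g4(1)[of a] by auto
    next
      fix a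
      have "\<bar>Re (f a - g a)\<bar> \<le> e / 2"
      proof -
        have "Re (f a - g a) = (max 0 (Re (f a)) - g1 a) - (max 0 (- Re (f a)) - g2 a)" by (simp add: g_def)
        then show ?thesis using g1(2)[of a] g2(2)[of a] abs_triangle_ineq4[of "max 0 (Re (f a)) - g1 a" "max 0 (- Re (f a)) - g2 a"] by linarith
      qed
      moreover have "\<bar>Im (f a - g a)\<bar> \<le> e / 2"
      proof -
        have "Im (f a - g a) = (max 0 (Im (f a)) - g3 a) - (max 0 (- Im (f a)) - g4 a)" by (simp add: g_def)
        then show ?thesis using g3(2)[of a] g4(2)[of a] abs_triangle_ineq4[of "max 0 (Im (f a)) - g3 a" "max 0 (- Im (f a)) - g4 a"] by linarith
      qed
      ultimately show "cmod (f a - g a) \<le> e" using cmod_le[of "f a - g a"] by linarith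
    qed
    ultimately show ?thesis by blast
  qed
  then show ?thesis by blast
qed

end

context smale
begin

text \<open>By irreducibility some point near \<open>x\<close> is moved near a point \<open>p\<close> of \<open>P\<close> in \<open>n\<close> steps. Projecting it to the
  unstable set of \<open>x\<close> along stable sets changes its forward orbit little; projecting the \<open>n\<close>-th iterate to the
  stable set of \<open>p\<close> along unstable sets changes its backward orbit little.\<close>
lemma stable_of_dense:
  assumes irr: "irreducible_smale S" and P: "periodic_orbit S P" and x: "x \<in> X" and r: "0 < r"
  shows "\<exists>x'. backward_close S r x x' \<and> x' \<in> stable_of S P"
proof -
  note PX = orbit_invariant[OF P bij_hom]
  obtain p where p: "p \<in> P" "p \<in> X" using PX by auto
  define r2 where "r2 = min (r / 2) (eps' S)"
  have r2: "0 < r2" "r2 \<le> r / 2" "r2 \<le> eps' S" using r eps'_pos by (auto simp: r2_def)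
  obtain \<gamma>2 where \<gamma>2: "0 < \<gamma>2" "\<And>x y. x \<in> X \<Longrightarrow> y \<in> X \<Longrightarrow> d x y \<le> \<gamma>2 \<Longrightarrow> forward_close S r2 x (br x y) \<and> backward_close S r2 y (br x y)"
    using local_product[OF r2(1)] by blast
  define r1 where "r1 = min (r / 2) (\<gamma>2 / 2)"
  have r1: "0 < r1" "r1 \<le> r / 2" "r1 \<le> \<gamma>2 / 2" using r \<gamma>2 by (auto simp: r1_def)
  obtain \<gamma>1 where \<gamma>1: "0 < \<gamma>1" "\<And>x y. x \<in> X \<Longrightarrow> y \<in> X \<Longrightarrow> d x y \<le> \<gamma>1 \<Longrightarrow> forward_close S r1 x (br x y) \<and> backward_close S r1 y (br x y)"
    using local_product[OF r1(1)] by blast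
  have "openin (top_of S) (mball x \<gamma>1)" "openin (top_of S) (mball p (\<gamma>2 / 2))" by (simp_all add: top_of_eq openin_mball)
  moreover have "mball x \<gamma>1 \<noteq> {}" "mball p (\<gamma>2 / 2) \<noteq> {}"
    using centre_in_mball_iff[of x \<gamma>1] centre_in_mball_iff[of p "\<gamma>2 / 2"] x p(2) \<gamma>1(1) half_gt_zero[OF \<gamma>2(1)] by blast+
  ultimately obtain n where "(\<phi> ^^ n) ` mball x \<gamma>1 \<inter> mball p (\<gamma>2 / 2) \<noteq> {}"
    using irr unfolding irreducible_smale_def by blast
  then obtain y where y: "y \<in> X" "d x y < \<gamma>1" "d p ((\<phi> ^^ n) y) < \<gamma>2 / 2" by auto
  define y' where "y' = br y x"
  have y': "forward_close S r1 y y'" "backward_close S r1 x y'"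
    using \<gamma>1(2)[of y x] x y commute[of x y] by (auto simp: y'_def)
  have y'X: "y' \<in> X" using forward_closeD(2)[OF y'(1)] .
  have "d p ((\<phi> ^^ n) y') \<le> \<gamma>2"
    using triangle[of p "(\<phi> ^^ n) y" "(\<phi> ^^ n) y'"] p y y'X forward_closeD(3)[OF y'(1), of n] r1 by simp
  then have z: "forward_close S r2 p (br p ((\<phi> ^^ n) y'))" "backward_close S r2 ((\<phi> ^^ n) y') (br p ((\<phi> ^^ n) y'))"
    using \<gamma>2(2) p y'X by auto
  define z where "z = br p ((\<phi> ^^ n) y')"
  have zX: "z \<in> X" using forward_closeD(2)[OF z(1)] by (simp add: z_def)
  have "backward_close S r2 y' ((\<psi> ^^ n) z)"
    using backward_close_pow[OF z(2), of n] y'X by (simp add: z_def)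
  then have "backward_close S (r1 + r2) x ((\<psi> ^^ n) z)" by (rule backward_close_trans[OF y'(2)])
  then have "backward_close S r x ((\<psi> ^^ n) z)" using backward_close_mono r1 r2 by fastforce
  moreover have "z \<in> stable_set S p"
    using stable_set_if_forward_close[OF zX, of r2 0 p] z(1) r2(3) by (simp add: z_def)
  then have "(\<psi> ^^ n) z \<in> stable_set S ((\<psi> ^^ n) p)" by (rule stable_set_pow(2)[OF p(2)])
  moreover have "(\<psi> ^^ n) p \<in> P" by (induction n) (use p PX in auto)
  ultimately show ?thesis by (auto simp: stable_of_def)
qed

lemma stable_of_closed:
  assumes "P \<subseteq> X" "y \<in> stable_of S P" "z \<in> stable_set S y"
  shows "z \<in> stable_of S P"
  using assms stable_set_trans unfolding stable_of_def by blast

lemma stable_of_pow: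
  assumes "P \<subseteq> X" "\<phi> ` P \<subseteq> P" "\<psi> ` P \<subseteq> P" "y \<in> stable_of S P"
  shows "(\<phi> ^^ n) y \<in> stable_of S P" "(\<psi> ^^ n) y \<in> stable_of S P"
proof -
  obtain p where p: "p \<in> P" "y \<in> stable_set S p" using assms(4) unfolding stable_of_def by blast
  have "(\<phi> ^^ n) p \<in> P" "(\<psi> ^^ n) p \<in> P" by (induction n) (use p assms in auto)
  moreover have "(\<phi> ^^ n) y \<in> stable_set S ((\<phi> ^^ n) p)" "(\<psi> ^^ n) y \<in> stable_set S ((\<psi> ^^ n) p)"
    using stable_set_pow[of p y n] p assms(1) by auto
  ultimately show "(\<phi> ^^ n) y \<in> stable_of S P" "(\<psi> ^^ n) y \<in> stable_of S P" unfolding stable_of_def by blast+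
qed

end

context self_similar_smale
begin

text \<open>A pair in the groupoid is moved, at a late time, to a pair whose first coordinate is in the dense set \<open>stable_of S P\<close>;
  the second coordinate follows by the bracket.\<close>
lemma homoclinic_dense:
  assumes irr: "irreducible_smale S" and P: "periodic_orbit S P" and a: "a \<in> G" and r: "0 < r" "r \<le> eps' S"
  shows "\<exists>k\<ge>k0. \<exists>b\<in>G. rectangle S r k a b \<and> fst b \<in> homoclinic S P Q"
proof -
  note PX = orbit_invariant[OF P bij_hom]
  obtain v w where vw: "a = (v, w)" by fastforce
  note aX = groupoid_cases[OF a, unfolded vw, simplified]
  obtain \<gamma> where \<gamma>: "0 < \<gamma>" "\<And>x y. x \<in> X \<Longrightarrow> y \<in> X \<Longrightarrow> d x y \<le> \<gamma> \<Longrightarrow> forward_close S r x (br x y) \<and> backward_close S r y (br x y)"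
    using local_product[OF r(1)] by blast
  define s where "s = min (\<gamma> / 2) r"
  have s: "0 < s" "2 * s \<le> \<gamma>" "s \<le> r" using \<gamma> r by (auto simp: s_def)
  obtain k1 where k1: "\<And>k. k \<ge> k1 \<Longrightarrow> forward_close S s ((\<phi> ^^ k) v) ((\<phi> ^^ k) w)"
    using groupoid_forward_close[OF a s(1)] vw by auto
  define k where "k = max k0 k1"
  have F: "forward_close S s ((\<phi> ^^ k) v) ((\<phi> ^^ k) w)" using k1 by (simp add: k_def)
  obtain V where V: "backward_close S s ((\<phi> ^^ k) v) V" "V \<in> stable_of S P"
    using stable_of_dense[OF irr P pow_in(1)[OF aX(1)] s(1)] by blast
  have VX: "V \<in> X" using backward_closeD(2)[OF V(1)] .
  have "d V ((\<phi> ^^ k) w) \<le> \<gamma>"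
    using triangle[of V "(\<phi> ^^ k) v" "(\<phi> ^^ k) w"] VX aX backward_closeD(4)[OF V(1)] forward_closeD(4)[OF F] s
      commute[of V "(\<phi> ^^ k) v"] by simp
  then have W: "forward_close S r V (br V ((\<phi> ^^ k) w))" "backward_close S r ((\<phi> ^^ k) w) (br V ((\<phi> ^^ k) w))"
    using \<gamma>(2) VX aX by auto
  have WX: "br V ((\<phi> ^^ k) w) \<in> X" using forward_closeD(2)[OF W(1)] .
  define b where "b = ((\<psi> ^^ k) V, (\<psi> ^^ k) (br V ((\<phi> ^^ k) w)))"
  have rect: "rectangle S r k a b"
    unfolding rectangle_def vw b_def
    using aX VX WX W backward_close_mono[OF V(1) s(3)] forward_close_mono[OF F s(3)] by simp
  have bG: "b \<in> G" by (rule rectangle_in_groupoid[OF Q_invariant(1) a rect r(2)])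
  have "fst b \<in> stable_of S P" using stable_of_pow(2)[OF PX(1,4,5) V(2)] by (simp add: b_def)
  then have "fst b \<in> homoclinic S P Q" using groupoid_cases(5)[OF bG] by (simp add: homoclinic_def)
  then show ?thesis using rect bG k_def by (intro exI[of _ k]) auto
qed

lemma Lip_eq_on_dense:
  assumes irr: "irreducible_smale S" and P: "periodic_orbit S P" and f: "f \<in> Lip" and g: "g \<in> Lip"
    and eq: "\<And>a. a \<in> G \<Longrightarrow> fst a \<in> homoclinic S P Q \<Longrightarrow> f a = g a"
  shows "f = g"
proof
  fix a
  show "f a = g a"
  proof (cases "a \<in> G")
    case True
    define h where "h a = f a + (- 1) * g a" for a
    have "h \<in> Lip" unfolding h_def[abs_def] by (intro Lip_add Lip_scale f g)
    then obtain C where C: "0 \<le> C" "\<And>a b k. a \<in> G \<Longrightarrow> b \<in> G \<Longrightarrow> rectangle S (eps' S / 8) k a b \<Longrightarrow> cmod (h a - h b) \<le> C * (1 / 2) ^ (k div L)"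
      using Lip_rectangle by blast
    have "cmod (h a) \<le> C * (1 / 2) ^ n" for n
    proof -
      obtain k b where kb: "k \<ge> n * L" "b \<in> G" "rectangle S (eps' S / 8) k a b" "fst b \<in> homoclinic S P Q"
        using homoclinic_dense[OF irr P True, of "eps' S / 8" "n * L"] eps'_pos by auto
      have "h b = 0" using eq[OF kb(2,4)] by (simp add: h_def)
      then have "cmod (h a) \<le> C * (1 / 2) ^ (k div L)" using C(2)[OF True kb(2,3)] by simp
      also have "\<dots> \<le> C * (1 / 2) ^ n"
      proof (intro mult_left_mono power_decreasing C)
        show "n \<le> k div L" using kb(1) L_pos by (simp add: less_eq_div_iff_mult_less_eq)
      qed auto
      finally show ?thesis .
    qed
    moreover have "(\<lambda>n. C * (1 / 2) ^ n) \<longlonglongrightarrow> C * 0" by (intro tendsto_mult tendsto_const LIMSEQ_realpow_zero) auto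
    ultimately have "cmod (h a) \<le> C * 0" by (intro LIMSEQ_le_const) auto
    then show ?thesis by (simp add: h_def)
  next
    case False
    then show ?thesis using Lip_outside[OF f, of a] Lip_outside[OF g, of a] by simp
  qed
qed

lemma homoclinic_maps:
  assumes P: "periodic_orbit S P" and v: "v \<in> homoclinic S P Q"
  shows "v \<in> X" "\<phi> v \<in> homoclinic S P Q" "\<psi> v \<in> homoclinic S P Q" "(v, w) \<in> G \<Longrightarrow> w \<in> homoclinic S P Q"
proof -
  note PX = orbit_invariant[OF P bij_hom]
  have vs: "v \<in> stable_of S P" "v \<in> unstable_of S Q" using v by (auto simp: homoclinic_def)
  then show vX: "v \<in> X" using unstable_of_subset by blast
  have "(v, v) \<in> G" using vs(2) stable_set_refl[OF vX] by (simp add: stable_groupoid_def)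
  then have "(\<phi> v, \<phi> v) \<in> G" "(\<psi> v, \<psi> v) \<in> G" using hom_groupoid by auto
  then show "\<phi> v \<in> homoclinic S P Q" "\<psi> v \<in> homoclinic S P Q"
    using stable_of_pow[OF PX(1,4,5) vs(1), of 1] stable_groupoidD(1) by (auto simp: homoclinic_def)
  show "w \<in> homoclinic S P Q" if "(v, w) \<in> G"
    using stable_groupoidD[OF that] stable_of_closed[OF PX(1) vs(1)] by (simp add: homoclinic_def)
qed

theorem dense_convolution_algebra_Lip:
  assumes "periodic_orbit S P"
  shows "dense_convolution_algebra G (homoclinic S P Q) X T Lip \<psi> \<phi>"
    "dense_convolution_algebra G (homoclinic S P Q) X T Lip \<phi> \<psi>"
proof -
  note H = homoclinic_maps[OF assms]
  have GX: "G \<subseteq> X \<times> X" using groupoid_cases(3) by blast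
  have IX: "homoclinic S P Q \<subseteq> X" using H(1) by blast
  note rules = stable_groupoid_sym stable_groupoid_trans topspace_T Cc_banded Lip_subset_Cc Lip_zero Lip_add Lip_scale
    Lip_conv Lip_invol Lip_approximates GX IX hinv_hom hom_hinv hom_groupoid Lip_alpha_hinv Lip_alpha_hom
  show "dense_convolution_algebra G (homoclinic S P Q) X T Lip \<psi> \<phi>"
    by unfold_locales (fact rules H)+
  show "dense_convolution_algebra G (homoclinic S P Q) X T Lip \<phi> \<psi>"
    by unfold_locales (fact rules H)+
qed

text \<open>The operator determines the values of the function in rows indexed by homoclinic points, and these rows are dense.\<close>
theorem rep_injective:
  assumes "irreducible_smale S" "periodic_orbit S P"
  shows "inj_on (rep G (homoclinic S P Q)) Lip"
proof (rule inj_onI)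
  interpret invariant_relation G "homoclinic S P Q"
    using dense_convolution_algebra_Lip(1)[OF assms(2)] by (simp add: dense_convolution_algebra_def)
  fix f g assume fg: "f \<in> Lip" "g \<in> Lip" "rep G (homoclinic S P Q) f = rep G (homoclinic S P Q) g"
  show "f = g"
  proof (rule Lip_eq_on_dense[OF assms fg(1,2)])
    fix a assume a: "a \<in> G" "fst a \<in> homoclinic S P Q"
    then show "f a = g a" using rep_delta[of "fst a" "snd a"] fg(3) by (metis prod.collapse)
  qed
qed

end

section \<open>Independence of the metric\<close>

text \<open>Two Smale structures on the same topological dynamical system; metrics, brackets and constants may differ.\<close>
definition same_system :: "'a smale \<Rightarrow> 'a smale \<Rightarrow> bool" where
  "same_system S S' \<longleftrightarrow> smale S \<and> smale S' \<and> pts S' = pts S \<and> hom S' = hom S \<and> top_of S' = top_of S"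

lemma same_systemD:
  assumes "same_system S S'"
  shows "smale S" "smale S'" "pts S' = pts S" "hom S' = hom S" "top_of S' = top_of S" "hinv S' = hinv S"
  using assms by (auto simp: same_system_def hinv_def)

lemma same_system_sym: "same_system S S' \<Longrightarrow> same_system S' S"
  by (simp add: same_system_def)

lemma same_system_inverse: "same_system S S' \<Longrightarrow> same_system (inverse_smale S) (inverse_smale S')"
proof -
  assume "same_system S S'"
  note same = same_systemD[OF this]
  show ?thesis
    unfolding same_system_def inverse_smale_simps using same smale.smale_inverse[OF same(1)] smale.smale_inverse[OF same(2)] by blast
qed

text \<open>The identity is uniformly continuous between two metrics of the same compact space. The upper bound \<open>t\<close> serves to
  keep the radius within the range in which rectangles in the first structure are controlled.\<close>
lemma uniformly_equivalent:
  assumes same: "same_system S S'" and r: "0 < r" and t: "0 < t"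
  shows "\<exists>s>0. s \<le> t \<and> (\<forall>x\<in>pts S. \<forall>y\<in>pts S. dst S x y \<le> s \<longrightarrow> dst S' x y \<le> r)"
proof (rule ccontr)
  assume neg: "\<not> ?thesis"
  note same = same_systemD[OF same]
  interpret A: smale S by (rule same)
  interpret B: smale S' by (rule same)
  have "\<exists>x y. x \<in> pts S \<and> y \<in> pts S \<and> dst S x y \<le> min t (inverse (real (Suc n))) \<and> r < dst S' x y" for n
  proof -
    have "0 < min t (inverse (real (Suc n)))" "min t (inverse (real (Suc n))) \<le> t" using t by auto
    then show ?thesis using neg not_le by blast
  qed
  then obtain x y where xy: "\<And>n. x n \<in> pts S" "\<And>n. y n \<in> pts S" "\<And>n. dst S (x n) (y n) \<le> min t (inverse (real (Suc n)))"
    "\<And>n. r < dst S' (x n) (y n)" by metis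
  obtain l s where l: "l \<in> pts S" "strict_mono s" "(\<lambda>n. dst S (x (s n)) l) \<longlonglongrightarrow> 0"
    using A.subsequence[of x] xy(1) by blast
  have t: "(\<lambda>n. inverse (real (Suc (s n)))) \<longlonglongrightarrow> 0"
    using LIMSEQ_subseq_LIMSEQ[OF LIMSEQ_inverse_real_of_nat l(2)] by (simp add: comp_def)
  have ly: "(\<lambda>n. dst S (y (s n)) l) \<longlonglongrightarrow> 0"
  proof (rule tendsto_sandwich[OF _ _ tendsto_const])
    show "(\<lambda>n. inverse (real (Suc (s n))) + dst S (x (s n)) l) \<longlonglongrightarrow> 0" using tendsto_add[OF t l(3)] by simp
    have "dst S (y (s n)) l \<le> inverse (real (Suc (s n))) + dst S (x (s n)) l" for n
      using A.triangle[OF xy(2) xy(1) l(1), of "s n" "s n"] xy(3)[of "s n"] by (simp add: A.commute)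
    then show "\<forall>\<^sub>F n in sequentially. dst S (y (s n)) l \<le> inverse (real (Suc (s n))) + dst S (x (s n)) l" by simp
  qed simp
  have "limitin (top_of S) (\<lambda>n. x (s n)) l sequentially" "limitin (top_of S) (\<lambda>n. y (s n)) l sequentially"
    unfolding A.top_of_eq A.limitin_iff using l ly xy by auto
  then have "(\<lambda>n. dst S' (x (s n)) l) \<longlonglongrightarrow> 0" "(\<lambda>n. dst S' (y (s n)) l) \<longlonglongrightarrow> 0"
    unfolding same(5)[symmetric] B.top_of_eq B.limitin_iff by auto
  then have "(\<lambda>n. dst S' (x (s n)) l + dst S' (y (s n)) l) \<longlonglongrightarrow> 0 + 0" by (rule tendsto_add)
  moreover have "r \<le> dst S' (x (s n)) l + dst S' (y (s n)) l" for n
    using B.triangle[of "x (s n)" l "y (s n)"] xy[of "s n"] l(1) same(3) by (simp add: B.commute)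
  ultimately have "r \<le> 0 + 0" by (intro LIMSEQ_le_const) auto
  then show False using r by simp
qed

lemma stable_set_same:
  assumes same: "same_system S S'" and x: "x \<in> pts S"
  shows "stable_set S' x = stable_set S x"
proof -
  have sub: "stable_set S1 x \<subseteq> stable_set S2 x" if same: "same_system S1 S2" and x: "x \<in> pts S1" for S1 S2
  proof
    fix y assume y: "y \<in> stable_set S1 x"
    note same' = same_systemD[OF same]
    interpret A: smale S1 by (rule same')
    interpret B: smale S2 by (rule same')
    have yX: "y \<in> pts S1" using y by (simp add: stable_set_def)
    have "(\<lambda>n. dst S2 ((hom S1 ^^ n) x) ((hom S1 ^^ n) y)) \<longlonglongrightarrow> 0"
    proof (rule LIMSEQ_I)
      fix r :: real assume "0 < r"
      then obtain s where s: "0 < s" "\<And>x y. x \<in> pts S1 \<Longrightarrow> y \<in> pts S1 \<Longrightarrow> dst S1 x y \<le> s \<Longrightarrow> dst S2 x y \<le> r / 2"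
        using uniformly_equivalent[OF same, of "r / 2" 1] by auto
      obtain N where N: "\<And>n. n \<ge> N \<Longrightarrow> dst S1 ((hom S1 ^^ n) x) ((hom S1 ^^ n) y) < s"
        using order_tendstoD(2)[OF A.stable_setD(2)[OF y] s(1)] by (auto simp: eventually_sequentially)
      have "norm (dst S2 ((hom S1 ^^ n) x) ((hom S1 ^^ n) y) - 0) < r" if "n \<ge> N" for n
        using s(2)[OF A.pow_in(1)[OF x] A.pow_in(1)[OF yX]] N[OF that] B.nonneg[of "(hom S1 ^^ n) x" "(hom S1 ^^ n) y"] \<open>0 < r\<close>
        by (simp add: less_imp_le) (smt (verit) field_sum_of_halves)
      then show "\<exists>N. \<forall>n\<ge>N. norm (dst S2 ((hom S1 ^^ n) x) ((hom S1 ^^ n) y) - 0) < r" by blast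
    qed
    then show "y \<in> stable_set S2 x" using yX same' by (simp add: stable_set_def)
  qed
  show ?thesis
    using sub[OF same x] sub[OF same_system_sym[OF same]] x same_systemD(3)[OF same] by auto
qed

lemma unstable_set_same:
  "same_system S S' \<Longrightarrow> x \<in> pts S \<Longrightarrow> unstable_set S' x = unstable_set S x"
  using stable_set_same[OF same_system_inverse, of S S' x] by simp

lemma groupoid_same:
  assumes "same_system S S'" "Q \<subseteq> pts S"
  shows "stable_of S' Q = stable_of S Q" "unstable_of S' Q = unstable_of S Q"
    "stable_groupoid S' Q = stable_groupoid S Q"
proof -
  show s: "stable_of S' Q = stable_of S Q" and u: "unstable_of S' Q = unstable_of S Q"
    using stable_set_same[OF assms(1)] unstable_set_same[OF assms(1)] assms(2)
    unfolding stable_of_def unstable_of_def by (auto simp: subset_eq)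
  have "unstable_of S Q \<subseteq> pts S" by (rule smale.unstable_of_subset[OF same_systemD(1)[OF assms(1)]])
  then show "stable_groupoid S' Q = stable_groupoid S Q"
    using u stable_set_same[OF assms(1)] unfolding stable_groupoid_def by blast
qed

lemma rectangle_same:
  assumes same: "same_system S S'" and r: "0 < r" and t: "0 < t"
  shows "\<exists>s>0. s \<le> t \<and> (\<forall>k a b. rectangle S s k a b \<longrightarrow> rectangle S' r k a b)"
proof -
  note same' = same_systemD[OF same]
  interpret A: smale S by (rule same')
  obtain s where s: "0 < s" "s \<le> t" "\<And>x y. x \<in> pts S \<Longrightarrow> y \<in> pts S \<Longrightarrow> dst S x y \<le> s \<Longrightarrow> dst S' x y \<le> r"
    using uniformly_equivalent[OF same r t] by auto
  have "forward_close S' r x y" if "forward_close S s x y" for x y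
    using that s(3) same' by (auto simp: forward_close_def)
  moreover have "backward_close S' r x y" if "backward_close S s x y" for x y
    using that s(3) same' by (auto simp: backward_close_def)
  ultimately have "rectangle S' r k a b" if "rectangle S s k a b" for k a b
    using that same' unfolding rectangle_def by simp
  then show ?thesis using s by blast
qed

text \<open>One structure provides the holonomy topology, the other one the metric. Both have rectangles at late times as
  neighbourhood bases, and small rectangles for one structure are rectangles for the other.\<close>
theorem stable_topology_eq_mtopology:
  assumes same: "same_system S S'" and ss: "self_similar_smale S' Q"
  shows "stable_topology S Q = Metric_space.mtopology (stable_groupoid S' Q) (stable_metric S' Q)"
proof -
  note same' = same_systemD[OF same]
  interpret A: smale S by (rule same')
  interpret B: self_similar_smale S' Q by (rule ss)
  interpret M: Metric_space "stable_groupoid S' Q" "stable_metric S' Q" by (rule B.metric_D)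
  have Q: "Q \<subseteq> pts S" using B.Q_invariant(1) same' by simp
  note G = groupoid_same(3)[OF same Q]
  have gen: "stable_topology S Q = topology_generated_by (stable_generators S Q)"
    by (simp add: stable_topology_def stable_generators_def)
  have sub: "V \<subseteq> stable_groupoid S' Q" if "V \<in> stable_generators S Q" for V
    using A.generator_subset[OF Q that] G by simp
  have coarse: "openin M.mtopology V" if V: "V \<in> stable_generators S Q" for V
    unfolding M.openin_mtopology
  proof (intro conjI allI impI sub[OF V])
    fix a assume a: "a \<in> V"
    obtain K where K: "\<And>k b. k \<ge> K \<Longrightarrow> rectangle S (eps' S / 4) k a b \<Longrightarrow> b \<in> V"
      using A.rectangle_in_generator[OF V a, of "eps' S / 4"] A.eps'_pos by auto
    obtain s where s: "0 < s" "s \<le> eps' S'" "\<And>k a b. rectangle S' s k a b \<Longrightarrow> rectangle S (eps' S / 4) k a b"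
      using rectangle_same[OF same_system_sym[OF same], of "eps' S / 4" "eps' S'"] A.eps'_pos B.eps'_pos by auto
    obtain \<rho> where \<rho>: "0 < \<rho>" "\<And>b. b \<in> stable_groupoid S' Q \<Longrightarrow> stable_metric S' Q a b < \<rho> \<Longrightarrow> \<exists>t\<ge>K. rectangle S' s t a b"
      using B.D_less_imp_rectangle[of a s K] sub[OF V] a s by blast
    have "M.mball a \<rho> \<subseteq> V"
    proof
      fix b assume "b \<in> M.mball a \<rho>"
      then obtain t where "t \<ge> K" "rectangle S' s t a b" using \<rho>(2)[of b] by auto
      then show "b \<in> V" using K s(3) by blast
    qed
    then show "\<exists>r>0. M.mball a r \<subseteq> V" using \<rho>(1) by blast
  qed
  have fine: "openin (topology_generated_by (stable_generators S Q)) U" if U: "openin M.mtopology U" for U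
  proof (subst openin_subopen, intro ballI)
    fix a assume a: "a \<in> U"
    then obtain \<rho> where \<rho>: "0 < \<rho>" "M.mball a \<rho> \<subseteq> U" and aG: "a \<in> stable_groupoid S' Q"
      using U unfolding M.openin_mtopology by blast
    obtain K where K: "\<And>k b. k \<ge> K \<Longrightarrow> b \<in> stable_groupoid S' Q \<Longrightarrow> rectangle S' (eps' S' / 8) k a b \<Longrightarrow> stable_metric S' Q a b < \<rho>"
      using B.rectangle_imp_D_less[OF aG \<rho>(1), of "eps' S' / 8"] B.eps'_pos by auto
    obtain s where s: "0 < s" "\<And>k a b. rectangle S s k a b \<Longrightarrow> rectangle S' (eps' S' / 8) k a b"
      using rectangle_same[OF same, of "eps' S' / 8" 1] B.eps'_pos by auto
    obtain k V where V: "k \<ge> K" "V \<in> stable_generators S Q" "a \<in> V" "\<And>b. b \<in> V \<Longrightarrow> rectangle S s k a b"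
      using A.generator_in_rectangle[of a Q s K] aG G s(1) by auto
    have "V \<subseteq> U"
    proof
      fix b assume b: "b \<in> V"
      then have "b \<in> stable_groupoid S' Q" "stable_metric S' Q a b < \<rho>"
        using sub[OF V(2)] K[OF V(1)] s(2)[OF V(4)[OF b]] by blast+
      then show "b \<in> U" using aG \<rho>(2) M.in_mball by blast
    qed
    then show "\<exists>V. openin (topology_generated_by (stable_generators S Q)) V \<and> a \<in> V \<and> V \<subseteq> U"
      using topology_generated_by_Basis[OF V(2)] V(3) by blast
  qed
  show ?thesis
    unfolding gen topology_eq
  proof (intro allI iffI)
    fix U assume "openin (topology_generated_by (stable_generators S Q)) U"
    then show "openin M.mtopology U"
      using generate_topology_on_coarsest[of "openin M.mtopology" "stable_generators S Q" U] coarse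
      by (simp add: openin_topology_generated_by_iff)
  qed (rule fine)
qed

section \<open>The inverse Smale space\<close>

lemma covers_cong:
  assumes "\<And>n a. a \<in> G \<Longrightarrow> V n a = V' n a"
  shows "covers G l N V = covers G l N V'"
proof
  fix n
  have "{V (level l N a n) a | a. a \<in> G} = {V' (level l N a n) a | a. a \<in> G}" using assms by metis
  then show "covers G l N V n = covers G l N V' n" by (simp add: covers_def)
qed

lemma chain_dist_cong:
  assumes "\<And>n a. a \<in> G \<Longrightarrow> V n a = V' n a"
  shows "chain_dist G l N V = chain_dist G l N V'"
proof -
  have "covers G l N V = covers G l N V'" using assms by (rule covers_cong)
  then have p: "pre_dist G l N V = pre_dist G l N V'" by (simp add: pre_dist_def[abs_def])
  show ?thesis unfolding chain_dist_def[abs_def] p ..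
qed

context smale
begin

lemma self_similar_inverse: "self_similar S \<Longrightarrow> self_similar (inverse_smale S)"
  by (simp add: self_similar_def)

lemma irreducible_inverse:
  assumes "irreducible_smale S"
  shows "irreducible_smale (inverse_smale S)"
  unfolding irreducible_smale_def inverse_smale_simps
proof (intro allI impI)
  fix U V assume UV: "openin (top_of S) U \<and> openin (top_of S) V \<and> U \<noteq> {} \<and> V \<noteq> {}"
  then obtain n where "(\<phi> ^^ n) ` V \<inter> U \<noteq> {}" using assms unfolding irreducible_smale_def by blast
  then obtain x where x: "x \<in> V" "(\<phi> ^^ n) x \<in> U" by blast
  have "V \<subseteq> X" using UV openin_subset[of "top_of S" V] by (simp add: top_of_eq)
  then have "(\<psi> ^^ n) ((\<phi> ^^ n) x) = x" using x by (simp add: subset_iff)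
  then show "\<exists>n. (\<psi> ^^ n) ` U \<inter> V \<noteq> {}" using x by (metis IntI empty_iff imageI)
qed

lemma periodic_orbit_inverse:
  assumes "periodic_orbit S P"
  shows "periodic_orbit (inverse_smale S) P"
proof -
  obtain p k where p: "p \<in> X" "k > 0" "(\<phi> ^^ k) p = p" "P = {(\<phi> ^^ i) p | i. i < k}"
    using assms by (auto simp: periodic_orbit_def)
  have rewind: "(\<psi> ^^ i) p = (\<phi> ^^ (k - i)) p" if "i \<le> k" for i
    using hinv_hom_pow[OF p(1) that] p(3) by simp
  have "P = {(\<psi> ^^ i) p | i. i < k}"
  proof (intro set_eqI iffI)
    fix q assume "q \<in> P"
    then obtain i where i: "i < k" "q = (\<phi> ^^ i) p" using p(4) by blast
    show "q \<in> {(\<psi> ^^ i) p | i. i < k}"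
    proof (cases i)
      case 0
      then have "q = (\<psi> ^^ 0) p" using i by simp
      then show ?thesis using p(2) by blast
    next
      case (Suc m)
      then have "k - i < k" "q = (\<psi> ^^ (k - i)) p" using i rewind[of "k - i"] by auto
      then show ?thesis by blast
    qed
  next
    fix q assume "q \<in> {(\<psi> ^^ i) p | i. i < k}"
    then obtain i where i: "i < k" "q = (\<psi> ^^ i) p" by blast
    show "q \<in> P"
    proof (cases i)
      case 0
      then have "q = (\<phi> ^^ 0) p" using i by simp
      then show ?thesis using p(2,4) by blast
    next
      case (Suc m)
      then have "k - i < k" "q = (\<phi> ^^ (k - i)) p" using i rewind[of i] by auto
      then show ?thesis using p(4) by blast
    qed
  qed
  moreover have "(\<psi> ^^ k) p = p" using rewind[of k] by simp
  ultimately show ?thesis using p(1,2) unfolding periodic_orbit_def inverse_smale_simps by blast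
qed

lemma unstable_set_inverse: "v \<in> X \<Longrightarrow> unstable_set (inverse_smale S) v = stable_set S v"
  by (auto simp: stable_set_def unstable_set_def)

lemma unstable_of_inverse: "P \<subseteq> X \<Longrightarrow> unstable_of (inverse_smale S) P = stable_of S P"
  using unstable_set_inverse unfolding unstable_of_def stable_of_def by (auto simp: subset_eq)

lemma unstable_groupoid_inverse: "P \<subseteq> X \<Longrightarrow> unstable_groupoid S P = stable_groupoid (inverse_smale S) P"
  by (simp add: unstable_groupoid_def stable_groupoid_def unstable_of_inverse)

lemma homoclinic_inverse: "P \<subseteq> X \<Longrightarrow> homoclinic S P Q = homoclinic (inverse_smale S) Q P"
  by (simp add: homoclinic_def unstable_of_inverse Int_commute)

lemma unstable_time_inverse: "unstable_time S = stable_time (inverse_smale S)"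
  by (simp add: unstable_time_def[abs_def] stable_time_def[abs_def])

text \<open>The assumption ensures that the bracket is a point of \<open>X\<close>, where inverting \<open>\<psi>\<close> gives \<open>\<phi>\<close>.\<close>
lemma unstable_holonomy_inverse:
  assumes "v \<in> X" "z \<in> X" "d ((\<psi> ^^ N) v) ((\<psi> ^^ N) z) \<le> eps S"
  shows "unstable_holonomy S N v z = stable_holonomy (inverse_smale S) N v z"
  using assms br_in[of "(\<psi> ^^ N) v" "(\<psi> ^^ N) z"] by (simp add: unstable_holonomy_def stable_holonomy_def)

lemma unstable_topology_inverse:
  assumes "P \<subseteq> X"
  shows "unstable_topology S P = stable_topology (inverse_smale S) P"
proof -
  have eq: "{(unstable_holonomy S N v z, z) | z. z \<in> local_stable S w \<eta>} =
      {(stable_holonomy (inverse_smale S) N v z, z) | z. z \<in> local_stable S w \<eta>}"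
    if h: "(v, w) \<in> stable_groupoid (inverse_smale S) P" "(\<psi> ^^ N) w \<in> local_unstable S ((\<psi> ^^ N) v) (eps' S / 2)"
      "(\<psi> ^^ N) ` local_stable S w \<eta> \<subseteq> local_stable S ((\<psi> ^^ N) w) (eps' S / 2)" for v w N \<eta>
  proof -
    have vw: "v \<in> X" "w \<in> X" using smale.stable_groupoidD(4,5)[OF smale_inverse h(1)] by simp_all
    have "unstable_holonomy S N v z = stable_holonomy (inverse_smale S) N v z" if z: "z \<in> local_stable S w \<eta>" for z
    proof (rule unstable_holonomy_inverse[OF vw(1)])
      show zX: "z \<in> X" using z by (simp add: local_stable_def)
      have "(\<psi> ^^ N) z \<in> local_stable S ((\<psi> ^^ N) w) (eps' S / 2)" using h(3) z by blast
      then have "d ((\<psi> ^^ N) v) ((\<psi> ^^ N) w) < eps' S / 2" "d ((\<psi> ^^ N) w) ((\<psi> ^^ N) z) < eps' S / 2"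
        using h(2) by (auto simp: local_stable_def local_unstable_def)
      then show "d ((\<psi> ^^ N) v) ((\<psi> ^^ N) z) \<le> eps S"
        using triangle[of "(\<psi> ^^ N) v" "(\<psi> ^^ N) w" "(\<psi> ^^ N) z"] vw zX eps'_le eps'_pos by simp
    qed
    then show ?thesis by force
  qed
  have cong: "(B = L \<and> C) = (B = R \<and> C)" if "C \<Longrightarrow> L = R" for B L R :: "('a \<times> 'a) set" and C
    using that by auto
  let ?C = "\<lambda>v w N \<eta>. (v, w) \<in> stable_groupoid (inverse_smale S) P \<and>
      (\<psi> ^^ N) w \<in> local_unstable S ((\<psi> ^^ N) v) (eps' S / 2) \<and> 0 < \<eta> \<and> \<eta> \<le> eps S / 2 \<and>
      (\<psi> ^^ N) ` local_stable S w \<eta> \<subseteq> local_stable S ((\<psi> ^^ N) w) (eps' S / 2)"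
  have "(B = {(unstable_holonomy S N v z, z) | z. z \<in> local_stable S w \<eta>} \<and> ?C v w N \<eta>) =
      (B = {(stable_holonomy (inverse_smale S) N v z, z) | z. z \<in> local_stable S w \<eta>} \<and> ?C v w N \<eta>)" for B v w N \<eta>
    by (rule cong) (intro eq; blast)
  then show ?thesis
    unfolding unstable_topology_def stable_topology_def inverse_smale_simps unstable_groupoid_inverse[OF assms] by (simp only:)
qed

lemma unstable_metric_inverse:
  assumes "self_similar_smale (inverse_smale S) P"
  shows "unstable_metric S P = stable_metric (inverse_smale S) P"
proof -
  interpret I: self_similar_smale "inverse_smale S" P by (rule assms)
  have PX: "P \<subseteq> X" using I.Q_invariant(1) by simp
  have "unstable_nbhd S n a = stable_nbhd (inverse_smale S) n a" if a: "a \<in> stable_groupoid (inverse_smale S) P" for n a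
  proof -
    define m where "m = max (stable_time (inverse_smale S) a) n"
    have aX: "fst a \<in> X" "snd a \<in> X" using I.groupoid_cases(1,2)[OF a] by simp_all
    have l: "1 < lam S" by (rule lam_gt1)
    have "unstable_holonomy S m (fst a) z = stable_holonomy (inverse_smale S) m (fst a) z"
      if z: "z \<in> local_stable S (snd a) (inverse (lam S) ^ m * eps' S / 4)" for z
    proof (rule unstable_holonomy_inverse[OF aX(1)])
      show zX: "z \<in> X" using z by (simp add: local_stable_def)
      have "d (snd a) z \<le> inverse (lam S) ^ m * eps' S / 4" using z by (simp add: local_stable_def)
      then have "lam S ^ m * d (snd a) z \<le> lam S ^ m * (inverse (lam S) ^ m * eps' S / 4)"
        using l by (intro mult_left_mono) auto
      also have "\<dots> = eps' S / 4" using l by (simp add: field_simps)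
      finally have "d ((\<psi> ^^ m) (snd a)) ((\<psi> ^^ m) z) \<le> eps' S / 4"
        using I.hom_pow_lipschitz[of "snd a" z m] aX zX by simp
      moreover have "d ((\<psi> ^^ m) (fst a)) ((\<psi> ^^ m) (snd a)) < eps' S / 2"
        using I.time_dist[OF a, of m] by (simp add: m_def)
      ultimately show "d ((\<psi> ^^ m) (fst a)) ((\<psi> ^^ m) z) \<le> eps S"
        using triangle[of "(\<psi> ^^ m) (fst a)" "(\<psi> ^^ m) (snd a)" "(\<psi> ^^ m) z"] aX zX eps'_le eps'_pos by simp
    qed
    then show ?thesis
      unfolding unstable_nbhd_def stable_nbhd_def Let_def unstable_time_inverse m_def[symmetric] by force
  qed
  then show ?thesis
    unfolding unstable_metric_def stable_metric_def unstable_time_inverse unstable_groupoid_inverse[OF PX] inverse_smale_simps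
    by (rule chain_dist_cong)
qed

end

section \<open>Lipschitz algebras of a Smale space\<close>

text \<open>The automorphism is given by \<open>hinv S\<close> in the stable case. The one of the unstable case is given by the same map,
  which is the homeomorphism \<open>hom\<close> of the inverse Smale space.\<close>
theorem Lip_dense_subalgebra:
  assumes same: "same_system S S'" and ss: "self_similar_smale S' Q"
    and irr: "irreducible_smale S" and P: "periodic_orbit S P"
    and G: "G = stable_groupoid S Q" and I: "I = homoclinic S P Q" and T: "T = stable_topology S Q"
    and L: "L = Lip_c G (stable_metric S' Q)" and A: "A = groupoid_algebra G T I"
    and \<kappa>: "\<kappa> = hinv S \<or> \<kappa> = hom S"
  shows "conv_star_subalgebra G L (Cc T)" "inj_on (rep G I) L" "dense_star_subalgebra I (rep G I ` L) A"
    "alpha G \<kappa> ` L = L"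
    "dense_star_subalgebra (UNIV \<times> I) (alg_crossed_product I A (alpha_ext G T I \<kappa>) (rep G I ` L))
      (crossed_product I A (alpha_ext G T I \<kappa>))"
proof -
  note same' = same_systemD[OF same]
  interpret B: self_similar_smale S' Q by (rule ss)
  have P': "periodic_orbit S' P" "irreducible_smale S'"
    using P irr same' by (simp_all add: periodic_orbit_def irreducible_smale_def)
  have "P \<subseteq> pts S'" by (rule orbit_invariant(1)[OF P'(1) B.bij_hom])
  then have PQ: "P \<subseteq> pts S" "Q \<subseteq> pts S" using B.Q_invariant(1) same' by auto
  have eq: "G = stable_groupoid S' Q" "I = homoclinic S' P Q"
    "T = Metric_space.mtopology (stable_groupoid S' Q) (stable_metric S' Q)"
    using groupoid_same[OF same PQ(2)] groupoid_same[OF same PQ(1)] stable_topology_eq_mtopology[OF same ss]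
    by (simp_all add: G I T homoclinic_def)
  have alg: "dense_convolution_algebra G I (pts S') T L \<kappa> (if \<kappa> = hinv S then hom S else hinv S)"
    using B.dense_convolution_algebra_Lip[OF P'(1)] \<kappa> same' by (auto simp: eq L)
  interpret dense_convolution_algebra G I "pts S'" T L \<kappa> "if \<kappa> = hinv S then hom S else hinv S" by (rule alg)
  show "conv_star_subalgebra G L (Cc T)" by (rule convolution_subalgebra)
  show "dense_star_subalgebra I (rep G I ` L) A" unfolding A by (rule rep_dense)
  show "alpha G \<kappa> ` L = L" by (rule alpha_image)
  show "dense_star_subalgebra (UNIV \<times> I) (alg_crossed_product I A (alpha_ext G T I \<kappa>) (rep G I ` L))
      (crossed_product I A (alpha_ext G T I \<kappa>))" unfolding A by (rule crossed_product_dense)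
  show "inj_on (rep G I) L" using B.rep_injective[OF P'(2,1)] by (simp add: eq L)
qed

theorem proposition7p1:
  fixes S S' :: "'a smale" and P Q :: "'a set"
  assumes "smale_space S" and "irreducible_smale S"
    and "periodic_orbit S P" and "periodic_orbit S Q" and "P \<inter> Q = {}"
    and "self_similar_form S S'"
  shows "conv_star_subalgebra (stable_groupoid S Q) (Lip_s S S' Q) (Cc (stable_topology S Q)) \<and>
    inj_on (rep_s S P Q) (Lip_s S S' Q) \<and>
    dense_star_subalgebra (homoclinic S P Q)
           (rep_s S P Q ` Lip_s S S' Q) (stable_algebra S P Q) \<and>
    alpha_s S Q ` Lip_s S S' Q = Lip_s S S' Q \<and>
    dense_star_subalgebra (UNIV \<times> homoclinic S P Q)
           (Lambda_s S S' P Q) (stable_ruelle S P Q) \<and>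
    conv_star_subalgebra (unstable_groupoid S P) (Lip_u S S' P) (Cc (unstable_topology S P)) \<and>
    inj_on (rep_u S P Q) (Lip_u S S' P) \<and>
    dense_star_subalgebra (homoclinic S P Q)
           (rep_u S P Q ` Lip_u S S' P) (unstable_algebra S P Q) \<and>
    alpha_u S P ` Lip_u S S' P = Lip_u S S' P \<and>
    dense_star_subalgebra (UNIV \<times> homoclinic S P Q)
           (Lambda_u S S' P Q) (unstable_ruelle S P Q)"
proof -
  have same: "same_system S S'"
    using assms(1,6) by (simp add: same_system_def self_similar_form_def smale_def)
  note same' = same_systemD[OF same]
  interpret A: smale S by (rule same')
  interpret B: smale S' by (rule same')
  have orb': "periodic_orbit S' P" "periodic_orbit S' Q"
    using assms(3,4) same' by (simp_all add: periodic_orbit_def)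
  have ss: "self_similar S'" using assms(6) by (simp add: self_similar_form_def)
  have s: "self_similar_smale S' Q" using ss orb' by unfold_locales
  have u: "self_similar_smale (inverse_smale S') P"
    using B.self_similar_inverse[OF ss] B.periodic_orbit_inverse[OF orb'(1)] B.smale_inverse
    by (simp add: self_similar_smale_def self_similar_smale_axioms_def)
  have PX: "P \<subseteq> pts S" by (rule orbit_invariant(1)[OF assms(3) A.bij_hom])
  note stable = Lip_dense_subalgebra[OF same s assms(2,3) refl refl refl refl refl disjI1[OF refl]]
  note unstable = Lip_dense_subalgebra[OF same_system_inverse[OF same] u A.irreducible_inverse[OF assms(2)]
      A.periodic_orbit_inverse[OF assms(4)] refl refl refl refl refl disjI2[OF refl],
      folded A.unstable_groupoid_inverse[OF PX] A.homoclinic_inverse[OF PX] A.unstable_topology_inverse[OF PX]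
        B.unstable_metric_inverse[OF u], unfolded inverse_smale_simps]
  show ?thesis
    unfolding Lip_s_def Lip_u_def stable_algebra_def unstable_algebra_def alpha_s_def alpha_u_def
      Lambda_s_def Lambda_u_def stable_ruelle_def unstable_ruelle_def aut_s_def aut_u_def
    by (intro conjI stable unstable)
qed

end
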